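(* Let $f:X\to\Delta$ be a proper surjective holomorphic map from a Kähler manifold of dimension $n+1$ onto the unit disk, smooth over $\Delta\setminus\{0\}$, whose central fiber $Y$ is a divisor with possibly non-reduced simple normal crossings, and let $\alpha\in[0,1)\cap\mathbb Q$. Any power of $R_\alpha$ on $(\mathcal M_\alpha,F_\bullet\mathcal M_\alpha)$ is strict: for every $a\in\mathbb Z_{\ge0}$, $$R_\alpha^aF_\bullet\mathcal M_\alpha=F_{a+\bullet}R_\alpha^a\mathcal M_\alpha,$$ where $F_{a+\bullet}R_\alpha^a\mathcal M_\alpha=F_{a+\bullet}\mathcal M_\alpha\cap R_\alpha^a\mathcal M_\alpha$.
   Context: $t$ is the coordinate on $\Delta$, $Y=f^{-1}(0)$ as a divisor. $\Omega_{X/\Delta}(\log Y)=\Omega_X(\log Y)/f^*\Omega_\Delta(\log 0)$, $\Omega^p_{X/\Delta}(\log Y)=\bigwedge^p\Omega_{X/\Delta}(\log Y)$; $|_Y$ means $\otimes\,\mathcal O_X/t$. $\mathscr D$-modules are right modules. $\mathcal M=\mathscr H^0(\Omega^{n+\bullet}_{X/\Delta}(\log Y)|_Y\otimes_{\mathcal O_X}\mathscr D_X)$, where the relative log de Rham complex is placed in degrees $-n,\dots,0$ and the differential is (up to the shift sign) $\beta\otimes P\mapsto d\beta\otimes P+\sum_j\xi_j\wedge\beta\otimes D_jP$ ($\xi_j$, $D_j$ dual local frames of $\Omega_{X/\Delta}(\log Y)$ and its dual $\mathscr T_{X/\Delta}(\log Y)\subset\mathscr T_X$); $F_\ell\mathcal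 M$ is the image of $\Omega^n_{X/\Delta}(\log Y)|_Y\otimes F_{\ell+n}\mathscr D_X$. The endomorphism $R:(\mathcal M,F_\bullet)\to(\mathcal M,F_{\bullet+1})$ is $[[\beta]\otimes P]\mapsto(\frac{dt}t\wedge)^{-1}\{d(\beta\otimes P)\}$ for $\beta\in\Omega^n_X(\log Y)$, with $d(\beta\otimes P)=d\beta\otimes P+\sum_idz_i\wedge\beta\otimes\partial_iP$ and $\frac{dt}t\wedge:\Omega^n_{X/\Delta}(\log Y)\simeq\Omega^{n+1}_X(\log Y)$; its eigenvalues lie in $[0,1)\cap\mathbb Q$. $\mathcal M_{\ge\alpha}$ (resp. $\mathcal M_{>\alpha}$) is the sum of the generalized eigenmodules $\ker(R-\lambda)^\infty$ with $\lambda\ge\alpha$ (resp. $\lambda>\alpha$); $\mathcal M_\alpha=\mathcal M_{\ge\alpha}/\mathcal M_{>\alpha}$ with $F_\bullet\mathcal M_\alpha=(F_\bullet\mathcal M\cap\mathcal M_{\ge\alpha})/(F_\bullet\mathcal M\cap\mathcal M_{>\alpha})$; $R_\alpha=R-\alpha$, a nilpotent endomorphism of $\mathcal M_\alpha$ with $R_\alpha F_\bullet\mathcal M_\alpha\subset F_{\bullet+1}\mathcal M_\alpha$. *)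

theory Defs
  imports
    "HOL-Complex_Analysis.Complex_Analysis"
    "HOL-Algebra.Free_Abelian_Groups"
    "HOL-Algebra.AbelCoset"
    "HOL-Algebra.Algebraic_Closure_Type"
    "HOL-Algebra.Module"
    "HOL-Computational_Algebra.Fraction_Field"
begin

section \<open>Holomorphic functions of several variables and complex manifolds\<close>

definition holo_on :: "(complex ^ 'm::finite \<Rightarrow> complex) \<Rightarrow> (complex ^ 'm) set \<Rightarrow> bool" where
  "holo_on g U \<longleftrightarrow> open U \<and>
     (\<forall>z\<in>U. \<exists>D. (g has_derivative D) (at z) \<and> (\<forall>c v. D (c *s v) = c * D v))"

type_synonym ('x, 'm) chart = "'x set \<times> ('x \<Rightarrow> complex ^ 'm)"

text \<open>Coordinate expression of a function on the domain of a chart.\<close>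
definition in_chart :: "('x, 'm) chart \<Rightarrow> ('x \<Rightarrow> 'b) \<Rightarrow> complex ^ 'm \<Rightarrow> 'b" where
  "in_chart c g = (\<lambda>z. g (inv_into (fst c) (snd c) z))"

definition complex_atlas :: "('x::topological_space, 'm::finite) chart set \<Rightarrow> bool" where
  "complex_atlas A \<longleftrightarrow>
     (\<Union>c\<in>A. fst c) = UNIV \<and>
     (\<forall>c\<in>A. open (fst c) \<and> open (snd c ` fst c) \<and>
        homeomorphism (fst c) (snd c ` fst c) (snd c) (inv_into (fst c) (snd c))) \<and>
     (\<forall>c\<in>A. \<forall>c'\<in>A. \<forall>i. holo_on (in_chart c (\<lambda>x. snd c' x $ i)) (snd c ` (fst c \<inter> fst c')))"

text \<open>Charts of the complex structure determined by \<open>A\<close>, i.e. of the maximal atlas.\<close>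
definition holo_chart :: "('x::topological_space, 'm::finite) chart set \<Rightarrow> ('x, 'm) chart \<Rightarrow> bool" where
  "holo_chart A c \<longleftrightarrow> complex_atlas (insert c A)"

definition holo_function ::
  "('x::topological_space, 'm::finite) chart set \<Rightarrow> 'x set \<Rightarrow> ('x \<Rightarrow> complex) \<Rightarrow> bool" where
  "holo_function A W g \<longleftrightarrow> open W \<and> (\<forall>c\<in>A. holo_on (in_chart c g) (snd c ` (fst c \<inter> W)))"

definition submersive_at ::
  "('x::topological_space, 'm::finite) chart set \<Rightarrow> ('x \<Rightarrow> complex) \<Rightarrow> 'x \<Rightarrow> bool" where
  "submersive_at A g x \<longleftrightarrow>
     (\<forall>c\<in>A. x \<in> fst c \<longrightarrow> \<not> (in_chart c g has_derivative (\<lambda>_. 0)) (at (snd c x)))"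

subsection \<open>Kaehler metrics\<close>

text \<open>Real \<open>C\<^sup>\<infinity>\<close> functions on an open set: all iterated directional derivatives exist
  and are differentiable.\<close>
coinductive smooth_on :: "'a::real_normed_vector set \<Rightarrow> ('a \<Rightarrow> 'b::real_normed_vector) \<Rightarrow> bool"
  for S where
  "\<lbrakk>\<forall>x\<in>S. g differentiable (at x); \<forall>v. smooth_on S (\<lambda>x. frechet_derivative g (at x) v)\<rbrakk>
   \<Longrightarrow> smooth_on S g"

text \<open>\<open>h c z\<close> is the metric in the chart \<open>c\<close> at the point with coordinates \<open>z\<close>, complex linear in
  its first argument. The last condition is \<open>d\<omega> = 0\<close> for \<open>\<omega> = Im h\<close>, evaluated
  on constant vector fields \<open>u, v, w\<close>.\<close>
definition kaehler_metric ::
  "('x::topological_space, 'm::finite) chart set \<Rightarrow>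
   (('x, 'm) chart \<Rightarrow> complex ^ 'm \<Rightarrow> complex ^ 'm \<Rightarrow> complex ^ 'm \<Rightarrow> complex) \<Rightarrow> bool" where
  "kaehler_metric A h \<longleftrightarrow>
     (\<forall>c\<in>A. \<forall>z \<in> snd c ` fst c.
        (\<forall>v v' w. h c z (v + v') w = h c z v w + h c z v' w) \<and>
        (\<forall>a v w. h c z (a *s v) w = a * h c z v w) \<and>
        (\<forall>v w. h c z w v = cnj (h c z v w)) \<and>
        (\<forall>v. v \<noteq> 0 \<longrightarrow> Re (h c z v v) > 0)) \<and>
     (\<forall>c\<in>A. \<forall>v w. smooth_on (snd c ` fst c) (\<lambda>z. h c z v w)) \<and>
     (\<forall>c\<in>A. \<forall>c'\<in>A. \<forall>x \<in> fst c \<inter> fst c'. \<forall>v w.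
        h c (snd c x) v w =
        h c' (snd c' x) (frechet_derivative (in_chart c (snd c')) (at (snd c x)) v)
                        (frechet_derivative (in_chart c (snd c')) (at (snd c x)) w)) \<and>
     (\<forall>c\<in>A. \<forall>z \<in> snd c ` fst c. \<forall>u v w.
        frechet_derivative (\<lambda>y. Im (h c y v w)) (at z) u +
        frechet_derivative (\<lambda>y. Im (h c y w u)) (at z) v +
        frechet_derivative (\<lambda>y. Im (h c y u v)) (at z) w = 0)"

subsection \<open>Simple normal crossings\<close>

text \<open>The divisor of zeros of \<open>f\<close> is \<open>\<Sum>i\<in>I. e i \<cdot> Z i\<close> with \<open>Z i\<close> connected smooth hypersurfaces
  that are distinct coordinate hyperplanes in a suitable chart around any point; \<open>\<sigma> i\<close> is the
  coordinate defining \<open>Z i\<close> in that chart.\<close>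
definition snc_zero_divisor ::
  "('x::topological_space, 'm::finite) chart set \<Rightarrow> ('x \<Rightarrow> complex) \<Rightarrow> bool" where
  "snc_zero_divisor A f \<longleftrightarrow>
     (\<exists>(I :: nat set) (Z :: nat \<Rightarrow> 'x set) (e :: nat \<Rightarrow> nat).
        finite I \<and> (\<forall>i\<in>I. connected (Z i) \<and> Z i \<noteq> {} \<and> e i \<ge> 1) \<and>
        (\<forall>x. \<exists>U \<phi> u \<sigma>.
           holo_chart A (U, \<phi>) \<and> x \<in> U \<and>
           inj_on \<sigma> {i\<in>I. x \<in> Z i} \<and>
           (\<forall>i\<in>I. Z i \<inter> U = (if x \<in> Z i then {y\<in>U. \<phi> y $ \<sigma> i = 0} else {})) \<and>
           holo_function A U u \<and> (\<forall>y\<in>U. u y \<noteq> 0) \<and>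
           (\<forall>y\<in>U. f y = u y * (\<Prod>i | i \<in> I \<and> x \<in> Z i. (\<phi> y $ \<sigma> i) ^ e i))))"


section \<open>Germs of holomorphic functions\<close>

lemma holo_on_subset: "holo_on f U \<Longrightarrow> open V \<Longrightarrow> V \<subseteq> U \<Longrightarrow> holo_on f V"
  unfolding holo_on_def by blast

lemma holo_on_const: "open U \<Longrightarrow> holo_on (\<lambda>_. k) U"
  unfolding holo_on_def by (auto intro!: exI[of _ "\<lambda>_. 0"])

lemma holo_on_add: assumes "holo_on f U" "holo_on g U" shows "holo_on (\<lambda>z. f z + g z) U"
  unfolding holo_on_def
proof (intro conjI ballI)
  fix z assume z: "z \<in> U"
  obtain D where D: "(f has_derivative D) (at z)" "\<And>c v. D (c *s v) = c * D v"
    using assms(1) z unfolding holo_on_def by blast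
  obtain E where E: "(g has_derivative E) (at z)" "\<And>c v. E (c *s v) = c * E v"
    using assms(2) z unfolding holo_on_def by blast
  show "\<exists>D. ((\<lambda>z. f z + g z) has_derivative D) (at z) \<and> (\<forall>c v. D (c *s v) = c * D v)"
    by (rule exI[of _ "\<lambda>v. D v + E v"]) (auto intro!: has_derivative_add D E simp: D(2) E(2) algebra_simps)
qed (use assms in \<open>auto simp: holo_on_def\<close>)

lemma holo_on_mult: assumes "holo_on f U" "holo_on g U" shows "holo_on (\<lambda>z. f z * g z) U"
  unfolding holo_on_def
proof (intro conjI ballI)
  fix z assume z: "z \<in> U"
  obtain D where D: "(f has_derivative D) (at z)" "\<And>c v. D (c *s v) = c * D v"
    using assms(1) z unfolding holo_on_def by blast
  obtain E where E: "(g has_derivative E) (at z)" "\<And>c v. E (c *s v) = c * E v"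
    using assms(2) z unfolding holo_on_def by blast
  show "\<exists>D. ((\<lambda>z. f z * g z) has_derivative D) (at z) \<and> (\<forall>c v. D (c *s v) = c * D v)"
    using has_derivative_mult[OF D(1) E(1)]
    by (intro exI[of _ "\<lambda>v. f z * E v + D v * g z"]) (auto simp: D(2) E(2) algebra_simps)
qed (use assms in \<open>auto simp: holo_on_def\<close>)

definition holo_near0 :: "(complex ^ 'm::finite \<Rightarrow> complex) \<Rightarrow> bool" where
  "holo_near0 g \<longleftrightarrow> (\<exists>U. 0 \<in> U \<and> holo_on g U)"

definition germ_rel :: "(complex ^ 'm::finite \<Rightarrow> complex) \<Rightarrow> (complex ^ 'm \<Rightarrow> complex) \<Rightarrow> bool" where
  "germ_rel g h \<longleftrightarrow> holo_near0 g \<and> holo_near0 h \<and> eventually (\<lambda>z. g z = h z) (nhds 0)"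

lemma holo_near0_const: "holo_near0 (\<lambda>_. k)"
  unfolding holo_near0_def by (auto intro!: exI[of _ UNIV] holo_on_const)

lemma holo_near0_add: "holo_near0 f \<Longrightarrow> holo_near0 g \<Longrightarrow> holo_near0 (\<lambda>z. f z + g z)"
  unfolding holo_near0_def
proof (elim exE conjE)
  fix U V :: "(complex^'a) set" assume "0 \<in> U" "holo_on f U" "0 \<in> V" "holo_on g V"
  moreover from this have "open (U \<inter> V)" by (auto simp: holo_on_def)
  ultimately have "0 \<in> U \<inter> V \<and> holo_on (\<lambda>z. f z + g z) (U \<inter> V)"
    by (auto intro!: holo_on_add intro: holo_on_subset)
  thus "\<exists>U. 0 \<in> U \<and> holo_on (\<lambda>z. f z + g z) U" by blast
qed

lemma holo_near0_mult: "holo_near0 f \<Longrightarrow> holo_near0 g \<Longrightarrow> holo_near0 (\<lambda>z. f z * g z)"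
  unfolding holo_near0_def
proof (elim exE conjE)
  fix U V :: "(complex^'a) set" assume "0 \<in> U" "holo_on f U" "0 \<in> V" "holo_on g V"
  moreover from this have "open (U \<inter> V)" by (auto simp: holo_on_def)
  ultimately have "0 \<in> U \<inter> V \<and> holo_on (\<lambda>z. f z * g z) (U \<inter> V)"
    by (auto intro!: holo_on_mult intro: holo_on_subset)
  thus "\<exists>U. 0 \<in> U \<and> holo_on (\<lambda>z. f z * g z) U" by blast
qed

text \<open>\<open>'m germ\<close> is the ring of germs at \<open>0\<close> of holomorphic functions on \<open>complex ^ 'm\<close>; a chart
  around a point identifies the stalk of the structure sheaf with it.\<close>
quotient_type 'm germ = "complex ^ ('m::finite) \<Rightarrow> complex" / partial: germ_rel
proof (rule part_equivpI)
  show "\<exists>g. germ_rel g (g :: complex ^ 'm \<Rightarrow> complex)"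
    by (rule exI[of _ "\<lambda>_. 0"]) (simp add: germ_rel_def holo_near0_const)
  show "symp germ_rel"
    by (rule sympI) (auto simp: germ_rel_def elim: eventually_mono)
  show "transp germ_rel"
    by (rule transpI) (auto simp: germ_rel_def elim: eventually_elim2)
qed

instantiation germ :: (finite) comm_ring_1
begin

lift_definition zero_germ :: "'a germ" is "\<lambda>_. 0"
  by (simp add: germ_rel_def holo_near0_const)
lift_definition one_germ :: "'a germ" is "\<lambda>_. 1"
  by (simp add: germ_rel_def holo_near0_const)
lift_definition plus_germ :: "'a germ \<Rightarrow> 'a germ \<Rightarrow> 'a germ" is "\<lambda>g h z. g z + h z"
  by (auto simp: germ_rel_def holo_near0_add elim: eventually_elim2)
lift_definition times_germ :: "'a germ \<Rightarrow> 'a germ \<Rightarrow> 'a germ" is "\<lambda>g h z. g z * h z"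
  by (auto simp: germ_rel_def holo_near0_mult elim: eventually_elim2)
lift_definition uminus_germ :: "'a germ \<Rightarrow> 'a germ" is "\<lambda>g z. - g z"
  by (auto simp: germ_rel_def elim: eventually_mono
      intro: holo_near0_mult[OF holo_near0_const[of "-1"], simplified])
definition minus_germ :: "'a germ \<Rightarrow> 'a germ \<Rightarrow> 'a germ" where
  "minus_germ g h = g + (- h)"

instance
proof
  fix a b c :: "'a germ"
  note [simp] = germ_rel_def holo_near0_add holo_near0_mult holo_near0_const
  show "a * b * c = a * (b * c)" by transfer (auto simp: mult.assoc)
  show "a * b = b * a" by transfer (auto simp: mult.commute)
  show "1 * a = a" by transfer auto
  show "a + b + c = a + (b + c)" by transfer (auto simp: add.assoc)
  show "a + b = b + a" by transfer (auto simp: add.commute)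
  show "0 + a = a" by transfer auto
  show "- a + a = 0" by transfer auto
  show "a - b = a + - b" by (simp add: minus_germ_def)
  show "(a + b) * c = a * c + b * c" by transfer (auto simp: distrib_right)
  show "(0 :: 'a germ) \<noteq> 1" by transfer (auto dest: eventually_nhds_x_imp_x)
qed

end

lemma linear_vector_scalar: "linear (\<lambda>w::complex. w *s b)"
  by (rule linearI) (simp_all add: vec_eq_iff distrib_right)

lemma holo_on_line:
  assumes "holo_on g U"
  shows "(\<lambda>w. g (a + w *s b)) holomorphic_on ((\<lambda>w::complex. a + w *s b) -` U)"
proof -
  have lin: "bounded_linear (\<lambda>w::complex. w *s b)"
    using linear_vector_scalar linear_conv_bounded_linear by blast
  have "(\<lambda>w. g (a + w *s b)) field_differentiable at w" if w: "a + w *s b \<in> U" for w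
  proof -
    obtain D where D: "(g has_derivative D) (at (a + w *s b))" "\<And>c v. D (c *s v) = c * D v"
      using assms w unfolding holo_on_def by blast
    have "((\<lambda>w. a + w *s b) has_derivative (\<lambda>w. w *s b)) (at w)"
      using has_derivative_add[OF has_derivative_const
          bounded_linear.has_derivative[OF lin has_derivative_ident]] by fastforce
    from has_derivative_compose[OF this D(1)]
    have "((\<lambda>w. g (a + w *s b)) has_derivative (\<lambda>w. D b * w)) (at w)"
      by (simp add: D(2) mult.commute)
    thus ?thesis unfolding field_differentiable_def has_field_derivative_def by blast
  qed
  thus ?thesis unfolding holomorphic_on_def
    by (auto intro: field_differentiable_at_within)
qed

lemma holo_on_ball_zero:
  assumes g: "holo_on g (ball 0 r)" and a: "a \<in> ball 0 r"
    and ev: "eventually (\<lambda>z. g z = 0) (nhds a)" and z: "z \<in> ball 0 r"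
  shows "g z = 0"
proof -
  define l where "l = (\<lambda>w::complex. a + w *s (z - a))"
  have lin: "linear (\<lambda>w::complex. w *s (z - a))"
    by (rule linear_vector_scalar)
  have cont: "continuous_on UNIV l"
    unfolding l_def by (intro continuous_intros linear_continuous_on linear_conv_bounded_linear[THEN iffD1] lin)
  define S where "S = l -` ball 0 r"
  have "open S" unfolding S_def using cont by (simp add: open_vimage)
  have "convex ((\<lambda>w. w *s (z - a)) -` ball (-a) r)"
    by (intro convex_linear_vimage lin convex_ball)
  moreover have "((\<lambda>w. w *s (z - a)) -` ball (-a) r) = S"
    by (auto simp: S_def l_def dist_norm norm_minus_commute algebra_simps)
  ultimately have "connected S" by (metis convex_connected)
  have "0 \<in> S" "1 \<in> S" using a z by (auto simp: S_def l_def)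
  obtain V where V: "open V" "a \<in> V" "\<And>y. y \<in> V \<Longrightarrow> g y = 0"
    using ev unfolding eventually_nhds by blast
  have "open (l -` V)" using cont V(1) by (simp add: open_vimage)
  moreover have "0 \<in> l -` V" using V(2) by (simp add: l_def)
  ultimately have T: "open (l -` V \<inter> S)" "0 \<in> l -` V \<inter> S" using \<open>open S\<close> \<open>0 \<in> S\<close> by auto
  have "(\<lambda>w. g (l w)) holomorphic_on S"
    unfolding S_def l_def using holo_on_line[OF g] .
  from analytic_continuation_open[OF T(1) \<open>open S\<close> _ \<open>connected S\<close> _ this holomorphic_on_const[of 0] _ \<open>1 \<in> S\<close>]
  have "g (l 1) = 0" using T(2) V(3) by auto
  thus ?thesis by (simp add: l_def)
qed

instance germ :: (finite) idom
proof
  fix a b :: "'a germ"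
  have main: "eventually (\<lambda>z. g z = 0) (nhds 0) \<or> eventually (\<lambda>z. h z = 0) (nhds 0)"
    if hol: "holo_near0 g" "holo_near0 h" and ev: "eventually (\<lambda>z. g z * h z = 0) (nhds 0)"
    for g h :: "complex ^ 'a \<Rightarrow> complex"
  proof -
    obtain U V W where *: "0 \<in> U" "holo_on g U" "0 \<in> V" "holo_on h V" "open W" "0 \<in> W"
        "\<And>z. z \<in> W \<Longrightarrow> g z * h z = 0"
      using hol ev unfolding holo_near0_def eventually_nhds by blast
    have "open (U \<inter> V \<inter> W)" using * by (auto simp: holo_on_def)
    then obtain r where r: "r > 0" "ball 0 r \<subseteq> U \<inter> V \<inter> W"
      using * openE[of "U \<inter> V \<inter> W" 0] by auto
    have g: "holo_on g (ball 0 r)" and h: "holo_on h (ball 0 r)"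
      using r(2) * by (auto intro: holo_on_subset)
    show ?thesis
    proof (cases "\<forall>z\<in>ball 0 r. g z = 0")
      case True
      hence "eventually (\<lambda>z. g z = 0) (nhds 0)"
        unfolding eventually_nhds using r(1) by (intro exI[of _ "ball 0 r"]) auto
      thus ?thesis by blast
    next
      case False
      then obtain p where p: "p \<in> ball 0 r" "g p \<noteq> 0" by blast
      have "isCont g p" using g p(1) unfolding holo_on_def
        by (auto dest!: bspec intro: has_derivative_continuous)
      hence "eventually (\<lambda>z. g z \<noteq> 0) (nhds p)"
        using p(2) tendsto_imp_eventually_ne[of g "g p" "at p" 0]
        by (auto simp: isCont_def eventually_at_filter elim: eventually_mono)
      moreover have "eventually (\<lambda>z. z \<in> ball 0 r) (nhds p)"
        using p(1) by (intro eventually_nhds_in_open) auto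
      ultimately have "eventually (\<lambda>z. h z = 0) (nhds p)"
        by eventually_elim (use *(7) r(2) in force)
      hence "\<forall>z\<in>ball 0 r. h z = 0" using holo_on_ball_zero[OF h p(1)] by blast
      hence "eventually (\<lambda>z. h z = 0) (nhds 0)"
        unfolding eventually_nhds using r(1) by (intro exI[of _ "ball 0 r"]) auto
      thus ?thesis by blast
    qed
  qed
  show "a \<noteq> 0 \<Longrightarrow> b \<noteq> 0 \<Longrightarrow> a * b \<noteq> 0"
    by transfer (use main in \<open>auto simp: germ_rel_def holo_near0_const holo_near0_mult\<close>)
qed


text \<open>The germ of \<open>g\<close> at \<open>x\<close>, in the coordinates of \<open>c\<close> translated so that \<open>x\<close> is the origin.\<close>
definition germ_at :: "('x, 'm::finite) chart \<Rightarrow> 'x \<Rightarrow> ('x \<Rightarrow> complex) \<Rightarrow> 'm germ" where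
  "germ_at c x g = abs_germ (\<lambda>z. in_chart c g (snd c x + z))"

lift_definition germ_const :: "complex \<Rightarrow> ('m::finite) germ" is "\<lambda>k _. k"
  by (simp add: germ_rel_def holo_near0_const)

definition germ_pd :: "'m \<Rightarrow> ('m::finite) germ \<Rightarrow> 'm germ" where
  "germ_pd i g = abs_germ (\<lambda>z. frechet_derivative (rep_germ g) (at z) (axis i 1))"

type_synonym 'm mero = "'m germ fract"

definition to_mero :: "('m::finite) germ \<Rightarrow> 'm mero" where
  "to_mero a = Fract a 1"

definition mero_pd :: "'m \<Rightarrow> ('m::finite) mero \<Rightarrow> 'm mero" where
  "mero_pd i q = (THE r. \<forall>a b. b \<noteq> 0 \<and> q = Fract a b \<longrightarrow>
     r = Fract (germ_pd i a * b - a * germ_pd i b) (b * b))"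

abbreviation germ_ring :: "('m::finite) germ ring" where
  "germ_ring \<equiv> ring_of_type_algebra"

abbreviation complex_ring :: "complex ring" where
  "complex_ring \<equiv> ring_of_type_algebra"


section \<open>Quotients, tensor products and restriction of scalars\<close>

text \<open>In all module records below the fields \<open>mult\<close> and \<open>one\<close> play no role.\<close>

definition submodule_gen :: "('r, 'k) ring_scheme \<Rightarrow> ('r, 'a, 'l) module_scheme \<Rightarrow> 'a set \<Rightarrow> 'a set" where
  "submodule_gen R M S = (\<lambda>N. submodule N R M) hull S"

definition quot_module :: "('r, 'a, 'l) module_scheme \<Rightarrow> 'a set \<Rightarrow> ('r, 'a set) module" where
  "quot_module M N =
     \<lparr>carrier = a_rcosets\<^bsub>M\<^esub> N, monoid.mult = undefined, one = undefined,
      zero = N, add = set_add M,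
      module.smult = (\<lambda>a C. \<Union>x\<in>C. N +>\<^bsub>M\<^esub> (a \<odot>\<^bsub>M\<^esub> x))\<rparr>"

definition tensor_relations ::
  "('r, 'k) ring_scheme \<Rightarrow> ('r, 'a, 'l) module_scheme \<Rightarrow> ('r, 'b, 'l2) module_scheme \<Rightarrow>
   ('a \<times> 'b \<Rightarrow>\<^sub>0 int) set" where
  "tensor_relations R M N =
     generate (free_Abelian_group (carrier M \<times> carrier N))
      ({frag_of (x \<oplus>\<^bsub>M\<^esub> x', y) - frag_of (x, y) - frag_of (x', y) | x x' y.
          x \<in> carrier M \<and> x' \<in> carrier M \<and> y \<in> carrier N} \<union>
       {frag_of (x, y \<oplus>\<^bsub>N\<^esub> y') - frag_of (x, y) - frag_of (x, y') | x y y'.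
          x \<in> carrier M \<and> y \<in> carrier N \<and> y' \<in> carrier N} \<union>
       {frag_of (a \<odot>\<^bsub>M\<^esub> x, y) - frag_of (x, a \<odot>\<^bsub>N\<^esub> y) | a x y.
          a \<in> carrier R \<and> x \<in> carrier M \<and> y \<in> carrier N})"

definition pure_tensor ::
  "('r, 'k) ring_scheme \<Rightarrow> ('r, 'a, 'l) module_scheme \<Rightarrow> ('r, 'b, 'l2) module_scheme \<Rightarrow>
   'a \<Rightarrow> 'b \<Rightarrow> ('a \<times> 'b \<Rightarrow>\<^sub>0 int) set" where
  "pure_tensor R M N x y =
     tensor_relations R M N #>\<^bsub>free_Abelian_group (carrier M \<times> carrier N)\<^esub> frag_of (x, y)"

definition tensor_module ::
  "('r, 'k) ring_scheme \<Rightarrow> ('r, 'a, 'l) module_scheme \<Rightarrow> ('r, 'b, 'l2) module_scheme \<Rightarrow>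
   ('r, ('a \<times> 'b \<Rightarrow>\<^sub>0 int) set) module" where
  "tensor_module R M N =
     (let F = free_Abelian_group (carrier M \<times> carrier N); K = tensor_relations R M N in
      \<lparr>carrier = rcosets\<^bsub>F\<^esub> K, monoid.mult = undefined, one = undefined,
       zero = K, add = set_mult F,
       module.smult = (\<lambda>a C. \<Union>u\<in>C.
          K #>\<^bsub>F\<^esub> frag_extend (\<lambda>(x, y). frag_of (a \<odot>\<^bsub>M\<^esub> x, y)) u)\<rparr>)"

definition restrict_scalars :: "('s \<Rightarrow> 'r) \<Rightarrow> ('r, 'a) module \<Rightarrow> ('s, 'a) module" where
  "restrict_scalars h M =
     \<lparr>carrier = carrier M, monoid.mult = monoid.mult M, one = one M, zero = zero M, add = add M,
      module.smult = (\<lambda>c x. h c \<odot>\<^bsub>M\<^esub> x)\<rparr>"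


section \<open>Logarithmic forms\<close>

text \<open>A meromorphic \<open>p\<close>-form \<open>\<omega>\<close> is represented by its values \<open>\<omega> [i\<^sub>1, \<dots>, i\<^sub>p]\<close> on the coordinate
  vector fields; it vanishes on lists of any other length.\<close>
type_synonym 'm form = "'m list \<Rightarrow> 'm mero"

definition form_module :: "(('m::finite) germ, 'm form) module" where
  "form_module =
     \<lparr>carrier = UNIV, monoid.mult = undefined, one = undefined,
      zero = (\<lambda>_. 0), add = (\<lambda>\<omega> \<eta> J. \<omega> J + \<eta> J),
      module.smult = (\<lambda>a \<omega> J. to_mero a * \<omega> J)\<rparr>"

text \<open>Exterior product of a \<open>1\<close>-form with a form.\<close>
definition wedge :: "('m::finite) form \<Rightarrow> 'm form \<Rightarrow> 'm form" where
  "wedge \<xi> \<beta> J =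
     (\<Sum>k<length J. (-1) ^ k * \<xi> [J ! k] * \<beta> (take k J @ drop (Suc k) J))"

definition ext_d :: "('m::finite) form \<Rightarrow> 'm form" where
  "ext_d \<beta> J =
     (\<Sum>k<length J. (-1) ^ k * mero_pd (J ! k) (\<beta> (take k J @ drop (Suc k) J)))"

definition one_form :: "('m \<Rightarrow> ('m::finite) mero) \<Rightarrow> 'm form" where
  "one_form \<xi> J = (case J of [i] \<Rightarrow> \<xi> i | _ \<Rightarrow> 0)"

definition dcoord :: "'m \<Rightarrow> ('m::finite) form" where
  "dcoord i = one_form (\<lambda>j. if j = i then 1 else 0)"

definition dlog :: "('m::finite) germ \<Rightarrow> 'm form" where
  "dlog g = one_form (\<lambda>j. Fract (germ_pd j g) g)"

definition wedge_list :: "('m::finite) form list \<Rightarrow> 'm form" where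
  "wedge_list \<omega>s = foldr wedge \<omega>s (\<lambda>J. if J = [] then 1 else 0)"

text \<open>\<open>\<Omega>\<^sub>X(log Y)\<close> for \<open>Y\<close> the zero divisor of \<open>t\<close>: generated by the holomorphic forms and the
  logarithmic differentials of the germs that are invertible off \<open>Y\<close>; by the Nullstellensatz these
  are the divisors of powers of \<open>t\<close>.\<close>
definition log_one_forms :: "('m::finite) germ \<Rightarrow> 'm form set" where
  "log_one_forms t =
     submodule_gen germ_ring form_module (range dcoord \<union> {dlog g | g. \<exists>k. g dvd t ^ k})"

definition log_forms :: "('m::finite) germ \<Rightarrow> nat \<Rightarrow> 'm form set" where
  "log_forms t p = submodule_gen germ_ring form_module
     {wedge_list \<omega>s | \<omega>s. length \<omega>s = p \<and> set \<omega>s \<subseteq> log_one_forms t}"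

definition log_module :: "('m::finite) germ \<Rightarrow> nat \<Rightarrow> ('m germ, 'm form) module" where
  "log_module t p = form_module\<lparr>carrier := log_forms t p\<rparr>"

text \<open>The kernel of \<open>\<Omega>\<^sup>p\<^sub>X(log Y) \<longrightarrow> \<Omega>\<^sup>p\<^sub>X\<^sub>/\<^sub>\<Delta>(log Y)\<close>: the degree \<open>p\<close> part of the ideal generated
  by \<open>dt/t\<close>, which generates \<open>f\<^sup>*\<Omega>\<^sub>\<Delta>(log 0)\<close>.\<close>
definition dt_multiples :: "('m::finite) germ \<Rightarrow> nat \<Rightarrow> 'm form set" where
  "dt_multiples t p =
     insert (\<lambda>_. 0) {wedge (dlog t) \<gamma> | \<gamma> q. Suc q = p \<and> \<gamma> \<in> log_forms t q}"

definition rel_log_module :: "('m::finite) germ \<Rightarrow> nat \<Rightarrow> ('m germ, 'm form set) module" where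
  "rel_log_module t p = quot_module (log_module t p) (dt_multiples t p)"

definition rel_log_module_Y :: "('m::finite) germ \<Rightarrow> nat \<Rightarrow> ('m germ, 'm form set set) module" where
  "rel_log_module_Y t p =
     quot_module (rel_log_module t p) ((\<lambda>x. t \<odot>\<^bsub>rel_log_module t p\<^esub> x) ` carrier (rel_log_module t p))"

definition rel_class_Y :: "('m::finite) germ \<Rightarrow> nat \<Rightarrow> 'm form \<Rightarrow> 'm form set set" where
  "rel_class_Y t p \<beta> =
     zero (rel_log_module_Y t p) +>\<^bsub>rel_log_module t p\<^esub> (dt_multiples t p +>\<^bsub>log_module t p\<^esub> \<beta>)"

text \<open>Vector fields are given by their coefficients with respect to the \<open>\<partial>\<^sub>i\<close>.\<close>
definition vf_apply :: "('m \<Rightarrow> 'm germ) \<Rightarrow> ('m::finite) germ \<Rightarrow> 'm germ" where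
  "vf_apply v g = (\<Sum>i\<in>UNIV. v i * germ_pd i g)"

definition pairing :: "('m::finite) form \<Rightarrow> ('m \<Rightarrow> 'm germ) \<Rightarrow> 'm mero" where
  "pairing \<xi> v = (\<Sum>i\<in>UNIV. \<xi> [i] * to_mero (v i))"

text \<open>The dual of \<open>\<Omega>\<^sub>X\<^sub>/\<^sub>\<Delta>(log Y)\<close> inside the vector fields.\<close>
definition rel_log_fields :: "('m::finite) germ \<Rightarrow> ('m \<Rightarrow> 'm germ) set" where
  "rel_log_fields t =
     {v. (\<forall>\<xi>\<in>log_one_forms t. pairing \<xi> v \<in> range to_mero) \<and> pairing (dlog t) v = 0}"

definition rel_dual_frames ::
  "('m::finite) germ \<Rightarrow> nat \<Rightarrow> (nat \<Rightarrow> 'm form) \<Rightarrow> (nat \<Rightarrow> 'm \<Rightarrow> 'm germ) \<Rightarrow> bool" where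
  "rel_dual_frames t n \<xi> D \<longleftrightarrow>
     (\<forall>j<n. \<xi> j \<in> log_one_forms t \<and> D j \<in> rel_log_fields t) \<and>
     (\<forall>i<n. \<forall>j<n. pairing (\<xi> i) (D j) = (if i = j then 1 else 0)) \<and>
     submodule_gen germ_ring form_module (insert (dlog t) (\<xi> ` {..<n})) = log_one_forms t"


section \<open>Differential operators\<close>

text \<open>\<open>diffop k\<close>: the operators \<open>\<Sum>a\<^sub>\<gamma> \<partial>\<^sup>\<gamma>\<close> of order at most \<open>k\<close>, acting on germs.\<close>
inductive diffop :: "nat \<Rightarrow> (('m::finite) germ \<Rightarrow> 'm germ) \<Rightarrow> bool" where
  scalar: "diffop k (\<lambda>g. a * g)"
| add: "diffop k P \<Longrightarrow> diffop k Q \<Longrightarrow> diffop k (\<lambda>g. P g + Q g)"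
| lmult: "diffop k P \<Longrightarrow> diffop k (\<lambda>g. a * P g)"
| pd: "diffop k P \<Longrightarrow> diffop (Suc k) (\<lambda>g. germ_pd i (P g))"

definition D_filt :: "int \<Rightarrow> (('m::finite) germ \<Rightarrow> 'm germ) set" where
  "D_filt l = (if l < 0 then {\<lambda>_. 0} else {P. diffop (nat l) P})"

definition D_module :: "(('m::finite) germ, 'm germ \<Rightarrow> 'm germ) module" where
  "D_module =
     \<lparr>carrier = (\<Union>l. D_filt l), monoid.mult = undefined, one = undefined,
      zero = (\<lambda>_. 0), add = (\<lambda>P Q g. P g + Q g), module.smult = (\<lambda>a P g. a * P g)\<rparr>"


section \<open>The module \<open>M\<close> and its endomorphism \<open>R\<close>\<close>

text \<open>Everything below takes place in the stalk at a point where \<open>t\<close> is the germ of the map to the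
  disk, on a manifold of dimension \<open>n + 1\<close>.\<close>

type_synonym 'm dr_elem = "('m form set set \<times> ('m germ \<Rightarrow> 'm germ) \<Rightarrow>\<^sub>0 int) set"

text \<open>\<open>\<Omega>\<^sup>p\<^sub>X\<^sub>/\<^sub>\<Delta>(log Y)|\<^sub>Y \<otimes> D\<^sub>X\<close> as a complex vector space.\<close>
definition dr_term :: "('m::finite) germ \<Rightarrow> nat \<Rightarrow> (complex, 'm dr_elem) module" where
  "dr_term t p =
     restrict_scalars germ_const (tensor_module germ_ring (rel_log_module_Y t p) D_module)"

definition dr_tensor ::
  "('m::finite) germ \<Rightarrow> nat \<Rightarrow> 'm form \<Rightarrow> ('m germ \<Rightarrow> 'm germ) \<Rightarrow> 'm dr_elem" where
  "dr_tensor t p \<beta> P = pure_tensor germ_ring (rel_log_module_Y t p) D_module (rel_class_Y t p \<beta>) P"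

text \<open>The image in \<open>dr_term t n\<close> of the differential of the complex (zero if \<open>n = 0\<close>).
  The differential does not depend on the choice of the dual frames \<open>\<xi>\<close>, \<open>D\<close>, and the sign
  coming from the shift does not affect its image.\<close>
definition dr_boundaries :: "('m::finite) germ \<Rightarrow> nat \<Rightarrow> 'm dr_elem set" where
  "dr_boundaries t n = submodule_gen complex_ring (dr_term t n)
     {dr_tensor t n (ext_d \<beta>) P \<oplus>\<^bsub>dr_term t n\<^esub>
        (\<Oplus>\<^bsub>dr_term t n\<^esub>j\<in>{..<n}. dr_tensor t n (wedge (\<xi> j) \<beta>) (vf_apply (D j) \<circ> P))
      | \<beta> P \<xi> D p. Suc p = n \<and> \<beta> \<in> log_forms t p \<and> P \<in> carrier D_module \<and>
          rel_dual_frames t n \<xi> D}"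

text \<open>The cohomology in degree \<open>0\<close>, the highest degree of the complex.\<close>
definition M_mod :: "('m::finite) germ \<Rightarrow> nat \<Rightarrow> (complex, 'm dr_elem set) module" where
  "M_mod t n = quot_module (dr_term t n) (dr_boundaries t n)"

definition M_class ::
  "('m::finite) germ \<Rightarrow> nat \<Rightarrow> 'm form \<Rightarrow> ('m germ \<Rightarrow> 'm germ) \<Rightarrow> 'm dr_elem set" where
  "M_class t n \<beta> P = dr_boundaries t n +>\<^bsub>dr_term t n\<^esub> dr_tensor t n \<beta> P"

definition M_filt :: "('m::finite) germ \<Rightarrow> nat \<Rightarrow> int \<Rightarrow> 'm dr_elem set set" where
  "M_filt t n l = submodule_gen complex_ring (M_mod t n)
     {M_class t n \<beta> P | \<beta> P. \<beta> \<in> log_forms t n \<and> P \<in> D_filt (l + int n)}"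

text \<open>Inverse of \<open>dt/t \<and> _\<close>, as a representative in \<open>\<Omega>\<^sup>n\<^sub>X(log Y)\<close> whose class in
  \<open>\<Omega>\<^sup>n\<^sub>X\<^sub>/\<^sub>\<Delta>(log Y)\<close> is well defined.\<close>
definition dt_wedge_inv :: "('m::finite) germ \<Rightarrow> nat \<Rightarrow> 'm form \<Rightarrow> 'm form" where
  "dt_wedge_inv t n \<omega> = (SOME \<gamma>. \<gamma> \<in> log_forms t n \<and> wedge (dlog t) \<gamma> = \<omega>)"

definition R_op :: "('m::finite) germ \<Rightarrow> nat \<Rightarrow> 'm dr_elem set \<Rightarrow> 'm dr_elem set" where
  "R_op t n = (THE R.
     R \<in> extensional (carrier (M_mod t n)) \<and>
     R \<in> hom (add_monoid (M_mod t n)) (add_monoid (M_mod t n)) \<and>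
     (\<forall>\<beta>\<in>log_forms t n. \<forall>P\<in>carrier D_module.
        R (M_class t n \<beta> P) =
          M_class t n (dt_wedge_inv t n (ext_d \<beta>)) P \<oplus>\<^bsub>M_mod t n\<^esub>
          (\<Oplus>\<^bsub>M_mod t n\<^esub>i\<in>UNIV.
             M_class t n (dt_wedge_inv t n (wedge (dcoord i) \<beta>)) (germ_pd i \<circ> P))))"

definition R_minus ::
  "('m::finite) germ \<Rightarrow> nat \<Rightarrow> real \<Rightarrow> 'm dr_elem set \<Rightarrow> 'm dr_elem set" where
  "R_minus t n \<mu> m = R_op t n m \<ominus>\<^bsub>M_mod t n\<^esub> (complex_of_real \<mu> \<odot>\<^bsub>M_mod t n\<^esub> m)"

definition R_gen_eigen :: "('m::finite) germ \<Rightarrow> nat \<Rightarrow> real \<Rightarrow> 'm dr_elem set set" where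
  "R_gen_eigen t n \<mu> =
     {m \<in> carrier (M_mod t n). \<exists>k. (R_minus t n \<mu> ^^ k) m = \<zero>\<^bsub>M_mod t n\<^esub>}"

definition M_ge :: "('m::finite) germ \<Rightarrow> nat \<Rightarrow> real \<Rightarrow> 'm dr_elem set set" where
  "M_ge t n \<alpha> = submodule_gen complex_ring (M_mod t n) (\<Union>\<mu>\<in>{\<alpha>..}. R_gen_eigen t n \<mu>)"

definition M_gt :: "('m::finite) germ \<Rightarrow> nat \<Rightarrow> real \<Rightarrow> 'm dr_elem set set" where
  "M_gt t n \<alpha> = submodule_gen complex_ring (M_mod t n) (\<Union>\<mu>\<in>{\<alpha><..}. R_gen_eigen t n \<mu>)"

definition M_gr :: "('m::finite) germ \<Rightarrow> nat \<Rightarrow> real \<Rightarrow> (complex, 'm dr_elem set set) module" where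
  "M_gr t n \<alpha> = quot_module ((M_mod t n)\<lparr>carrier := M_ge t n \<alpha>\<rparr>) (M_gt t n \<alpha>)"

text \<open>\<open>(F\<^sub>l M \<inter> M\<^sub>\<ge>\<^sub>\<alpha>) / (F\<^sub>l M \<inter> M\<^sub>>\<^sub>\<alpha>)\<close> as a subset of \<open>M_gr t n \<alpha>\<close>.\<close>
definition M_gr_filt :: "('m::finite) germ \<Rightarrow> nat \<Rightarrow> real \<Rightarrow> int \<Rightarrow> 'm dr_elem set set set" where
  "M_gr_filt t n \<alpha> l =
     (\<lambda>m. M_gt t n \<alpha> +>\<^bsub>M_mod t n\<^esub> m) ` (M_filt t n l \<inter> M_ge t n \<alpha>)"

text \<open>The endomorphism of \<open>M_gr t n \<alpha>\<close> induced by \<open>R - \<alpha>\<close>.\<close>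
definition R_gr ::
  "('m::finite) germ \<Rightarrow> nat \<Rightarrow> real \<Rightarrow> 'm dr_elem set set \<Rightarrow> 'm dr_elem set set" where
  "R_gr t n \<alpha> C = (\<Union>m\<in>C. M_gt t n \<alpha> +>\<^bsub>M_mod t n\<^esub> R_minus t n \<alpha> m)"

end

theory Submission
  imports Defs "HOL-Library.Function_Algebras"
begin

text \<open>At points where \<open>f\<close> does not vanish \<open>t\<close> is a unit and \<open>M = 0\<close>. At a point of \<open>Y\<close> write
  \<open>t = \<Prod>\<^sub>i x\<^sub>i\<^bsup>e\<^sub>i\<^esup>\<close>. A logarithmic frame trivializes the top relative forms and identifies \<open>M\<close> with
  \<open>D/(tD + \<Sum>\<^sub>j E\<^sub>j D)\<close>, where the \<open>E\<^sub>j\<close> span the relative logarithmic vector fields, and \<open>R\<close> with left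
  multiplication by a logarithmic field \<open>s\<close> dual to \<open>dt/t\<close>. Letting \<open>D\<close> act on the multivalued form
  \<open>\<Prod>\<^sub>i x\<^sub>i\<^bsup>-e\<^sub>is-1\<^esup> dx\<close> turns a differential operator modulo \<open>\<Sum>\<^sub>j E\<^sub>j D\<close> into a polynomial in \<open>s\<close> with
  germs as coefficients. Membership in \<open>x\<^sup>a D + \<Sum>\<^sub>j E\<^sub>j D\<close> then means that the part of each exponent
  is divisible by a Bernstein polynomial, a product of factors \<open>e\<^sub>i s - k\<close>. Consequently
  \<open>M\<^bsub>\<ge>\<alpha>\<^esub>\<close> and \<open>M\<^bsub>>\<alpha>\<^esub>\<close> are the images of the right ideals with \<open>a\<^sub>i = \<lceil>e\<^sub>i\<alpha>\<rceil>\<close> and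
  \<open>a\<^sub>i = \<lfloor>e\<^sub>i\<alpha>\<rfloor> + 1\<close>, and strictness is checked exponent by exponent, where it amounts to dividing
  by \<open>(s - \<alpha>)\<^sup>r\<close>, which lowers the order of an operator by \<open>r\<close>.\<close>

text \<open>A class in \<open>M\<close> has many representatives, and lying in x^a D + \<Sum> E_j D
  says nothing about the order of a good one; this is the obstacle. The polynomial model controls
  orders: the transform has degree at most the order, its kernel is exactly \<Sum> E_j D, and a
  polynomial of degree at most q that passes the divisibility test is the transform of some x^a Q
  with Q of order at most q. The exponents -e_i s - 1 are chosen so that the right action of x_i
  \<partial>_i, minus the Lie derivative, is multiplication by e_i s; the combinations E_j then act
  by zero, and repeated \<partial>_i produce the factors e_i s + 1, e_i s + 2, ... with constant
  coefficients. Divisibility is thus decided over the complex numbers, where Bezout identities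
  exist. The rounding of e_i \<alpha> comes from the roots: modulo t D the eigenvalues of s on x^a D
  are among the k / e_i with a_i \<le> k < e_i. Replacing a_i by b_i adds a factor s - \<alpha> for
  each i with e_i \<alpha> an integer, as far as the exponent still needs it; the number of these
  factors, compared with r, decides what happens to that exponent.\<close>

no_notation fps_nth (infixl "$" 75)

section \<open>Holomorphic functions of several variables\<close>

abbreviation fd :: "(complex ^ 'm::finite => complex) => complex ^ 'm => complex ^ 'm => complex" where
  "fd g z v \<equiv> frechet_derivative g (at z) v"

lemma holo_on_has_derivative:
  assumes "holo_on g U" "z \<in> U"
  shows "(g has_derivative frechet_derivative g (at z)) (at z)"
  using assms unfolding holo_on_def by (metis differentiableI frechet_derivative_works)

lemma holo_on_fd_scale:
  assumes "holo_on g U" "z \<in> U"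
  shows "fd g z (c *s v) = c * fd g z v" using assms unfolding holo_on_def by (metis frechet_derivative_at)

lemma holo_on_fd_add:
  assumes "holo_on g U" "z \<in> U"
  shows "fd g z (v + w) = fd g z v + fd g z w"
  using holo_on_has_derivative[OF assms] by (simp add: has_derivative_linear linear_add)

lemma holo_on_open: "holo_on g U ==> open U" by (simp add: holo_on_def)

lemma holo_on_continuous:
  assumes "holo_on g U" shows "continuous_on U g"
  using assms by (meson continuous_at_imp_continuous_on has_derivative_continuous holo_on_has_derivative)

lemma holo_onI:
  assumes "open U" "!!z. z \<in> U ==> (g has_derivative D z) (at z)"
    "!!z c v. z \<in> U ==> D z (c *s v) = c * D z v"
  shows "holo_on g U" unfolding holo_on_def using assms by blast

lemma holo_on_cong:
  assumes "holo_on g U" "!!z. z \<in> U ==> h z = g z" shows "holo_on h U"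
proof (rule holo_onI[OF holo_on_open[OF assms(1)]])
  fix z assume z: "z \<in> U"
  show "(h has_derivative frechet_derivative g (at z)) (at z)"
    by (rule has_derivative_transform_within_open[OF holo_on_has_derivative[OF assms(1) z] holo_on_open[OF assms(1)] z])
       (simp add: assms(2))
  show "fd g z (c *s v) = c * fd g z v" for c v by (rule holo_on_fd_scale[OF assms(1) z])
qed

lemma holo_on_Union:
  assumes "!!z. z \<in> U ==> \<exists>V. z \<in> V \<and> V \<subseteq> U \<and> holo_on g V"
  shows "holo_on g U"
proof -
  have "open U" using assms by (metis holo_on_open openI open_contains_ball subset_trans)
  moreover have "\<exists>D. (g has_derivative D) (at z) \<and> (\<forall>c v. D (c *s v) = c * D v)" if "z \<in> U" for z
    using assms[OF that] unfolding holo_on_def by blast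
  ultimately show ?thesis unfolding holo_on_def by blast
qed

section \<open>Complex scaling of vectors and integrals depending on a parameter\<close>

lemma vector_scaleR_eq: "(r::real) *\<^sub>R (v::complex ^ 'm) = complex_of_real r *s v"
  by (simp add: vec_eq_iff complex_eq_iff)

lemma norm_vector_scale: "norm ((c::complex) *s (v::complex ^ 'm::finite)) = cmod c * norm v"
  by (simp add: norm_vec_def norm_mult L2_set_right_distrib)

lemma bounded_linear_vector_scale: "bounded_linear (%c::complex. c *s (v::complex ^ 'm::finite))"
  using linear_vector_scalar linear_conv_bounded_linear by blast

lemma continuous_on_vector_scale [continuous_intros]:
  "continuous_on S f ==> continuous_on S g ==> continuous_on S (%x. f x *s (g x :: complex ^ 'm::finite))"
  unfolding vector_scalar_mult_def by (intro continuous_intros)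

text \<open>Complex analogue of the Leibniz rule for \<open>\<integral> k(s) g(z + c(s) z\<^sub>i e\<^sub>i + b(s)) ds\<close>:
  for \<open>c = 0\<close> it applies to Cauchy integrals and for \<open>c(s) = s - 1\<close> to Hadamard's quotient.\<close>
lemma has_derivative_param_integral:
  fixes i :: "'m::finite" and g :: "complex ^ 'm::finite => complex" and k c :: "real => complex" and b :: "real => complex ^ 'm"
  defines "q \<equiv> %z s. z + (c s * z $ i) *s axis i 1 + b s"
  assumes g: "holo_on g U" and C1: "!!v. continuous_on U (%z. fd g z v)"
    and kcb: "continuous_on {0..1} k" "continuous_on {0..1} c" "continuous_on {0..1} b"
    and V: "open V" "convex V" and q: "!!z s. z \<in> V ==> s \<in> {0..1} ==> q z s \<in> U" and z: "z \<in> V"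
  defines "D \<equiv> %z v. integral {0..1} (%s. k s * fd g (q z s) (v + (c s * v $ i) *s axis i 1))"
  shows "((%z. integral {0..1} (%s. k s * g (q z s))) has_derivative D z) (at z)"
    and "D z (w *s v) = w * D z v"
proof -
  define L where "L = (%s (v::complex ^ 'm). v + (c s * v $ i) *s axis i 1)"
  have L: "bounded_linear (L s)" for s unfolding L_def linear_conv_bounded_linear[symmetric]
    by (rule linearI) (auto simp: vec_eq_iff algebra_simps vector_scaleR_eq)
  have Lq: "((%z. q z s) has_derivative L s) (at x within V)" for s x unfolding q_def L_def[symmetric]
    using has_derivative_add[OF bounded_linear.has_derivative[OF L has_derivative_ident] has_derivative_const, of s "b s"]
    by (simp add: L_def)
  have D1: "((%z. k s * g (q z s)) has_derivative (%v. k s * fd g (q x s) (L s v))) (at x within V)"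
    if "x \<in> V" "s \<in> {0..1}" for s x
  proof -
    have "(g has_derivative frechet_derivative g (at (q x s))) (at (q x s))"
      by (rule holo_on_has_derivative[OF g q[OF that]])
    from has_derivative_compose[OF Lq this] show ?thesis by (intro has_derivative_mult_right)
  qed
  \<comment> \<open>The Leibniz rule wants the derivative as a continuous family of bounded linear
    maps; its continuity is checked vector by vector, which is where the continuity of
    \<open>fd g _ v\<close> for each v enters.\<close>
  define fx where "fx = (%x s. Blinfun (%v. k s * fd g (q x s) (L s v)))"
  have fx: "blinfun_apply (fx x s) = (%v. k s * fd g (q x s) (L s v))"
    if "x \<in> V" "s \<in> {0..1}" for s x
    unfolding fx_def by (rule bounded_linear_Blinfun_apply[OF has_derivative_bounded_linear[OF D1[OF that]]])
  have contq: "continuous_on (V \<times> {0..1}) (%(z,s). q z s)" unfolding q_def case_prod_beta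
    by (intro continuous_intros continuous_on_compose2[OF kcb(2)] continuous_on_compose2[OF kcb(3)]) auto
  have contfd: "continuous_on (V \<times> {0..1}) (%(z,s). fd g (q z s) v)" for v
    using continuous_on_compose2[OF C1 contq, of v] q by (fastforce simp: case_prod_beta)
  have "continuous_on (V \<times> {0..1}) (%(z,s). k s * (fd g (q z s) v + (c s * v $ i) * fd g (q z s) (axis i 1)))" for v
    unfolding case_prod_beta
    by (intro continuous_intros continuous_on_compose2[OF kcb(1)] continuous_on_compose2[OF kcb(2)]
          contfd[unfolded case_prod_beta]) auto
  moreover have "k s * (fd g (q z s) v + (c s * v $ i) * fd g (q z s) (axis i 1)) = blinfun_apply (fx z s) v"
    if "z \<in> V" "s \<in> {0..1}" for z s v
    unfolding fx[OF that] L_def holo_on_fd_add[OF g q[OF that]] holo_on_fd_scale[OF g q[OF that]] ..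
  ultimately have "continuous_on (V \<times> {0..1}) (%p. blinfun_apply (case p of (z,s) => fx z s) v)" for v
    by (subst continuous_on_cong[OF refl, where g = "%(z,s). k s * (fd g (q z s) v + (c s * v $ i) * fd g (q z s) (axis i 1))"]) auto
  hence contfx: "continuous_on (V \<times> cbox 0 1) (%(z,s). fx z s)"
    by (intro continuous_on_blinfun_componentwise) simp
  have cg: "continuous_on {0..1} (%s. k s * g (q x s))" if "x \<in> V" for x
    unfolding q_def by (intro continuous_intros kcb continuous_on_compose2[OF holo_on_continuous[OF g]])
      (use q that in \<open>auto simp: q_def\<close>)
  have cfx: "continuous_on {0..1} (fx z)"
  proof -
    have "continuous_on {0..1} (%s. case (z, s) of (z, s) => fx z s)"
      by (rule continuous_on_compose2[OF contfx]) (use z in \<open>auto intro!: continuous_intros\<close>)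
    thus ?thesis by simp
  qed
  have "((%z. integral (cbox 0 1) (%s. k s * g (q z s))) has_derivative integral (cbox 0 1) (fx z)) (at z within V)"
    by (rule leibniz_rule) (use D1 fx cg contfx z V in \<open>auto intro!: integrable_continuous_interval\<close>)
  moreover have "blinfun_apply (integral (cbox 0 1) (fx z)) = D z"
  proof
    fix v
    have "blinfun_apply (integral {0..1} (fx z)) v = integral {0..1} (%s. blinfun_apply (fx z s) v)"
      by (rule blinfun_apply_integral) (rule integrable_continuous_interval[OF cfx])
    also have "\<dots> = D z v" unfolding D_def by (rule integral_cong) (simp add: fx z L_def)
    finally show "blinfun_apply (integral (cbox 0 1) (fx z)) v = D z v" by simp
  qed
  ultimately show "((%z. integral {0..1} (%s. k s * g (q z s))) has_derivative D z) (at z)"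
    by (simp add: at_within_open[OF z V(1)])
  have "D z (w *s v) = integral {0..1} (%s. w * (k s * fd g (q z s) (L s v)))" unfolding D_def
  proof (rule integral_cong)
    fix s :: real assume s: "s \<in> {0..1}"
    have "(w *s v) + (c s * (w *s v) $ i) *s axis i 1 = w *s L s v"
      by (simp add: L_def vec_eq_iff algebra_simps)
    thus "k s * fd g (q z s) (w *s v + (c s * (w *s v) $ i) *s axis i 1) = w * (k s * fd g (q z s) (L s v))"
      using holo_on_fd_scale[OF g q[OF z s]] by simp
  qed
  thus "D z (w *s v) = w * D z v" by (simp add: D_def L_def)
qed

section \<open>Cauchy's formula along complex lines and its consequences for derivatives\<close>

lemma fd_eq_deriv_line:
  assumes "holo_on g U" "z \<in> U"
  shows "deriv (%w. g (z + w *s v)) 0 = fd g z v"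
proof (rule DERIV_imp_deriv)
  have "((%w. z + w *s v) has_derivative (%w. w *s v)) (at (0::complex))"
    using has_derivative_add[OF has_derivative_const
          bounded_linear.has_derivative[OF bounded_linear_vector_scale has_derivative_ident]] by fastforce
  moreover have "(g has_derivative frechet_derivative g (at (z + (0::complex) *s v))) (at (z + (0::complex) *s v))"
    using holo_on_has_derivative[OF assms] by simp
  ultimately have "((%w. g (z + w *s v)) has_derivative (%w. fd g (z + (0::complex) *s v) (w *s v))) (at 0)"
    by (rule has_derivative_compose)
  thus "((%w. g (z + w *s v)) has_field_derivative fd g z v) (at 0)"
    by (simp add: has_field_derivative_def holo_on_fd_scale[OF assms] mult_commute_abs)
qed

abbreviation "circ \<equiv> circlepath 0"

text \<open>Cauchy's formula for the first derivative on the disc w \<mapsto> z + w v. Over [0,1]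
  the velocity of the circle is 2 \<pi> \<i> \<open>circ r s\<close>, which cancels the constant in
  front and one of the two denominators. The point z now enters only through g, so regularity in z
  follows by working under the integral sign.\<close>

lemma fd_Cauchy_integral:
  assumes g: "holo_on g U" and r: "r > 0" and sub: "!!w. w \<in> cball 0 r ==> z + w *s v \<in> U"
  shows "fd g z v = integral {0..1} (%s. 1 / circ r s * g (z + circ r s *s v))"
proof -
  let ?h = "%w. g (z + w *s v)" and ?c = "circlepath 0 r"
  have hol: "?h holomorphic_on (%w. z + w *s v) -` U" by (rule holo_on_line[OF g])
  have sub': "cball 0 r \<subseteq> (%w. z + w *s v) -` U" using sub by auto
  have "((%u. ?h u / (u - 0) ^ Suc 1) has_contour_integral (2 * pi * \<i>) / fact 1 * (deriv ^^ 1) ?h 0) ?c"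
  proof (rule Cauchy_has_contour_integral_higher_derivative_circlepath)
    show "continuous_on (cball 0 r) ?h" "?h holomorphic_on ball 0 r"
      using holomorphic_on_subset[OF hol sub'] holomorphic_on_subset[OF _ ball_subset_cball]
      by (blast intro: holomorphic_on_imp_continuous_on)+
  qed (use r in auto)
  hence "((%s. ?h (?c s) / (?c s)^2 * vector_derivative ?c (at s within {0..1})) has_integral 2 * pi * \<i> * deriv ?h 0) {0..1}"
    by (simp add: has_contour_integral_def numeral_2_eq_2)
  hence "((%s. 2 * pi * \<i> * (1 / ?c s * ?h (?c s))) has_integral 2 * pi * \<i> * deriv ?h 0) {0..1}"
  proof (rule has_integral_eq[rotated])
    fix s :: real assume s: "s \<in> {0..1}"
    have "vector_derivative ?c (at s within {0..1}) = 2 * pi * \<i> * ?c s"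
      using s by (subst vector_derivative_circlepath01) (auto simp: circlepath)
    moreover have "?c s ~= 0" using r by (simp add: circlepath)
    ultimately show "?h (?c s) / (?c s)^2 * vector_derivative ?c (at s within {0..1}) = 2 * pi * \<i> * (1 / ?c s * ?h (?c s))"
      by (simp only:) (simp add: power2_eq_square)
  qed
  from has_integral_mult_right[OF this, of "1 / (2 * pi * \<i>)"]
  have "((%s. 1 / ?c s * ?h (?c s)) has_integral deriv ?h 0) {0..1}" by (simp add: field_simps)
  moreover have "z \<in> U" using sub[of 0] r by simp
  ultimately show ?thesis using fd_eq_deriv_line[OF g] by (simp add: integral_unique)
qed

text \<open>One radius has to serve all base points near \<open>z0\<close>, so that Cauchy's formula
  holds there with a fixed circle and can be differentiated in the base point.\<close>

lemma disc_translates_in_open: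
  fixes v :: "complex ^ 'm::finite"
  assumes "open U" "z0 \<in> U"
  obtains r V where "r > 0" "open V" "convex V" "z0 \<in> V" "V \<subseteq> U"
    "!!z w. z \<in> V ==> w \<in> cball 0 r ==> z + w *s v \<in> U"
proof -
  obtain R where R: "R > 0" "ball z0 R \<subseteq> U" using assms openE by blast
  \<comment> \<open>The summand 1 keeps the denominator positive when v = 0. Half of R is left for
    moving the centre, half for the disc.\<close>
  define r where "r = R / (2 * (norm v + 1))"
  have nv: "norm v + 1 > 0" by (simp add: add_nonneg_pos)
  have r: "r > 0" using R(1) nv by (simp add: r_def)
  have rv: "r * norm v \<le> R / 2" unfolding r_def using R(1) nv by (simp add: field_simps)
  show thesis
  proof
    show "ball z0 (R/2) \<subseteq> U" using R by (auto simp: dist_norm)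
    fix z w assume z: "z \<in> ball z0 (R/2)" and w: "w \<in> cball (0::complex) r"
    have "dist z0 (z + w *s v) \<le> dist z0 z + norm (w *s v)"
      by (metis add_diff_cancel_left' dist_commute dist_norm dist_triangle2)
    also have "norm (w *s v) \<le> r * norm v" using w by (simp add: norm_vector_scale mult_right_mono)
    finally show "z + w *s v \<in> U" using z rv R by auto
  qed (use R r in auto)
qed

lemma continuous_on_circlepath: "continuous_on {0..1} (circlepath z r)"
  using valid_path_imp_path[OF valid_path_circlepath[of z r]] by (simp add: path_def)

text \<open>\<open>holo_on\<close> only demands complex differentiability at each point, so
  continuity of the derivative has to be earned: near \<open>z0\<close> it is an integral of the
  continuous function g over a fixed circle.\<close>

lemma continuous_on_fd:
  fixes g :: "complex ^ 'm::finite => complex"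
  assumes g: "holo_on g U"
  shows "continuous_on U (%z. fd g z v)"
proof (rule continuous_at_imp_continuous_on, intro ballI)
  fix z0 assume z0: "z0 \<in> U"
  obtain r V where rV: "r > 0" "open V" "convex V" "z0 \<in> V" "V \<subseteq> U"
    "!!z w. z \<in> V ==> w \<in> cball 0 r ==> z + w *s v \<in> U"
    by (rule disc_translates_in_open[OF holo_on_open[OF g] z0, of v]) blast
  have "continuous_on (V \<times> cbox 0 1) (%(z,s). 1 / circ r s * g (z + circ r s *s v))"
    unfolding case_prod_beta by (intro continuous_intros continuous_on_compose2[OF holo_on_continuous[OF g]]
        continuous_on_compose2[OF continuous_on_circlepath])
       (use rV in \<open>auto simp: circlepath norm_mult\<close>)
  hence "continuous_on V (%z. integral {0..1} (%s. 1 / circ r s * g (z + circ r s *s v)))"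
    using integral_continuous_on_param by fastforce
  moreover have "integral {0..1} (%s. 1 / circ r s * g (z + circ r s *s v)) = fd g z v"
    if "z \<in> V" for z by (rule fd_Cauchy_integral[OF g rV(1), symmetric]) (use rV that in auto)
  ultimately have "continuous_on V (%z. fd g z v)" by simp
  thus "isCont (%z. fd g z v) z0" using rV continuous_on_eq_continuous_at by blast
qed

text \<open>The derivative in direction v is a Cauchy integral of g; differentiating it under the
  integral in direction u gives the Cauchy integral of the derivative of g in direction u. Keeping
  this explicit formula is what yields the symmetry of second derivatives.\<close>

lemma has_derivative_fd:
  fixes g :: "complex ^ 'm::finite => complex"
  assumes g: "holo_on g U" and z: "z \<in> U"
  obtains r where "r > 0" "!!w. w \<in> cball 0 r ==> z + w *s v \<in> U"
    "((%z. fd g z v) has_derivative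
       (%u. integral {0..1} (%s. 1 / circ r s * fd g (z + circ r s *s v) u))) (at z)"
    "!!w u. integral {0..1} (%s. 1 / circ r s * fd g (z + circ r s *s v) (w *s u)) =
       w * integral {0..1} (%s. 1 / circ r s * fd g (z + circ r s *s v) u)"
proof -
  obtain r V where rV: "r > 0" "open V" "convex V" "z \<in> V" "V \<subseteq> U"
    "!!z w. z \<in> V ==> w \<in> cball 0 r ==> z + w *s v \<in> U"
    by (rule disc_translates_in_open[OF holo_on_open[OF g] z, of v]) blast
  have k: "continuous_on {0..1} (%s. 1 / circ r s)"
    by (intro continuous_intros continuous_on_circlepath) (use rV(1) in \<open>auto simp: circlepath\<close>)
  have b: "continuous_on {0..1} (%s. circ r s *s v)"
    by (intro continuous_intros continuous_on_circlepath)
  have q: "x + (0 * x $ i) *s axis i 1 + circ r s *s v \<in> U" if "x \<in> V" for x s i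
    using rV(6)[OF that, of "circ r s"] rV(1) by (simp add: circlepath norm_mult)
  note par = has_derivative_param_integral[OF g continuous_on_fd[OF g] k continuous_on_const b rV(2,3) q rV(4)]
  have "((%z. integral {0..1} (%s. 1 / circ r s * g (z + circ r s *s v))) has_derivative
       (%u. integral {0..1} (%s. 1 / circ r s * fd g (z + circ r s *s v) u))) (at z)"
    using par(1) by simp
  moreover have "integral {0..1} (%s. 1 / circ r s * g (z + circ r s *s v)) = fd g z v"
    if "z \<in> V" for z by (rule fd_Cauchy_integral[OF g rV(1), symmetric]) (use rV that in auto)
  ultimately have "((%z. fd g z v) has_derivative
       (%u. integral {0..1} (%s. 1 / circ r s * fd g (z + circ r s *s v) u))) (at z)"
    by (rule has_derivative_transform_within_open[OF _ rV(2,4)])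
  thus thesis using rV(1) rV(6)[OF rV(4)] par(2) by (intro that) simp_all
qed

lemma holo_on_fd:
  assumes g: "holo_on g U"
  shows "holo_on (%z. fd g z v) U" unfolding holo_on_def
proof (intro conjI ballI)
  fix z assume "z \<in> U"
  from g this show "\<exists>D. ((%z. fd g z v) has_derivative D) (at z) \<and> (\<forall>c u. D (c *s u) = c * D u)"
    by (rule has_derivative_fd) blast
qed (rule holo_on_open[OF g])

lemma fd_fd_commute:
  assumes g: "holo_on g U" and z: "z \<in> U"
  shows "fd (%z. fd g z v) z u = fd (%z. fd g z u) z v"
proof -
  obtain r where r: "r > 0" "!!w. w \<in> cball 0 r ==> z + w *s v \<in> U"
    "((%z. fd g z v) has_derivative
       (%u. integral {0..1} (%s. 1 / circ r s * fd g (z + circ r s *s v) u))) (at z)"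
    by (rule has_derivative_fd[OF g z]) blast
  have "fd (%z. fd g z v) z u = integral {0..1} (%s. 1 / circ r s * fd g (z + circ r s *s v) u)"
    using fun_cong[OF frechet_derivative_at[OF r(3)], of u] by simp
  also have "\<dots> = fd (%z. fd g z u) z v" by (rule fd_Cauchy_integral[OF holo_on_fd[OF g] r(1,2), symmetric])
  finally show ?thesis .
qed

section \<open>Hadamard's lemma in one coordinate direction\<close>

lemma norm_scale_component_le:
  fixes z :: "complex ^ 'm::finite"
  assumes "\<bar>1 + s\<bar> \<le> (1::real)"
  shows "norm (z + (complex_of_real s * z $ i) *s axis i 1) \<le> norm z"
proof -
  have "cmod ((z + (complex_of_real s * z $ i) *s axis i 1) $ j) \<le> cmod (z $ j)" for j
  proof (cases "j = i")
    case True
    have "cmod ((z + (complex_of_real s * z $ i) *s axis i 1) $ i) = cmod (complex_of_real (1 + s) * z $ i)"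
      by (simp add: algebra_simps)
    also have "\<dots> = \<bar>1 + s\<bar> * cmod (z $ i)" by (simp only: norm_mult norm_of_real)
    also have "\<dots> \<le> cmod (z $ i)" using assms by (simp add: mult_left_le_one_le)
    finally show ?thesis by (simp add: True)
  qed (simp add: axis_def)
  thus ?thesis unfolding norm_vec_def by (intro L2_set_mono) auto
qed

text \<open>h is the mean of the i-th partial derivative over the segment joining z to its
  projection onto z_i = 0; the factor s - 1 makes s = 0 the projection and s = 1 the point itself,
  and the ball contains the whole segment.\<close>

lemma Hadamard_quotient:
  fixes g :: "complex ^ 'm::finite => complex"
  assumes g: "holo_on g (ball 0 R)"
  obtains h where "holo_on h (ball 0 R)"
    "!!z. z \<in> ball 0 R ==> g z = g (z + (- z $ i) *s axis i 1) + z $ i * h z"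
proof
  let ?B = "ball (0 :: complex ^ 'm) R"
  let ?q = "%z (s::real). z + (complex_of_real (s - 1) * z $ i) *s axis i 1"
  define h where "h = (%z. integral {0..1} (%s. fd g (?q z s) (axis i 1)))"
  have q: "?q z s \<in> ?B" if "z \<in> ?B" "s \<in> {0..1}" for z s
    using norm_scale_component_le[of "s - 1" z i] that by simp
  note fdh = holo_on_fd[OF g, of "axis i 1"]
  note par = has_derivative_param_integral[OF fdh continuous_on_fd[OF fdh], where V = ?B and i = i
      and c = "%s. complex_of_real (s - 1)" and k = "%_. 1" and b = "%_. 0", simplified add_0_right mult_1]
  show "holo_on h ?B"
  proof (rule holo_onI)
    fix z assume z: "z \<in> ?B"
    show "(h has_derivative (%v. integral {0..1} (%s. fd (%z. fd g z (axis i 1)) (?q z s)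
         (v + (complex_of_real (s - 1) * v $ i) *s axis i 1)))) (at z)"
      unfolding h_def by (rule par(1)) (use q z in \<open>auto intro!: continuous_intros\<close>)
    show "integral {0..1} (%s. fd (%z. fd g z (axis i 1)) (?q z s)
         (c *s v + (complex_of_real (s - 1) * (c *s v) $ i) *s axis i 1)) =
      c * integral {0..1} (%s. fd (%z. fd g z (axis i 1)) (?q z s)
         (v + (complex_of_real (s - 1) * v $ i) *s axis i 1))" for c v
      by (rule par(2)) (use q z in \<open>auto intro!: continuous_intros\<close>)
  qed simp
  fix z assume z: "z \<in> ?B"
  have "((%s. z $ i * fd g (?q z s) (axis i 1)) has_integral g (?q z 1) - g (?q z 0)) {0..1}"
  proof (rule fundamental_theorem_of_calculus)
    fix s :: real assume s: "s \<in> {0..1}"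
    have 1: "(?q z has_derivative (%u. (complex_of_real u * z $ i) *s axis i 1)) (at s within {0..1})"
    proof -
      have "bounded_linear (%u. (complex_of_real u * z $ i) *s (axis i 1 :: complex ^ 'm))"
        by (intro bounded_linear_compose[OF bounded_linear_vector_scale]
            bounded_linear_mult_const bounded_linear_of_real)
      from bounded_linear.has_derivative[OF this has_derivative_diff[OF has_derivative_ident has_derivative_const], of 1]
      have "((%s. (complex_of_real (s - 1) * z $ i) *s (axis i 1 :: complex ^ 'm)) has_derivative
          (%u. (complex_of_real u * z $ i) *s axis i 1)) (at s within {0..1})" by simp
      from has_derivative_add[OF has_derivative_const this] show ?thesis by simp
    qed
    have "((%s. g (?q z s)) has_derivative (%u. fd g (?q z s) ((complex_of_real u * z $ i) *s axis i 1))) (at s within {0..1})"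
      by (rule has_derivative_compose[OF 1 holo_on_has_derivative[OF g q[OF z s]]])
    thus "((%s. g (?q z s)) has_vector_derivative z $ i * fd g (?q z s) (axis i 1)) (at s within {0..1})"
      unfolding has_vector_derivative_def holo_on_fd_scale[OF g q[OF z s]]
      by (simp add: scaleR_conv_of_real mult.assoc)
  qed simp
  from integral_unique[OF this] have "z $ i * h z = g (?q z 1) - g (?q z 0)"
    unfolding h_def by (simp only: integral_mult_right)
  thus "g z = g (z + (- z $ i) *s axis i 1) + z $ i * h z" by simp
qed

section \<open>Chain rules and rules of differentiation\<close>

lemma fd_sum_basis:
  assumes "holo_on g U" "z \<in> U"
  shows "fd g z v = (\<Sum>j\<in>UNIV. v $ j * fd g z (axis j 1))"
proof -
  have "fd g z v = fd g z (\<Sum>j\<in>UNIV. v $ j *s axis j 1)" by (simp add: basis_expansion)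
  also have "\<dots> = (\<Sum>j\<in>UNIV. fd g z (v $ j *s axis j 1))"
    using has_derivative_linear[OF holo_on_has_derivative[OF assms]] by (rule linear_sum)
  finally show ?thesis by (simp add: holo_on_fd_scale[OF assms])
qed

lemma has_derivative_vec_lambda_components:
  fixes F :: "complex ^ 'm::finite => complex ^ 'k::finite"
  assumes "!!j. holo_on (%z. F z $ j) V" "z \<in> V"
  shows "(F has_derivative (%v. \<chi> j. fd (%z. F z $ j) z v)) (at z)"
proof -
  have "((%z. \<Sum>j\<in>UNIV. F z $ j *s (axis j 1 :: complex ^ 'k)) has_derivative
      (%v. \<Sum>j\<in>UNIV. fd (%z. F z $ j) z v *s axis j 1)) (at z)"
    by (intro has_derivative_sum bounded_linear.has_derivative[OF bounded_linear_vector_scale]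
        holo_on_has_derivative[OF assms])
  moreover have "(\<Sum>j\<in>UNIV. c j *s (axis j 1 :: complex ^ 'k)) = (\<chi> j. c j)" for c
    using basis_expansion[of "\<chi> j. c j"] by simp
  ultimately show ?thesis by (simp add: basis_expansion)
qed

lemma holo_on_compose:
  fixes F :: "complex ^ 'm::finite => complex ^ 'k::finite"
  assumes g: "holo_on g U" and F: "!!j. holo_on (%z. F z $ j) V" and sub: "F ` V \<subseteq> U"
  shows "holo_on (%z. g (F z)) V"
    and "z \<in> V ==> fd (%z. g (F z)) z v = (\<Sum>j\<in>UNIV. fd (%z. F z $ j) z v * fd g (F z) (axis j 1))"
proof -
  have d: "((%z. g (F z)) has_derivative (%v. fd g (F z) (\<chi> j. fd (%z. F z $ j) z v))) (at z)"
    if "z \<in> V" for z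
    by (rule has_derivative_compose[OF has_derivative_vec_lambda_components[OF F that] holo_on_has_derivative[OF g]])
       (use sub that in auto)
  have e: "fd g (F z) (\<chi> j. fd (%z. F z $ j) z v) = (\<Sum>j\<in>UNIV. fd (%z. F z $ j) z v * fd g (F z) (axis j 1))"
    if "z \<in> V" for z v by (subst fd_sum_basis[OF g]) (use sub that in auto)
  show "holo_on (%z. g (F z)) V"
  proof (rule holo_onI[OF holo_on_open[OF F] d])
    fix z c v assume z: "z \<in> V"
    show "fd g (F z) (\<chi> j. fd (%z. F z $ j) z (c *s v)) = c * fd g (F z) (\<chi> j. fd (%z. F z $ j) z v)"
      unfolding e[OF z] unfolding holo_on_fd_scale[OF F z] by (simp add: sum_distrib_left mult.assoc)
  qed
  show "z \<in> V ==> fd (%z. g (F z)) z v = (\<Sum>j\<in>UNIV. fd (%z. F z $ j) z v * fd g (F z) (axis j 1))"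
    using fun_cong[OF frechet_derivative_at[OF d], of z v] e[of z v] by simp
qed

lemma holo_on_component: "holo_on (%z. z $ i) UNIV" and fd_component: "fd (%z. z $ i) z v = v $ i"
proof -
  have d: "((%z :: complex ^ 'm::finite. z $ i) has_derivative (%v. v $ i)) (at z)" for z i
    by (intro bounded_linear_imp_has_derivative bounded_linear_vec_nth)
  show "holo_on (%z :: complex ^ 'm::finite. z $ i) UNIV" for i
    by (rule holo_onI[where D = "%_ v. v $ i"]) (use d in auto)
  show "fd (%z :: complex ^ 'm::finite. z $ i) z v = v $ i" for i z v
    using fun_cong[OF frechet_derivative_at[OF d], where x = v] by simp
qed

lemma holo_on_holomorphic_compose:
  assumes k: "k holomorphic_on S" "open S" and g: "holo_on g V" and sub: "g ` V \<subseteq> S"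
  shows "holo_on (%z. k (g z)) V"
    and "z \<in> V ==> fd (%z. k (g z)) z v = deriv k (g z) * fd g z v"
proof -
  have d: "((%z. k (g z)) has_derivative (%v. deriv k (g z) * fd g z v)) (at z)" if "z \<in> V" for z
    by (rule has_derivative_compose[OF holo_on_has_derivative[OF g that]])
       (use holomorphic_derivI[OF k, of "g z"] sub that in \<open>auto simp: has_field_derivative_def\<close>)
  show "holo_on (%z. k (g z)) V"
    by (rule holo_onI[OF holo_on_open[OF g] d]) (auto simp: holo_on_fd_scale[OF g])
  show "z \<in> V ==> fd (%z. k (g z)) z v = deriv k (g z) * fd g z v"
    using fun_cong[OF frechet_derivative_at[OF d], of z v] by simp
qed

lemma
  assumes f: "holo_on f U" and g: "holo_on g U" and z: "z \<in> U"
  shows fd_add: "fd (%z. f z + g z) z v = fd f z v + fd g z v"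
    and fd_mult: "fd (%z. f z * g z) z v = f z * fd g z v + fd f z v * g z"
  using fun_cong[OF frechet_derivative_at[OF has_derivative_add[OF holo_on_has_derivative[OF f z] holo_on_has_derivative[OF g z]]], of v]
    fun_cong[OF frechet_derivative_at[OF has_derivative_mult[OF holo_on_has_derivative[OF f z] holo_on_has_derivative[OF g z]]], of v]
  by simp_all

section \<open>Germs and their coordinate systems\<close>

lemma holo_near0_ball: "holo_near0 g \<longleftrightarrow> (\<exists>r>0. holo_on g (ball 0 r))"
proof
  assume "holo_near0 g"
  then obtain U where U: "0 \<in> U" "holo_on g U" by (auto simp: holo_near0_def)
  then obtain r where "r > 0" "ball 0 r \<subseteq> U" using holo_on_open openE by blast
  thus "\<exists>r>0. holo_on g (ball 0 r)" using U holo_on_subset by blast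
qed (use centre_in_ball in \<open>auto simp: holo_near0_def intro: exI[of _ "ball 0 _"]\<close>)

lemma abs_germ_eq_iff:
  assumes "holo_near0 g" "holo_near0 h"
  shows "abs_germ g = abs_germ h \<longleftrightarrow> eventually (%z. g z = h z) (nhds 0)"
proof -
  have "germ_rel g g" "germ_rel h h" using assms by (auto simp: germ_rel_def)
  hence "abs_germ g = abs_germ h \<longleftrightarrow> germ_rel g h" using Quotient3_rel[OF Quotient3_germ] by blast
  thus ?thesis using assms by (auto simp: germ_rel_def)
qed

lemma germ_rel_self: "holo_near0 g ==> eq_onp holo_near0 g g" "holo_near0 g ==> germ_rel g g"
  by (auto simp: germ_rel_def eq_onp_def)

lemma rep_germ: "holo_near0 (rep_germ a)" "abs_germ (rep_germ a) = a"
proof -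
  show "abs_germ (rep_germ a) = a" using Quotient3_abs_rep[OF Quotient3_germ] .
  have "germ_rel (rep_germ a) (rep_germ a)" using Quotient3_rep_reflp[OF Quotient3_germ] .
  thus "holo_near0 (rep_germ a)" by (simp add: germ_rel_def)
qed

lemma germ_cases:
  obtains g where "holo_near0 g" "a = abs_germ g" using rep_germ by metis

lemma rep_abs_germ:
  assumes "holo_near0 g"
  shows "eventually (%z. rep_germ (abs_germ g) z = g z) (nhds 0)"
  using abs_germ_eq_iff[OF rep_germ(1) assms] rep_germ(2) by blast

lemma abs_germ_add: "holo_near0 g ==> holo_near0 h ==> abs_germ g + abs_germ h = abs_germ (%z. g z + h z)"
  and abs_germ_mult: "holo_near0 g ==> holo_near0 h ==> abs_germ g * abs_germ h = abs_germ (%z. g z * h z)"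
  by (simp_all add: plus_germ.abs_eq times_germ.abs_eq germ_rel_self)

lemma abs_germ_const: "abs_germ (%_. k) = germ_const k" by (simp add: germ_const_def)

lemma germ_const_0 [simp]: "germ_const 0 = 0" and germ_const_1 [simp]: "germ_const 1 = 1"
  by (transfer, simp add: germ_rel_def holo_near0_const)+

lemma germ_const_add: "germ_const (a + b) = germ_const a + germ_const b"
  and germ_const_mult: "germ_const (a * b) = germ_const a * germ_const b"
  by (transfer, simp add: germ_rel_def holo_near0_const)+

lemma germ_const_minus: "germ_const (- a) = - germ_const a"
  by (rule minus_unique[symmetric]) (simp flip: germ_const_add)

lemma germ_const_eq_0_iff [simp]: "germ_const a = 0 \<longleftrightarrow> a = 0"
proof
  assume a: "germ_const a = (0 :: 'm::finite germ)"
  show "a = 0"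
  proof (rule ccontr)
    assume "a ~= 0"
    hence "(1 :: 'm germ) = germ_const a * germ_const (inverse a)" by (simp flip: germ_const_mult)
    thus False using a by simp
  qed
qed simp

text \<open>\<open>germ_pd\<close> differentiates a representative chosen arbitrarily. Two
  representatives that agree near 0 agree near every point close to 0, so their derivatives agree as
  functions near 0 and not merely at 0.\<close>

lemma
  assumes "holo_near0 g"
  shows holo_near0_fd: "holo_near0 (%z. fd g z v)"
    and germ_pd_abs: "germ_pd i (abs_germ g) = abs_germ (%z. fd g z (axis i 1))"
proof -
  have *: "holo_near0 (%z. fd g z v)" if "holo_near0 g" for g :: "complex ^ 'a => complex" and v
    using that holo_on_fd unfolding holo_near0_def by blast
  show "holo_near0 (%z. fd g z v)" by (rule *[OF assms])
  let ?h = "rep_germ (abs_germ g)"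
  have "eventually (%z. eventually (%w. ?h w = g w) (nhds z)) (nhds 0)"
    using rep_abs_germ[OF assms] by (simp add: eventually_eventually)
  hence "eventually (%z. fd ?h z (axis i 1) = fd g z (axis i 1)) (nhds 0)"
  proof eventually_elim
    case (elim z)
    have "(?h has_derivative D) (at z) \<longleftrightarrow> (g has_derivative D) (at z)" for D
    proof -
      have "?h z = g z" by (rule eventually_nhds_x_imp_x[OF elim])
      moreover have "eventually (%w. ?h w = g w) (at z)" using elim by (auto simp: eventually_at_filter elim: eventually_mono)
      ultimately show ?thesis
        using has_derivative_transform_eventually[of ?h D z UNIV g] has_derivative_transform_eventually[of g D z UNIV ?h]
        by (auto simp: eq_commute elim: eventually_mono)
    qed
    thus ?case by (simp add: frechet_derivative_def)
  qed
  thus "germ_pd i (abs_germ g) = abs_germ (%z. fd g z (axis i 1))"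
    unfolding germ_pd_def by (subst abs_germ_eq_iff) (auto intro: * assms rep_germ)
qed

lemma holo_near0_common:
  assumes "holo_near0 g" "holo_near0 h"
  obtains U where "0 \<in> U" "holo_on g U" "holo_on h U" "open U"
proof -
  obtain U V where "0 \<in> U" "holo_on g U" "0 \<in> V" "holo_on h V" using assms by (auto simp: holo_near0_def)
  moreover have "open (U \<inter> V)" using calculation holo_on_open by blast
  ultimately show thesis by (intro that[of "U \<inter> V"]) (auto intro: holo_on_subset)
qed

lemma germ_pd_add: "germ_pd i (a + b) = germ_pd i a + germ_pd i b"
  and germ_pd_mult: "germ_pd i (a * b) = a * germ_pd i b + germ_pd i a * b"
proof -
  obtain g h where gh: "holo_near0 g" "a = abs_germ g" "holo_near0 h" "b = abs_germ h" by (metis germ_cases)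
  obtain U where U: "0 \<in> U" "holo_on g U" "holo_on h U" "open U" using holo_near0_common[OF gh(1,3)] by blast
  have ev: "eventually (%z. z \<in> U) (nhds 0)" using U by (intro eventually_nhds_in_open) auto
  note [simp] = gh abs_germ_add abs_germ_mult germ_pd_abs holo_near0_fd holo_near0_add holo_near0_mult
  show "germ_pd i (a + b) = germ_pd i a + germ_pd i b"
    by (simp add: abs_germ_eq_iff) (use ev in eventually_elim, simp add: fd_add[OF U(2,3)])
  show "germ_pd i (a * b) = a * germ_pd i b + germ_pd i a * b"
    by (simp add: abs_germ_eq_iff) (use ev in eventually_elim, simp add: fd_mult[OF U(2,3)])
qed

lemma germ_pd_const [simp]: "germ_pd i (germ_const k) = 0"
  by (simp only: abs_germ_const[symmetric] germ_pd_abs[OF holo_near0_const] frechet_derivative_const)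
     (simp only: abs_germ_const germ_const_0)

lemma germ_pd_commute: "germ_pd i (germ_pd j a) = germ_pd j (germ_pd i a)"
proof -
  obtain g where g: "holo_near0 g" "a = abs_germ g" by (metis germ_cases)
  then obtain U where U: "0 \<in> U" "holo_on g U" by (auto simp: holo_near0_def)
  have ev: "eventually (%z. z \<in> U) (nhds 0)" using U holo_on_open by (intro eventually_nhds_in_open) auto
  show ?thesis by (simp add: g germ_pd_abs holo_near0_fd abs_germ_eq_iff)
       (use ev in eventually_elim, rule fd_fd_commute[OF U(2)])
qed

definition germ_coord :: "'m => 'm::finite germ" where
  "germ_coord i = abs_germ (%z. z $ i)"

lemma holo_near0_component: "holo_near0 (%z. z $ i)" using holo_on_component unfolding holo_near0_def by blast

lemma germ_pd_coord: "germ_pd i (germ_coord j) = (if i = j then 1 else 0)"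
  by (simp add: germ_coord_def germ_pd_abs holo_near0_component fd_component axis_def abs_germ_const)

subsection \<open>Substitution\<close>

definition holo_map0 :: "(complex ^ 'm::finite => complex ^ 'm) => bool" where
  "holo_map0 Y \<longleftrightarrow> Y 0 = 0 \<and> (\<forall>j. holo_near0 (%z. Y z $ j))"

definition germ_subst :: "(complex ^ 'm::finite => complex ^ 'm) => 'm germ => 'm germ" where
  "germ_subst Y a = abs_germ (%z. rep_germ a (Y z))"

lemma holo_map0_common:
  fixes Y :: "complex ^ 'm::finite => complex ^ 'm"
  assumes "holo_map0 Y" "open W" "0 \<in> W"
  obtains V where "0 \<in> V" "open V" "!!j. holo_on (%z. Y z $ j) V" "Y ` V \<subseteq> W"
proof -
  have "\<exists>V. 0 \<in> V \<and> holo_on (%z. Y z $ j) V" for j using assms by (auto simp: holo_map0_def holo_near0_def)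
  then obtain V where V: "!!j. 0 \<in> V j" "!!j. holo_on (%z. Y z $ j) (V j)" by metis
  define V' where "V' = (\<Inter>j. V j)"
  have V': "open V'" "0 \<in> V'" using V(1) holo_on_open[OF V(2)] by (auto simp: V'_def)
  have h: "holo_on (%z. Y z $ j) V'" for j by (rule holo_on_subset[OF V(2)]) (use V' in \<open>auto simp: V'_def\<close>)
  have "continuous_on V' Y" by (rule continuous_at_imp_continuous_on)
       (use has_derivative_vec_lambda_components[OF h] has_derivative_continuous in blast)
  hence o: "open (V' \<inter> Y -` W)" using V'(1) assms(2) continuous_open_preimage by blast
  show thesis
    by (rule that[of "V' \<inter> Y -` W"]) (use o V' assms h in \<open>auto intro: holo_on_subset simp: holo_map0_def\<close>)
qed

lemma holo_map0_eventually:
  assumes "holo_map0 Y" "eventually P (nhds 0)"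
  shows "eventually (%z. P (Y z)) (nhds 0)"
proof -
  obtain W where W: "open W" "0 \<in> W" "!!z. z \<in> W ==> P z" using assms(2) unfolding eventually_nhds by blast
  obtain V where "0 \<in> V" "open V" "Y ` V \<subseteq> W" using holo_map0_common[OF assms(1) W(1,2)] by metis
  thus ?thesis unfolding eventually_nhds using W by blast
qed

lemma holo_near0_compose:
  assumes "holo_map0 Y" "holo_near0 g"
  shows "holo_near0 (%z. g (Y z))"
proof -
  obtain U where U: "0 \<in> U" "holo_on g U" using assms(2) by (auto simp: holo_near0_def)
  obtain V where "0 \<in> V" "!!j. holo_on (%z. Y z $ j) V" "Y ` V \<subseteq> U"
    using holo_map0_common[OF assms(1) holo_on_open[OF U(2)] U(1)] by metis
  thus ?thesis using holo_on_compose(1)[OF U(2)] unfolding holo_near0_def by blast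
qed

lemma germ_subst_abs:
  assumes "holo_map0 Y" "holo_near0 g"
  shows "germ_subst Y (abs_germ g) = abs_germ (%z. g (Y z))" unfolding germ_subst_def
  by (subst abs_germ_eq_iff)
     (auto intro: holo_near0_compose assms rep_germ holo_map0_eventually[OF assms(1) rep_abs_germ[OF assms(2)]])

lemma
  assumes Y: "holo_map0 Y"
  shows germ_subst_add: "germ_subst Y (a + b) = germ_subst Y a + germ_subst Y b"
    and germ_subst_mult: "germ_subst Y (a * b) = germ_subst Y a * germ_subst Y b"
    and germ_subst_const: "germ_subst Y (germ_const k) = germ_const k"
    and germ_subst_coord: "germ_subst Y (germ_coord i) = abs_germ (%z. Y z $ i)"
proof -
  obtain g h where gh: "holo_near0 g" "a = abs_germ g" "holo_near0 h" "b = abs_germ h" by (metis germ_cases)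
  note [simp] = gh abs_germ_add abs_germ_mult holo_near0_add holo_near0_mult germ_subst_abs[OF Y] holo_near0_compose[OF Y]
  show "germ_subst Y (a + b) = germ_subst Y a + germ_subst Y b" by simp
  show "germ_subst Y (a * b) = germ_subst Y a * germ_subst Y b" by simp
  show "germ_subst Y (germ_const k) = germ_const k" by (simp add: holo_near0_const flip: abs_germ_const)
  show "germ_subst Y (germ_coord i) = abs_germ (%z. Y z $ i)"
    by (simp add: holo_near0_component germ_coord_def)
qed

lemma germ_subst_sum:
  assumes "holo_map0 Y" shows "germ_subst Y (\<Sum>i\<in>S. f i) = (\<Sum>i\<in>S. germ_subst Y (f i))"
  by (induction S rule: infinite_finite_induct)
     (auto simp: germ_subst_add[OF assms] germ_subst_const[OF assms, of 0, simplified])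

lemma germ_pd_subst:
  assumes Y: "holo_map0 Y"
  shows "germ_pd i (germ_subst Y a) = (\<Sum>j\<in>UNIV. germ_pd i (abs_germ (%z. Y z $ j)) * germ_subst Y (germ_pd j a))"
proof -
  obtain g where g: "holo_near0 g" "a = abs_germ g" by (metis germ_cases)
  then obtain U where U: "0 \<in> U" "holo_on g U" by (auto simp: holo_near0_def)
  obtain V where V: "0 \<in> V" "open V" "!!j. holo_on (%z. Y z $ j) V" "Y ` V \<subseteq> U"
    using holo_map0_common[OF Y holo_on_open[OF U(2)] U(1)] by metis
  have Yj: "holo_near0 (%z. Y z $ j)" for j using Y by (simp add: holo_map0_def)
  have h: "holo_near0 (%z. fd (%z. Y z $ j) z (axis i 1) * fd g (Y z) (axis j 1))" for j
    by (intro holo_near0_mult holo_near0_fd Yj holo_near0_compose[OF Y holo_near0_fd[OF g(1)]])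
  have sum: "holo_near0 (%z. \<Sum>j\<in>S. F j z) \<and> (\<Sum>j\<in>S. abs_germ (F j)) = abs_germ (%z. \<Sum>j\<in>S. F j z)"
    if "!!j. holo_near0 (F j)" for F :: "'a => complex ^ 'a => complex" and S
    by (induction S rule: infinite_finite_induct)
       (auto simp: holo_near0_const abs_germ_const abs_germ_add holo_near0_add that)
  have "germ_pd i (germ_subst Y a) = abs_germ (%z. fd (%z. g (Y z)) z (axis i 1))"
    by (simp add: g germ_subst_abs[OF Y] germ_pd_abs holo_near0_compose[OF Y])
  also have "\<dots> = abs_germ (%z. \<Sum>j\<in>UNIV. fd (%z. Y z $ j) z (axis i 1) * fd g (Y z) (axis j 1))"
  proof (subst abs_germ_eq_iff)
    have "eventually (%z. z \<in> V) (nhds 0)" using V by (intro eventually_nhds_in_open) auto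
    thus "\<forall>\<^sub>F z in nhds 0. fd (%z. g (Y z)) z (axis i 1) =
          (\<Sum>j\<in>UNIV. fd (%z. Y z $ j) z (axis i 1) * fd g (Y z) (axis j 1))"
      by eventually_elim (rule holo_on_compose(2)[OF U(2) V(3,4)])
    show "holo_near0 (%z. \<Sum>j\<in>UNIV. fd (%z. Y z $ j) z (axis i 1) * fd g (Y z) (axis j 1))"
      using sum[of "%j z. fd (%z. Y z $ j) z (axis i 1) * fd g (Y z) (axis j 1)", OF h] by blast
  qed (intro holo_near0_fd holo_near0_compose[OF Y g(1)])
  also have "\<dots> = (\<Sum>j\<in>UNIV. abs_germ (%z. fd (%z. Y z $ j) z (axis i 1) * fd g (Y z) (axis j 1)))"
    using sum[of "%j z. fd (%z. Y z $ j) z (axis i 1) * fd g (Y z) (axis j 1)", OF h] by simp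
  also have "\<dots> = (\<Sum>j\<in>UNIV. germ_pd i (abs_germ (%z. Y z $ j)) * germ_subst Y (germ_pd j a))"
    by (simp add: g germ_pd_abs Yj germ_subst_abs[OF Y] holo_near0_fd abs_germ_mult
        holo_near0_compose[OF Y holo_near0_fd[OF g(1)]])
  finally show ?thesis .
qed

lemma germ_subst_subst_inverse:
  assumes "holo_map0 Y" "holo_map0 Z" "eventually (%z. Z (Y z) = z) (nhds 0)"
  shows "germ_subst Y (germ_subst Z a) = a"
proof -
  obtain g where g: "holo_near0 g" "a = abs_germ g" by (metis germ_cases)
  have "germ_subst Y (germ_subst Z a) = abs_germ (%z. g (Z (Y z)))"
    by (simp add: g germ_subst_abs assms holo_near0_compose)
  also have "\<dots> = abs_germ g" by (rule abs_germ_eq_iff[THEN iffD2])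
       (use assms(3) in \<open>auto intro!: g(1) holo_near0_compose[OF assms(1) holo_near0_compose[OF assms(2) g(1)]]
          elim: eventually_mono\<close>)
  finally show ?thesis by (simp add: g)
qed

subsection \<open>Restriction to a coordinate hyperplane\<close>

definition kill_coord :: "'m => complex ^ 'm::finite => complex ^ 'm" where
  "kill_coord i z = z + (- z $ i) *s axis i 1"

lemma holo_map0_kill_coord: "holo_map0 (kill_coord i)"
proof -
  have "kill_coord i z $ j = (if j = i then 0 else z $ j)" for z :: "complex ^ 'a" and j
    by (simp add: kill_coord_def axis_def)
  moreover have "holo_near0 (%z :: complex ^ 'a. if j = i then 0 else z $ j)" for j
    by (cases "j = i") (simp_all add: holo_near0_component holo_near0_const)
  ultimately show ?thesis by (simp add: holo_map0_def vec_eq_iff)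
qed

text \<open>Hadamard's quotient in terms of germs: the analytic input behind all later divisions by
  coordinates.\<close>

lemma germ_coord_dvd: "germ_coord i dvd a - germ_subst (kill_coord i) a"
proof -
  obtain g where g: "holo_near0 g" "a = abs_germ g" by (metis germ_cases)
  then obtain r where r: "r > 0" "holo_on g (ball 0 r)" by (auto simp: holo_near0_ball)
  obtain h where h: "holo_on h (ball 0 r)" "!!z. z \<in> ball 0 r ==> g z = g (kill_coord i z) + z $ i * h z"
    using Hadamard_quotient[OF r(2), of i] unfolding kill_coord_def by metis
  have hh: "holo_near0 h" using h r by (auto simp: holo_near0_ball)
  note [simp] = holo_near0_compose[OF holo_map0_kill_coord] holo_near0_component hh g(1)
  have "a = germ_subst (kill_coord i) a + germ_coord i * abs_germ h"
  proof (simp add: g(2) germ_subst_abs[OF holo_map0_kill_coord] germ_coord_def abs_germ_mult abs_germ_add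
        holo_near0_mult, subst abs_germ_eq_iff)
    have "eventually (%z. z \<in> ball 0 r) (nhds (0 :: complex ^ 'a))" using r by (intro eventually_nhds_in_open) auto
    thus "\<forall>\<^sub>F z in nhds 0. g z = g (kill_coord i z) + z $ i * h z" by eventually_elim (rule h(2))
  qed (auto simp: holo_near0_mult holo_near0_add)
  thus ?thesis by (metis add_diff_cancel_left' dvd_triv_left)
qed

lemma germ_subst_kill_commute:
  "germ_subst (kill_coord i) (germ_subst (kill_coord j) a) = germ_subst (kill_coord j) (germ_subst (kill_coord i) a)"
proof -
  obtain g where g: "holo_near0 g" "a = abs_germ g" by (metis germ_cases)
  have "kill_coord i (kill_coord j z) = kill_coord j (kill_coord i z)" for z :: "complex ^ 'a"
    by (simp add: kill_coord_def vec_eq_iff axis_def)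
  thus ?thesis by (simp add: g germ_subst_abs holo_map0_kill_coord holo_near0_compose)
qed

text \<open>Local coordinates \<open>x\<close> on the ring of germs: \<open>\<delta> i\<close> is the partial derivative with respect
  to \<open>x i\<close>, and \<open>\<rho> i\<close> is restriction to \<open>x i = 0\<close> followed by extension along the \<open>x i\<close>-axis.\<close>
locale germ_coords =
  fixes x :: "'m::finite => 'm germ" and \<delta> \<rho> :: "'m => 'm germ => 'm germ"
  assumes \<delta>_add: "\<delta> i (a + b) = \<delta> i a + \<delta> i b"
    and \<delta>_mult: "\<delta> i (a * b) = a * \<delta> i b + \<delta> i a * b"
    and \<delta>_const [simp]: "\<delta> i (germ_const k) = 0"
    and \<delta>_commute: "\<delta> i (\<delta> j a) = \<delta> j (\<delta> i a)"
    and \<delta>_x: "\<delta> i (x j) = (if i = j then 1 else 0)"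
    and pd_\<delta>: "germ_pd i a = (\<Sum>j\<in>UNIV. germ_pd i (x j) * \<delta> j a)"
    and \<delta>_pd: "\<delta> j a = (\<Sum>i\<in>UNIV. \<delta> j (germ_coord i) * germ_pd i a)"
    and \<rho>_add: "\<rho> i (a + b) = \<rho> i a + \<rho> i b"
    and \<rho>_mult: "\<rho> i (a * b) = \<rho> i a * \<rho> i b"
    and \<rho>_const [simp]: "\<rho> i (germ_const k) = germ_const k"
    and \<rho>_x: "\<rho> i (x j) = (if i = j then 0 else x j)"
    and \<rho>_commute: "\<rho> i (\<rho> j a) = \<rho> j (\<rho> i a)"
    and x_dvd: "x i dvd a - \<rho> i a"

text \<open>The real inverse function theorem supplies Z; its derivative is the inverse of a complex
  linear bijection, hence complex linear, so Z is holomorphic. B is a left inverse of the Jacobian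
  at 0, given as a plain matrix because the applications exhibit it entry by entry.\<close>

lemma holo_inverse_function:
  fixes Y :: "complex ^ 'm::finite => complex ^ 'm"
  assumes Y: "holo_map0 Y"
    and B: "!!i k. (\<Sum>j\<in>UNIV. B i j * fd (%z. Y z $ j) 0 (axis k 1)) = (if i = k then 1 else 0)"
  obtains Z where "holo_map0 Z" "eventually (%z. Z (Y z) = z) (nhds 0)" "eventually (%z. Y (Z z) = z) (nhds 0)"
proof -
  obtain U where U: "0 \<in> U" "open U" "!!j. holo_on (%z. Y z $ j) U"
    using holo_map0_common[OF Y open_UNIV] by auto
  define D where "D = (%z v. (\<chi> j. fd (%z. Y z $ j) z v))"
  have D: "(Y has_derivative D z) (at z)" if "z \<in> U" for z
    unfolding D_def by (rule has_derivative_vec_lambda_components[OF U(3) that])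
  have D_scale: "D z (c *s v) = c *s D z v" if "z \<in> U" for z c v
    by (simp add: D_def vec_eq_iff holo_on_fd_scale[OF U(3) that])
  define f' where "f' = (%z. Blinfun (D z))"
  have f': "blinfun_apply (f' z) = D z" if "z \<in> U" for z
    unfolding f'_def by (rule bounded_linear_Blinfun_apply[OF has_derivative_bounded_linear[OF D[OF that]]])
  have contf: "continuous_on U f'"
  proof (rule continuous_on_blinfun_componentwise)
    fix v :: "complex ^ 'm"
    have "continuous_on U (%z. D z v)" unfolding D_def by (intro continuous_on_vec_lambda continuous_on_fd U)
    thus "continuous_on U (%z. blinfun_apply (f' z) v)" by (rule continuous_on_eq) (simp add: f')
  qed
  define E where "E = (%v :: complex ^ 'm. \<chi> i. \<Sum>j\<in>UNIV. B i j * v $ j)"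
  have "linear E"
    by (rule linearI) (simp_all add: E_def vec_eq_iff algebra_simps sum.distrib vector_scaleR_eq sum_distrib_left)
  hence E: "blinfun_apply (Blinfun E) = E"
    using linear_conv_bounded_linear bounded_linear_Blinfun_apply by blast
  have "E (D 0 v) = v" for v
  proof -
    have "(\<Sum>j\<in>UNIV. B i j * fd (%z. Y z $ j) 0 v) = v $ i" for i
    proof -
      have "(\<Sum>j\<in>UNIV. B i j * fd (%z. Y z $ j) 0 v)
          = (\<Sum>j\<in>UNIV. \<Sum>k\<in>UNIV. v $ k * (B i j * fd (%z. Y z $ j) 0 (axis k 1)))"
        by (subst fd_sum_basis[OF U(3) U(1)]) (simp add: sum_distrib_left algebra_simps)
      also have "\<dots> = (\<Sum>k\<in>UNIV. v $ k * (\<Sum>j\<in>UNIV. B i j * fd (%z. Y z $ j) 0 (axis k 1)))"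
        by (subst sum.swap) (simp add: sum_distrib_left)
      also have "\<dots> = v $ i" by (simp add: B if_distrib cong: if_cong)
      finally show ?thesis .
    qed
    thus ?thesis by (simp add: E_def D_def vec_eq_iff)
  qed
  hence inv: "Blinfun E o\<^sub>L f' 0 = id_blinfun" by (intro blinfun_eqI) (simp add: E f'[OF U(1)])
  have derf: "(Y has_derivative blinfun_apply (f' z)) (at z)" if "z \<in> U" for z using D f' that by simp
  obtain U' V Z g' where *: "open U'" "U' \<subseteq> U" "0 \<in> U'" "open V" "Y 0 \<in> V" "homeomorphism U' V Y Z"
    "!!y. y \<in> V ==> (Z has_derivative (g' y)) (at y)"
    "!!y. y \<in> V ==> g' y = inv_into UNIV (blinfun_apply (f' (Z y)))"
    "!!y. y \<in> V ==> bij (blinfun_apply (f' (Z y)))"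
  proof (rule inverse_function_theorem[where f = Y and f' = f' and U = U and invf = "Blinfun E", OF U(2) derf contf U(1) inv])
    fix U' V Z g'
    assume "open U'" "U' \<subseteq> U" "0 \<in> U'" "open V" "Y 0 \<in> V" "homeomorphism U' V Y Z"
      "!!y. y \<in> V ==> (Z has_derivative (g' y)) (at y)"
      "!!y. y \<in> V ==> g' y = inv_into UNIV (blinfun_apply (f' (Z y)))"
      "!!y. y \<in> V ==> bij (blinfun_apply (f' (Z y)))"
    thus thesis by (rule that)
  qed
  have Y0: "Y 0 = 0" using Y by (simp add: holo_map0_def)
  have ZY: "Z (Y z) = z" if "z \<in> U'" for z using *(6) that by (simp add: homeomorphism_def)
  have YZ: "Y (Z z) = z" "Z z \<in> U'" if "z \<in> V" for z using *(6) that by (auto simp: homeomorphism_def)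
  have "holo_on (%z. Z z $ j) V" for j
  proof (rule holo_onI[OF *(4)])
    fix y assume y: "y \<in> V"
    show "((%z. Z z $ j) has_derivative (%v. g' y v $ j)) (at y)"
      by (rule bounded_linear.has_derivative[OF bounded_linear_vec_nth *(7)[OF y]])
    fix c v
    have ZU: "Z y \<in> U" using YZ(2)[OF y] *(2) by blast
    have b: "bij (D (Z y))" using *(9)[OF y] f'[OF ZU] by simp
    have "g' y (c *s v) = c *s g' y v" unfolding *(8)[OF y] f'[OF ZU] by (rule inv_f_eq[OF bij_is_inj[OF b]])
         (simp add: D_scale[OF ZU] surj_f_inv_f[OF bij_is_surj[OF b]])
    thus "g' y (c *s v) $ j = c * g' y v $ j" by simp
  qed
  moreover have "Z 0 = 0" using ZY[OF *(3)] Y0 by simp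
  ultimately have "holo_map0 Z" using *(5) Y0 unfolding holo_map0_def holo_near0_def by auto
  moreover have "eventually (%z. Z (Y z) = z) (nhds 0)" unfolding eventually_nhds using *(1,3) ZY by blast
  moreover have "eventually (%z. Y (Z z) = z) (nhds 0)" unfolding eventually_nhds using *(4,5) Y0 YZ by auto
  ultimately show thesis by (rule that)
qed

text \<open>Substitution by Y is an automorphism of the ring of germs, with inverse substitution by
  Z. Conjugating partial differentiation and restriction to hyperplanes by it carries the axioms
  over from the standard coordinates; the two conversion formulas between the derivations are the
  chain rules for Y and for Z.\<close>

lemma germ_coords_exists:
  fixes Y :: "complex ^ 'm::finite => complex ^ 'm"
  assumes Y: "holo_map0 Y"
    and B: "!!i k. (\<Sum>j\<in>UNIV. B i j * fd (%z. Y z $ j) 0 (axis k 1)) = (if i = k then 1 else 0)"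
  obtains \<delta> \<rho> where "germ_coords (%j. abs_germ (%z. Y z $ j)) \<delta> \<rho>"
proof -
  obtain Z where Z: "holo_map0 Z" "eventually (%z. Z (Y z) = z) (nhds 0)" "eventually (%z. Y (Z z) = z) (nhds 0)"
    using holo_inverse_function[OF Y B] by blast
  let ?y = "%j. abs_germ (%z. Y z $ j)" and ?S = "germ_subst Y" and ?T = "germ_subst Z"
  define \<delta> where "\<delta> = (%j a. ?S (germ_pd j (?T a)))"
  define \<rho> where "\<rho> = (%i a. ?S (germ_subst (kill_coord i) (?T a)))"
  have ST: "?S (?T a) = a" for a by (rule germ_subst_subst_inverse[OF Y Z(1,2)])
  have TS: "?T (?S a) = a" for a by (rule germ_subst_subst_inverse[OF Z(1) Y Z(3)])
  note S = germ_subst_add[OF Y] germ_subst_mult[OF Y] germ_subst_const[OF Y]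
  note T = germ_subst_add[OF Z(1)] germ_subst_mult[OF Z(1)] germ_subst_const[OF Z(1)]
  note K = germ_subst_add[OF holo_map0_kill_coord] germ_subst_mult[OF holo_map0_kill_coord] germ_subst_const[OF holo_map0_kill_coord]
  have S0: "?S 0 = 0" "?S 1 = 1" using S(3)[of 0] S(3)[of 1] by simp_all
  have y: "?y j = ?S (germ_coord j)" for j by (simp add: germ_subst_coord[OF Y])
  have Ty: "?T (?y j) = germ_coord j" for j by (simp add: y TS)
  have kc: "germ_subst (kill_coord i) (germ_coord j) = (if i = j then 0 else germ_coord j)" for i j :: 'm
    by (cases "i = j")
       (simp_all add: germ_subst_coord[OF holo_map0_kill_coord] kill_coord_def axis_def abs_germ_const,
        simp add: germ_coord_def)
  have "germ_coords ?y \<delta> \<rho>"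
  proof
    fix i j a b k
    show "\<delta> i (a + b) = \<delta> i a + \<delta> i b" by (simp add: \<delta>_def S T germ_pd_add)
    show "\<delta> i (a * b) = a * \<delta> i b + \<delta> i a * b" by (simp add: \<delta>_def S T germ_pd_mult ST)
    show "\<delta> i (germ_const k) = 0" by (simp add: \<delta>_def T S0)
    show "\<delta> i (\<delta> j a) = \<delta> j (\<delta> i a)" by (simp add: \<delta>_def TS germ_pd_commute[of i j])
    show "\<delta> i (?y j) = (if i = j then 1 else 0)" by (simp add: \<delta>_def Ty germ_pd_coord S0)
    show "germ_pd i a = (\<Sum>j\<in>UNIV. germ_pd i (?y j) * \<delta> j a)"
      using germ_pd_subst[OF Y, of i "?T a"] by (simp add: \<delta>_def ST)
    have "\<delta> j a = ?S (\<Sum>i\<in>UNIV. germ_pd j (abs_germ (%z. Z z $ i)) * ?T (germ_pd i a))"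
      by (simp add: \<delta>_def germ_pd_subst[OF Z(1)])
    also have "\<dots> = (\<Sum>i\<in>UNIV. \<delta> j (germ_coord i) * germ_pd i a)"
      by (simp add: germ_subst_sum[OF Y] S ST \<delta>_def germ_subst_coord[OF Z(1)])
    finally show "\<delta> j a = (\<Sum>i\<in>UNIV. \<delta> j (germ_coord i) * germ_pd i a)" .
    show "\<rho> i (a + b) = \<rho> i a + \<rho> i b" "\<rho> i (a * b) = \<rho> i a * \<rho> i b" "\<rho> i (germ_const k) = germ_const k"
      by (simp_all add: \<rho>_def S T K)
    show "\<rho> i (?y j) = (if i = j then 0 else ?y j)" by (simp add: \<rho>_def Ty kc S0) (simp add: y)
    show "\<rho> i (\<rho> j a) = \<rho> j (\<rho> i a)" by (simp add: \<rho>_def TS germ_subst_kill_commute[of i j])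
    obtain c where c: "?T a - germ_subst (kill_coord i) (?T a) = germ_coord i * c"
      using germ_coord_dvd by (metis dvd_def)
    have "?S (?T a) = ?S (germ_subst (kill_coord i) (?T a) + germ_coord i * c)" by (simp flip: c)
    hence "a = \<rho> i a + ?y i * ?S c" by (simp add: ST S y \<rho>_def)
    hence "a - \<rho> i a = ?y i * ?S c" by (metis add_diff_cancel_left')
    thus "?y i dvd a - \<rho> i a" by simp
  qed
  thus thesis by (rule that)
qed

subsection \<open>Germs of functions in a chart\<close>

abbreviation local_expr :: "('x, 'm::finite) chart => 'x => ('x => 'b) => complex ^ 'm => 'b" where
  "local_expr c x q \<equiv> (%z. in_chart c q (snd c x + z))"

definition centred_transition :: "('x, 'm::finite) chart => ('x, 'm) chart => 'x => complex ^ 'm => complex ^ 'm" where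
  "centred_transition c s x z = local_expr c x (snd s) z - snd s x"

context
  fixes A :: "('x::topological_space, 'm::finite) chart set"
  assumes A: "complex_atlas A"
begin

lemma holo_chart_homeomorphism:
  assumes "holo_chart A c"
  shows "open (fst c)" "open (snd c ` fst c)"
    "homeomorphism (fst c) (snd c ` fst c) (snd c) (inv_into (fst c) (snd c))"
  using assms by (auto simp: holo_chart_def complex_atlas_def)

lemma holo_chart_inv:
  assumes "holo_chart A c" "y \<in> fst c"
  shows "inv_into (fst c) (snd c) (snd c y) = y"
  using holo_chart_homeomorphism(3)[OF assms(1)] assms(2) by (simp add: homeomorphism_def)

lemma holo_chart_open_image:
  assumes "holo_chart A c" "open W"
  shows "open (snd c ` (fst c \<inter> W))"
proof -
  have "openin (top_of_set (fst c)) (fst c \<inter> W)" using assms(2) by auto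
  from homeomorphism_imp_open_map[OF holo_chart_homeomorphism(3)[OF assms(1)] this]
  show ?thesis using holo_chart_homeomorphism(2)[OF assms(1)] openin_open_trans by blast
qed

lemma atlas_holo_chart: "c \<in> A ==> holo_chart A c" using A by (simp add: holo_chart_def insert_absorb)

lemma atlas_cover: "\<exists>c\<in>A. y \<in> fst c" using A by (auto simp: complex_atlas_def)

lemma holo_chart_transition:
  assumes "holo_chart A c" "c' \<in> A"
  shows "holo_on (in_chart c (%x. snd c' x $ i)) (snd c ` (fst c \<inter> fst c'))"
    and "holo_on (in_chart c' (%x. snd c x $ i)) (snd c' ` (fst c' \<inter> fst c))"
  using assms by (auto simp: holo_chart_def complex_atlas_def)

lemma holo_chart_function:
  assumes "holo_chart A c"
  shows "holo_function A (fst c) (%x. snd c x $ i)" unfolding holo_function_def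
  using holo_chart_homeomorphism(1)[OF assms] holo_chart_transition(2)[OF assms] by auto

text \<open>\<open>holo_function\<close> tests the charts of A only, whereas c belongs to the
  maximal atlas; near each point the expression in c factors through a chart of A by a holomorphic
  transition.\<close>

lemma holo_function_in_chart:
  assumes q: "holo_function A W q" and c: "holo_chart A c"
  shows "holo_on (in_chart c q) (snd c ` (fst c \<inter> W))"
proof (rule holo_on_Union)
  fix z assume "z \<in> snd c ` (fst c \<inter> W)"
  then obtain y where y: "z = snd c y" "y \<in> fst c" "y \<in> W" by auto
  obtain c0 where c0: "c0 \<in> A" "y \<in> fst c0" using atlas_cover by blast
  have hc0: "holo_chart A c0" by (rule atlas_holo_chart[OF c0(1)])
  have W: "open W" using q by (simp add: holo_function_def)
  let ?V = "snd c ` (fst c \<inter> (W \<inter> fst c0))"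
  let ?F = "%z. snd c0 (inv_into (fst c) (snd c) z)"
  have V: "open ?V" by (rule holo_chart_open_image[OF c]) (use W holo_chart_homeomorphism(1)[OF hc0] in auto)
  have F: "holo_on (%z. ?F z $ i) ?V" for i
    by (rule holo_on_subset[OF holo_chart_transition(1)[OF c c0(1), unfolded in_chart_def] V]) auto
  have "holo_on (in_chart c0 q) (snd c0 ` (fst c0 \<inter> W))" using q c0 by (simp add: holo_function_def)
  hence "holo_on (%z. in_chart c0 q (?F z)) ?V"
    by (rule holo_on_compose(1)[OF _ F]) (auto simp: holo_chart_inv[OF c])
  hence "holo_on (in_chart c q) ?V"
    by (rule holo_on_cong) (auto simp: in_chart_def holo_chart_inv[OF c] holo_chart_inv[OF hc0])
  thus "\<exists>V. z \<in> V \<and> V \<subseteq> snd c ` (fst c \<inter> W) \<and> holo_on (in_chart c q) V"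
    using y c0 by (intro exI[of _ ?V]) auto
qed

lemma holo_on_translate:
  assumes "holo_on g U"
  shows "holo_on (%z. g (a + z)) ((%z. a + z) -` U)" "a + z \<in> U ==> fd (%z. g (a + z)) z v = fd g (a + z) v"
proof -
  have d: "((%z. g (a + z)) has_derivative frechet_derivative g (at (a + z))) (at z)" if "a + z \<in> U" for z
  proof -
    have "((%z. a + z) has_derivative (%v. v)) (at z)"
      using has_derivative_add[OF has_derivative_const has_derivative_ident, of a] by simp
    from has_derivative_compose[OF this holo_on_has_derivative[OF assms that]] show ?thesis .
  qed
  have "open ((%z. a + z) -` U)" by (rule open_vimage[OF holo_on_open[OF assms]]) (intro continuous_intros)
  thus "holo_on (%z. g (a + z)) ((%z. a + z) -` U)"
    by (rule holo_onI) (use d holo_on_fd_scale[OF assms] in auto)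
  show "a + z \<in> U ==> fd (%z. g (a + z)) z v = fd g (a + z) v"
    using fun_cong[OF frechet_derivative_at[OF d], of z v] by simp
qed

lemma holo_near0_local_expr:
  assumes "holo_function A W q" "holo_chart A c" "x \<in> fst c" "x \<in> W"
  shows "holo_near0 (local_expr c x q)"
proof -
  have "0 \<in> (%z. snd c x + z) -` (snd c ` (fst c \<inter> W))" using assms(3,4) by simp
  from conjI[OF this holo_on_translate(1)[OF holo_function_in_chart[OF assms(1,2)]]]
  show ?thesis unfolding holo_near0_def by (rule exI)
qed

lemma local_expr_0:
  assumes "holo_chart A c" "x \<in> fst c" shows "local_expr c x q 0 = q x"
  using holo_chart_inv[OF assms] by (simp add: in_chart_def)

lemma eventually_local_expr:
  assumes c: "holo_chart A c" "x \<in> fst c" and W: "open W" "x \<in> W" "!!y. y \<in> W ==> P y"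
  shows "eventually (%z. P (inv_into (fst c) (snd c) (snd c x + z))) (nhds 0)"
proof -
  let ?S = "(%z. snd c x + z) -` (snd c ` (fst c \<inter> W))"
  have "open ?S" by (rule open_vimage[OF holo_chart_open_image[OF c(1) W(1)]]) (intro continuous_intros)
  moreover have "0 \<in> ?S" using c W by auto
  moreover have "P (inv_into (fst c) (snd c) (snd c x + z))" if "z \<in> ?S" for z
  proof -
    obtain y where "snd c x + z = snd c y" "y \<in> fst c" "y \<in> W" using \<open>z \<in> ?S\<close> by auto
    thus ?thesis using W(3) holo_chart_inv[OF c(1), of y] by simp
  qed
  ultimately show ?thesis unfolding eventually_nhds by (intro exI[of _ ?S]) simp
qed

lemma holo_map0_centred_transition:
  assumes c: "holo_chart A c" "x \<in> fst c" and s: "holo_chart A s" "x \<in> fst s"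
  shows "holo_map0 (centred_transition c s x)"
proof -
  have "holo_near0 (%z. local_expr c x (%y. snd s y $ j) z + - (snd s x $ j))" for j
    by (rule holo_near0_add[OF holo_near0_local_expr[OF holo_chart_function[OF s(1)] c s(2)] holo_near0_const])
  moreover have "centred_transition c s x z $ j = local_expr c x (%y. snd s y $ j) z + - (snd s x $ j)" for z j
    by (simp add: centred_transition_def in_chart_def)
  moreover have "centred_transition c s x 0 = 0" unfolding centred_transition_def local_expr_0[OF c] by simp
  ultimately show ?thesis unfolding holo_map0_def by simp
qed

lemma centred_transition_inverse:
  assumes c: "holo_chart A c" "x \<in> fst c" and s: "holo_chart A s" "x \<in> fst s"
  shows "eventually (%z. centred_transition s c x (centred_transition c s x z) = z) (nhds 0)"
proof -
  have 1: "eventually (%z. inv_into (fst c) (snd c) (snd c x + z) \<in> fst s) (nhds 0)"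
    by (rule eventually_local_expr[OF c holo_chart_homeomorphism(1)[OF s(1)] s(2)])
  let ?S = "(%z. snd c x + z) -` (snd c ` fst c)"
  have "open ?S" by (rule open_vimage[OF holo_chart_homeomorphism(2)[OF c(1)]]) (intro continuous_intros)
  hence 2: "eventually (%z. z \<in> ?S) (nhds 0)" using c by (intro eventually_nhds_in_open) auto
  show ?thesis using 1 2
  proof eventually_elim
    case (elim z)
    obtain y where y: "snd c x + z = snd c y" "y \<in> fst c" using elim(2) by auto
    have "y \<in> fst s" using elim(1) holo_chart_inv[OF c(1) y(2)] y(1) by simp
    have "centred_transition c s x z = snd s y - snd s x"
      by (simp add: centred_transition_def in_chart_def y(1) holo_chart_inv[OF c(1) y(2)])
    hence "centred_transition s c x (centred_transition c s x z) = snd c y - snd c x"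
      by (simp add: centred_transition_def in_chart_def holo_chart_inv[OF s(1) \<open>y \<in> fst s\<close>])
    thus ?case by (simp flip: y(1))
  qed
qed

end

section \<open>Units, roots and local normal forms of the map to the disk\<close>

lemma fd_cong_ev:
  assumes "eventually (%z. g z = h z) (nhds a)" "(g has_derivative D) (at a)"
  shows "fd h a v = D v"
proof -
  obtain S where S: "open S" "a \<in> S" "!!z. z \<in> S ==> g z = h z" using assms(1) unfolding eventually_nhds by blast
  have "(h has_derivative D) (at a)" by (rule has_derivative_transform_within_open[OF assms(2) S])
  from fun_cong[OF frechet_derivative_at[OF this], of v] show ?thesis by simp
qed

lemma fd_compose0:
  assumes Y: "holo_map0 Y" and g: "holo_near0 g"
  shows "fd (%z. g (Y z)) 0 v = (\<Sum>j\<in>UNIV. fd (%z. Y z $ j) 0 v * fd g 0 (axis j 1))"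
    and "((%z. g (Y z)) has_derivative (%v. \<Sum>j\<in>UNIV. fd (%z. Y z $ j) 0 v * fd g 0 (axis j 1))) (at 0)"
proof -
  obtain U where U: "0 \<in> U" "holo_on g U" using g by (auto simp: holo_near0_def)
  obtain V where V: "0 \<in> V" "open V" "!!j. holo_on (%z. Y z $ j) V" "Y ` V \<subseteq> U"
    using holo_map0_common[OF Y holo_on_open[OF U(2)] U(1)] by metis
  have Y0: "Y 0 = 0" using Y by (simp add: holo_map0_def)
  show *: "fd (%z. g (Y z)) 0 v = (\<Sum>j\<in>UNIV. fd (%z. Y z $ j) 0 v * fd g 0 (axis j 1))" for v
    using holo_on_compose(2)[OF U(2) V(3,4,1), of v] by (simp add: Y0)
  show "((%z. g (Y z)) has_derivative (%v. \<Sum>j\<in>UNIV. fd (%z. Y z $ j) 0 v * fd g 0 (axis j 1))) (at 0)"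
    using holo_on_has_derivative[OF holo_on_compose(1)[OF U(2) V(3,4)] V(1)] unfolding *[symmetric] .
qed

lemma holo_map0_inverse_jacobian:
  assumes Y: "holo_map0 Y" and G: "holo_map0 G" and inv: "eventually (%z. G (Y z) = z) (nhds 0)"
  shows "(\<Sum>j\<in>UNIV. fd (%z. G z $ i) 0 (axis j 1) * fd (%z. Y z $ j) 0 (axis k 1)) = (if i = k then 1 else 0)"
proof -
  have g: "holo_near0 (%z. G z $ i)" using G by (simp add: holo_map0_def)
  have "fd (%z. z $ i) 0 (axis k 1) = (\<Sum>j\<in>UNIV. fd (%z. Y z $ j) 0 (axis k 1) * fd (%z. G z $ i) 0 (axis j 1))"
  proof (rule fd_cong_ev[OF _ fd_compose0(2)[OF Y g]])
    show "eventually (%z. G (Y z) $ i = z $ i) (nhds 0)" by (rule eventually_mono[OF inv]) simp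
  qed
  also have "\<dots> = (\<Sum>j\<in>UNIV. fd (%z. G z $ i) 0 (axis j 1) * fd (%z. Y z $ j) 0 (axis k 1))"
    by (intro sum.cong refl mult.commute)
  finally show ?thesis by (simp add: fd_component axis_def)
qed

lemma holo_near0_holomorphic_compose:
  assumes g: "holo_near0 g" and k: "k holomorphic_on S" "open S" and "g 0 \<in> S"
  obtains V where "open V" "0 \<in> V" "holo_on g V" "g ` V \<subseteq> S" "holo_on (%z. k (g z)) V"
proof -
  obtain U where U: "0 \<in> U" "holo_on g U" using g by (auto simp: holo_near0_def)
  define V where "V = U \<inter> g -` S"
  have "open V" unfolding V_def
    using continuous_open_preimage[OF holo_on_continuous[OF U(2)] holo_on_open[OF U(2)] k(2)] .
  moreover have "holo_on g V" by (rule holo_on_subset[OF U(2) \<open>open V\<close>]) (simp add: V_def)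
  moreover have "g ` V \<subseteq> S" by (auto simp: V_def)
  moreover have "holo_on (%z. k (g z)) V" by (rule holo_on_holomorphic_compose(1)[OF k]) fact+
  moreover have "0 \<in> V" using U assms by (simp add: V_def)
  ultimately show thesis by (intro that)
qed

lemma germ_unit:
  assumes g: "holo_near0 g" "g 0 ~= 0"
  shows "abs_germ g dvd 1"
proof -
  obtain V where V: "open V" "0 \<in> V" "holo_on g V" "g ` V \<subseteq> - {0}" "holo_on (%z. inverse (g z)) V"
    by (rule holo_near0_holomorphic_compose[OF g(1), of inverse "- {0}"])
       (use g in \<open>auto intro!: holomorphic_intros\<close>)
  have h: "holo_near0 (%z. inverse (g z))" using V unfolding holo_near0_def by auto
  have "abs_germ g * abs_germ (%z. inverse (g z)) = abs_germ (%_. 1)" unfolding abs_germ_mult[OF g(1) h]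
  proof (rule abs_germ_eq_iff[THEN iffD2])
    have "eventually (%z. z \<in> V) (nhds 0)" using V by (intro eventually_nhds_in_open)
    thus "\<forall>\<^sub>F z in nhds 0. g z * inverse (g z) = 1" proof eventually_elim
      case (elim z)
      hence "g z ~= 0" using V(4) by blast
      thus ?case by simp
    qed
  qed (intro holo_near0_mult g h holo_near0_const)+
  hence "abs_germ g * abs_germ (%z. inverse (g z)) = 1" by (simp add: abs_germ_const)
  thus ?thesis by (metis dvd_triv_left)
qed

lemma
  assumes "holo_near0 g"
  shows holo_near0_power: "holo_near0 (%z. g z ^ n)" and abs_germ_power: "abs_germ g ^ n = abs_germ (%z. g z ^ n)"
proof -
  have "holo_near0 (%z. g z ^ n) \<and> abs_germ g ^ n = abs_germ (%z. g z ^ n)"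
    by (induction n) (simp_all add: holo_near0_const abs_germ_const abs_germ_mult holo_near0_mult assms)
  thus "holo_near0 (%z. g z ^ n)" "abs_germ g ^ n = abs_germ (%z. g z ^ n)" by auto
qed

lemma
  assumes "!!i. i \<in> I ==> holo_near0 (F i)"
  shows holo_near0_prod: "holo_near0 (%z. \<Prod>i\<in>I. F i z)"
    and abs_germ_prod: "(\<Prod>i\<in>I. abs_germ (F i)) = abs_germ (%z. \<Prod>i\<in>I. F i z)"
proof -
  have "holo_near0 (%z. \<Prod>i\<in>I. F i z) \<and> (\<Prod>i\<in>I. abs_germ (F i)) = abs_germ (%z. \<Prod>i\<in>I. F i z)"
    using assms by (induction I rule: infinite_finite_induct)
      (simp_all add: holo_near0_const abs_germ_const abs_germ_mult holo_near0_mult)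
  thus "holo_near0 (%z. \<Prod>i\<in>I. F i z)" "(\<Prod>i\<in>I. abs_germ (F i)) = abs_germ (%z. \<Prod>i\<in>I. F i z)" by auto
qed

lemma fd_mult0:
  assumes "holo_near0 f" "holo_near0 g"
  shows "fd (%z. f z * g z) 0 v = f 0 * fd g 0 v + fd f 0 v * g 0"
proof -
  obtain U where "0 \<in> U" "holo_on f U" "holo_on g U" using holo_near0_common[OF assms] by blast
  thus ?thesis using fd_mult by blast
qed

text \<open>The root is the exponential of a logarithm divided by n. The branch Ln(g 0) + Ln(w / g
  0) is used because it is holomorphic near w = g 0 even when g 0 lies on the negative real
  axis.\<close>

lemma holo_near0_root:
  assumes g: "holo_near0 g" "g 0 ~= 0" and n: "n \<ge> 1"
  obtains v where "holo_near0 v" "v 0 ~= 0" "eventually (%z. v z ^ n = g z) (nhds 0)"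
proof -
  define k where "k = (%w. exp ((Ln (g 0) + Ln (w / g 0)) / of_nat n))"
  define S where "S = (%w. w / g 0) -` (- \<real>\<^sub>\<le>\<^sub>0)"
  have S: "open S" unfolding S_def
    by (rule open_vimage) (use g in \<open>auto intro!: continuous_intros closed_nonpos_Reals_complex\<close>)
  have k: "k holomorphic_on S" unfolding k_def using g by (intro holomorphic_intros) (auto simp: S_def)
  have kn: "k w ^ n = w" if "w \<in> S" for w
  proof -
    have w: "w ~= 0" using that g by (auto simp: S_def)
    have "k w ^ n = exp (of_nat n * ((Ln (g 0) + Ln (w / g 0)) / of_nat n))"
      unfolding k_def by (simp only: exp_of_nat_mult)
    also have "\<dots> = w" using n w g by (simp add: exp_add exp_Ln)
    finally show ?thesis .
  qed
  obtain V where V: "open V" "0 \<in> V" "holo_on g V" "g ` V \<subseteq> S" "holo_on (%z. k (g z)) V"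
    by (rule holo_near0_holomorphic_compose[OF g(1) k S]) (use g in \<open>simp_all add: S_def\<close>)
  show thesis
  proof
    show "holo_near0 (%z. k (g z))" using V unfolding holo_near0_def by (intro exI[of _ V]) simp
    show "k (g 0) ~= 0" by (simp add: k_def)
    have "eventually (%z. z \<in> V) (nhds 0)" using V by (intro eventually_nhds_in_open)
    thus "eventually (%z. k (g z) ^ n = g z) (nhds 0)" by eventually_elim (use V kn in auto)
  qed
qed

context
  fixes A :: "('x::topological_space, 'm::finite) chart set" and f :: "'x => complex" and c :: "('x, 'm) chart" and x :: 'x
  assumes A: "complex_atlas A" and f: "holo_function A UNIV f" and c: "holo_chart A c" "x \<in> fst c"
begin

lemma germ_at_eq: "germ_at c x f = abs_germ (local_expr c x f)" by (simp add: germ_at_def)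

lemma holo_near0_f: "holo_near0 (local_expr c x f)" by (rule holo_near0_local_expr[OF A f c]) simp

text \<open>A branch of log(f / f x) is taken as the i-th coordinate, where i is a direction of
  nonzero derivative. Then f is its exponential up to a constant, so the derivation along that
  coordinate reproduces the germ and the others kill it.\<close>

lemma unit_normal_form:
  assumes fx: "f x ~= 0" and smooth: "submersive_at A f x"
  obtains y \<delta> \<rho> i where "germ_coords y \<delta> \<rho>" "germ_at c x f dvd 1"
    "!!j. \<delta> j (germ_at c x f) = (if j = i then germ_at c x f else 0)"
proof -
  let ?t = "local_expr c x f"
  note t = holo_near0_f
  have t0: "?t 0 = f x" by (rule local_expr_0[OF A c])
  \<comment> \<open>\<open>submersive_at\<close> speaks of charts in A, and c need not be one: a
    vanishing gradient in c would be carried by the chain rule to a chart of A around x.\<close>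
  have "\<exists>i. fd ?t 0 (axis i 1) ~= 0"
  proof (rule ccontr)
    assume "\<not> ?thesis"
    hence z: "fd ?t 0 (axis i 1) = 0" for i by blast
    obtain c0 where c0: "c0 \<in> A" "x \<in> fst c0" using atlas_cover[OF A] by blast
    have hc0: "holo_chart A c0" by (rule atlas_holo_chart[OF A c0(1)])
    let ?Y = "centred_transition c0 c x"
    have Y: "holo_map0 ?Y" by (rule holo_map0_centred_transition[OF A hc0 c0(2) c])
    have d1: "((%z. ?t (?Y z)) has_derivative (%v. 0)) (at 0)" using fd_compose0(2)[OF Y t] by (simp add: z)
    have "eventually (%z. inv_into (fst c0) (snd c0) (snd c0 x + z) \<in> fst c) (nhds 0)"
      by (rule eventually_local_expr[OF A hc0 c0(2) holo_chart_homeomorphism(1)[OF A c(1)] c(2)])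
    hence "eventually (%z. ?t (?Y z) = local_expr c0 x f z) (nhds 0)"
    proof eventually_elim
      case (elim z)
      thus ?case using holo_chart_inv[OF A c(1) elim] by (simp add: centred_transition_def in_chart_def)
    qed
    then obtain S where S: "open S" "0 \<in> S" "!!z. z \<in> S ==> ?t (?Y z) = local_expr c0 x f z"
      unfolding eventually_nhds by blast
    have d2: "(local_expr c0 x f has_derivative (%v. 0)) (at 0)"
      by (rule has_derivative_transform_within_open[OF d1 S])
    have "((%w. w - snd c0 x) has_derivative (%v. v)) (at (snd c0 x))"
      using has_derivative_diff[OF has_derivative_ident has_derivative_const, of "snd c0 x"] by simp
    moreover have "(local_expr c0 x f has_derivative (%v. 0)) (at (snd c0 x - snd c0 x))" using d2 by simp
    ultimately have "((%w. local_expr c0 x f (w - snd c0 x)) has_derivative (%v. 0)) (at (snd c0 x))"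
      by (rule has_derivative_compose)
    hence "(in_chart c0 f has_derivative (%v. 0)) (at (snd c0 x))" by simp
    thus False using smooth c0 unfolding submersive_at_def by blast
  qed
  then obtain i where i: "fd ?t 0 (axis i 1) ~= 0" by blast
  define S where "S = (%w. w / f x) -` (- \<real>\<^sub>\<le>\<^sub>0)"
  define k where "k = (%w. Ln (w / f x))"
  have S: "open S" unfolding S_def
    by (rule open_vimage) (use fx in \<open>auto intro!: continuous_intros closed_nonpos_Reals_complex\<close>)
  have k: "k holomorphic_on S" unfolding k_def using fx by (intro holomorphic_intros) (auto simp: S_def)
  have dk: "deriv k w = inverse w" if "w \<in> S" for w
  proof -
    have w: "w ~= 0" "w / f x \<notin> \<real>\<^sub>\<le>\<^sub>0" using that fx by (auto simp: S_def)
    have "(k has_field_derivative inverse w) (at w)" unfolding k_def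
      using w fx by (auto intro!: derivative_eq_intros simp: field_simps)
    thus ?thesis by (rule DERIV_imp_deriv)
  qed
  obtain V where V: "open V" "0 \<in> V" "holo_on ?t V" "?t ` V \<subseteq> S" "holo_on (%z. k (?t z)) V"
    by (rule holo_near0_holomorphic_compose[OF t k S]) (use fx t0 in \<open>simp_all add: S_def\<close>)
  have tk: "holo_near0 (%z. k (?t z))" using V unfolding holo_near0_def by (intro exI[of _ V]) simp
  have fdk: "fd (%z. k (?t z)) z v = inverse (?t z) * fd ?t z v" if "z \<in> V" for z v
    using holo_on_holomorphic_compose(2)[OF k S V(3,4) that, of v] dk[of "?t z"] V(4) that by auto
  define Y where "Y = (%z :: complex ^ 'm. \<chi> j. if j = i then k (?t z) else z $ j)"
  have Yc: "(%z. Y z $ j) = (if j = i then (%z. k (?t z)) else (%z. z $ j))" for j by (auto simp: Y_def)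
  have Y: "holo_map0 Y" unfolding holo_map0_def
    by (auto simp: Yc tk holo_near0_component) (simp add: Y_def vec_eq_iff k_def t0[simplified] fx)
  define a where "a = (%j. fd ?t 0 (axis j 1))"
  \<comment> \<open>The Jacobian is the identity matrix with row i replaced by the gradient a / f x.
    Solving that row for the i-th variable gives row i of its inverse B.\<close>
  define B where "B = (%l j. if l = i then (if j = i then f x / a i else - a j / a i) else if l = j then 1 else (0 :: complex))"
  have J: "fd (%z. Y z $ j) 0 (axis l 1) = (if j = i then a l / f x else if j = l then 1 else 0)" for j l
    using fdk[OF V(2)] by (auto simp: Yc fd_component axis_def a_def t0[simplified] field_simps)
  have "(\<Sum>j\<in>UNIV. B r j * fd (%z. Y z $ j) 0 (axis l 1)) = (if r = l then 1 else 0)" for r l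
  proof -
    have "(\<Sum>j\<in>UNIV. B r j * fd (%z. Y z $ j) 0 (axis l 1)) =
        B r i * (a l / f x) + (\<Sum>j\<in>UNIV - {i}. B r j * (if j = l then 1 else 0))"
      unfolding J by (subst sum.remove[of _ i]) auto
    also have "(\<Sum>j\<in>UNIV - {i}. B r j * (if j = l then 1 else 0)) = (if l = i then 0 else B r l)"
      by (auto simp: if_distrib sum.delta cong: if_cong)
    also have "B r i * (a l / f x) + \<dots> = (if r = l then 1 else 0)" using i fx by (auto simp: B_def a_def)
    finally show ?thesis .
  qed
  then obtain \<delta> \<rho> where coords: "germ_coords (%j. abs_germ (%z. Y z $ j)) \<delta> \<rho>"
    by (rule germ_coords_exists[OF Y])
  interpret germ_coords "%j. abs_germ (%z. Y z $ j)" \<delta> \<rho> by (rule coords)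
  have pdt: "germ_pd l (abs_germ ?t) = abs_germ ?t * germ_pd l (abs_germ (%z. Y z $ i))" for l
  proof -
    have "abs_germ ?t * germ_pd l (abs_germ (%z. Y z $ i)) = abs_germ (%z. ?t z * fd (%z. k (?t z)) z (axis l 1))"
      unfolding Yc by (simp add: germ_pd_abs tk abs_germ_mult t holo_near0_fd)
    also have "\<dots> = abs_germ (%z. fd ?t z (axis l 1))"
    proof (rule abs_germ_eq_iff[THEN iffD2])
      have "eventually (%z. z \<in> V) (nhds 0)" using V by (intro eventually_nhds_in_open)
      thus "\<forall>\<^sub>F z in nhds 0. ?t z * fd (%z. k (?t z)) z (axis l 1) = fd ?t z (axis l 1)"
      proof eventually_elim
        case (elim z)
        have "?t z \<in> S" using V(4) elim by blast
        hence "?t z ~= 0" by (auto simp: S_def)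
        thus ?case by (simp only: fdk[OF elim]) simp
      qed
    qed (intro holo_near0_mult holo_near0_fd t tk)+
    finally show ?thesis by (simp add: germ_pd_abs t)
  qed
  have "\<delta> j (abs_germ ?t) = (if j = i then abs_germ ?t else 0)" for j
  proof -
    have "\<delta> j (abs_germ ?t) = abs_germ ?t * \<delta> j (abs_germ (%z. Y z $ i))"
      unfolding \<delta>_pd[of j "abs_germ ?t"] \<delta>_pd[of j "abs_germ (%z. Y z $ i)"] pdt sum_distrib_left
      by (intro sum.cong refl mult.left_commute)
    thus ?thesis by (simp add: \<delta>_x)
  qed
  moreover have "abs_germ ?t dvd 1" by (rule germ_unit[OF t]) (simp add: t0[simplified] fx)
  ultimately show thesis using coords unfolding germ_at_eq[symmetric] by (intro that)
qed

text \<open>The unit factor u disappears into one coordinate: with v ^ \<open>e i0\<close> = u, the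
  product of v with the old coordinate replaces it. As f vanishes at x and u does not, some branch
  passes through x, so such an \<open>i0\<close> exists.\<close>

lemma snc_normal_form:
  assumes snc: "snc_zero_divisor A f" and fx: "f x = 0"
  obtains y \<delta> \<rho> I e where "germ_coords y \<delta> \<rho>" "I ~= {}" "!!i. i \<in> I ==> e i \<ge> 1"
    "germ_at c x f = (\<Prod>i\<in>I. y i ^ e i)"
proof -
  obtain I Z e where I: "finite (I :: nat set)" "\<forall>i\<in>I. connected (Z i) \<and> Z i ~= {} \<and> e i \<ge> (1::nat)" and
    loc: "\<forall>x. \<exists>U \<phi> u \<sigma>. holo_chart A (U, \<phi>) \<and> x \<in> U \<and> inj_on \<sigma> {i\<in>I. x \<in> Z i} \<and>
           (\<forall>i\<in>I. Z i \<inter> U = (if x \<in> Z i then {y\<in>U. \<phi> y $ \<sigma> i = 0} else {})) \<and>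
           holo_function A U u \<and> (\<forall>y\<in>U. u y ~= 0) \<and>
           (\<forall>y\<in>U. f y = u y * (\<Prod>i | i \<in> I \<and> x \<in> Z i. (\<phi> y $ \<sigma> i) ^ e i))"
    using snc unfolding snc_zero_divisor_def by blast
  obtain U \<phi> u \<sigma> where s: "holo_chart A (U, \<phi>)" "x \<in> U" and \<sigma>: "inj_on \<sigma> {i\<in>I. x \<in> Z i}"
    and Z: "!!i. i \<in> I ==> Z i \<inter> U = (if x \<in> Z i then {y\<in>U. \<phi> y $ \<sigma> i = 0} else {})"
    and u: "holo_function A U u" "!!y. y \<in> U ==> u y ~= 0"
    and fu: "!!y. y \<in> U ==> f y = u y * (\<Prod>i | i \<in> I \<and> x \<in> Z i. (\<phi> y $ \<sigma> i) ^ e i)"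
    using spec[OF loc, of x] by (elim exE conjE) blast
  define I' where "I' = {i\<in>I. x \<in> Z i}"
  have fin: "finite I'" using I by (simp add: I'_def)
  have "I' ~= {}"
  proof
    assume "I' = {}"
    moreover have "f x = u x * (\<Prod>i\<in>I'. (\<phi> x $ \<sigma> i) ^ e i)" using fu[OF s(2)] unfolding I'_def .
    ultimately have "f x = u x" by simp
    thus False using u(2)[OF s(2)] fx by simp
  qed
  then obtain i0 where i0: "i0 \<in> I'" by blast
  have \<phi>0: "\<phi> x $ \<sigma> i = 0" if "i \<in> I'" for i using Z[of i] that s(2) by (auto simp: I'_def)
  let ?s = "(U, \<phi>)"
  have s': "x \<in> fst ?s" using s by simp
  define \<psi> where "\<psi> = centred_transition c ?s x"
  define G where "G = centred_transition ?s c x"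
  have \<psi>: "holo_map0 \<psi>" unfolding \<psi>_def by (rule holo_map0_centred_transition[OF A c s(1) s'])
  have G: "holo_map0 G" unfolding G_def by (rule holo_map0_centred_transition[OF A s(1) s' c])
  have G\<psi>: "eventually (%z. G (\<psi> z) = z) (nhds 0)"
    unfolding G_def \<psi>_def by (rule centred_transition_inverse[OF A c s(1) s'])
  have \<psi>j: "holo_near0 (%z. \<psi> z $ j)" for j using \<psi> by (simp add: holo_map0_def)
  have u1: "holo_near0 (local_expr c x u)" by (rule holo_near0_local_expr[OF A u(1) c s(2)])
  have u10: "local_expr c x u 0 ~= 0" unfolding local_expr_0[OF A c] using u(2) s(2) by blast
  have e0: "e i0 \<ge> 1" using I(2) i0 by (simp add: I'_def)
  obtain v where v: "holo_near0 v" "v 0 ~= 0" "eventually (%z. v z ^ e i0 = local_expr c x u z) (nhds 0)"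
    using holo_near0_root[OF u1 u10 e0] by blast
  define Y where "Y = (%z. \<chi> j. (if j = \<sigma> i0 then v z else 1) * \<psi> z $ j)"
  have w: "holo_near0 (if j = \<sigma> i0 then v else (%_. 1))" for j using v holo_near0_const by auto
  have Yc: "(%z. Y z $ j) = (%z. (if j = \<sigma> i0 then v else (%_. 1)) z * \<psi> z $ j)" for j by (auto simp: Y_def)
  have Yj: "holo_near0 (%z. Y z $ j)" for j unfolding Yc by (rule holo_near0_mult[OF w \<psi>j])
  have \<psi>0: "\<psi> 0 = 0" using \<psi> by (simp add: holo_map0_def)
  have Y: "holo_map0 Y" unfolding holo_map0_def using Yj \<psi>0 by (auto simp: Y_def vec_eq_iff)
  define w0 where "w0 = (%j. if j = \<sigma> i0 then v 0 else 1)"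
  have w0: "w0 j ~= 0" for j using v by (simp add: w0_def)
  \<comment> \<open>Each \<psi>_j vanishes at 0, so the product rule leaves only the term with the
    derivative of \<psi>_j; the Jacobian is that of the transition map with one row scaled by
    v(0).\<close>
  have J: "fd (%z. Y z $ j) 0 l = w0 j * fd (%z. \<psi> z $ j) 0 l" for j l
    unfolding Yc fd_mult0[OF w \<psi>j] by (simp add: \<psi>0 w0_def)
  have "(\<Sum>j\<in>UNIV. (fd (%z. G z $ r) 0 (axis j 1) / w0 j) * fd (%z. Y z $ j) 0 (axis l 1)) = (if r = l then 1 else 0)" for r l
    unfolding J using w0 holo_map0_inverse_jacobian[OF \<psi> G G\<psi>, of r l] by (simp add: field_simps)
  then obtain \<delta> \<rho> where coords: "germ_coords (%j. abs_germ (%z. Y z $ j)) \<delta> \<rho>"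
    by (rule germ_coords_exists[OF Y])
  \<comment> \<open>Exponents are indexed by branches in \<open>snc_zero_divisor\<close> but by
    coordinates from here on; \<sigma> is injective on the branches through x, so they can be
    carried over.\<close>
  define e' where "e' = (%j. e (the_inv_into I' \<sigma> j))"
  have inj: "inj_on \<sigma> I'" using \<sigma> by (simp add: I'_def)
  have e': "e' (\<sigma> i) = e i" if "i \<in> I'" for i by (simp add: e'_def the_inv_into_f_f[OF inj that])
  have U: "open U" using holo_chart_homeomorphism(1)[OF A s(1)] by simp
  have "eventually (%z. inv_into (fst c) (snd c) (snd c x + z) \<in> U) (nhds 0)"
    by (rule eventually_local_expr[OF A c U s(2)])
  with v(3) have ev: "eventually (%z. local_expr c x f z = (\<Prod>j\<in>\<sigma> ` I'. Y z $ j ^ e' j)) (nhds 0)"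
  proof eventually_elim
    case (elim z)
    let ?y = "inv_into (fst c) (snd c) (snd c x + z)"
    have \<psi>z: "\<psi> z $ \<sigma> i = \<phi> ?y $ \<sigma> i" if "i \<in> I'" for i
      using \<phi>0[OF that] by (simp add: \<psi>_def centred_transition_def in_chart_def)
    have "(\<Prod>j\<in>\<sigma> ` I'. Y z $ j ^ e' j) = (\<Prod>i\<in>I'. Y z $ \<sigma> i ^ e i)" by (simp add: prod.reindex[OF inj] e')
    also have "\<dots> = (\<Prod>i\<in>I'. (if i = i0 then v z ^ e i0 else 1) * \<phi> ?y $ \<sigma> i ^ e i)"
      by (rule prod.cong) (use inj i0 in \<open>auto simp: Y_def \<psi>z power_mult_distrib inj_on_eq_iff\<close>)
    also have "\<dots> = v z ^ e i0 * (\<Prod>i\<in>I'. \<phi> ?y $ \<sigma> i ^ e i)" using fin i0 by (simp add: prod.distrib prod.delta)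
    also have "\<dots> = local_expr c x f z" using fu[OF elim(2)] elim(1) by (simp add: in_chart_def I'_def)
    finally show ?case ..
  qed
  have "germ_at c x f = abs_germ (%z. \<Prod>j\<in>\<sigma> ` I'. Y z $ j ^ e' j)" unfolding germ_at_eq
    by (rule abs_germ_eq_iff[THEN iffD2, OF holo_near0_f holo_near0_prod ev]) (rule holo_near0_power[OF Yj])
  also have "\<dots> = (\<Prod>j\<in>\<sigma> ` I'. abs_germ (%z. Y z $ j) ^ e' j)"
    unfolding abs_germ_power[OF Yj] by (rule abs_germ_prod[symmetric]) (rule holo_near0_power[OF Yj])
  finally have "germ_at c x f = (\<Prod>j\<in>\<sigma> ` I'. abs_germ (%z. Y z $ j) ^ e' j)" .
  moreover have "\<sigma> ` I' ~= {}" using i0 by blast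
  moreover have "e' j \<ge> 1" if "j \<in> \<sigma> ` I'" for j using that e' I(2) by (auto simp: I'_def)
  ultimately show thesis using coords by (intro that)
qed

end

section \<open>Differential operators in local coordinates\<close>

text \<open>A type of additive maps makes composition the multiplication of a ring, so that
  differential operators can be handled by the ring laws; additivity is what one of the two
  distributive laws of composition requires.\<close>

typedef (overloaded) 'a endo = "{P :: 'a::comm_ring_1 => 'a. \<forall>a b. P (a + b) = P a + P b}"
  morphisms app Endo by (rule exI[of _ "%_. 0"]) simp

setup_lifting type_definition_endo

instantiation endo :: (comm_ring_1) ring_1
begin

lift_definition zero_endo :: "'a endo" is "%_. 0" by simp
lift_definition one_endo :: "'a endo" is "%a. a" by simp
lift_definition plus_endo :: "'a endo => 'a endo => 'a endo" is "%P Q a. P a + Q a" by (simp add: algebra_simps)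
lift_definition uminus_endo :: "'a endo => 'a endo" is "%P a. - P a" by simp
lift_definition minus_endo :: "'a endo => 'a endo => 'a endo" is "%P Q a. P a - Q a" by simp
lift_definition times_endo :: "'a endo => 'a endo => 'a endo" is "%P Q a. P (Q a)" by simp

instance
proof
  show "(0 :: 'a endo) ~= 1" by transfer (metis zero_neq_one)
qed (transfer; simp add: fun_eq_iff algebra_simps)+

end

lift_definition mop :: "'a::comm_ring_1 => 'a endo" is "%a b. a * b" by (simp add: algebra_simps)

lemma mop_add: "mop (a + b) = mop a + mop b"
  and mop_mult: "mop (a * b) = mop a * mop b"
  and mop_0 [simp]: "mop 0 = 0"
  and mop_1 [simp]: "mop 1 = 1"
  and mop_minus: "mop (- a) = - mop a" by (transfer; simp add: fun_eq_iff algebra_simps)+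

lemma mop_diff: "mop (a - b) = mop a - mop b"
  using mop_add[of a "- b"] by (simp add: mop_minus)

lemma mop_commute: "mop a * mop b = mop b * mop a"
  by (simp flip: mop_mult add: mult.commute)

lemma mop_of_nat: "mop (of_nat n) = of_nat n" by (induction n) (simp_all add: mop_add)

lemma mop_sum: "mop (\<Sum>i\<in>S. f i) = (\<Sum>i\<in>S. mop (f i))"
  by (induction S rule: infinite_finite_induct) (simp_all add: mop_add)

lemma mop_eq_0_iff [simp]: "mop a = 0 \<longleftrightarrow> a = 0" by (transfer, metis mult_zero_left mult.right_neutral)

lemma app_simps: "app 0 a = 0" "app 1 a = a" "app (P + Q) a = app P a + app Q a" "app (- P) a = - app P a"
    "app (P - Q) a = app P a - app Q a" "app (P * Q) a = app P (app Q a)" "app (mop b) a = b * a"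
  by (transfer, simp)+

lemma endo_eqI: "(!!a. app P a = app Q a) ==> P = Q" by transfer auto

lemma germ_of_nat: "(of_nat n :: 'm::finite germ) = germ_const (of_nat n)"
  by (induction n) (simp_all add: germ_const_add)

lemma germ_of_nat_eq_0_iff [simp]: "(of_nat n :: 'm::finite germ) = 0 \<longleftrightarrow> n = 0" by (simp add: germ_of_nat)

lemma multi_index_induct [case_names zero incr]:
  fixes m :: "'m::finite => nat"
  assumes "P (%_. 0)" "!!m j. P m ==> P (m(j := Suc (m j)))"
  shows "P m"
proof (induction "sum m UNIV" arbitrary: m)
  case 0
  hence "m = (%_. 0)" by auto
  thus ?case using assms(1) by simp
next
  case (Suc k)
  hence "\<exists>j. m j ~= 0" by (metis Zero_not_Suc sum.neutral)
  then obtain j where j: "m j ~= 0" by blast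
  let ?m' = "m(j := m j - 1)"
  have eq: "m = ?m'(j := Suc (?m' j))" using j by auto
  have "sum m UNIV = Suc (sum ?m' UNIV)" using j by (simp add: sum.remove[of UNIV j])
  hence "P ?m'" using Suc by simp
  thus ?case using assms(2) eq by metis
qed

definition mi_le :: "nat => ('m::finite => nat) set" where
  "mi_le k = {m. sum m UNIV \<le> k}"

lemma mi_le_component: "m \<in> mi_le k ==> m j \<le> k" using member_le_sum[of j UNIV m] by (simp add: mi_le_def)

lemma finite_mi_le [simp]: "finite (mi_le k :: ('m::finite => nat) set)"
proof (rule finite_subset)
  show "mi_le k \<subseteq> (PiE (UNIV :: 'm set) (%_. {..k}))" using mi_le_component by fastforce
qed (rule finite_PiE, auto)

lemma sum_incr: "sum (m(j := Suc (m j))) UNIV = Suc (sum m (UNIV :: 'm::finite set))"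
  by (simp add: sum.remove[of UNIV j])

lemma mi_le_mono: "k \<le> l ==> mi_le k \<subseteq> mi_le l" by (auto simp: mi_le_def)

lemma mi_le_incr: "m(j := Suc (m j)) \<in> mi_le (Suc k) \<longleftrightarrow> m \<in> mi_le k"
  by (simp only: mi_le_def mem_Collect_eq sum_incr Suc_le_mono)

context germ_coords
begin

lemma \<delta>_0 [simp]: "\<delta> i 0 = 0" and \<delta>_1 [simp]: "\<delta> i 1 = 0" using \<delta>_const[of i 0] \<delta>_const[of i 1] by simp_all

lemma \<delta>_minus: "\<delta> i (- a) = - \<delta> i a" using \<delta>_add[of i a "- a"] by (simp add: add_eq_0_iff)

definition deriv_op :: "'m => 'm germ endo" where
  "deriv_op i = Endo (\<delta> i)"

lemma app_deriv_op: "app (deriv_op i) a = \<delta> i a" by (simp add: deriv_op_def Endo_inverse \<delta>_add)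

lemma deriv_op_mop: "deriv_op i * mop a = mop a * deriv_op i + mop (\<delta> i a)"
  by (rule endo_eqI) (simp add: app_simps app_deriv_op \<delta>_mult)

lemma deriv_op_commute: "deriv_op i * deriv_op j = deriv_op j * deriv_op i"
  by (rule endo_eqI) (simp add: app_simps app_deriv_op \<delta>_commute[of i j])

text \<open>The product runs over a fixed enumeration of the coordinates because \<open>endo\<close> is not commutative.\<close>
definition dmon :: "('m => nat) => 'm germ endo" where
  "dmon m = prod_list (map (%i. deriv_op i ^ m i) (SOME vs. distinct vs \<and> set vs = UNIV))"

lemma deriv_op_power_commute: "deriv_op i * deriv_op j ^ k = deriv_op j ^ k * deriv_op i"
  by (rule power_commuting_commutes[symmetric]) (rule deriv_op_commute)

lemma dmon_0 [simp]: "dmon (%_. 0) = 1"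
proof -
  have "prod_list (map (%_. 1) vs) = (1 :: 'm germ endo)" for vs :: "'m list" by (induction vs) auto
  thus ?thesis by (simp add: dmon_def)
qed

lemma dmon_incr: "dmon (m(i := Suc (m i))) = deriv_op i * dmon m"
proof -
  let ?p = "%m vs. prod_list (map (%i. deriv_op i ^ m i) vs)"
  have c: "deriv_op i * ?p m vs = ?p m vs * deriv_op i" for i vs
  proof (induction vs)
    case (Cons v vs)
    have "deriv_op i * (deriv_op v ^ m v * ?p m vs) = deriv_op v ^ m v * (deriv_op i * ?p m vs)"
      by (simp only: mult.assoc[symmetric] deriv_op_power_commute)
    thus ?case by (simp add: Cons mult.assoc)
  qed simp
  have n: "?p (m(i := Suc (m i))) vs = ?p m vs" if "i \<notin> set vs" for vs using that by (induction vs) auto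
  have "?p (m(i := Suc (m i))) vs = deriv_op i * ?p m vs" if "distinct vs" "i \<in> set vs" for vs using that
  proof (induction vs)
    case (Cons v vs)
    show ?case
    proof (cases "v = i")
      case True
      thus ?thesis using Cons.prems n[of vs] by (simp add: mult.assoc)
    next
      case False
      hence "?p (m(i := Suc (m i))) vs = deriv_op i * ?p m vs" using Cons by auto
      thus ?thesis using False by (simp add: mult.assoc[symmetric] deriv_op_power_commute)
    qed
  qed simp
  moreover obtain vs :: "'m list" where "distinct vs \<and> set vs = UNIV"
    using finite_distinct_list[OF finite[of "UNIV :: 'm set"]] by blast
  hence "distinct (SOME vs :: 'm list. distinct vs \<and> set vs = UNIV) \<and> set (SOME vs :: 'm list. distinct vs \<and> set vs = UNIV) = UNIV"
    by (rule someI)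
  ultimately show ?thesis unfolding dmon_def by blast
qed

text \<open>Iteration of [\<partial>_i, x_i] = 1. When \<open>m i\<close> is 0 the truncated index
  \<open>m i - 1\<close> is harmless, since its coefficient vanishes.\<close>

lemma dmon_x:
  "dmon m * mop (x i) = mop (x i) * dmon m + of_nat (m i) * dmon (m(i := m i - 1))"
proof (induction m rule: multi_index_induct)
  case (incr m j)
  have "dmon (m(j := Suc (m j))) * mop (x i) =
      deriv_op j * mop (x i) * dmon m + of_nat (m i) * (deriv_op j * dmon (m(i := m i - 1)))"
    unfolding dmon_incr mult.assoc incr by (simp add: algebra_simps mult_of_nat_commute)
  also have "deriv_op j * mop (x i) = mop (x i) * deriv_op j + (if i = j then 1 else 0)"
    by (simp add: deriv_op_mop \<delta>_x)
  also have "(mop (x i) * deriv_op j + (if i = j then 1 else 0)) * dmon m =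
      mop (x i) * dmon (m(j := Suc (m j))) + (if i = j then dmon m else 0)"
    by (simp add: dmon_incr algebra_simps)
  also have "of_nat (m i) * (deriv_op j * dmon (m(i := m i - 1))) =
      of_nat (m i) * (if i = j then dmon m else dmon (m(j := Suc (m j), i := m i - 1)))"
  proof (cases "m i = 0")
    case False
    show ?thesis
    proof (cases "i = j")
      case True
      have "deriv_op j * dmon (m(i := m i - 1)) = dmon ((m(i := m i - 1))(j := Suc ((m(i := m i - 1)) j)))"
        by (rule dmon_incr[symmetric])
      thus ?thesis using True False by simp
    next
      case False
      have "deriv_op j * dmon (m(i := m i - 1)) = dmon ((m(i := m i - 1))(j := Suc ((m(i := m i - 1)) j)))"
        by (rule dmon_incr[symmetric])
      thus ?thesis using False by (simp add: fun_upd_twist)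
    qed
  qed simp
  finally have *: "dmon (m(j := Suc (m j))) * mop (x i) =
      mop (x i) * dmon (m(j := Suc (m j))) + (if i = j then dmon m else 0) +
      of_nat (m i) * (if i = j then dmon m else dmon (m(j := Suc (m j), i := m i - 1)))" .
  have "(if i = j then dmon m else 0) +
      of_nat (m i) * (if i = j then dmon m else dmon (m(j := Suc (m j), i := m i - 1))) =
      of_nat ((m(j := Suc (m j))) i) * dmon ((m(j := Suc (m j)))(i := (m(j := Suc (m j))) i - 1))"
  proof (cases "i = j")
    case True
    thus ?thesis by (simp add: distrib_right)
  qed simp
  thus ?case unfolding * by (simp only: add.assoc)
qed simp

subsection \<open>The order filtration and right normal forms\<close>

text \<open>Coefficients are written to the right of the derivatives because D acts on forms from
  the right: the transform is then linear in the coefficients. \<open>D_filt\<close> has them on the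
  left; \<open>diffop_endo\<close> and \<open>ord_le_diffop\<close> show that the two filtrations
  coincide.\<close>

inductive ord_le :: "nat => 'm germ endo => bool" where
  monom: "m \<in> mi_le k ==> ord_le k (dmon m * mop b)"
| add: "ord_le k P ==> ord_le k Q ==> ord_le k (P + Q)"

lemma ord_le_mop [simp]: "ord_le k (mop b)"
  using ord_le.monom[of "%_. 0" k b] by (simp add: mi_le_def)

lemma ord_le_0 [simp]: "ord_le k 0" and ord_le_1 [simp]: "ord_le k 1"
  using ord_le_mop[of k 0] ord_le_mop[of k 1] by simp_all

lemma ord_le_sum: "(!!i. i \<in> S ==> ord_le k (f i)) ==> ord_le k (\<Sum>i\<in>S. f i)"
  by (induction S rule: infinite_finite_induct) (auto intro: ord_le.add)

lemma ord_le_mono: "ord_le k P ==> k \<le> l ==> ord_le l P"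
proof (induction rule: ord_le.induct)
  case (monom m k b)
  thus ?case using mi_le_mono by (intro ord_le.monom) blast
qed (auto intro: ord_le.add)

lemma ord_le_mop_right: "ord_le k P ==> ord_le k (P * mop a)"
proof (induction rule: ord_le.induct)
  case (monom m k b)
  thus ?case using ord_le.monom[of m k "b * a"] by (simp add: mop_mult mult.assoc)
qed (auto intro: ord_le.add simp: algebra_simps)

lemma ord_le_uminus: "ord_le k P ==> ord_le k (- P)"
  using ord_le_mop_right[of k P "- 1"] by (simp add: mop_minus)

lemma ord_le_diff: "ord_le k P ==> ord_le k Q ==> ord_le k (P - Q)"
  using ord_le.add[of k P "- Q"] ord_le_uminus by simp

lemma ord_le_deriv_op_left: "ord_le k P ==> ord_le (Suc k) (deriv_op i * P)"
proof (induction rule: ord_le.induct)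
  case (monom m k b)
  hence "m(i := Suc (m i)) \<in> mi_le (Suc k)" by (simp only: mi_le_incr)
  from ord_le.monom[OF this, of b] show ?case by (simp add: dmon_incr mult.assoc)
qed (auto intro: ord_le.add simp: algebra_simps)

text \<open>A function moves past a derivative by a \<partial>_j = \<partial>_j a - \<delta>_j(a),
  where the correction has lower order. The induction needs all functions a at once because
  \<delta>_j(a) takes the place of a.\<close>

lemma ord_le_mop_left: "ord_le k P ==> ord_le k (mop a * P)"
proof (induction rule: ord_le.induct)
  case (monom m k b)
  have "ord_le (sum m UNIV) (mop a * (dmon m * mop b))" for a
  proof (induction m arbitrary: a rule: multi_index_induct)
    case zero
    show ?case by (simp flip: mop_mult)
  next
    case (incr m j)
    have "mop a * (dmon (m(j := Suc (m j))) * mop b) =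
      deriv_op j * (mop a * (dmon m * mop b)) - mop (\<delta> j a) * (dmon m * mop b)"
      unfolding dmon_incr mult.assoc[symmetric] deriv_op_mop by (simp add: algebra_simps)
    moreover have "ord_le (Suc (sum m UNIV)) (mop (\<delta> j a) * (dmon m * mop b))"
      using ord_le_mono[OF incr] by simp
    ultimately show ?case unfolding sum_incr by (simp only: ord_le_diff ord_le_deriv_op_left[OF incr])
  qed
  thus ?case using ord_le_mono monom by (auto simp: mi_le_def)
qed (auto intro: ord_le.add simp: algebra_simps)

definition normal_form :: "nat => (('m => nat) => 'm germ) => 'm germ endo" where
  "normal_form k F = (\<Sum>m\<in>mi_le k. dmon m * mop (F m))"

lemma normal_form_add: "normal_form k (%m. F m + G m) = normal_form k F + normal_form k G"
  by (simp add: normal_form_def mop_add algebra_simps sum.distrib)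

lemma normal_form_diff: "normal_form k (%m. F m - G m) = normal_form k F - normal_form k G"
  by (simp add: normal_form_def mop_diff algebra_simps sum_subtractf)

lemma normal_form_single: "m \<in> mi_le k ==> normal_form k (%m'. if m' = m then b else 0) = dmon m * mop b"
  by (simp add: normal_form_def if_distrib[of mop] if_distrib[of "(*) _"] cong: if_cong)

lemma ord_le_normal_form: "ord_le k P \<longleftrightarrow> (\<exists>F. P = normal_form k F)"
proof
  assume "ord_le k P"
  thus "\<exists>F. P = normal_form k F"
  proof (induction rule: ord_le.induct)
    case (monom m k b)
    thus ?case using normal_form_single by metis
  next
    case (add k P Q)
    thus ?case using normal_form_add by metis
  qed
next
  assume "\<exists>F. P = normal_form k F"
  thus "ord_le k P" unfolding normal_form_def by (auto intro!: ord_le_sum ord_le.monom)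
qed

text \<open>Uniqueness by induction on the order, taking commutators with the coordinates.\<close>
lemma normal_form_eq_0:
  assumes "normal_form k F = 0" "m \<in> mi_le k"
  shows "F m = 0" using assms
proof (induction k arbitrary: F m)
  case 0
  have "mi_le 0 = {(%_. 0) :: 'm => nat}" by (auto simp: mi_le_def)
  thus ?case using 0 by (simp add: normal_form_def)
next
  case (Suc k)
  have *: "F (m(i := Suc (m i))) = 0" if "m \<in> mi_le k" for m i
  proof -
    let ?up = "%m :: 'm => nat. m(i := Suc (m i))" and ?dn = "%m :: 'm => nat. m(i := m i - 1)"
    \<comment> \<open>Commuting with x_i lowers the order by one and multiplies the coefficient of
      index m by m_i; the commutator of the zero operator is zero, so the induction hypothesis
      applies to it.\<close>
    have "normal_form (Suc k) F * mop (x i) - mop (x i) * normal_form (Suc k) F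
        = (\<Sum>m\<in>mi_le (Suc k). of_nat (m i) * dmon (?dn m) * mop (F m))"
    proof -
      have "dmon m * mop (F m) * mop (x i) - mop (x i) * (dmon m * mop (F m))
          = of_nat (m i) * dmon (?dn m) * mop (F m)" for m
      proof -
        have "dmon m * mop (F m) * mop (x i) - mop (x i) * (dmon m * mop (F m))
          = (dmon m * mop (x i) - mop (x i) * dmon m) * mop (F m)"
          by (simp only: mult.assoc mop_commute[of "F m" "x i"] left_diff_distrib)
        thus ?thesis unfolding dmon_x by simp
      qed
      thus ?thesis by (simp add: normal_form_def sum_distrib_left sum_distrib_right flip: sum_subtractf)
    qed
    also have "\<dots> = (\<Sum>m\<in>?up ` mi_le k. of_nat (m i) * dmon (?dn m) * mop (F m))"
    proof (rule sum.mono_neutral_right)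
      show "\<forall>m\<in>mi_le (Suc k) - ?up ` mi_le k. of_nat (m i) * dmon (?dn m) * mop (F m) = 0"
      proof
        fix m :: "'m => nat" assume m: "m \<in> mi_le (Suc k) - ?up ` mi_le k"
        have "m i = 0"
        proof (rule ccontr)
          assume "m i ~= 0"
          hence eq: "m = ?up (?dn m)" by auto
          have "?up (?dn m) \<in> mi_le (Suc k)" unfolding eq[symmetric] using m by (rule DiffD1)
          hence "?up (?dn m) \<in> ?up ` mi_le k" by (intro imageI) (rule mi_le_incr[THEN iffD1])
          hence "m \<in> ?up ` mi_le k" unfolding eq[symmetric] .
          thus False using m by blast
        qed
        thus "of_nat (m i) * dmon (?dn m) * mop (F m) = 0" by simp
      qed
    qed (use mi_le_incr in auto)
    also have "\<dots> = (\<Sum>m\<in>mi_le k. of_nat (Suc (m i)) * dmon m * mop (F (?up m)))"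
    proof (subst sum.reindex)
      show "inj_on ?up (mi_le k)"
      proof (rule inj_onI, rule ext)
        fix m m' :: "'m => nat" and j assume "?up m = ?up m'"
        from fun_cong[OF this, of j] show "m j = m' j" by (cases "j = i") simp_all
      qed
    qed (simp add: fun_upd_idem)
    also have "\<dots> = normal_form k (%m. of_nat (Suc (m i)) * F (?up m))"
      unfolding normal_form_def mop_mult mop_of_nat
      by (rule sum.cong) (auto simp del: of_nat_Suc simp: mult.assoc mult_of_nat_commute)
    finally have "normal_form k (%m. of_nat (Suc (m i)) * F (?up m)) = 0" using Suc.prems by simp
    hence "of_nat (Suc (m i)) * F (?up m) = 0" by (rule Suc.IH[OF _ that])
    thus ?thesis by (simp only: mult_eq_0_iff germ_of_nat_eq_0_iff) simp
  qed
  have ne: "F m = 0" if "m \<in> mi_le (Suc k)" "m ~= (%_. 0)" for m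
  proof -
    have "\<exists>i. m i ~= 0" using that(2) by auto
    then obtain i where "m i ~= 0" by blast
    hence eq: "m = (m(i := m i - 1))(i := Suc ((m(i := m i - 1)) i))" by auto
    have "(m(i := m i - 1))(i := Suc ((m(i := m i - 1)) i)) \<in> mi_le (Suc k)"
      unfolding eq[symmetric] by (rule that(1))
    from *[OF mi_le_incr[THEN iffD1, OF this], of i] show ?thesis unfolding eq[symmetric] .
  qed
  have 0: "(%_. 0) \<in> mi_le (Suc k)" by (simp add: mi_le_def)
  \<comment> \<open>Only multiplication by the coefficient of index 0 is left, and its value at 1 is
    that coefficient.\<close>
  have "normal_form (Suc k) F = (\<Sum>m\<in>{%_. 0}. dmon m * mop (F m))"
    unfolding normal_form_def by (rule sum.mono_neutral_right) (use ne 0 in auto)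
  hence "F (%_. 0) = 0" using Suc.prems(1) by simp
  thus ?case using ne Suc.prems(2) by blast
qed

definition coef :: "nat => 'm germ endo => ('m => nat) => 'm germ" where
  "coef k P = (SOME F. P = normal_form k F)"

lemma normal_form_coef: "ord_le k P ==> normal_form k (coef k P) = P"
  unfolding coef_def ord_le_normal_form by (metis (mono_tags, lifting) someI_ex)

lemma coef_normal_form:
  assumes "m \<in> mi_le k" shows "coef k (normal_form k F) m = F m"
proof -
  have "normal_form k (coef k (normal_form k F)) = normal_form k F"
    by (rule normal_form_coef) (auto simp: ord_le_normal_form)
  hence "normal_form k (%m. coef k (normal_form k F) m - F m) = 0" by (simp add: normal_form_diff)
  from normal_form_eq_0[OF this assms] show ?thesis by simp
qed

end

hide_const (open) module.smult up_ring.coeff Polynomials.degree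

subsection \<open>Polynomials with constant coefficients\<close>

abbreviation gpoly :: "complex poly => 'm::finite germ poly" where
  "gpoly \<equiv> map_poly germ_const"

lemma coeff_gpoly [simp]: "coeff (gpoly p) n = germ_const (coeff p n)" by (simp add: coeff_map_poly)

lemma gpoly_1 [simp]: "gpoly 1 = 1" by simp

lemma gpoly_pCons: "gpoly (pCons c p) = pCons (germ_const c) (gpoly p)"
  by (rule map_poly_pCons) simp

lemma gpoly_add: "gpoly (p + q) = gpoly p + gpoly q"
  by (rule poly_eqI) (simp add: germ_const_add)

lemma gpoly_minus: "gpoly (- p) = - gpoly p" by (rule poly_eqI) (simp add: germ_const_minus)

lemma gpoly_diff: "gpoly (p - q) = gpoly p - gpoly q"
  using gpoly_add[of p "- q"] by (simp add: gpoly_minus)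

lemma gpoly_smult: "gpoly (smult c p) = smult (germ_const c) (gpoly p)"
  by (rule poly_eqI) (simp add: germ_const_mult)

lemma gpoly_mult: "gpoly (p * q) = gpoly p * gpoly q"
  by (induction p) (simp_all add: gpoly_pCons gpoly_add gpoly_smult)

lemma gpoly_eq_0_iff [simp]: "gpoly p = 0 \<longleftrightarrow> p = 0" by (simp add: poly_eq_iff)

lemma degree_gpoly [simp]: "degree (gpoly p) = degree p" by (rule degree_map_poly) simp

lemma gpoly_dvd: "p dvd q ==> gpoly p dvd gpoly q" by (auto simp: dvd_def gpoly_mult)

text \<open>The ring of germs is not a field, so the Bezout identity is taken over the complex
  numbers and pushed forward. This is why the Bernstein polynomials are kept with complex
  coefficients.\<close>

lemma gpoly_coprime_dvd:
  assumes "coprime p q" "gpoly p dvd gpoly q * f"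
  shows "gpoly p dvd f"
proof -
  obtain u v where "u * p + v * q = 1"
    using bezout_coefficients_fst_snd[of p q] assms(1) by (metis coprime_imp_gcd_eq_1)
  hence "f = gpoly (u * p + v * q) * f" by simp
  also have "\<dots> = gpoly p * (gpoly u * f) + gpoly v * (gpoly q * f)"
    by (simp add: gpoly_add gpoly_mult algebra_simps)
  finally show ?thesis using assms(2) by (metis dvd_add dvd_mult dvd_triv_left)
qed

text \<open>I lists the branches of the divisor through the point and e their multiplicities. The
  chosen branch p supplies the field lifting t d/dt, namely its Euler field divided by e_p.\<close>

locale snc_coords = germ_coords x \<delta> \<rho>
  for x :: "'m::finite => 'm germ" and \<delta> \<rho> +
  fixes I :: "'m set" and e :: "'m => nat" and p :: 'm
  assumes p_in_I: "p \<in> I" and e_pos: "i \<in> I ==> e i \<ge> 1"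
begin

definition xmon :: "('m => nat) => 'm germ" where
  "xmon w = (\<Prod>i\<in>I. x i ^ w i)"

lemma x_neq_0: "x i ~= 0" using \<delta>_x[of i i] by auto

lemma xmon_neq_0: "xmon w ~= 0" by (simp add: xmon_def x_neq_0)

lemma xmon_add: "xmon (%i. v i + w i) = xmon v * xmon w"
  by (simp add: xmon_def power_add prod.distrib)

lemma xmon_0 [simp]: "xmon (%_. 0) = 1" by (simp add: xmon_def)

lemma xmon_cong: "(!!i. i \<in> I ==> v i = w i) ==> xmon v = xmon w"
  by (simp add: xmon_def)

lemma xmon_incr: "j \<in> I ==> xmon (w(j := Suc (w j))) = x j * xmon w"
  unfolding xmon_def by (simp add: prod.remove[of I j])

text \<open>The factors of the Bernstein polynomials: \<open>z\<^sub>i\<partial>\<^sub>i - k\<close> acts as \<open>e\<^sub>i s - k\<close>.\<close>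
definition lin_factor :: "'m => int => complex poly" where
  "lin_factor i k = [:- of_int k, of_nat (e i):]"

definition bernstein :: "('m => nat) => ('m => nat) => complex poly" where
  "bernstein a m = (\<Prod>i\<in>I. \<Prod>l<m i. lin_factor i (int (a i) - 1 - int l))"

lemma bernstein_cong: "(!!i. i \<in> I ==> a i = a' i \<and> m i = m' i) ==> bernstein a m = bernstein a' m'"
  by (simp add: bernstein_def)

lemma lin_factor_neq_0: "i \<in> I ==> lin_factor i k ~= 0" using e_pos[of i] by (simp add: lin_factor_def)

lemma bernstein_neq_0: "bernstein a m ~= 0" by (simp add: bernstein_def lin_factor_neq_0)

lemma degree_bernstein: "degree (bernstein a m) = sum m I"
proof -
  have "degree (lin_factor i k) = 1" if "i \<in> I" for i k using e_pos[OF that] by (simp add: lin_factor_def)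
  thus ?thesis unfolding bernstein_def by (subst degree_prod_eq_sum_degree)
      (auto simp: lin_factor_neq_0 degree_prod_eq_sum_degree)
qed

text \<open>A further derivative appends a factor at the lower end of the range of k, while raising
  \<open>a j\<close> together with \<open>m j\<close> appends one at the upper end. Comparing the
  two is the recursion behind \<open>tpoly_monom\<close>.\<close>

lemma bernstein_incr:
  assumes "j \<in> I"
  shows "bernstein a (m(j := Suc (m j))) = bernstein a m * lin_factor j (int (a j) - 1 - int (m j))"
    and "bernstein (a(j := Suc (a j))) (m(j := Suc (m j))) = bernstein a m * lin_factor j (int (a j))"
proof -
  have fin: "finite I" by simp
  show "bernstein a (m(j := Suc (m j))) = bernstein a m * lin_factor j (int (a j) - 1 - int (m j))"
    unfolding bernstein_def by (simp add: prod.remove[OF fin assms])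
  show "bernstein (a(j := Suc (a j))) (m(j := Suc (m j))) = bernstein a m * lin_factor j (int (a j))"
    unfolding bernstein_def
    by (simp add: prod.remove[OF fin assms] prod.lessThan_Suc_shift del: prod.lessThan_Suc)
       (simp add: algebra_simps)
qed

definition supp_I :: "('m => nat) => bool" where
  "supp_I m \<longleftrightarrow> (\<forall>j. j \<notin> I \<longrightarrow> m j = 0)"

text \<open>The image of \<open>P\<close> under the right action on the multivalued form
  \<open>\<omega> = \<Prod>\<^sub>i z\<^sub>i\<^bsup>-e\<^sub>is-1\<^esup> dz\<close>, divided by \<open>\<omega>\<close> and multiplied by \<open>\<Prod>\<^sub>i z\<^sub>i\<^bsup>N\<^esup>\<close> to clear poles.\<close>
definition tpoly :: "nat => 'm germ endo => 'm germ poly" where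
  "tpoly N P = (\<Sum>m | m \<in> mi_le N \<and> supp_I m.
     smult (xmon (%i. N - m i) * coef N P m) (gpoly (bernstein (%_. 0) m)))"

lemma coef_add:
  assumes "ord_le N P" "ord_le N Q" "m \<in> mi_le N"
  shows "coef N (P + Q) m = coef N P m + coef N Q m"
proof -
  have "P + Q = normal_form N (%m. coef N P m + coef N Q m)"
    using assms by (simp add: normal_form_add normal_form_coef)
  thus ?thesis using coef_normal_form[OF assms(3)] by metis
qed

lemma tpoly_add:
  assumes "ord_le N P" "ord_le N Q"
  shows "tpoly N (P + Q) = tpoly N P + tpoly N Q"
  unfolding tpoly_def sum.distrib[symmetric]
  by (rule sum.cong) (auto simp: coef_add[OF assms] algebra_simps smult_add_left)

lemma tpoly_0 [simp]: "tpoly N 0 = 0"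
proof -
  have "tpoly N 0 + tpoly N 0 = tpoly N 0 + 0" using tpoly_add[of N 0 0] by simp
  thus ?thesis by (simp only: add_left_cancel)
qed

lemma tpoly_sum:
  "(!!i. i \<in> S ==> ord_le N (f i)) ==> tpoly N (\<Sum>i\<in>S. f i) = (\<Sum>i\<in>S. tpoly N (f i))"
  by (induction S rule: infinite_finite_induct) (simp_all add: tpoly_add ord_le_sum)

lemma tpoly_minus: "ord_le N P ==> tpoly N (- P) = - tpoly N P"
  using tpoly_add[of N P "- P"] ord_le_uminus[of N P] by (simp add: add_eq_0_iff)

lemma tpoly_diff:
  "ord_le N P ==> ord_le N Q ==> tpoly N (P - Q) = tpoly N P - tpoly N Q"
  using tpoly_add[of N P "- Q"] ord_le_uminus[of N Q] by (simp add: tpoly_minus)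

lemma tpoly_dmon:
  assumes "m \<in> mi_le N"
  shows "tpoly N (dmon m * mop b) =
    (if supp_I m then smult (xmon (%i. N - m i) * b) (gpoly (bernstein (%_. 0) m)) else 0)"
proof -
  have "coef N (dmon m * mop b) m' = (if m' = m then b else 0)" if "m' \<in> mi_le N" for m'
    using coef_normal_form[OF that, of "%m'. if m' = m then b else 0"] normal_form_single[OF assms] by metis
  hence "tpoly N (dmon m * mop b) = (\<Sum>m' | m' \<in> mi_le N \<and> supp_I m'.
     if m' = m then smult (xmon (%i. N - m i) * b) (gpoly (bernstein (%_. 0) m)) else 0)"
    unfolding tpoly_def by (intro sum.cong) auto
  also have "\<dots> = (if supp_I m then smult (xmon (%i. N - m i) * b) (gpoly (bernstein (%_. 0) m)) else 0)"
    using assms by (subst sum.delta) auto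
  finally show ?thesis .
qed

lemma tpoly_mop:
  assumes "ord_le k P" "k \<le> N"
  shows "tpoly N (P * mop b) = smult b (tpoly N P)" using assms
proof (induction rule: ord_le.induct)
  case (monom m k c)
  hence m: "m \<in> mi_le N" using mi_le_mono by blast
  show ?case using tpoly_dmon[OF m, of c] tpoly_dmon[OF m, of "c * b"]
    by (simp add: mop_mult mult.assoc) (simp add: algebra_simps)
next
  case (add k P Q)
  have o: "ord_le N P" "ord_le N Q" using add ord_le_mono by auto
  show ?case using add by (simp add: distrib_right tpoly_add o ord_le_mop_right smult_add_right)
qed

text \<open>Multiplying the form by x^a shifts its exponents, so \<partial>^m yields the same
  factors shifted by a. The induction runs over a and uses x_j \<partial>^m = \<partial>^m x_j - m_j
  \<partial>^(m - 1_j), because it is functions on the right whose effect on the transform is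
  known.\<close>

lemma tpoly_monom:
  assumes "m \<in> mi_le N" "supp_I m"
  shows "tpoly N (mop (xmon a) * dmon m) =
    smult (xmon (%i. a i + N - m i)) (gpoly (bernstein a m))" using assms
proof (induction a arbitrary: m rule: multi_index_induct)
  case zero
  thus ?case using tpoly_dmon[of m N 1] by simp
next
  case (incr a j)
  show "tpoly N (mop (xmon (a(j := Suc (a j)))) * dmon m) =
    smult (xmon (%i. (a(j := Suc (a j))) i + N - m i)) (gpoly (bernstein (a(j := Suc (a j))) m))"
  proof (cases "j \<in> I")
    case False
    have "xmon (a(j := Suc (a j))) = xmon a"
      "xmon (%i. (a(j := Suc (a j))) i + N - m i) = xmon (%i. a i + N - m i)"
      "bernstein (a(j := Suc (a j))) m = bernstein a m"
      using False by (auto intro!: xmon_cong bernstein_cong)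
    thus ?thesis using incr.IH[OF incr.prems] by metis
  next
    case j: True
    let ?m' = "m(j := m j - 1)" and ?a' = "a(j := Suc (a j))"
    have mN: "m i \<le> N" for i using mi_le_component[OF incr.prems(1)] .
    have m': "?m' \<in> mi_le N" "supp_I ?m'"
    proof -
      have "sum ?m' UNIV \<le> sum m UNIV" by (rule sum_mono) simp
      thus "?m' \<in> mi_le N" using incr.prems(1) by (simp add: mi_le_def)
      show "supp_I ?m'" using incr.prems(2) by (auto simp: supp_I_def)
    qed
    have o: "ord_le N (mop (xmon a) * dmon m)"
      "ord_le N (mop (xmon a) * dmon ?m')"
      using ord_le_mop_left[OF ord_le.monom[OF incr.prems(1), of 1], of "xmon a"]
        ord_le_mop_left[OF ord_le.monom[OF m'(1), of 1], of "xmon a"] by simp_all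
    have "mop (xmon ?a') * dmon m = mop (xmon a) * (mop (x j) * dmon m)"
      by (simp only: xmon_incr[OF j] mop_mult mop_commute[of "x j"] mult.assoc)
    also have "mop (x j) * dmon m = dmon m * mop (x j) - dmon ?m' * mop (of_nat (m j))"
      by (simp only: dmon_x mop_of_nat mult_of_nat_commute[symmetric]) simp
    finally have "mop (xmon ?a') * dmon m =
        mop (xmon a) * dmon m * mop (x j) -
        mop (xmon a) * dmon ?m' * mop (of_nat (m j))"
      by (simp only: right_diff_distrib mult.assoc)
    hence eq: "tpoly N (mop (xmon ?a') * dmon m) =
        smult (x j * xmon (%i. a i + N - m i)) (gpoly (bernstein a m)) -
        smult (of_nat (m j) * xmon (%i. a i + N - ?m' i)) (gpoly (bernstein a ?m'))"
      by (simp only: tpoly_diff ord_le_mop_right o tpoly_mop[OF o(1) order_refl]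
          tpoly_mop[OF o(2) order_refl] incr.IH[OF incr.prems] incr.IH[OF m'] smult_smult)
    have c1: "x j * xmon (%i. a i + N - m i) = xmon (%i. ?a' i + N - m i)"
    proof -
      have "(%i. ?a' i + N - m i) = (%i. a i + N - m i)(j := Suc (a j + N - m j))"
        using mN[of j] by (auto simp: fun_eq_iff)
      thus ?thesis using xmon_incr[OF j, of "%i. a i + N - m i"] by metis
    qed
    show ?thesis
    proof (cases "m j")
      case 0
      have "bernstein ?a' m = bernstein a m" unfolding bernstein_def by (rule prod.cong) (auto simp: 0)
      thus ?thesis using eq c1 0 by simp
    next
      case (Suc g)
      have c2: "xmon (%i. a i + N - ?m' i) = xmon (%i. ?a' i + N - m i)"
        using mN[of j] Suc by (intro xmon_cong) auto
      have meq: "m = ?m'(j := Suc (?m' j))" using Suc by auto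
      have b1: "bernstein a m = bernstein a ?m' * lin_factor j (int (a j) - 1 - int g)"
        using bernstein_incr(1)[OF j, of a ?m'] unfolding meq[symmetric] by (simp add: Suc)
      have b2: "bernstein ?a' m = bernstein a ?m' * lin_factor j (int (a j))"
        using bernstein_incr(2)[OF j, of a ?m'] unfolding meq[symmetric] .
      \<comment> \<open>With m_j = g + 1 the remaining factor is (e_j s - (a_j - 1 - g)) - (g + 1) =
        e_j s - a_j, the one that \<open>?a'\<close> adds at the top.\<close>
      have "bernstein a m - smult (of_nat (m j)) (bernstein a ?m') = bernstein ?a' m"
        unfolding b1 b2 by (simp add: Suc lin_factor_def algebra_simps) (simp flip: smult_add_left add: algebra_simps)
      hence b3: "gpoly (bernstein ?a' m) = gpoly (bernstein a m) - smult (of_nat (m j)) (gpoly (bernstein a ?m'))"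
        by (metis gpoly_diff gpoly_smult germ_of_nat)
      show ?thesis unfolding eq c1 c2 b3 smult_diff_right smult_smult by (simp only: mult.commute)
    qed
  qed
qed

text \<open>The coefficient of the form does not involve x_j for j outside I, so \<partial>_j kills
  it; in the normal form this shows as an index not supported on I.\<close>

lemma tpoly_deriv_op:
  assumes "ord_le k P" "Suc k \<le> N" "j \<notin> I"
  shows "tpoly N (deriv_op j * P) = 0" using assms(1,2)
proof (induction rule: ord_le.induct)
  case (monom m k b)
  hence m: "m(j := Suc (m j)) \<in> mi_le N" using mi_le_mono mi_le_incr by blast
  have "\<not> supp_I (m(j := Suc (m j)))" using assms(3) by (auto simp: supp_I_def)
  thus ?case using tpoly_dmon[OF m, of b] by (simp only: dmon_incr mult.assoc if_False)
next
  case (add k P Q)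
  have o: "ord_le N (deriv_op j * P)" "ord_le N (deriv_op j * Q)"
    using ord_le_mono[OF ord_le_deriv_op_left] add by auto
  show ?case using add by (simp add: distrib_left tpoly_add o)
qed

definition euler_op :: "'m => 'm germ endo" where
  "euler_op i = mop (x i) * deriv_op i"

lemma ord_le_euler_op: "ord_le k P ==> ord_le (Suc k) (euler_op i * P)"
  by (simp add: euler_op_def mult.assoc ord_le_mop_left ord_le_deriv_op_left)

text \<open>On a monomial, x_i \<partial>_i \<partial>^m is x_i \<partial>^(m + 1_i), the case a =
  1_i of \<open>tpoly_monom\<close>; the new top factor is e_i s - 0.\<close>

lemma tpoly_euler_op:
  assumes "ord_le k P" "Suc k \<le> N" "i \<in> I"
  shows "tpoly N (euler_op i * P) = gpoly [:0, of_nat (e i):] * tpoly N P" using assms(1,2)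
proof (induction rule: ord_le.induct)
  case (monom m k b)
  let ?m' = "m(i := Suc (m i))" and ?a = "(%_. 0 :: nat)(i := Suc 0)"
  have m': "?m' \<in> mi_le N" using monom mi_le_mono mi_le_incr by blast
  have m: "m \<in> mi_le N" using monom mi_le_mono[of k N] by auto
  have a: "xmon ?a = x i" using xmon_incr[OF assms(3), of "%_. 0"] by simp
  have eq: "euler_op i * (dmon m * mop b) = mop (x i) * dmon ?m' * mop b"
    by (simp only: euler_op_def dmon_incr mult.assoc)
  have o: "ord_le N (mop (x i) * dmon ?m')"
    using ord_le_mop_left[OF ord_le.monom[OF m', of 1], of "x i"] by simp
  show ?case
  proof (cases "supp_I m")
    case True
    hence s: "supp_I ?m'" using assms(3) by (auto simp: supp_I_def)
    have lf0: "lin_factor i 0 = [:0, of_nat (e i):]" by (simp add: lin_factor_def)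
    have "xmon (%k. ?a k + N - ?m' k) = xmon (%k. N - m k)" by (intro xmon_cong) auto
    moreover have "bernstein ?a ?m' = bernstein (%_. 0) m * lin_factor i 0"
      using bernstein_incr(2)[OF assms(3), of "%_. 0" m] by simp
    ultimately have "tpoly N (mop (x i) * dmon ?m') =
        smult (xmon (%k. N - m k)) (gpoly (bernstein (%_. 0) m * lin_factor i 0))"
      using tpoly_monom[OF m' s, of ?a] a by metis
    thus ?thesis unfolding eq tpoly_mop[OF o order_refl] tpoly_dmon[OF m]
      using True by (simp only: gpoly_mult lf0 smult_smult mult_smult_right if_True mult.commute[of b]
          mult.commute[of "gpoly (bernstein (%_. 0) m)"])
  next
    case False
    then obtain j where j: "j \<notin> I" "m j ~= 0" by (auto simp: supp_I_def)
    let ?g = "?m'(j := ?m' j - 1)"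
    have ij: "i ~= j" using j assms(3) by blast
    have geq: "?m' = ?g(j := Suc (?g j))" using j ij by (auto simp: fun_eq_iff)
    have "?g(j := Suc (?g j)) \<in> mi_le (Suc k)" unfolding geq[symmetric] using monom(1) mi_le_incr by blast
    hence g: "?g \<in> mi_le k" by (rule mi_le_incr[THEN iffD1])
    \<comment> \<open>A derivative outside I can be pulled to the front past x_i, where the
      transform kills it.\<close>
    have c: "mop (x i) * deriv_op j = deriv_op j * mop (x i)"
      using ij by (simp add: deriv_op_mop \<delta>_x)
    have "dmon ?m' = deriv_op j * dmon ?g"
      using dmon_incr[of ?g j] unfolding geq[symmetric] .
    hence "mop (x i) * dmon ?m' * mop b = deriv_op j * (mop (x i) * (dmon ?g * mop b))"
      by (simp only: mult.assoc[symmetric] c)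
    hence "tpoly N (mop (x i) * dmon ?m' * mop b) = 0"
      using tpoly_deriv_op[OF ord_le_mop_left[OF ord_le.monom[OF g]] monom(2) j(1)] by metis
    thus ?thesis using False tpoly_dmon[OF m, of b] by (simp add: eq)
  qed
next
  case (add k P Q)
  have o: "ord_le N (euler_op i * P)" "ord_le N (euler_op i * Q)" "ord_le N P" "ord_le N Q"
    using ord_le_mono[OF ord_le_euler_op] add ord_le_mono by auto
  show ?case using add by (simp add: distrib_left tpoly_add o)
qed

end

subsection \<open>Decomposition of germs by exponents\<close>

context germ_coords
begin

lemma x_nonzero: "x i ~= 0" using \<delta>_x[of i i] by auto

lemma \<rho>_0 [simp]: "\<rho> i 0 = 0" and \<rho>_1 [simp]: "\<rho> i 1 = 1" using \<rho>_const[of i 0] \<rho>_const[of i 1] by simp_all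

lemma \<rho>_power: "\<rho> i (a ^ n) = \<rho> i a ^ n" by (induction n) (simp_all add: \<rho>_mult)

lemma \<rho>_prod: "\<rho> i (\<Prod>j\<in>S. f j) = (\<Prod>j\<in>S. \<rho> i (f j))"
  by (induction S rule: infinite_finite_induct) (simp_all add: \<rho>_mult)

definition x_quot :: "'m => 'm germ => 'm germ" where
  "x_quot i a = (SOME b. a - \<rho> i a = x i * b)"

lemma x_quot: "a = \<rho> i a + x i * x_quot i a"
proof -
  have "\<exists>b. a - \<rho> i a = x i * b" using x_dvd by (metis dvd_def)
  hence "a - \<rho> i a = x i * x_quot i a" unfolding x_quot_def by (rule someI_ex)
  thus ?thesis by (simp add: algebra_simps)
qed

lemma x_quot_eqI: "a = \<rho> i a + x i * b ==> x_quot i a = b"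
  using x_quot[of a i] x_nonzero[of i] by (metis add_left_cancel mult_left_cancel)

lemma \<rho>_x_mult [simp]: "\<rho> i (x i * a) = 0" by (simp add: \<rho>_mult \<rho>_x)

lemma \<rho>_idem [simp]: "\<rho> i (\<rho> i a) = \<rho> i a" using arg_cong[OF x_quot[of a i], of "\<rho> i"] by (simp add: \<rho>_add)

lemma x_quot_add: "x_quot i (a + b) = x_quot i a + x_quot i b"
  by (rule x_quot_eqI, subst (1) x_quot[of a i], subst (1) x_quot[of b i]) (simp add: \<rho>_add algebra_simps)

lemma x_quot_x [simp]: "x_quot i (x i * a) = a" by (rule x_quot_eqI) simp

lemma x_quot_\<rho> [simp]: "x_quot i (\<rho> i a) = 0" by (rule x_quot_eqI) simp

lemma x_quot_0 [simp]: "x_quot i 0 = 0" by (rule x_quot_eqI) simp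

lemma x_quot_mult: "\<rho> i u = u ==> x_quot i (u * a) = u * x_quot i a"
  by (rule x_quot_eqI, subst (1) x_quot[of a i]) (simp add: \<rho>_mult algebra_simps)

lemma x_quot_\<rho>_commute:
  assumes "i ~= j" shows "x_quot i (\<rho> j a) = \<rho> j (x_quot i a)"
  using arg_cong[OF x_quot[of a i], of "\<rho> j"] assms
  by (intro x_quot_eqI) (simp add: \<rho>_add \<rho>_mult \<rho>_x \<rho>_commute[of j i])

lemma x_quot_commute:
  assumes "i ~= j" shows "x_quot i (x_quot j a) = x_quot j (x_quot i a)"
proof (rule x_quot_eqI)
  have "x_quot j a = x_quot j (\<rho> i a + x i * x_quot i a)" using x_quot[of a i] by simp
  also have "\<dots> = x_quot j (\<rho> i a) + x i * x_quot j (x_quot i a)"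
    using assms by (simp add: x_quot_add x_quot_mult \<rho>_x)
  finally show "x_quot j a = \<rho> i (x_quot j a) + x i * x_quot j (x_quot i a)"
    using assms by (simp add: x_quot_\<rho>_commute)
qed

text \<open>Taylor expansion in x_i cut off at M: for k < M the term of exponent k, for k = M the
  whole remainder divisible by x_i^M. The expansion is finite, so no convergence is involved, and
  its pieces are mutually annihilating projections.\<close>

definition axis_cell :: "'m => nat => nat => 'm germ => 'm germ" where
  "axis_cell i M k a = (if k < M then x i ^ k * \<rho> i ((x_quot i ^^ k) a) else x i ^ k * (x_quot i ^^ k) a)"

lemma x_quot_pow_add: "(x_quot i ^^ k) (a + b) = (x_quot i ^^ k) a + (x_quot i ^^ k) b"
  by (induction k) (simp_all add: x_quot_add)

lemma x_quot_pow_0 [simp]: "(x_quot i ^^ k) 0 = 0" by (induction k) simp_all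

lemma x_quot_pow_mult: "\<rho> i u = u ==> (x_quot i ^^ k) (u * a) = u * (x_quot i ^^ k) a"
  by (induction k) (simp_all add: x_quot_mult)

lemma x_quot_pow_x: "(x_quot i ^^ k) (x i ^ (k + l) * a) = x i ^ l * a"
proof (induction k arbitrary: a)
  case (Suc k)
  have "(x_quot i ^^ Suc k) (x i ^ (Suc k + l) * a) = x_quot i ((x_quot i ^^ k) (x i ^ (k + l) * (x i * a)))"
    by (simp add: algebra_simps)
  also have "\<dots> = x_quot i (x i * (x i ^ l * a))" unfolding Suc by (simp add: algebra_simps)
  finally show ?case by simp
qed simp

lemma x_quot_pow_\<rho>: "k > 0 ==> (x_quot i ^^ k) (\<rho> i a) = 0"
  by (cases k) (simp_all del: funpow.simps add: funpow_Suc_right)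

lemma x_quot_pow_\<rho>_commute: "i ~= j ==> (x_quot i ^^ k) (\<rho> j a) = \<rho> j ((x_quot i ^^ k) a)"
  by (induction k) (simp_all add: x_quot_\<rho>_commute)

lemma x_quot_pow_commute: "i ~= j ==> (x_quot i ^^ k) (x_quot j a) = x_quot j ((x_quot i ^^ k) a)"
  by (induction k) (simp_all add: x_quot_commute)

lemma axis_cell_add: "axis_cell i M k (a + b) = axis_cell i M k a + axis_cell i M k b"
  by (simp add: axis_cell_def x_quot_pow_add \<rho>_add algebra_simps)

lemma axis_cell_0 [simp]: "axis_cell i M k 0 = 0" by (simp add: axis_cell_def)

lemma axis_cell_mult: "\<rho> i u = u ==> axis_cell i M k (u * a) = u * axis_cell i M k a"
  by (simp add: axis_cell_def x_quot_pow_mult \<rho>_mult mult.left_commute)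

lemma axis_cell_sum: "(\<Sum>k\<le>M. axis_cell i M k a) = a"
proof -
  have "(\<Sum>k<M. x i ^ k * \<rho> i ((x_quot i ^^ k) a)) + x i ^ M * (x_quot i ^^ M) a = a"
  proof (induction M)
    case (Suc M)
    have "x i ^ M * (x_quot i ^^ M) a =
        x i ^ M * (\<rho> i ((x_quot i ^^ M) a) + x i * x_quot i ((x_quot i ^^ M) a))"
      by (subst x_quot[of "(x_quot i ^^ M) a" i]) simp
    thus ?case using Suc by (simp add: algebra_simps)
  qed simp
  thus ?thesis by (simp add: axis_cell_def lessThan_Suc_atMost[symmetric])
qed

lemma axis_cell_orth:
  assumes "k \<le> M" "l \<le> M"
  shows "axis_cell i M k (axis_cell i M l a) = (if k = l then axis_cell i M l a else 0)"
proof -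
  consider "k < l" | "k = l" | "l < k" by linarith
  thus ?thesis
  proof cases
    case 1
    then obtain d where d: "l = k + Suc d" using less_iff_Suc_add by auto
    have z: "\<rho> i ((x_quot i ^^ k) (x i ^ l * b)) = 0" for b unfolding d x_quot_pow_x by (simp add: mult.assoc)
    show ?thesis by (cases "l < M") (use 1 assms z in \<open>simp_all add: axis_cell_def\<close>)
  next
    case 2
    have "(x_quot i ^^ l) (x i ^ l * b) = b" for b using x_quot_pow_x[of l i 0 b] by simp
    thus ?thesis using 2 by (simp add: axis_cell_def)
  next
    case 3
    then obtain d where d: "k = Suc d + l" using less_iff_Suc_add[of l k] by (auto simp: add.commute)
    have z: "(x_quot i ^^ k) (x i ^ l * \<rho> i b) = 0" for b
    proof -
      have "(x_quot i ^^ k) (x i ^ l * \<rho> i b) = (x_quot i ^^ Suc d) ((x_quot i ^^ l) (x i ^ (l + 0) * \<rho> i b))"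
        unfolding d by (simp only: funpow_add comp_apply add_0_right)
      also have "\<dots> = 0" unfolding x_quot_pow_x power_0 mult_1 by (rule x_quot_pow_\<rho>) simp
      finally show ?thesis .
    qed
    show ?thesis by (cases "k < M") (use 3 assms z in \<open>simp_all add: axis_cell_def\<close>)
  qed
qed

lemma axis_cell_small:
  assumes "k < w" "w \<le> M" shows "axis_cell i M k (x i ^ w * a) = 0"
proof -
  obtain d where d: "w = k + Suc d" using assms less_iff_Suc_add by auto
  have "\<rho> i ((x_quot i ^^ k) (x i ^ (k + Suc d) * a)) = 0" unfolding x_quot_pow_x by (simp add: mult.assoc)
  thus ?thesis using assms unfolding d axis_cell_def by simp
qed

lemma axis_cell_dvd: "\<exists>b. axis_cell i M k a = x i ^ k * b" by (auto simp: axis_cell_def)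

text \<open>Division by x_i and restriction to x_i = 0 commute with those of another coordinate.
  Hence the order in which variables are treated is immaterial, and cells in several variables can
  be built one variable at a time.\<close>

lemma axis_cell_commute:
  assumes "i ~= j"
  shows "axis_cell i M k (axis_cell j M' l a) = axis_cell j M' l (axis_cell i M k a)"
proof -
  have \<rho>: "axis_cell i M k (\<rho> j a) = \<rho> j (axis_cell i M k a)" for a
    using assms by (simp add: axis_cell_def x_quot_pow_\<rho>_commute \<rho>_commute[of i j] \<rho>_mult \<rho>_power \<rho>_x)
  have q1: "axis_cell i M k (x_quot j a) = x_quot j (axis_cell i M k a)" for a
  proof -
    have u: "\<rho> j (x i ^ k) = x i ^ k" using assms by (simp add: \<rho>_power \<rho>_x)
    show ?thesis using assms
      by (simp add: axis_cell_def x_quot_pow_commute x_quot_mult[OF u] x_quot_\<rho>_commute)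
  qed
  have q: "axis_cell i M k ((x_quot j ^^ l) a) = (x_quot j ^^ l) (axis_cell i M k a)" for a l
    by (induction l) (simp_all add: q1)
  have u: "\<rho> i (x j ^ l) = x j ^ l" using assms by (simp add: \<rho>_power \<rho>_x)
  show ?thesis unfolding axis_cell_def[of j] by (simp add: axis_cell_mult[OF u] q \<rho>)
qed

primrec list_cell :: "('m => nat) => 'm list => ('m => nat) => 'm germ => 'm germ" where
  "list_cell M [] c a = a"
| "list_cell M (i # is) c a = axis_cell i (M i) (c i) (list_cell M is c a)"

lemma list_cell_add: "list_cell M is c (a + b) = list_cell M is c a + list_cell M is c b"
  by (induction "is") (simp_all add: axis_cell_add)

lemma list_cell_0 [simp]: "list_cell M is c 0 = 0" by (induction "is") simp_all

lemma list_cell_mult: "(!!i. i \<in> set is ==> \<rho> i u = u) ==> list_cell M is c (u * a) = u * list_cell M is c a"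
  by (induction "is") (simp_all add: axis_cell_mult)

lemma list_cell_cong: "(!!i. i \<in> set is ==> c i = c' i) ==> list_cell M is c a = list_cell M is c' a"
  by (induction "is") simp_all

lemma list_cell_axis_commute:
  "i \<notin> set is ==> list_cell M is c (axis_cell i K k a) = axis_cell i K k (list_cell M is c a)"
  by (induction "is") (auto simp: axis_cell_commute)

lemma axis_cell_sum_arg: "axis_cell i M k (\<Sum>s\<in>S. f s) = (\<Sum>s\<in>S. axis_cell i M k (f s))"
  by (induction S rule: infinite_finite_induct) (simp_all add: axis_cell_add)

lemma list_cell_sum:
  "distinct is ==> (\<Sum>c\<in>PiE (set is) (%i. {..M i}). list_cell M is c a) = a"
proof (induction "is")
  case (Cons i "is")
  have i: "i \<notin> set is" using Cons.prems by simp
  have "(\<Sum>c\<in>PiE (set (i # is)) (%i. {..M i}). list_cell M (i # is) c a) =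
      (\<Sum>(k, c)\<in>{..M i} \<times> PiE (set is) (%i. {..M i}). list_cell M (i # is) (c(i := k)) a)"
    unfolding list.set(2) PiE_insert_eq
    by (subst sum.reindex[OF inj_combinator[OF i]]) (simp add: case_prod_beta comp_def)
  also have "\<dots> = (\<Sum>(k, c)\<in>{..M i} \<times> PiE (set is) (%i. {..M i}). axis_cell i (M i) k (list_cell M is c a))"
  proof (rule sum.cong[OF refl], clarify)
    fix k c
    have "list_cell M is (c(i := k)) a = list_cell M is c a" by (rule list_cell_cong) (use i in auto)
    thus "list_cell M (i # is) (c(i := k)) a = axis_cell i (M i) k (list_cell M is c a)" by simp
  qed
  also have "\<dots> = (\<Sum>k\<le>M i. axis_cell i (M i) k (\<Sum>c\<in>PiE (set is) (%i. {..M i}). list_cell M is c a))"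
    by (simp add: axis_cell_sum_arg sum.cartesian_product)
  also have "\<dots> = a" using Cons by (simp add: axis_cell_sum)
  finally show ?case .
qed simp

lemma list_cell_orth:
  assumes "distinct is" "!!i. i \<in> set is ==> c i \<le> M i \<and> c' i \<le> M i"
  shows "list_cell M is c (list_cell M is c' a) = (if \<forall>i\<in>set is. c i = c' i then list_cell M is c a else 0)"
  using assms
proof (induction "is")
  case (Cons i "is")
  have "list_cell M (i # is) c (list_cell M (i # is) c' a) =
      axis_cell i (M i) (c i) (axis_cell i (M i) (c' i) (list_cell M is c (list_cell M is c' a)))"
    using Cons.prems by (simp add: list_cell_axis_commute)
  thus ?case using Cons by (auto simp: axis_cell_orth)
qed simp

lemma list_cell_dvd:
  assumes "distinct is"
  shows "\<exists>b. list_cell M is c a = (\<Prod>i\<in>set is. x i ^ c i) * b" using assms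
proof (induction "is")
  case (Cons i "is")
  then obtain b where b: "list_cell M is c a = (\<Prod>i\<in>set is. x i ^ c i) * b" by auto
  have "\<rho> i (\<Prod>i\<in>set is. x i ^ c i) = (\<Prod>i\<in>set is. x i ^ c i)"
    unfolding \<rho>_prod by (rule prod.cong) (use Cons.prems in \<open>auto simp: \<rho>_power \<rho>_x\<close>)
  from axis_cell_mult[OF this]
  have "list_cell M (i # is) c a = (\<Prod>i\<in>set is. x i ^ c i) * axis_cell i (M i) (c i) b" by (simp add: b)
  moreover obtain b' where "axis_cell i (M i) (c i) b = x i ^ c i * b'" using axis_cell_dvd by blast
  ultimately have "list_cell M (i # is) c a = (\<Prod>i\<in>set (i # is). x i ^ c i) * b'"
    using Cons.prems by (simp add: mult_ac)
  thus ?case by blast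
qed simp

lemma list_cell_small:
  assumes "distinct is" "i \<in> set is" "c i < w" "w \<le> M i"
  shows "list_cell M is c (x i ^ w * a) = 0" using assms
proof (induction "is")
  case (Cons j "is")
  show ?case
  proof (cases "i = j")
    case True
    have "list_cell M is c (x i ^ w * a) = x i ^ w * list_cell M is c a"
      by (rule list_cell_mult) (use Cons.prems True in \<open>auto simp: \<rho>_power \<rho>_x\<close>)
    thus ?thesis using True Cons.prems by (simp add: axis_cell_small)
  qed (use Cons in auto)
qed simp

end

context snc_coords
begin

definition cells :: "('m => nat) => ('m => nat) set" where
  "cells M = PiE I (%i. {..M i})"

abbreviation "I_vars \<equiv> SOME vs. distinct vs \<and> set vs = I"

text \<open>\<open>cell M c\<close> projects to the part of exponent \<open>c i\<close> (at least \<open>M i\<close>, if \<open>c i = M i\<close>) in each \<open>x i\<close>, \<open>i \<in> I\<close>.\<close>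
definition cell :: "('m => nat) => ('m => nat) => 'm germ => 'm germ" where
  "cell M = list_cell M I_vars"

lemma I_list: "distinct I_vars" "set I_vars = I"
proof -
  obtain vs where "distinct vs \<and> set vs = I" using finite_distinct_list[OF finite[of I]] by blast
  hence "distinct I_vars \<and> set I_vars = I"
    by (rule someI)
  thus "distinct I_vars" "set I_vars = I"
    by simp_all
qed

lemma finite_cells [simp]: "finite (cells M)" unfolding cells_def by (rule finite_PiE) auto

lemma cell_add: "cell M c (a + b) = cell M c a + cell M c b"
  and cell_0 [simp]: "cell M c 0 = 0"
  and cell_sum: "(\<Sum>c\<in>cells M. cell M c a) = a"
  and cell_const_mult: "cell M c (germ_const k * a) = germ_const k * cell M c a"
  using list_cell_sum[OF I_list(1), of M a]
  by (simp_all add: cell_def list_cell_add cells_def I_list(2) list_cell_mult)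

lemma cell_orth:
  assumes "c \<in> cells M" "c' \<in> cells M"
  shows "cell M c (cell M c' a) = (if c = c' then cell M c a else 0)"
proof -
  have "list_cell M I_vars c (list_cell M I_vars c' a) =
      (if \<forall>i\<in>set I_vars. c i = c' i
       then list_cell M I_vars c a else 0)"
    by (rule list_cell_orth[OF I_list(1)]) (use assms in \<open>auto simp: I_list(2) cells_def\<close>)
  moreover have "(\<forall>i\<in>I. c i = c' i) \<longleftrightarrow> c = c'" using PiE_ext[of c I _ c'] assms unfolding cells_def by blast
  ultimately show ?thesis unfolding cell_def I_list(2) by simp
qed

lemma cell_dvd: "\<exists>b. cell M c a = xmon c * b"
  using list_cell_dvd[OF I_list(1), of M c a] unfolding cell_def xmon_def I_list(2) .

text \<open>The bound \<open>w i \<le> M i\<close> excludes the last cell, which collects all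
  exponents from \<open>M i\<close> on and need not vanish on multiples of higher powers.\<close>

lemma cell_xmon_small:
  assumes "i \<in> I" "c i < w i" "w i \<le> M i"
  shows "cell M c (xmon w * a) = 0"
proof -
  have "xmon w * a = x i ^ w i * ((\<Prod>j\<in>I - {i}. x j ^ w j) * a)"
    unfolding xmon_def using assms(1) by (simp add: prod.remove[of I i] mult.assoc)
  moreover have "cell M c (x i ^ w i * b) = 0" for b
    unfolding cell_def by (rule list_cell_small[OF I_list(1)]) (use assms I_list(2) in auto)
  ultimately show ?thesis by metis
qed

abbreviation poly_cell :: "('m => nat) => ('m => nat) => 'm germ poly => 'm germ poly" where
  "poly_cell M c \<equiv> map_poly (cell M c)"

lemma coeff_poly_cell [simp]: "coeff (poly_cell M c f) n = cell M c (coeff f n)" by (simp add: coeff_map_poly)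

lemma poly_cell_add: "poly_cell M c (f + g) = poly_cell M c f + poly_cell M c g"
  by (rule poly_eqI) (simp add: cell_add)

lemma poly_cell_sum_arg: "poly_cell M c (\<Sum>s\<in>S. f s) = (\<Sum>s\<in>S. poly_cell M c (f s))"
  by (induction S rule: infinite_finite_induct) (simp_all add: poly_cell_add)

lemma cell_minus: "cell M c (- a) = - cell M c a" using cell_add[of M c a "- a"] by (simp add: add_eq_0_iff)

lemma poly_cell_diff: "poly_cell M c (f - g) = poly_cell M c f - poly_cell M c g"
  using cell_add[of M c _ "- _"] by (intro poly_eqI) (simp add: cell_minus)

lemma poly_cell_sum: "(\<Sum>c\<in>cells M. poly_cell M c f) = f" by (rule poly_eqI) (simp add: coeff_sum cell_sum)

text \<open>Cells are not linear over germs, but they commute with constants. Since Bernstein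
  polynomials have constant coefficients, divisibility by them can be tested on each cell
  separately.\<close>

lemma poly_cell_const_mult: "poly_cell M c (gpoly r * f) = gpoly r * poly_cell M c f"
proof -
  have s: "cell M c (\<Sum>i\<in>S. g i) = (\<Sum>i\<in>S. cell M c (g i))" for S and g :: "nat => 'm germ"
    by (induction S rule: infinite_finite_induct) (simp_all add: cell_add)
  show ?thesis by (rule poly_eqI) (simp add: coeff_mult s cell_const_mult)
qed

lemma poly_cell_smult_const: "poly_cell M c (smult a (gpoly r)) = smult (cell M c a) (gpoly r)"
  by (rule poly_eqI) (simp add: mult.commute[of _ "germ_const _"] cell_const_mult)

lemma poly_cell_orth:
  "c \<in> cells M ==> c' \<in> cells M ==> poly_cell M c (poly_cell M c' f) = (if c = c' then poly_cell M c f else 0)"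
  by (intro poly_eqI) (simp add: cell_orth)

lemma degree_poly_cell: "degree (poly_cell M c f) \<le> degree f" by (rule degree_le) (simp add: coeff_eq_0)

lemma poly_cell_dvd:
  shows "\<exists>g. poly_cell M c f = smult (xmon c) g"
proof -
  obtain b where b: "!!a. cell M c a = xmon c * b a" using cell_dvd by metis
  have b0: "b 0 = 0" using b[of 0] xmon_neq_0[of c] by simp
  have "poly_cell M c f = smult (xmon c) (map_poly b f)"
    by (rule poly_eqI) (simp add: coeff_map_poly[where f = b, OF b0] b)
  thus ?thesis by blast
qed

end

subsection \<open>The kernel of the transform\<close>

context snc_coords
begin

definition const_op :: "complex => 'm germ endo" where
  "const_op k = mop (germ_const k)"

lemma const_op_simps: "const_op 0 = 0" "const_op 1 = 1" "const_op (a + b) = const_op a + const_op b"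
    "const_op (a * b) = const_op a * const_op b" "const_op (- a) = - const_op a"
  by (simp_all add: const_op_def germ_const_add germ_const_mult germ_const_minus mop_add mop_mult mop_minus)

lemma \<delta>_const_mult: "\<delta> i (germ_const k * a) = germ_const k * \<delta> i a" by (simp add: \<delta>_mult)

lemma const_op_commute_endo: "const_op k * deriv_op i = deriv_op i * const_op k"
  "const_op k * mop a = mop a * const_op k" "const_op k * const_op l = const_op l * const_op k"
  by (simp_all add: const_op_def deriv_op_mop mop_commute)

lemma const_op_monom_commute: "const_op k * dmon m = dmon m * const_op k"
proof (induction m rule: multi_index_induct)
  case (incr m j)
  have "const_op k * (deriv_op j * dmon m) = deriv_op j * (const_op k * dmon m)"
    by (simp only: mult.assoc[symmetric] const_op_commute_endo)
  thus ?case by (simp only: dmon_incr incr mult.assoc)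
qed simp

lemma const_op_commute:
  assumes "ord_le n P" shows "const_op k * P = P * const_op k" using assms
proof (induction rule: ord_le.induct)
  case (monom m n b)
  have "const_op k * (dmon m * mop b) = dmon m * (const_op k * mop b)"
    by (simp only: mult.assoc[symmetric] const_op_monom_commute)
  thus ?case by (simp only: const_op_commute_endo mult.assoc)
qed (simp add: algebra_simps)

text \<open>The Euler field of branch p, normalized so that dt/t takes the value 1 on it; left
  multiplication by it will represent R.\<close>

definition s_op :: "'m germ endo" where
  "s_op = const_op (1 / of_nat (e p)) * euler_op p"

text \<open>Relative logarithmic vector fields, indexed so that \<open>E_op p = 0\<close>.\<close>
definition E_op :: "'m => 'm germ endo" where
  "E_op j = (if j \<in> I then euler_op j - const_op (of_nat (e j) / of_nat (e p)) * euler_op p else deriv_op j)"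

lemma ord_le_s_op_1: "ord_le 1 s_op"
  using ord_le_mop_left[OF ord_le_euler_op[OF ord_le_1, of 0 p], of "germ_const (1 / of_nat (e p))"]
  by (simp add: s_op_def const_op_def)

lemma ep_neq_0: "complex_of_nat (e p) ~= 0" using e_pos[OF p_in_I] by simp

lemma s_const_commute: "const_op k * s_op = s_op * const_op k" by (rule const_op_commute[OF ord_le_s_op_1])

lemma E_op_p: "E_op p = 0" using p_in_I ep_neq_0 by (simp add: E_op_def const_op_simps)

lemma euler_op_eq: "i \<in> I ==> euler_op i = const_op (of_nat (e i)) * s_op + E_op i"
  by (simp add: E_op_def s_op_def flip: const_op_simps(4) mult.assoc)

lemma ord_le_const_op: "ord_le n P ==> ord_le n (const_op k * P)"
  by (simp add: const_op_def ord_le_mop_left)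

lemma ord_le_s_op: "ord_le k P ==> ord_le (Suc k) (s_op * P)"
  by (simp add: s_op_def mult.assoc ord_le_const_op ord_le_euler_op)

lemma ord_le_E_op: "ord_le k P ==> ord_le (Suc k) (E_op j * P)"
  by (simp add: E_op_def left_diff_distrib mult.assoc ord_le_diff ord_le_const_op ord_le_euler_op
      ord_le_deriv_op_left)

lemma euler_op_commute: "euler_op i * euler_op j = euler_op j * euler_op i"
  by (rule endo_eqI) (auto simp: euler_op_def app_simps app_deriv_op \<delta>_mult \<delta>_x \<delta>_commute[of i j] algebra_simps)

text \<open>Euler fields commute with each other and with the \<partial>_j outside I. Hence left
  multiplication by s preserves the right ideal \<open>E_ideal\<close>.\<close>

lemma s_E_commute: "s_op * E_op j = E_op j * s_op"
proof (cases "j = p \<or> j \<notin> I")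
  case True
  thus ?thesis using p_in_I by (intro endo_eqI)
       (auto simp: E_op_p s_op_def E_op_def const_op_def app_simps app_deriv_op euler_op_def \<delta>_mult \<delta>_x \<delta>_commute[of j p])
next
  case False
  let ?c = "const_op (1 / of_nat (e p))" and ?d = "const_op (of_nat (e j) / of_nat (e p))"
    and ?u = "euler_op p" and ?v = "euler_op j"
  have c: "const_op k * euler_op i = euler_op i * const_op k" for k i
    using const_op_commute[OF ord_le_euler_op[OF ord_le_1]] by simp
  have l: "euler_op i * (const_op k * P) = const_op k * (euler_op i * P)" for i k P
    by (simp only: mult.assoc[symmetric] c)
  have "?c * ?u * ?v = ?v * (?c * ?u)" by (simp only: mult.assoc l euler_op_commute[of p j])
  moreover have "?c * ?u * (?d * ?u) = ?d * ?u * (?c * ?u)"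
    by (simp only: mult.assoc l) (simp only: mult.assoc[symmetric] const_op_commute_endo(3)[of "1 / of_nat (e p)"])
  ultimately show ?thesis using False by (simp add: s_op_def E_op_def left_diff_distrib right_diff_distrib)
qed

lemma tpoly_s_op:
  assumes "ord_le k P" "Suc k \<le> N"
  shows "tpoly N (s_op * P) = [:0, 1:] * tpoly N P"
proof -
  have o: "ord_le N (euler_op p * P)" using ord_le_mono[OF ord_le_euler_op[OF assms(1)] assms(2)] .
  have "s_op * P = euler_op p * P * mop (germ_const (1 / of_nat (e p)))"
    unfolding s_op_def mult.assoc[of _ "euler_op p"] const_op_commute[OF o] by (simp add: const_op_def)
  hence "tpoly N (s_op * P) = smult (germ_const (1 / of_nat (e p))) (gpoly [:0, of_nat (e p):] * tpoly N P)"
    by (simp only: tpoly_mop[OF o order_refl] tpoly_euler_op[OF assms p_in_I])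
  also have "\<dots> = gpoly (smult (1 / of_nat (e p)) [:0, of_nat (e p):]) * tpoly N P"
    by (simp only: gpoly_smult mult_smult_left)
  also have "smult (1 / of_nat (e p)) [:0, of_nat (e p):] = [:0, 1 :: complex:]" using ep_neq_0 by simp
  also have "gpoly [:0, 1:] = [:0, 1:]" by (simp add: gpoly_pCons)
  finally show ?thesis .
qed

lemma tpoly_E_op:
  assumes "ord_le k P" "Suc k \<le> N"
  shows "tpoly N (E_op j * P) = 0"
proof (cases "j \<in> I")
  case False
  thus ?thesis using tpoly_deriv_op[OF assms] by (simp add: E_op_def)
next
  case True
  have oj: "ord_le N (euler_op j * P)" and os: "ord_le N (s_op * P)"
    using ord_le_mono[OF _ assms(2)] ord_le_euler_op[OF assms(1)] ord_le_s_op[OF assms(1)] by auto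
  have "E_op j * P = euler_op j * P - s_op * P * mop (germ_const (of_nat (e j)))"
    unfolding euler_op_eq[OF True] const_op_def[symmetric] const_op_commute[OF os, symmetric]
    by (simp add: algebra_simps)
  hence "tpoly N (E_op j * P) = gpoly [:0, of_nat (e j):] * tpoly N P -
      smult (germ_const (of_nat (e j))) ([:0, 1:] * tpoly N P)"
    by (simp only: tpoly_diff oj ord_le_mop_right os tpoly_mop[OF os order_refl]
        tpoly_s_op[OF assms] tpoly_euler_op[OF assms True])
  also have "gpoly [:0, of_nat (e j):] = smult (germ_const (of_nat (e j))) [:0, 1:]"
    by (simp add: gpoly_pCons)
  finally show ?thesis by simp
qed

definition E_ideal :: "'m germ endo set" where
  "E_ideal = {\<Sum>j\<in>UNIV. E_op j * P j | P k. \<forall>j. ord_le k (P j)}"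

lemma E_idealI: "(!!j. ord_le k (P j)) ==> (\<Sum>j\<in>UNIV. E_op j * P j) \<in> E_ideal" by (auto simp: E_ideal_def)

lemma E_idealE:
  assumes "Y \<in> E_ideal"
  obtains P k where "!!j. ord_le k (P j)" "Y = (\<Sum>j\<in>UNIV. E_op j * P j)"
  using assms unfolding E_ideal_def by blast

lemma E_ideal_0 [simp]: "0 \<in> E_ideal" using E_idealI[of 0 "%_. 0"] by simp

lemma E_ideal_add:
  assumes "Y \<in> E_ideal" "Z \<in> E_ideal" shows "Y + Z \<in> E_ideal"
proof -
  obtain P k where P: "!!j. ord_le k (P j)" "Y = (\<Sum>j\<in>UNIV. E_op j * P j)" by (rule E_idealE[OF assms(1)]) (rule that)
  obtain Q l where Q: "!!j. ord_le l (Q j)" "Z = (\<Sum>j\<in>UNIV. E_op j * Q j)" by (rule E_idealE[OF assms(2)]) (rule that)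
  have "ord_le (max k l) (P j + Q j)" for j
    using ord_le_mono[OF P(1), of "max k l"] ord_le_mono[OF Q(1), of "max k l"] by (intro ord_le.add) auto
  from E_idealI[of "max k l" "%j. P j + Q j", OF this] show ?thesis
    by (simp add: P Q distrib_left sum.distrib)
qed

lemma E_ideal_sum: "(!!i. i \<in> S ==> f i \<in> E_ideal) ==> (\<Sum>i\<in>S. f i) \<in> E_ideal"
  by (induction S rule: infinite_finite_induct) (auto intro: E_ideal_add)

lemma E_ideal_mop:
  assumes "Y \<in> E_ideal" shows "Y * mop b \<in> E_ideal"
proof -
  obtain P k where P: "!!j. ord_le k (P j)" "Y = (\<Sum>j\<in>UNIV. E_op j * P j)" by (rule E_idealE[OF assms(1)]) (rule that)
  from E_idealI[of k "%j. P j * mop b", OF ord_le_mop_right[OF P(1)]] show ?thesis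
    by (simp add: P sum_distrib_right mult.assoc)
qed

lemma E_ideal_uminus: "Y \<in> E_ideal ==> - Y \<in> E_ideal"
  using E_ideal_mop[of Y "- 1"] by (simp add: mop_minus)

lemma E_ideal_s_op:
  assumes "Y \<in> E_ideal" shows "s_op * Y \<in> E_ideal"
proof -
  obtain P k where P: "!!j. ord_le k (P j)" "Y = (\<Sum>j\<in>UNIV. E_op j * P j)" by (rule E_idealE[OF assms(1)]) (rule that)
  have "s_op * Y = (\<Sum>j\<in>UNIV. E_op j * (s_op * P j))"
    unfolding P(2) sum_distrib_left by (simp only: mult.assoc[symmetric] s_E_commute)
  thus ?thesis using E_idealI[of "Suc k" "%j. s_op * P j", OF ord_le_s_op[OF P(1)]] by simp
qed

lemma E_op_in_ideal: assumes "ord_le k P" shows "E_op j * P \<in> E_ideal"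
proof -
  have "(\<Sum>i\<in>UNIV. E_op i * (if i = j then P else 0)) \<in> E_ideal" by (rule E_idealI) (use assms in auto)
  moreover have "(\<Sum>i\<in>UNIV. E_op i * (if i = j then P else 0)) = E_op j * P"
    by (simp add: if_distrib[of "(*) _"] cong: if_cong)
  ultimately show ?thesis by simp
qed

lemma E_ideal_order: assumes "Y \<in> E_ideal" obtains k where "ord_le k Y"
proof -
  obtain P k where P: "!!j. ord_le k (P j)" "Y = (\<Sum>j\<in>UNIV. E_op j * P j)" by (rule E_idealE[OF assms(1)]) (rule that)
  have "ord_le (Suc k) Y" unfolding P(2) by (intro ord_le_sum ord_le_E_op P(1))
  thus thesis by (rule that)
qed

lemma tpoly_E_ideal:
  assumes "Y \<in> E_ideal" obtains N0 where "!!N. N \<ge> N0 ==> ord_le N Y \<and> tpoly N Y = 0"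
proof -
  obtain P k where P: "!!j. ord_le k (P j)" "Y = (\<Sum>j\<in>UNIV. E_op j * P j)" by (rule E_idealE[OF assms(1)]) (rule that)
  show thesis
  proof (rule that)
    fix N assume N: "N \<ge> Suc k"
    have o: "ord_le N (E_op j * P j)" for j using ord_le_mono[OF ord_le_E_op[OF P(1)] N] .
    show "ord_le N Y \<and> tpoly N Y = 0"
      unfolding P(2) by (simp add: ord_le_sum tpoly_sum o tpoly_E_op[OF P(1) N])
  qed
qed

text \<open>\<open>poly_op f Q = \<Sum>\<^sub>k s\<^sup>k Q f\<^sub>k\<close>.\<close>
definition poly_op :: "'m germ poly => 'm germ endo => 'm germ endo" where
  "poly_op f Q = fold_coeffs (%c P. Q * mop c + s_op * P) f 0"

definition cpoly_op :: "complex poly => 'm germ endo" where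
  "cpoly_op r = fold_coeffs (%c P. const_op c + s_op * P) r 0"

lemma poly_op_0 [simp]: "poly_op 0 Q = 0" and poly_op_pCons: "poly_op (pCons c f) Q = Q * mop c + s_op * poly_op f Q"
  by (simp add: poly_op_def) (cases "f = 0"; cases "c = 0"; simp add: poly_op_def)

lemma cpoly_op_0 [simp]: "cpoly_op 0 = 0" and cpoly_op_pCons: "cpoly_op (pCons c r) = const_op c + s_op * cpoly_op r"
  by (simp add: cpoly_op_def) (cases "r = 0"; cases "c = 0"; simp add: cpoly_op_def const_op_simps)

lemma cpoly_op_1 [simp]: "cpoly_op 1 = 1" by (simp add: one_pCons cpoly_op_pCons const_op_simps)

lemma poly_op_add: "poly_op (f + g) Q = poly_op f Q + poly_op g Q"
  by (induction f g rule: poly_induct2) (simp_all add: poly_op_pCons mop_add algebra_simps)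

lemma poly_op_sum: "poly_op (\<Sum>i\<in>S. f i) Q = (\<Sum>i\<in>S. poly_op (f i) Q)"
  by (induction S rule: infinite_finite_induct) (simp_all add: poly_op_add)

lemma cpoly_op_add: "cpoly_op (r + q) = cpoly_op r + cpoly_op q"
  by (induction r q rule: poly_induct2) (simp_all add: cpoly_op_pCons const_op_simps algebra_simps)

lemma cpoly_op_smult: "cpoly_op (smult k r) = const_op k * cpoly_op r"
proof (induction r)
  case (pCons c r)
  note s = s_const_commute[of k]
  have "const_op k * (s_op * cpoly_op r) = s_op * (const_op k * cpoly_op r)"
    by (simp only: mult.assoc[symmetric] s)
  thus ?case by (simp only: smult_pCons cpoly_op_pCons pCons.IH const_op_simps distrib_left)
qed simp

lemma cpoly_op_mult: "cpoly_op (r * q) = cpoly_op r * cpoly_op q"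
  by (induction r) (simp_all add: cpoly_op_pCons cpoly_op_add cpoly_op_smult const_op_simps distrib_right mult.assoc)

lemma cpoly_op_power: "cpoly_op (r ^ n) = cpoly_op r ^ n" by (induction n) (simp_all add: cpoly_op_mult)

lemma poly_op_gpoly:
  assumes "ord_le n Q" shows "poly_op (smult z (gpoly r)) Q = cpoly_op r * (Q * mop z)"
proof (induction r)
  case (pCons c r)
  have "Q * mop (z * germ_const c) = const_op c * (Q * mop z)"
    unfolding const_op_commute[OF ord_le_mop_right[OF assms]]
    by (simp only: mop_mult const_op_def mult.assoc)
  thus ?case using pCons.IH
    by (simp add: gpoly_pCons poly_op_pCons cpoly_op_pCons distrib_right mult.assoc)
qed simp

lemma ord_le_cpoly_op: "ord_le n Q ==> \<exists>k. ord_le k (cpoly_op r * Q)"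
proof (induction r)
  case (pCons c r)
  then obtain k where k: "ord_le k (cpoly_op r * Q)" by blast
  have "ord_le (max n (Suc k)) (const_op c * Q + s_op * (cpoly_op r * Q))"
    by (intro ord_le.add ord_le_mono[OF ord_le_const_op[OF pCons.prems]] ord_le_mono[OF ord_le_s_op[OF k]]) auto
  thus ?case by (auto simp: cpoly_op_pCons distrib_right mult.assoc)
qed (auto intro: exI[of _ 0])

lemma E_ideal_const_op: "Y \<in> E_ideal ==> const_op k * Y \<in> E_ideal"
proof -
  assume Y: "Y \<in> E_ideal"
  obtain n where "ord_le n Y" by (rule E_ideal_order[OF Y])
  thus ?thesis using const_op_commute E_ideal_mop[OF Y] by (simp add: const_op_def)
qed

lemma E_ideal_cpoly_op: "Y \<in> E_ideal ==> cpoly_op r * Y \<in> E_ideal"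
  by (induction r) (auto simp: cpoly_op_pCons distrib_right mult.assoc intro!: E_ideal_add E_ideal_const_op E_ideal_s_op)

lemma
  assumes "ord_le q Q" "f ~= 0 ==> degree f + q \<le> k"
  shows ord_le_poly_op: "ord_le k (poly_op f Q)"
    and tpoly_poly_op: "k \<le> N ==> tpoly N (poly_op f Q) = f * tpoly N Q"
proof -
  have "ord_le k (poly_op f Q) \<and> (k \<le> N \<longrightarrow> tpoly N (poly_op f Q) = f * tpoly N Q)" using assms(2)
  proof (induction f arbitrary: k)
    case (pCons c f)
    have kq: "q \<le> k" using pCons by auto
    have o1: "ord_le k (Q * mop c)" by (rule ord_le_mono[OF ord_le_mop_right[OF assms(1)] kq])
    show ?case
    proof (cases "f = 0")
      case True
      thus ?thesis using o1 kq by (auto simp: poly_op_pCons tpoly_mop[OF assms(1)])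
    next
      case False
      hence "Suc (degree f) + q \<le> k" using pCons by auto
      then obtain k' where k': "k = Suc k'" "degree f + q \<le> k'" by (cases k) auto
      have IH: "ord_le k' (poly_op f Q)" "k' \<le> N ==> tpoly N (poly_op f Q) = f * tpoly N Q"
        using pCons.IH[of k'] k' by auto
      have o2: "ord_le k (s_op * poly_op f Q)" unfolding k' by (rule ord_le_s_op[OF IH(1)])
      have "tpoly N (poly_op (pCons c f) Q) = pCons c f * tpoly N Q" if N: "k \<le> N"
      proof -
        have "tpoly N (poly_op (pCons c f) Q) = smult c (tpoly N Q) + [:0, 1:] * (f * tpoly N Q)"
          unfolding poly_op_pCons using N kq k'(1)
          by (simp only: tpoly_add[OF ord_le_mono[OF o1 N] ord_le_mono[OF o2 N]]
              tpoly_mop[OF assms(1)] tpoly_s_op[OF IH(1)] IH(2) le_trans[of q k N])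
        thus ?thesis by simp
      qed
      thus ?thesis using o1 o2 by (auto simp: poly_op_pCons intro: ord_le.add)
    qed
  qed simp
  thus "ord_le k (poly_op f Q)" "k \<le> N ==> tpoly N (poly_op f Q) = f * tpoly N Q" by auto
qed

text \<open>Modulo the E_j one has \<partial>_j^(g+1) x_j = (e_j s + 1 + g) \<partial>_j^g. A power
  of x_j standing to the right of enough derivatives can thus be exchanged for a polynomial in s on
  the left, and that polynomial is the quotient of the two Bernstein polynomials.\<close>

lemma dmon_xmon:
  assumes "supp_I \<nu>"
  shows "\<exists>r. bernstein (%_. 0) (%i. m i + \<nu> i) = r * bernstein (%_. 0) m \<and>
     dmon (%i. m i + \<nu> i) * mop (xmon \<nu>) - cpoly_op r * dmon m \<in> E_ideal" using assms
proof (induction \<nu> rule: multi_index_induct)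
  case zero
  show ?case by (rule exI[of _ 1]) simp
next
  case (incr \<nu> j)
  have j: "j \<in> I" and s: "supp_I \<nu>" using incr.prems by (auto simp: supp_I_def split: if_splits)
  obtain r where r: "bernstein (%_. 0) (%i. m i + \<nu> i) = r * bernstein (%_. 0) m"
    "dmon (%i. m i + \<nu> i) * mop (xmon \<nu>) - cpoly_op r * dmon m \<in> E_ideal"
    using incr.IH[OF s] by blast
  define g where "g = (%i. m i + \<nu> i)"
  define L where "L = lin_factor j (- 1 - int (g j))"
  have up: "(%i. m i + (\<nu>(j := Suc (\<nu> j))) i) = g(j := Suc (g j))" by (auto simp: g_def)
  have M: "xmon (\<nu>(j := Suc (\<nu> j))) = x j * xmon \<nu>" by (rule xmon_incr[OF j])
  have "dmon (g(j := Suc (g j))) * mop (x j) =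
      mop (x j) * dmon (g(j := Suc (g j))) + of_nat (Suc (g j)) * dmon g"
    using dmon_x[of "g(j := Suc (g j))" j] by simp
  also have "mop (x j) * dmon (g(j := Suc (g j))) = euler_op j * dmon g"
    by (simp only: dmon_incr euler_op_def mult.assoc)
  also have "\<dots> = const_op (of_nat (e j)) * s_op * dmon g + E_op j * dmon g"
    by (simp only: euler_op_eq[OF j] distrib_right)
  also have "\<dots> + of_nat (Suc (g j)) * dmon g = cpoly_op L * dmon g + E_op j * dmon g"
  proof -
    have c: "const_op (of_nat n) = of_nat n" for n
      by (simp add: const_op_def mop_of_nat flip: germ_of_nat)
    have "cpoly_op L = const_op (of_nat (Suc (g j))) + s_op * const_op (of_nat (e j))"
      by (simp add: L_def lin_factor_def cpoly_op_pCons add.commute)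
    also have "s_op * const_op (of_nat (e j)) = const_op (of_nat (e j)) * s_op"
      by (rule s_const_commute[symmetric])
    finally show ?thesis by (simp only: c distrib_right) (simp only: add_ac)
  qed
  finally have step: "dmon (g(j := Suc (g j))) * mop (x j) = cpoly_op L * dmon g + E_op j * dmon g" .
  have og: "ord_le (sum g UNIV) (dmon g)"
    using ord_le.monom[of g "sum g UNIV" 1] by (simp add: mi_le_def)
  have "dmon (g(j := Suc (g j))) * mop (x j * xmon \<nu>) - cpoly_op (L * r) * dmon m =
      cpoly_op L * (dmon g * mop (xmon \<nu>) - cpoly_op r * dmon m)
        + E_op j * dmon g * mop (xmon \<nu>)"
    unfolding mop_mult mult.assoc[symmetric] step cpoly_op_mult by (simp add: algebra_simps)
  also have "\<dots> \<in> E_ideal"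
    by (intro E_ideal_add E_ideal_cpoly_op E_ideal_mop E_op_in_ideal[OF og]) (use r(2) in \<open>simp add: g_def\<close>)
  finally have "dmon (g(j := Suc (g j))) * mop (x j * xmon \<nu>) - cpoly_op (L * r) * dmon m \<in> E_ideal" .
  moreover have "bernstein (%_. 0) (g(j := Suc (g j))) = L * r * bernstein (%_. 0) m"
    using bernstein_incr(1)[OF j, of "%_. 0" g] r(1) unfolding g_def[symmetric] by (simp add: L_def mult_ac)
  ultimately show ?case unfolding up M by blast
qed

lemma dmon_in_ideal:
  assumes "\<not> supp_I m" shows "dmon m * mop b \<in> E_ideal"
proof -
  obtain j where j: "j \<notin> I" "m j ~= 0" using assms by (auto simp: supp_I_def)
  let ?g = "m(j := m j - 1)"
  have geq: "m = ?g(j := Suc (?g j))" using j by auto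
  have "dmon m = E_op j * dmon ?g"
    using dmon_incr[of ?g j] j(1) unfolding geq[symmetric] by (simp add: E_op_def)
  moreover have "ord_le (sum ?g UNIV) (dmon ?g)"
    using ord_le.monom[of ?g "sum ?g UNIV" 1] by (simp add: mi_le_def)
  ultimately show ?thesis using E_op_in_ideal E_ideal_mop by metis
qed

end

context snc_coords
begin

text \<open>Splitting the coefficients into cells and exchanging surplus powers of x for polynomials
  in s brings P, modulo \<open>E_ideal\<close>, to a sum over cells c of polynomials in s with germ
  coefficients applied to the single monomial \<open>dmon (g c)\<close>. The c-cell of the transform
  is this polynomial times x^c and a nonzero Bernstein polynomial, so the polynomial vanishes
  together with the transform.\<close>

lemma tpoly_kernel:
  assumes P: "ord_le N P" "tpoly N P = 0"
  shows "P \<in> E_ideal"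
proof -
  let ?M = "%_ :: 'm. N" and ?b = "bernstein (%_. 0)"
  define C where "C = cells ?M"
  define G where "G = {m. m \<in> mi_le N \<and> supp_I m}"
  define F where "F = coef N P"
  define A where "A = (%m. xmon (%i. N - m i) * F m)"
  \<comment> \<open>The exponents of the transform are shifted by N, so N - c is the pole order of
    cell c and hence the least number of derivatives reaching it; \<nu> is the surplus of m over
    this number.\<close>
  define g where "g = (%c i. if i \<in> I then N - c i else 0)"
  define \<nu> where "\<nu> = (%m c i. if i \<in> I then c i - (N - m i) else 0)"
  define good where "good = (%m c. \<forall>i\<in>I. N - m i \<le> c i)"
  have fin: "finite G" "finite C" by (simp_all add: G_def C_def)
  define z where "z = (%m c. SOME b. cell ?M c (A m) = xmon c * b)"
  have z: "cell ?M c (A m) = xmon c * z m c" for m c unfolding z_def by (rule someI_ex) (rule cell_dvd)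
  \<comment> \<open>The m-th summand of the transform is a multiple of x^(N - m), so it has no part
    in a cell with a smaller exponent.\<close>
  have bad: "z m c = 0" if not_good: "\<not> good m c" for m c
  proof -
    obtain i where i: "i \<in> I" "\<not> N - m i \<le> c i" using not_good unfolding good_def by blast
    have "cell ?M c (A m) = 0" unfolding A_def by (rule cell_xmon_small[OF i(1)]) (use i(2) in auto)
    thus ?thesis using z xmon_neq_0 by simp
  qed
  have cC: "c i \<le> N" if "c \<in> C" "i \<in> I" for c i using that by (auto simp: C_def cells_def PiE_def)
  have gN: "m i \<le> N" if "m \<in> G" for m i using that mi_le_component[of m N i] by (simp add: G_def)
  have m_eq: "m = (%i. g c i + \<nu> m c i)" if "m \<in> G" "c \<in> C" "good m c" for m c
  proof
    fix i show "m i = g c i + \<nu> m c i"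
    proof (cases "i \<in> I")
      case True
      have "N - m i \<le> c i" using that(3) True by (simp add: good_def)
      thus ?thesis using True cC[OF that(2) True] gN[OF that(1), of i] by (simp add: g_def \<nu>_def)
    qed (use that(1) in \<open>simp add: g_def \<nu>_def G_def supp_I_def\<close>)
  qed
  have c_eq: "xmon c = xmon (%i. N - m i) * xmon (\<nu> m c)" if "good m c" for m c
    unfolding xmon_add[symmetric] using that by (intro xmon_cong) (auto simp: \<nu>_def good_def)
  have F_sum: "F m = (\<Sum>c\<in>C. xmon (\<nu> m c) * z m c)" for m
  proof -
    have "xmon (%i. N - m i) * F m = (\<Sum>c\<in>C. cell ?M c (A m))"
      unfolding C_def cell_sum by (simp add: A_def)
    also have "\<dots> = xmon (%i. N - m i) * (\<Sum>c\<in>C. xmon (\<nu> m c) * z m c)" unfolding sum_distrib_left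
    proof (rule sum.cong[OF refl])
      fix c show "cell ?M c (A m) = xmon (%i. N - m i) * (xmon (\<nu> m c) * z m c)"
        by (cases "good m c") (simp_all add: z c_eq[of m] bad mult.assoc)
    qed
    finally show ?thesis using xmon_neq_0 by (simp only: mult_cancel_left) simp
  qed
  define R where "R = (%m c r. ?b (%i. g c i + \<nu> m c i) = r * ?b (g c) \<and>
      dmon (%i. g c i + \<nu> m c i) * mop (xmon (\<nu> m c)) - cpoly_op r * dmon (g c) \<in> E_ideal)"
  define r where "r = (%m c. SOME r. R m c r)"
  have "\<exists>r. R m c r" for m c unfolding R_def by (rule dmon_xmon) (simp add: supp_I_def \<nu>_def)
  hence R: "R m c (r m c)" for m c unfolding r_def by (rule someI_ex)
  have r: "?b (%i. g c i + \<nu> m c i) = r m c * ?b (g c)"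
    "dmon (%i. g c i + \<nu> m c i) * mop (xmon (\<nu> m c)) - cpoly_op (r m c) * dmon (g c) \<in> E_ideal" for m c
    using R[of m c] unfolding R_def by blast+
  have step: "dmon m * mop (F m) - (\<Sum>c\<in>C. cpoly_op (r m c) * (dmon (g c) * mop (z m c))) \<in> E_ideal"
    if "m \<in> G" for m
  proof -
    have "dmon m * mop (xmon (\<nu> m c) * z m c) -
        cpoly_op (r m c) * (dmon (g c) * mop (z m c)) \<in> E_ideal" if "c \<in> C" for c
    proof (cases "good m c")
      case True
      have "(dmon m * mop (xmon (\<nu> m c)) - cpoly_op (r m c) * dmon (g c)) * mop (z m c) \<in> E_ideal"
        using E_ideal_mop[OF r(2)[of c m]] unfolding m_eq[OF \<open>m \<in> G\<close> that True, symmetric] .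
      thus ?thesis by (simp only: left_diff_distrib mop_mult mult.assoc)
    qed (simp add: bad)
    from E_ideal_sum[OF this] show ?thesis unfolding F_sum[of m] mop_sum sum_distrib_left sum_subtractf .
  qed
  have og: "ord_le (sum (g c) UNIV) (dmon (g c))" for c
    using ord_le.monom[of "g c" "sum (g c) UNIV" 1] by (simp add: mi_le_def)
  \<comment> \<open>Germs form a domain, so the common factor, x^c times a Bernstein polynomial, can
    be cancelled from the c-cell.\<close>
  have vanish: "(\<Sum>m\<in>G. smult (z m c) (gpoly (r m c))) = 0" if c: "c \<in> C" for c
  proof -
    have "0 = poly_cell ?M c (tpoly N P)" by (simp add: P(2))
    also have "\<dots> = (\<Sum>m\<in>G. smult (cell ?M c (A m)) (gpoly (?b m)))"
      unfolding tpoly_def poly_cell_sum_arg poly_cell_smult_const by (simp add: G_def A_def F_def)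
    also have "\<dots> = (\<Sum>m\<in>G. smult (xmon c) (gpoly (?b (g c))) * smult (z m c) (gpoly (r m c)))"
    proof (rule sum.cong[OF refl])
      fix m assume m: "m \<in> G"
      show "smult (cell ?M c (A m)) (gpoly (?b m)) =
          smult (xmon c) (gpoly (?b (g c))) * smult (z m c) (gpoly (r m c))"
      proof (cases "good m c")
        case True
        have "?b m = r m c * ?b (g c)" using r(1)[of c m] unfolding m_eq[OF m c True, symmetric] .
        thus ?thesis unfolding z by (simp only: gpoly_mult mult_smult_left mult_smult_right smult_smult mult.commute)
      qed (simp add: z bad)
    qed
    finally have "smult (xmon c) (gpoly (?b (g c))) * (\<Sum>m\<in>G. smult (z m c) (gpoly (r m c))) = 0"
      by (simp only: sum_distrib_left)
    thus ?thesis by (simp add: xmon_neq_0 bernstein_neq_0)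
  qed
  have "(\<Sum>m\<in>G. \<Sum>c\<in>C. cpoly_op (r m c) * (dmon (g c) * mop (z m c)))
      = (\<Sum>c\<in>C. poly_op (\<Sum>m\<in>G. smult (z m c) (gpoly (r m c))) (dmon (g c)))"
    by (subst sum.swap) (simp add: poly_op_sum poly_op_gpoly[OF og])
  also have "\<dots> = 0" by (rule sum.neutral) (simp add: vanish)
  finally have zero: "(\<Sum>m\<in>G. \<Sum>c\<in>C. cpoly_op (r m c) * (dmon (g c) * mop (z m c))) = 0" .
  have "(\<Sum>m\<in>G. dmon m * mop (F m)) \<in> E_ideal"
    using E_ideal_sum[of G "%m. dmon m * mop (F m) -
        (\<Sum>c\<in>C. cpoly_op (r m c) * (dmon (g c) * mop (z m c)))", OF step]
    unfolding sum_subtractf zero by simp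
  moreover have "(\<Sum>m\<in>mi_le N - G. dmon m * mop (F m)) \<in> E_ideal"
    by (rule E_ideal_sum, rule dmon_in_ideal) (auto simp: G_def)
  moreover have "P = (\<Sum>m\<in>mi_le N - G. dmon m * mop (F m)) + (\<Sum>m\<in>G. dmon m * mop (F m))"
    using normal_form_coef[OF P(1)] sum.subset_diff[of G "mi_le N" "%m. dmon m * mop (F m)"]
    by (simp add: normal_form_def F_def[symmetric] G_def)
  ultimately show ?thesis by (simp add: E_ideal_add)
qed

subsection \<open>Membership criterion for the V-filtration\<close>

text \<open>For a = e this is the right ideal that cuts out \<open>M\<close>, since x^e = t.\<close>

definition V_ideal :: "('m => nat) => 'm germ endo set" where
  "V_ideal a = {P. \<exists>Q n. ord_le n Q \<and> P - mop (xmon a) * Q \<in> E_ideal}"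

text \<open>The transform of x^a \<partial>^m has exponent a + N - m, so contributing to cell c
  takes at least a + N - c derivatives, and the Bernstein polynomial of that many derivatives
  divides the contribution. Truncated subtraction gives an empty product where no derivative is
  required.\<close>

definition cell_poly :: "nat => ('m => nat) => ('m => nat) => complex poly" where
  "cell_poly N a c = bernstein a (%i. a i + N - c i)"

text \<open>The cutoff N + e_i lies at or above a_i + N whenever a_i \<le> e_i, so the last cell,
  which lumps many exponents together, carries an empty condition in the variable x_i.\<close>

definition V_criterion :: "nat => ('m => nat) => 'm germ poly => bool" where
  "V_criterion N a f \<longleftrightarrow> (\<forall>c\<in>cells (%i. N + e i). gpoly (cell_poly N a c) dvd poly_cell (%i. N + e i) c f)"

lemma bernstein_dvd: "(!!i. i \<in> I ==> m i \<le> m' i) ==> bernstein a m dvd bernstein a m'"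
  unfolding bernstein_def by (intro prod_dvd_prod prod_dvd_prod_subset) auto

lemma V_criterion_add: "V_criterion N a f ==> V_criterion N a g ==> V_criterion N a (f + g)"
  by (simp add: V_criterion_def poly_cell_add)

lemma V_criterion_xmon:
  assumes "ord_le k Q" "k \<le> N" "!!i. i \<in> I ==> a i \<le> e i"
  shows "V_criterion N a (tpoly N (mop (xmon a) * Q))" using assms(1,2)
proof (induction rule: ord_le.induct)
  case (monom m k b)
  have m: "m \<in> mi_le N" using monom mi_le_mono by blast
  have o: "ord_le N (mop (xmon a) * dmon m)"
    using ord_le_mop_left[OF ord_le.monom[OF m, of 1]] by simp
  show ?case
  proof (cases "supp_I m")
    case True
    have f: "tpoly N (mop (xmon a) * (dmon m * mop b)) =
        smult (xmon (%i. a i + N - m i) * b) (gpoly (bernstein a m))"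
      unfolding mult.assoc[symmetric] tpoly_mop[OF o order_refl] tpoly_monom[OF m True]
      by (simp add: mult.commute)
    show ?thesis unfolding V_criterion_def f
    proof
      fix c assume c: "c \<in> cells (%i. N + e i)"
      show "gpoly (cell_poly N a c) dvd
         poly_cell (%i. N + e i) c (smult (xmon (%i. a i + N - m i) * b) (gpoly (bernstein a m)))"
      proof (cases "\<forall>i\<in>I. a i + N - m i \<le> c i")
        case True
        have "cell_poly N a c dvd bernstein a m" unfolding cell_poly_def
          using True by (intro bernstein_dvd) force
        thus ?thesis unfolding poly_cell_smult_const by (intro dvd_smult gpoly_dvd)
      next
        case False
        then obtain i where i: "i \<in> I" "c i < a i + N - m i" by (auto simp: not_le)
        have "cell (%i. N + e i) c (xmon (%i. a i + N - m i) * b) = 0"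
          by (rule cell_xmon_small[OF i(1)]) (use i assms(3)[OF i(1)] in auto)
        thus ?thesis unfolding poly_cell_smult_const by simp
      qed
    qed
  next
    case False
    then obtain j where j: "j \<notin> I" "m j ~= 0" by (auto simp: supp_I_def)
    let ?g = "m(j := m j - 1)"
    have geq: "m = ?g(j := Suc (?g j))" using j by auto
    have "?g(j := Suc (?g j)) \<in> mi_le N" unfolding geq[symmetric] by (rule m)
    hence gN: "Suc (sum ?g UNIV) \<le> N" unfolding mi_le_def mem_Collect_eq sum_incr .
    have "\<delta> j (xmon a) = 0"
    proof -
      have "\<delta> j (x i ^ n) = 0" if "i \<in> I" for i n using that j(1) by (induction n) (auto simp: \<delta>_mult \<delta>_x)
      hence "\<delta> j (\<Prod>i\<in>S. x i ^ a i) = 0" if "S \<subseteq> I" for S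
        using that by (induction S rule: infinite_finite_induct) (auto simp: \<delta>_mult)
      thus ?thesis by (simp add: xmon_def)
    qed
    hence comm: "mop (xmon a) * deriv_op j = deriv_op j * mop (xmon a)"
      by (simp add: deriv_op_mop)
    have "dmon m = deriv_op j * dmon ?g"
      using dmon_incr[of ?g j] unfolding geq[symmetric] .
    hence eq: "mop (xmon a) * (dmon m * mop b) =
        deriv_op j * (mop (xmon a) * (dmon ?g * mop b))"
      by (simp only: mult.assoc[symmetric] comm)
    have "ord_le (sum ?g UNIV) (mop (xmon a) * (dmon ?g * mop b))"
      by (intro ord_le_mop_left ord_le.monom) (simp add: mi_le_def)
    from tpoly_deriv_op[OF this gN j(1)] show ?thesis unfolding eq V_criterion_def by simp
  qed
next
  case (add k P Q)
  have "ord_le N (mop (xmon a) * P)" "ord_le N (mop (xmon a) * Q)"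
    using add.hyps add.prems ord_le_mono ord_le_mop_left by blast+
  thus ?case using add by (simp add: distrib_left tpoly_add V_criterion_add)
qed

lemma V_ideal_criterion:
  assumes "P \<in> V_ideal a" "!!i. i \<in> I ==> a i \<le> e i"
  obtains N0 where "!!N. N \<ge> N0 ==> ord_le N P \<and> V_criterion N a (tpoly N P)"
proof -
  obtain Q n where Q: "ord_le n Q" "P - mop (xmon a) * Q \<in> E_ideal"
    using assms(1) by (auto simp: V_ideal_def)
  obtain N1 where N1: "!!N. N \<ge> N1 ==> ord_le N (P - mop (xmon a) * Q) \<and> tpoly N (P - mop (xmon a) * Q) = 0"
    using tpoly_E_ideal[OF Q(2)] by blast
  show thesis
  proof (rule that)
    fix N assume N: "N \<ge> max n N1"
    have o: "ord_le N (mop (xmon a) * Q)"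
      using N by (intro ord_le_mop_left ord_le_mono[OF Q(1)]) simp
    have Y: "ord_le N (P - mop (xmon a) * Q)" "tpoly N (P - mop (xmon a) * Q) = 0"
      using N1 N by auto
    have "P = (P - mop (xmon a) * Q) + mop (xmon a) * Q" by simp
    hence "ord_le N P" "tpoly N P = tpoly N (mop (xmon a) * Q)"
      using ord_le.add[OF Y(1) o] tpoly_add[OF Y(1) o] Y(2) by auto
    moreover have "V_criterion N a (tpoly N (mop (xmon a) * Q))"
      by (rule V_criterion_xmon[OF Q(1) _ assms(2)]) (use N in auto)
    ultimately show "ord_le N P \<and> V_criterion N a (tpoly N P)" by simp
  qed
qed

lemma degree_tpoly:
  assumes "ord_le q P" "q \<le> N" shows "degree (tpoly N P) \<le> q" using assms
proof (induction rule: ord_le.induct)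
  case (monom m k b)
  hence m: "m \<in> mi_le N" using mi_le_mono by blast
  have "sum m I \<le> sum m UNIV" by (rule sum_mono2) auto
  also have "\<dots> \<le> k" using monom by (simp add: mi_le_def)
  finally have "degree (gpoly (bernstein (%_. 0) m) :: 'm germ poly) \<le> k" by (simp add: degree_bernstein)
  thus ?case unfolding tpoly_dmon[OF m] using degree_smult_le order_trans by auto
next
  case (add k P Q)
  have "ord_le N P" "ord_le N Q" using add.hyps add.prems ord_le_mono by blast+
  thus ?case using add by (simp add: tpoly_add degree_add_le)
qed

text \<open>s x^a = x^a (s + a_p / e_p): multiplication by s keeps the factor x^a in front and
  raises the order by at most one. This makes the ideals \<open>V_ideal a\<close> stable under s
  without loss of order control.\<close>

lemma s_op_xmon:
  assumes "ord_le n Q"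
  obtains Q' where "s_op * (mop (xmon a) * Q) = mop (xmon a) * Q'" "ord_le (Suc n) Q'"
proof -
  have "euler_op p * mop (xmon a) = mop (xmon a) * euler_op p + mop (x p * \<delta> p (xmon a))"
    by (simp add: euler_op_def mult.assoc deriv_op_mop distrib_left)
       (simp add: mult.assoc[symmetric] mop_mult[symmetric] mult.commute)
  moreover have "x p * \<delta> p (xmon a) = xmon a * of_nat (a p)"
  proof -
    have pw: "x p * \<delta> p (x p ^ n) = of_nat n * x p ^ n" for n
      by (induction n) (simp_all add: \<delta>_mult \<delta>_x algebra_simps)
    have "\<delta> p (x i ^ n) = 0" if "i ~= p" for i n using that by (induction n) (auto simp: \<delta>_mult \<delta>_x)
    hence z: "\<delta> p (\<Prod>i\<in>S. x i ^ a i) = 0" if "p \<notin> S" for S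
      using that by (induction S rule: infinite_finite_induct) (auto simp: \<delta>_mult)
    have "xmon a = x p ^ a p * (\<Prod>i\<in>I - {p}. x i ^ a i)"
      unfolding xmon_def by (rule prod.remove) (use p_in_I in auto)
    thus ?thesis using z[of "I - {p}"] pw[of "a p"] by (simp add: \<delta>_mult algebra_simps)
  qed
  ultimately have E: "euler_op p * mop (xmon a) = mop (xmon a) * (euler_op p + mop (of_nat (a p)))"
    by (simp add: mop_mult distrib_left)
  let ?c = "const_op (1 / of_nat (e p))"
  have "s_op * (mop (xmon a) * Q) = ?c * (euler_op p * mop (xmon a)) * Q"
    by (simp only: s_op_def mult.assoc)
  also have "\<dots> = ?c * mop (xmon a) * (euler_op p + mop (of_nat (a p))) * Q"
    unfolding E by (simp only: mult.assoc)
  also have "\<dots> = mop (xmon a) * (?c * (euler_op p * Q + mop (of_nat (a p)) * Q))"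
    by (simp only: const_op_commute_endo mult.assoc distrib_right)
  finally show thesis by (rule that) (intro ord_le_const_op ord_le.add ord_le_euler_op assms
        ord_le_mono[OF ord_le_mop_left[OF assms]], simp)
qed

lemma poly_op_xmon:
  assumes "ord_le q Q" "f ~= 0 ==> degree f + q \<le> k"
  shows "\<exists>Q'. poly_op f (mop (xmon a) * Q) = mop (xmon a) * Q' \<and> ord_le k Q'"
  using assms(2)
proof (induction f arbitrary: k)
  case 0
  show ?case by (rule exI[of _ 0]) simp
next
  case (pCons c f)
  have kq: "q \<le> k" using pCons by auto
  have o1: "ord_le k (Q * mop c)" by (rule ord_le_mono[OF ord_le_mop_right[OF assms(1)] kq])
  show ?case
  proof (cases "f = 0")
    case True
    thus ?thesis using o1 by (intro exI[of _ "Q * mop c"]) (simp add: poly_op_pCons mult.assoc)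
  next
    case False
    hence "Suc (degree f) + q \<le> k" using pCons by auto
    then obtain k' where k': "k = Suc k'" "degree f + q \<le> k'" by (cases k) auto
    obtain Q1 where Q1: "poly_op f (mop (xmon a) * Q) = mop (xmon a) * Q1" "ord_le k' Q1"
      using pCons.IH[of k'] k' by blast
    obtain Q2 where Q2: "s_op * (mop (xmon a) * Q1) = mop (xmon a) * Q2" "ord_le k Q2"
      using s_op_xmon[OF Q1(2)] k'(1) by blast
    show ?thesis by (rule exI[of _ "Q * mop c + Q2"])
         (simp add: poly_op_pCons Q1 Q2 mult.assoc distrib_left ord_le.add o1)
  qed
qed

text \<open>On a cell c the quotient of f by the Bernstein polynomial is still divisible by x^c, and
  x^a \<open>dmon (m c)\<close> x^\<nu> has transform exactly x^c times that polynomial; the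
  remaining factor g is applied as a polynomial in s. Degrees add up without cancellation, which is
  why the order of Q is bounded by the degree of f and not by N.\<close>

lemma V_criterion_realize:
  assumes f: "V_criterion N a f" "f ~= 0 ==> degree f \<le> q" "q \<le> N"
  obtains Q where "ord_le q Q" "tpoly N (mop (xmon a) * Q) = f"
proof -
  let ?M = "%i. N + e i"
  define C where "C = cells ?M"
  define m where "m = (%c i. if i \<in> I then a i + N - c i else 0)"
  define \<nu> where "\<nu> = (%c i. if i \<in> I then c i - (a i + N) else 0)"
  have bern: "bernstein a (m c) = cell_poly N a c" for c
    unfolding cell_poly_def by (rule bernstein_cong) (simp add: m_def)
  have supp: "supp_I (m c)" for c by (simp add: supp_I_def m_def)
  have "\<exists>Q. ord_le q Q \<and> tpoly N (mop (xmon a) * Q) = poly_cell ?M c f" if c: "c \<in> C" for c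
  proof -
    obtain f' where f': "poly_cell ?M c f = gpoly (cell_poly N a c) * f'"
      using f(1) c unfolding V_criterion_def C_def by (metis dvd_def)
    have nz: "gpoly (cell_poly N a c) ~= (0 :: 'm germ poly)"
      using bernstein_neq_0 unfolding cell_poly_def by simp
    \<comment> \<open>The projection commutes with the constant polynomial, so f' is its own c-cell
      and therefore divisible by x^c.\<close>
    have "gpoly (cell_poly N a c) * poly_cell ?M c f' = poly_cell ?M c (poly_cell ?M c f)"
      unfolding f' poly_cell_const_mult ..
    also have "\<dots> = gpoly (cell_poly N a c) * f'" using c by (simp add: poly_cell_orth C_def f'[symmetric])
    finally have "poly_cell ?M c f' = f'" using nz by simp
    then obtain g where g: "f' = smult (xmon c) g" using poly_cell_dvd by metis
    show ?thesis
    proof (cases "g = 0")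
      case True
      thus ?thesis by (intro exI[of _ 0]) (simp add: f' g)
    next
      case False
      have sumI: "sum (m c) UNIV = sum (m c) I" by (rule sum.mono_neutral_right) (auto simp: m_def)
      have ne: "poly_cell ?M c f ~= 0" using False nz by (simp add: f' g xmon_neq_0)
      hence fne: "f ~= 0" by auto
      have "degree (poly_cell ?M c f) = sum (m c) I + degree g"
        unfolding f' g using nz False by (simp add: degree_mult_eq xmon_neq_0 degree_bernstein flip: bern)
      hence deg: "degree g + sum (m c) UNIV \<le> q" using f(2)[OF fne] degree_poly_cell[of ?M c f] sumI by simp
      have mN: "m c \<in> mi_le N" using deg f(3) by (simp add: mi_le_def)
      have o: "ord_le (sum (m c) UNIV) (dmon (m c) * mop (xmon (\<nu> c)))"
        by (rule ord_le.monom) (simp add: mi_le_def)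
      have o': "ord_le N (mop (xmon a) * dmon (m c))"
        using ord_le_mop_left[OF ord_le.monom[OF mN, of 1]] by simp
      have "xmon (\<nu> c) * xmon (%i. a i + N - m c i) = xmon c"
        unfolding xmon_add[symmetric] by (rule xmon_cong) (auto simp: m_def \<nu>_def)
      hence t: "tpoly N (mop (xmon a) * (dmon (m c) * mop (xmon (\<nu> c)))) =
          smult (xmon c) (gpoly (cell_poly N a c))"
        unfolding mult.assoc[symmetric] tpoly_mop[OF o' order_refl] tpoly_monom[OF mN supp] bern by simp
      obtain Q where Q: "poly_op g (mop (xmon a) * (dmon (m c) * mop (xmon (\<nu> c)))) =
          mop (xmon a) * Q" "ord_le q Q" using poly_op_xmon[OF o, of g q] deg by blast
      have "tpoly N (mop (xmon a) * Q) = g * smult (xmon c) (gpoly (cell_poly N a c))"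
        unfolding Q(1)[symmetric] t[symmetric]
        by (rule tpoly_poly_op[OF ord_le_mop_left[OF o] deg f(3)])
      thus ?thesis using Q(2) by (intro exI[of _ Q]) (simp add: f' g mult.commute)
    qed
  qed
  then obtain Q where Q: "!!c. c \<in> C ==> ord_le q (Q c)"
    "!!c. c \<in> C ==> tpoly N (mop (xmon a) * Q c) = poly_cell ?M c f" by metis
  have o: "ord_le N (mop (xmon a) * Q c)" if "c \<in> C" for c
    using ord_le_mono[OF ord_le_mop_left[OF Q(1)[OF that]] f(3)] .
  show thesis
  proof (rule that)
    show "ord_le q (\<Sum>c\<in>C. Q c)" by (intro ord_le_sum Q(1))
    show "tpoly N (mop (xmon a) * (\<Sum>c\<in>C. Q c)) = f"
    proof -
      have "tpoly N (\<Sum>c\<in>C. mop (xmon a) * Q c) = (\<Sum>c\<in>C. poly_cell ?M c f)"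
        by (subst tpoly_sum[OF o]) (auto simp: Q(2))
      thus ?thesis unfolding sum_distrib_left by (simp only: C_def poly_cell_sum)
    qed
  qed
qed

text \<open>The criterion yields some x^a Q with the same transform as P, and the difference lies in
  the kernel \<open>E_ideal\<close>.\<close>

lemma V_criterion_imp_ideal:
  assumes "ord_le N P" "V_criterion N a (tpoly N P)"
  shows "P \<in> V_ideal a"
proof -
  obtain Q where Q: "ord_le N Q" "tpoly N (mop (xmon a) * Q) = tpoly N P"
    by (rule V_criterion_realize[OF assms(2) degree_tpoly[OF assms(1) order_refl] order_refl])
  have "P - mop (xmon a) * Q \<in> E_ideal" by (rule tpoly_kernel[of N])
       (simp_all add: assms(1) Q ord_le_diff ord_le_mop_left tpoly_diff)
  thus ?thesis using Q(1) unfolding V_ideal_def by blast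
qed

end

subsection \<open>Generalized eigenspaces and strictness\<close>

abbreviation lin_root :: "complex => complex poly" where
  "lin_root \<mu> \<equiv> [:- \<mu>, 1:]"

lemma coprime_lin_root_power:
  assumes "poly q \<mu> ~= 0" shows "coprime q (lin_root \<mu> ^ r)"
proof -
  have "prime_elem (lin_root \<mu>)" by (rule prime_elem_linear_field_poly) simp
  moreover have "\<not> lin_root \<mu> dvd q" using assms by (simp add: poly_eq_0_iff_dvd)
  ultimately have "coprime (lin_root \<mu>) q" by (rule prime_elem_imp_coprime)
  thus ?thesis by (simp add: coprime_commute)
qed

context snc_coords
begin

text \<open>Indexed by the roots (k - N) / e_i, the polynomial depends on a only through the upper
  end of the range, so enlarging a appends factors.\<close>

lemma cell_poly_eq: "cell_poly N a c = (\<Prod>i\<in>I. \<Prod>k\<in>{c i..<a i + N}. lin_factor i (int k - int N))"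
  unfolding cell_poly_def bernstein_def
proof (rule prod.cong[OF refl])
  fix i
  show "(\<Prod>l<a i + N - c i. lin_factor i (int (a i) - 1 - int l)) = (\<Prod>k\<in>{c i..<a i + N}. lin_factor i (int k - int N))"
    by (rule prod.reindex_bij_witness[of _ "%k. a i + N - 1 - k" "%l. a i + N - 1 - l"])
       (auto intro!: arg_cong[of _ _ "lin_factor i"])
qed

lemma cell_poly_mono: "(!!i. i \<in> I ==> a i \<le> b i) ==> cell_poly N a c dvd cell_poly N b c"
  unfolding cell_poly_eq by (intro prod_dvd_prod prod_dvd_prod_subset) auto

lemma poly_lin_factor: "poly (lin_factor i k) \<mu> = of_nat (e i) * \<mu> - of_int k" by (simp add: lin_factor_def)

text \<open>The roots coming from branch i are at most (a_i - 1) / e_i, and the hypothesis puts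
  \<mu> strictly above that.\<close>

lemma poly_cell_poly_neq_0:
  assumes "!!i. i \<in> I ==> real (a i) < real (e i) * \<mu> + 1"
  shows "poly (cell_poly N a c) (of_real \<mu>) ~= 0"
proof -
  have "poly (lin_factor i (int k - int N)) (of_real \<mu>) ~= 0" if i: "i \<in> I" and k: "k < a i + N" for i k
  proof -
    have "real k + 1 \<le> real (a i) + real N" using k by linarith
    hence "real (e i) * \<mu> - of_int (int k - int N) ~= 0" using assms[OF i] by simp
    hence "complex_of_real (real (e i) * \<mu> - of_int (int k - int N)) ~= 0" unfolding of_real_eq_0_iff .
    thus ?thesis by (simp add: poly_lin_factor)
  qed
  thus ?thesis unfolding cell_poly_eq by (auto simp: poly_prod)
qed

lemma V_ideal_0 [simp]: "0 \<in> V_ideal a" unfolding V_ideal_def by (auto intro!: exI[of _ 0])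

lemma V_ideal_add: assumes "P \<in> V_ideal a" "Q \<in> V_ideal a" shows "P + Q \<in> V_ideal a"
proof -
  obtain P' n where P: "ord_le n P'" "P - mop (xmon a) * P' \<in> E_ideal" using assms(1) by (auto simp: V_ideal_def)
  obtain Q' m where Q: "ord_le m Q'" "Q - mop (xmon a) * Q' \<in> E_ideal" using assms(2) by (auto simp: V_ideal_def)
  have "P + Q - mop (xmon a) * (P' + Q') = (P - mop (xmon a) * P') + (Q - mop (xmon a) * Q')"
    by (simp add: algebra_simps)
  also have "\<dots> \<in> E_ideal" by (rule E_ideal_add[OF P(2) Q(2)])
  finally have "P + Q - mop (xmon a) * (P' + Q') \<in> E_ideal" .
  moreover have "ord_le (max n m) (P' + Q')"
    by (intro ord_le.add ord_le_mono[OF P(1)] ord_le_mono[OF Q(1)]) auto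
  ultimately show ?thesis unfolding V_ideal_def by blast
qed

lemma V_ideal_order: assumes "P \<in> V_ideal a" obtains n where "ord_le n P"
proof -
  obtain P' n where P: "ord_le n P'" "P - mop (xmon a) * P' \<in> E_ideal" using assms(1) by (auto simp: V_ideal_def)
  obtain m where m: "ord_le m (P - mop (xmon a) * P')" by (rule E_ideal_order[OF P(2)])
  have "ord_le (max n m) ((P - mop (xmon a) * P') + mop (xmon a) * P')"
    by (intro ord_le.add ord_le_mono[OF m] ord_le_mono[OF ord_le_mop_left[OF P(1)]]) auto
  thus thesis by (intro that) simp
qed

lemma poly_op_gpoly': "ord_le n Q ==> poly_op (gpoly r) Q = cpoly_op r * Q"
  using poly_op_gpoly[of n Q 1 r] by simp

lemma V_ideal_cpoly_op: assumes "P \<in> V_ideal a" shows "cpoly_op r * P \<in> V_ideal a"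
proof -
  obtain P' n where P: "ord_le n P'" "P - mop (xmon a) * P' \<in> E_ideal" using assms(1) by (auto simp: V_ideal_def)
  obtain Q where Q: "poly_op (gpoly r) (mop (xmon a) * P') = mop (xmon a) * Q"
    "ord_le (degree (gpoly r :: 'm germ poly) + n) Q"
    using poly_op_xmon[OF P(1), of "gpoly r"] by blast
  have "cpoly_op r * P - mop (xmon a) * Q = cpoly_op r * (P - mop (xmon a) * P')"
    unfolding Q(1)[symmetric] poly_op_gpoly'[OF ord_le_mop_left[OF P(1)]] by (simp only: right_diff_distrib)
  also have "\<dots> \<in> E_ideal" by (rule E_ideal_cpoly_op[OF P(2)])
  finally show ?thesis using Q(2) unfolding V_ideal_def by blast
qed

lemma cpoly_op_const: "cpoly_op [:k:] = const_op k" by (simp add: cpoly_op_pCons)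

lemma V_ideal_const_op: "P \<in> V_ideal a ==> const_op k * P \<in> V_ideal a"
  using V_ideal_cpoly_op[of P a "[:k:]"] by (simp add: cpoly_op_const)

lemma V_ideal_uminus: "P \<in> V_ideal a ==> - P \<in> V_ideal a"
  using V_ideal_const_op[of P a "- 1"] by (simp add: const_op_simps)

lemma cpoly_op_lin_root: "cpoly_op (lin_root \<mu>) = s_op - const_op \<mu>"
  by (simp add: cpoly_op_pCons const_op_simps)

lemma tpoly_cpoly_op:
  assumes "ord_le n Q" obtains N0 where
    "!!N. N \<ge> N0 ==> ord_le N (cpoly_op r * Q) \<and> tpoly N (cpoly_op r * Q) = gpoly r * tpoly N Q"
proof (rule that)
  fix N assume N: "N \<ge> degree (gpoly r :: 'm germ poly) + n"
  show "ord_le N (cpoly_op r * Q) \<and> tpoly N (cpoly_op r * Q) = gpoly r * tpoly N Q"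
    using ord_le_poly_op[OF assms, of "gpoly r" N] tpoly_poly_op[OF assms, of "gpoly r" N N] N
    unfolding poly_op_gpoly'[OF assms] by auto
qed

lemma V_criterion_mono:
  assumes "V_criterion N b f" "!!i. i \<in> I ==> a i \<le> b i" shows "V_criterion N a f"
  using assms cell_poly_mono[of a b N] gpoly_dvd unfolding V_criterion_def by (meson dvd_trans)

text \<open>(s - \<mu>)^k is coprime to every polynomial in the criterion for a, so it can be
  cancelled from the divisibility conditions satisfied by its product with the transform.\<close>

lemma gen_eigen_in_V_ideal:
  assumes P: "ord_le n P" "(s_op - const_op (of_real \<mu>)) ^ k * P \<in> V_ideal e"
    and a: "!!i. i \<in> I ==> a i \<le> e i" "!!i. i \<in> I ==> real (a i) < real (e i) * \<mu> + 1"
  shows "P \<in> V_ideal a"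
proof -
  let ?r = "lin_root (of_real \<mu>) ^ k"
  have "cpoly_op ?r * P \<in> V_ideal e" using P(2) by (simp only: cpoly_op_power cpoly_op_lin_root)
  then obtain N1 where N1: "!!N. N \<ge> N1 ==> ord_le N (cpoly_op ?r * P) \<and> V_criterion N e (tpoly N (cpoly_op ?r * P))"
    using V_ideal_criterion[of "cpoly_op ?r * P" e] by blast
  obtain N2 where N2: "!!N. N \<ge> N2 ==> ord_le N (cpoly_op ?r * P) \<and> tpoly N (cpoly_op ?r * P) = gpoly ?r * tpoly N P"
    using tpoly_cpoly_op[OF P(1)] by blast
  define N where "N = Max {n, N1, N2}"
  have N: "N \<ge> n" "N \<ge> N1" "N \<ge> N2" by (simp_all add: N_def)
  have "V_criterion N e (gpoly ?r * tpoly N P)" using N1[OF N(2)] N2[OF N(3)] by simp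
  hence c: "V_criterion N a (gpoly ?r * tpoly N P)" by (rule V_criterion_mono) (rule a(1))
  have "V_criterion N a (tpoly N P)" unfolding V_criterion_def
  proof
    fix c assume "c \<in> cells (%i. N + e i)"
    hence "gpoly (cell_poly N a c) dvd gpoly ?r * poly_cell (%i. N + e i) c (tpoly N P)"
      using c by (simp only: V_criterion_def poly_cell_const_mult)
    moreover have "coprime (cell_poly N a c) ?r"
      by (rule coprime_lin_root_power[OF poly_cell_poly_neq_0[OF a(2)]])
    ultimately show "gpoly (cell_poly N a c) dvd poly_cell (%i. N + e i) c (tpoly N P)"
      by (rule gpoly_coprime_dvd[rotated])
  qed
  thus ?thesis using V_criterion_imp_ideal ord_le_mono[OF P(1) N(1)] by blast
qed

text \<open>The roots by which the criterion for e can exceed the one for a are the k / e_i with a_i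
  \<le> k < e_i; multiplying by all these factors fulfils the stronger conditions. The polynomial
  bounds the possible eigenvalues of s on the quotient.\<close>

lemma V_ideal_annihilate:
  assumes P: "P \<in> V_ideal a" and a: "!!i. i \<in> I ==> a i \<le> e i"
  shows "cpoly_op (\<Prod>i\<in>I. \<Prod>k\<in>{a i..<e i}. lin_factor i (int k)) * P \<in> V_ideal e"
proof -
  let ?r = "\<Prod>i\<in>I. \<Prod>k\<in>{a i..<e i}. lin_factor i (int k)"
  obtain n where n: "ord_le n P" by (rule V_ideal_order[OF P])
  obtain N1 where N1: "!!N. N \<ge> N1 ==> ord_le N P \<and> V_criterion N a (tpoly N P)"
    using V_ideal_criterion[OF P a] by blast
  obtain N2 where N2: "!!N. N \<ge> N2 ==> ord_le N (cpoly_op ?r * P) \<and> tpoly N (cpoly_op ?r * P) = gpoly ?r * tpoly N P"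
    using tpoly_cpoly_op[OF n] by blast
  define N where "N = max N1 N2"
  have N: "N \<ge> N1" "N \<ge> N2" by (simp_all add: N_def)
  have dvd: "cell_poly N e c dvd ?r * cell_poly N a c" for c
  proof -
    have "(\<Prod>k\<in>{c i..<e i + N}. lin_factor i (int k - int N)) dvd
        (\<Prod>k\<in>{a i..<e i}. lin_factor i (int k)) * (\<Prod>k\<in>{c i..<a i + N}. lin_factor i (int k - int N))" for i
    proof -
      have "(\<Prod>k\<in>{c i..<e i + N}. lin_factor i (int k - int N)) dvd
          (\<Prod>k\<in>{a i + N..<e i + N} \<union> {c i..<a i + N}. lin_factor i (int k - int N))"
        by (rule prod_dvd_prod_subset) auto
      also have "\<dots> = (\<Prod>k\<in>{a i + N..<e i + N}. lin_factor i (int k - int N)) * (\<Prod>k\<in>{c i..<a i + N}. lin_factor i (int k - int N))"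
        by (rule prod.union_disjoint) auto
      also have "(\<Prod>k\<in>{a i + N..<e i + N}. lin_factor i (int k - int N)) = (\<Prod>k\<in>{a i..<e i}. lin_factor i (int k))"
        by (simp add: prod.shift_bounds_nat_ivl)
      finally show ?thesis .
    qed
    thus ?thesis unfolding cell_poly_eq prod.distrib[symmetric] by (rule prod_dvd_prod)
  qed
  have "V_criterion N e (gpoly ?r * tpoly N P)" unfolding V_criterion_def poly_cell_const_mult
  proof
    fix c assume "c \<in> cells (%i. N + e i)"
    hence "gpoly (cell_poly N a c) dvd poly_cell (%i. N + e i) c (tpoly N P)"
      using N1[OF N(1)] by (auto simp: V_criterion_def)
    hence "gpoly (?r * cell_poly N a c) dvd gpoly ?r * poly_cell (%i. N + e i) c (tpoly N P)"
      unfolding gpoly_mult by (rule mult_dvd_mono[OF dvd_refl])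
    thus "gpoly (cell_poly N e c) dvd gpoly ?r * poly_cell (%i. N + e i) c (tpoly N P)"
      using gpoly_dvd[OF dvd] dvd_trans by blast
  qed
  thus ?thesis using V_criterion_imp_ideal[of N "cpoly_op ?r * P" e] N2[OF N(2)] by simp
qed

text \<open>Bezout between the factor at one root and the product of the others splits P into a part
  killed by a power of s - \<mu> and a part for the remaining roots. The target T is any additive
  set containing \<open>V_ideal b\<close>, so a span is bounded without being formed.\<close>

lemma primary_decomposition:
  assumes "finite S" "ord_le n P" "cpoly_op (\<Prod>\<mu>\<in>S. lin_root (of_real \<mu>) ^ k \<mu>) * P \<in> V_ideal b"
    and T: "0 \<in> T" "!!P Q. P \<in> T ==> Q \<in> T ==> P + Q \<in> T" "V_ideal b \<subseteq> T"
    and eig: "!!\<mu> n k P. \<mu> \<in> S ==> ord_le n P ==> (s_op - const_op (of_real \<mu>)) ^ k * P \<in> V_ideal b ==> P \<in> T"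
  shows "P \<in> T" using assms(1-3) eig
proof (induction S arbitrary: n P rule: finite_induct)
  case empty
  hence "P \<in> V_ideal b" by (simp only: prod.empty cpoly_op_1 mult_1)
  thus ?case using T(3) by (rule subsetD[rotated])
next
  case (insert \<mu> S)
  let ?l = "lin_root (of_real \<mu>) ^ k \<mu>" and ?B = "\<Prod>\<mu>\<in>S. lin_root (of_real \<mu>) ^ k \<mu>"
  have "poly ?B (of_real \<mu>) ~= 0" 
    unfolding poly_prod poly_power prod_zero_iff[OF insert.hyps(1)] using insert.hyps(2) by fastforce
  hence "coprime ?B ?l" by (rule coprime_lin_root_power)
  then obtain u v where uv: "u * ?B + v * ?l = 1"
    using bezout_coefficients_fst_snd[of ?B ?l] unfolding coprime_iff_gcd_eq_1 by force
  have ann: "cpoly_op (?l * ?B) * P \<in> V_ideal b" using insert.prems(2) unfolding prod.insert[OF insert.hyps] .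
  have P: "P = cpoly_op (u * ?B) * P + cpoly_op (v * ?l) * P"
    unfolding distrib_right[symmetric] cpoly_op_add[symmetric] uv cpoly_op_1 by (rule mult_1[symmetric])
  obtain m1 where m1: "ord_le m1 (cpoly_op (u * ?B) * P)" using ord_le_cpoly_op[OF insert.prems(1)] by blast
  obtain m2 where m2: "ord_le m2 (cpoly_op (v * ?l) * P)" using ord_le_cpoly_op[OF insert.prems(1)] by blast
  have "(s_op - const_op (of_real \<mu>)) ^ k \<mu> * (cpoly_op (u * ?B) * P) = cpoly_op ?l * (cpoly_op (u * ?B) * P)"
    by (simp only: cpoly_op_power cpoly_op_lin_root)
  also have "\<dots> = cpoly_op u * (cpoly_op (?l * ?B) * P)"
    unfolding mult.assoc[symmetric] cpoly_op_mult[symmetric] by (simp only: mult.commute[of ?l] mult.left_commute)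
  also have "\<dots> \<in> V_ideal b" by (rule V_ideal_cpoly_op[OF ann])
  finally have "(s_op - const_op (of_real \<mu>)) ^ k \<mu> * (cpoly_op (u * ?B) * P) \<in> V_ideal b" .
  hence 1: "cpoly_op (u * ?B) * P \<in> T" by (rule insert.prems(3)[OF insertI1 m1])
  have "cpoly_op ?B * (cpoly_op (v * ?l) * P) = cpoly_op v * (cpoly_op (?l * ?B) * P)"
    by (simp only: mult.assoc[symmetric] cpoly_op_mult[symmetric]) (simp only: mult_ac)
  also have "\<dots> \<in> V_ideal b" by (rule V_ideal_cpoly_op[OF ann])
  finally have "cpoly_op ?B * (cpoly_op (v * ?l) * P) \<in> V_ideal b" .
  hence 2: "cpoly_op (v * ?l) * P \<in> T" by (rule insert.IH[OF m2]) (rule insert.prems(3)[OF insertI2])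
  show ?case by (subst P) (rule T(2)[OF 1 2])
qed

lemma V_ideal_subset_eigen_span:
  assumes P: "P \<in> V_ideal a" and a: "!!i. i \<in> I ==> a i \<le> e i"
    and T: "0 \<in> T" "!!P Q. P \<in> T ==> Q \<in> T ==> P + Q \<in> T" "V_ideal e \<subseteq> T"
    and eig: "!!i k n l P. i \<in> I ==> a i \<le> k ==> ord_le n P ==>
      (s_op - const_op (of_real (real k / real (e i)))) ^ l * P \<in> V_ideal e ==> P \<in> T"
  shows "P \<in> T"
proof -
  define K where "K = (SIGMA i:I. {a i..<e i})"
  define \<mu> where "\<mu> = (%(i, k). real k / real (e i))"
  define S where "S = \<mu> ` K"
  \<comment> \<open>Roots k / e_i belonging to different branches may coincide; the multiplicity
    counts the pairs (i, k) with a given root.\<close>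
  define m where "m = (%y. card {t \<in> K. \<mu> t = y})"
  have finK: "finite K" by (auto simp: K_def)
  have lf: "lin_factor i (int k) = smult (of_nat (e i)) (lin_root (of_real (\<mu> (i, k))))" if "i \<in> I" for i k
    using e_pos[OF that] by (simp add: lin_factor_def \<mu>_def)
  define \<kappa> :: complex where "\<kappa> = (\<Prod>(i, k)\<in>K. of_nat (e i))"
  have \<kappa>: "\<kappa> ~= 0" unfolding \<kappa>_def prod_zero_iff[OF finK] using e_pos by (fastforce simp: K_def)
  have "(\<Prod>i\<in>I. \<Prod>k\<in>{a i..<e i}. lin_factor i (int k)) = (\<Prod>(i, k)\<in>K. lin_factor i (int k))"
    unfolding K_def by (rule prod.Sigma) auto
  also have "\<dots> = (\<Prod>t\<in>K. smult (case t of (i, k) => of_nat (e i)) (lin_root (of_real (\<mu> t))))"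
    by (rule prod.cong) (auto simp: K_def lf simp del: smult_pCons)
  also have "\<dots> = smult \<kappa> (\<Prod>t\<in>K. lin_root (of_real (\<mu> t)))" by (simp only: prod_smult \<kappa>_def)
  also have "(\<Prod>t\<in>K. lin_root (of_real (\<mu> t))) = (\<Prod>y\<in>S. lin_root (of_real y) ^ m y)"
    unfolding S_def m_def by (subst prod.image_gen[OF finK, of _ \<mu>]) (intro prod.cong refl, simp)
  finally have B: "(\<Prod>i\<in>I. \<Prod>k\<in>{a i..<e i}. lin_factor i (int k)) = smult \<kappa> (\<Prod>y\<in>S. lin_root (of_real y) ^ m y)" .
  have "cpoly_op (smult \<kappa> (\<Prod>y\<in>S. lin_root (of_real y) ^ m y)) * P \<in> V_ideal e"
    using V_ideal_annihilate[OF P a] unfolding B .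
  from V_ideal_const_op[OF this, of "inverse \<kappa>"]
  have ann: "cpoly_op (\<Prod>y\<in>S. lin_root (of_real y) ^ m y) * P \<in> V_ideal e"
    using \<kappa> by (simp only: mult.assoc[symmetric] cpoly_op_smult[symmetric]) simp
  obtain n where n: "ord_le n P" by (rule V_ideal_order[OF P])
  show ?thesis
  proof (rule primary_decomposition[OF _ n ann T])
    show "finite S" using finK by (simp add: S_def)
    fix y n l P assume "y \<in> S" and P: "ord_le n P" "(s_op - const_op (of_real y)) ^ l * P \<in> V_ideal e"
    then obtain i k where ik: "i \<in> I" "a i \<le> k" "y = real k / real (e i)" by (auto simp: S_def K_def \<mu>_def)
    show "P \<in> T" by (rule eig[OF ik(1,2) P[unfolded ik(3)]])
  qed
qed

text \<open>Each i in J contributes the new factor e_i s - a_i = e_i (s - \<alpha>), provided c_i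
  \<le> a_i + N; for larger c_i the range of k stays empty. \<kappa> collects the constants
  e_i.\<close>

lemma cell_poly_step:
  assumes J: "J \<subseteq> I" "!!i. i \<in> J ==> b i = Suc (a i) \<and> real (a i) = real (e i) * \<alpha>" "!!i. i \<in> I - J ==> b i = a i"
  obtains \<kappa> where "\<kappa> ~= 0"
    "cell_poly N b c = smult \<kappa> (cell_poly N a c * lin_root (of_real \<alpha>) ^ card {i \<in> J. c i \<le> a i + N})"
proof -
  let ?J = "{i \<in> J. c i \<le> a i + N}"
  define \<kappa> :: complex where "\<kappa> = (\<Prod>i\<in>?J. of_nat (e i))"
  have finJ: "finite ?J" by simp
  have "(\<Prod>k\<in>{c i..<b i + N}. lin_factor i (int k - int N)) =
      (\<Prod>k\<in>{c i..<a i + N}. lin_factor i (int k - int N)) * (if i \<in> ?J then lin_factor i (int (a i)) else 1)"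
    if "i \<in> I" for i using J(2)[of i] J(3)[of i] that by (cases "i \<in> J") auto
  hence "cell_poly N b c = cell_poly N a c * (\<Prod>i\<in>I. if i \<in> ?J then lin_factor i (int (a i)) else 1)"
    unfolding cell_poly_eq by (simp add: prod.distrib cong: prod.cong)
  also have "(\<Prod>i\<in>I. if i \<in> ?J then lin_factor i (int (a i)) else 1) = (\<Prod>i\<in>?J. lin_factor i (int (a i)))"
    using J(1) by (subst prod.inter_restrict[symmetric]) (auto intro!: prod.cong)
  also have "\<dots> = (\<Prod>i\<in>?J. smult (of_nat (e i)) (lin_root (of_real \<alpha>)))"
  proof (rule prod.cong[OF refl])
    fix i assume "i \<in> ?J"
    hence "of_nat (a i) = of_nat (e i) * complex_of_real \<alpha>"
      using J(2)[of i] by (metis (no_types, lifting) mem_Collect_eq of_real_mult of_real_of_nat_eq)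
    thus "lin_factor i (int (a i)) = smult (of_nat (e i)) (lin_root (of_real \<alpha>))"
      by (simp add: lin_factor_def)
  qed
  also have "\<dots> = smult \<kappa> (lin_root (of_real \<alpha>) ^ card ?J)" by (simp only: prod_smult prod_constant \<kappa>_def)
  finally have "cell_poly N b c = smult \<kappa> (cell_poly N a c * lin_root (of_real \<alpha>) ^ card ?J)"
    by (simp only: mult_smult_right)
  moreover have "\<kappa> ~= 0" unfolding \<kappa>_def using e_pos J(1) by (force simp: prod_zero_iff)
  ultimately show thesis by (intro that)
qed

text \<open>Cells on which \<open>(s - \<alpha>)\<^sup>r\<close> divides the new factor of the Bernstein polynomial lie in \<open>V_ideal b\<close>
  or can be divided by \<open>(s - \<alpha>)\<^sup>r\<close>; the quotient has the right order.\<close>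
theorem strictness:
  assumes ab: "!!i. i \<in> I ==> a i \<le> b i" "!!i. i \<in> I ==> b i \<le> e i"
    and J: "J \<subseteq> I" "!!i. i \<in> J ==> b i = Suc (a i) \<and> real (a i) = real (e i) * \<alpha>" "!!i. i \<in> I - J ==> b i = a i"
    and a: "!!i. i \<in> I ==> real (a i) < real (e i) * \<alpha> + 1"
    and P: "ord_le n P" "P \<in> V_ideal a" and Q: "Q \<in> V_ideal a"
    and PQ: "P - (s_op - const_op (of_real \<alpha>)) ^ r * Q \<in> V_ideal b"
  shows "\<exists>Q'. Q' \<in> V_ideal a \<and> (if r \<le> n then ord_le (n - r) Q' else Q' = 0) \<and>
    P - (s_op - const_op (of_real \<alpha>)) ^ r * Q' \<in> V_ideal b"
proof -
  let ?l = "lin_root (of_real \<alpha>)" and ?L = "s_op - const_op (of_real \<alpha>)"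
  have ae: "a i \<le> e i" if "i \<in> I" for i using ab that by (meson order_trans)
  have lr: "cpoly_op (?l ^ r) = ?L ^ r" by (simp only: cpoly_op_power cpoly_op_lin_root)
  obtain nQ where nQ: "ord_le nQ Q" by (rule V_ideal_order[OF Q])
  obtain N1 where N1: "!!N. N \<ge> N1 ==> ord_le N P \<and> V_criterion N a (tpoly N P)"
    using V_ideal_criterion[OF P(2) ae] by blast
  obtain N2 where N2: "!!N. N \<ge> N2 ==> ord_le N Q \<and> V_criterion N a (tpoly N Q)"
    using V_ideal_criterion[OF Q ae] by blast
  obtain N3 where N3: "!!N. N \<ge> N3 ==> ord_le N (P - ?L ^ r * Q) \<and> V_criterion N b (tpoly N (P - ?L ^ r * Q))"
    using V_ideal_criterion[OF PQ ab(2)] by blast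
  obtain N4 where N4: "!!N. N \<ge> N4 ==> ord_le N (?L ^ r * Q) \<and> tpoly N (?L ^ r * Q) = gpoly (?l ^ r) * tpoly N Q"
    using tpoly_cpoly_op[OF nQ, of "?l ^ r"] unfolding lr by blast
  define N where "N = Max {n, N1, N2, N3, N4}"
  have N: "N \<ge> n" "N \<ge> N1" "N \<ge> N2" "N \<ge> N3" "N \<ge> N4" by (simp_all add: N_def)
  let ?M = "%i. N + e i"
  define C where "C = cells ?M"
  define f where "f = tpoly N P"
  define h where "h = tpoly N Q"
  define v where "v = tpoly N (P - ?L ^ r * Q)"
  have v: "v = f - gpoly (?l ^ r) * h"
    unfolding v_def f_def h_def using N1[OF N(2)] N4[OF N(5)] by (simp add: tpoly_diff)
  have crit: "gpoly (cell_poly N a c) dvd poly_cell ?M c f" "gpoly (cell_poly N a c) dvd poly_cell ?M c h"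
    "gpoly (cell_poly N b c) dvd poly_cell ?M c v" if "c \<in> C" for c
    using N1[OF N(2)] N2[OF N(3)] N3[OF N(4)] that by (auto simp: V_criterion_def C_def f_def h_def v_def)
  define m where "m = (%c. card {i \<in> J. c i \<le> a i + N})"
  \<comment> \<open>f is (s - \<alpha>)^r h up to v, and v satisfies the stronger criterion for b.
    The task is to replace h by a polynomial of the right degree, cell by cell.\<close>
  have fcell: "poly_cell ?M c f = poly_cell ?M c v + gpoly (?l ^ r) * poly_cell ?M c h" for c
    by (simp add: v poly_cell_diff poly_cell_const_mult)
  have b_dvd: "cell_poly N b c dvd cell_poly N a c * ?l ^ m c" "cell_poly N a c * ?l ^ m c dvd cell_poly N b c" for c
  proof -
    obtain \<kappa> where "\<kappa> ~= 0" "cell_poly N b c = smult \<kappa> (cell_poly N a c * ?l ^ m c)"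
      using cell_poly_step[OF J, of N c] unfolding m_def by blast
    thus "cell_poly N b c dvd cell_poly N a c * ?l ^ m c" "cell_poly N a c * ?l ^ m c dvd cell_poly N b c"
      by (simp_all add: smult_dvd dvd_smult)
  qed
  \<comment> \<open>At least r of the new factors are present here, so (s - \<alpha>)^r divides the
    cell of v and therefore that of f. It is coprime to the criterion for a, hence the quotient
    still meets that criterion, and its degree is lower by r.\<close>
  have big: "\<exists>g. poly_cell ?M c f = gpoly (?l ^ r) * g \<and> gpoly (cell_poly N a c) dvd g \<and> poly_cell ?M c g = g \<and>
      (g ~= 0 \<longrightarrow> degree g + r \<le> n)" if c: "c \<in> C" and m: "m c \<ge> r" for c
  proof -
    have "?l ^ r dvd cell_poly N b c" using dvd_trans[OF dvd_mult[OF le_imp_power_dvd[OF m]] b_dvd(2)] .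
    hence "gpoly (?l ^ r) dvd poly_cell ?M c v" using crit(3)[OF c] gpoly_dvd dvd_trans by blast
    hence "gpoly (?l ^ r) dvd poly_cell ?M c f" unfolding fcell by (intro dvd_add) auto
    then obtain g where g: "poly_cell ?M c f = gpoly (?l ^ r) * g" by (rule dvdE)
    have nz: "gpoly (?l ^ r) ~= (0 :: 'm germ poly)" by simp
    have "gpoly (cell_poly N a c) dvd gpoly (?l ^ r) * g" using crit(1)[OF c] g by simp
    moreover have "coprime (cell_poly N a c) (?l ^ r)"
      by (rule coprime_lin_root_power, rule poly_cell_poly_neq_0, rule a)
    ultimately have 1: "gpoly (cell_poly N a c) dvd g" by (rule gpoly_coprime_dvd[rotated])
    have "gpoly (?l ^ r) * poly_cell ?M c g = poly_cell ?M c (poly_cell ?M c f)"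
      unfolding g poly_cell_const_mult ..
    also have "\<dots> = gpoly (?l ^ r) * g" using c by (simp add: poly_cell_orth C_def g[symmetric])
    finally have 2: "poly_cell ?M c g = g" using nz by (simp only: mult_cancel_left) simp
    have "degree g + r \<le> n" if "g ~= 0"
    proof -
      have "degree (gpoly (?l ^ r) * g) = r + degree g"
        using nz that by (subst degree_mult_eq) (simp_all add: degree_power_eq)
      moreover have "degree (poly_cell ?M c f) \<le> n"
        using degree_poly_cell[of ?M c f] degree_tpoly[OF P(1) N(1)] unfolding f_def by linarith
      ultimately show ?thesis unfolding g by simp
    qed
    thus ?thesis using g 1 2 by blast
  qed
  define g where "g = (%c. if m c \<ge> r then (SOME g. poly_cell ?M c f = gpoly (?l ^ r) * g \<and>
    gpoly (cell_poly N a c) dvd g \<and> poly_cell ?M c g = g \<and> (g ~= 0 \<longrightarrow> degree g + r \<le> n)) else 0)"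
  have g: "poly_cell ?M c f = gpoly (?l ^ r) * g c \<and> gpoly (cell_poly N a c) dvd g c \<and> poly_cell ?M c (g c) = g c \<and>
      (g c ~= 0 \<longrightarrow> degree (g c) + r \<le> n)" if "c \<in> C" "m c \<ge> r" for c
    using someI_ex[OF big[OF that]] that(2) unfolding g_def by simp
  have g0: "g c = 0" if "\<not> m c \<ge> r" for c using that by (simp add: g_def)
  define G where "G = (\<Sum>c\<in>C. g c)"
  have G: "poly_cell ?M c G = g c" if c: "c \<in> C" for c
  proof -
    have "poly_cell ?M c (g c') = (if c' = c then g c else 0)" if c': "c' \<in> C" for c'
    proof (cases "m c' \<ge> r")
      case True
      have "poly_cell ?M c (g c') = poly_cell ?M c (poly_cell ?M c' (g c'))" using g[OF c' True] by simp
      also have "\<dots> = (if c = c' then poly_cell ?M c (g c') else 0)" using c c' by (simp add: poly_cell_orth C_def)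
      finally show ?thesis using g[OF c' True] by auto
    qed (use g0 in auto)
    hence "poly_cell ?M c G = (\<Sum>c'\<in>C. if c' = c then g c else 0)"
      unfolding G_def poly_cell_sum_arg by (intro sum.cong) auto
    thus ?thesis using c by (simp add: C_def)
  qed
  have GA: "V_criterion N a G" unfolding V_criterion_def C_def[symmetric]
  proof
    fix c assume c: "c \<in> C"
    show "gpoly (cell_poly N a c) dvd poly_cell ?M c G"
      using g[OF c] g0[of c] G[OF c] by (cases "m c \<ge> r") auto
  qed
  have rest: "V_criterion N b (f - gpoly (?l ^ r) * G)" unfolding V_criterion_def C_def[symmetric]
  proof
    fix c assume c: "c \<in> C"
    have eq: "poly_cell ?M c (f - gpoly (?l ^ r) * G) = poly_cell ?M c f - gpoly (?l ^ r) * g c"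
      by (simp add: poly_cell_diff poly_cell_const_mult G[OF c])
    show "gpoly (cell_poly N b c) dvd poly_cell ?M c (f - gpoly (?l ^ r) * G)"
    proof (cases "m c \<ge> r")
      case True
      thus ?thesis unfolding eq using g[OF c True] by simp
    next
      case False
      \<comment> \<open>With fewer than r new factors, (s - \<alpha>)^r h already contains all of
        them, so this cell of f satisfies the criterion for b and 0 is an admissible
        quotient.\<close>
      have "gpoly (cell_poly N a c * ?l ^ m c) dvd gpoly (?l ^ r) * poly_cell ?M c h"
        unfolding gpoly_mult mult.commute[of "gpoly (cell_poly N a c)"]
        using False by (intro mult_dvd_mono gpoly_dvd le_imp_power_dvd crit(2)[OF c]) simp
      hence "gpoly (cell_poly N b c) dvd gpoly (?l ^ r) * poly_cell ?M c h"
        using gpoly_dvd[OF b_dvd(1)] dvd_trans by blast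
      hence "gpoly (cell_poly N b c) dvd poly_cell ?M c f" unfolding fcell using crit(3)[OF c] by (rule dvd_add[rotated])
      thus ?thesis unfolding eq using g0[OF False] by simp
    qed
  qed
  have degG: "r \<le> n \<and> degree G \<le> n - r" if "G ~= 0"
  proof -
    have "\<exists>c\<in>C. g c ~= 0" using that unfolding G_def by (meson sum.neutral)
    then obtain c where "c \<in> C" "g c ~= 0" by blast
    hence "r \<le> n" using g[of c] g0[of c] by (cases "m c \<ge> r") auto
    moreover have "degree (g c) \<le> n - r" if "c \<in> C" for c
      using g[OF that] g0[of c] by (cases "m c \<ge> r"; cases "g c = 0") auto
    ultimately show ?thesis unfolding G_def by (auto intro!: degree_sum_le simp: C_def)
  qed
  have fin: "P - ?L ^ r * Q' \<in> V_ideal b" if Q': "ord_le N (?L ^ r * Q')" "tpoly N (?L ^ r * Q') = gpoly (?l ^ r) * G" for Q'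
    by (rule V_criterion_imp_ideal[of N]) (use Q' N1[OF N(2)] rest in \<open>simp_all add: ord_le_diff tpoly_diff f_def\<close>)
  show ?thesis
  proof (cases "G = 0")
    case True
    \<comment> \<open>This case contains r > n, where no order below 0 is available: P then lies in
      \<open>V_ideal b\<close> and Q' = 0 serves.\<close>
    hence "P \<in> V_ideal b" using fin[of 0] by simp
    thus ?thesis by (intro exI[of _ 0]) simp
  next
    case False
    hence rn: "r \<le> n" and d: "degree G \<le> n - r" using degG by auto
    have nN: "n - r \<le> N" using N(1) by simp
    obtain Q0 where Q0: "ord_le (n - r) Q0" "tpoly N (mop (xmon a) * Q0) = G"
      by (rule V_criterion_realize[OF GA d nN])
    let ?Q' = "mop (xmon a) * Q0"
    have oQ: "ord_le (n - r) ?Q'" by (rule ord_le_mop_left[OF Q0(1)])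
    have "?Q' \<in> V_ideal a" using Q0(1) unfolding V_ideal_def by (auto intro!: exI[of _ Q0])
    moreover have "P - ?L ^ r * ?Q' \<in> V_ideal b"
    proof (rule fin)
      have deg: "degree (gpoly (?l ^ r) :: 'm germ poly) + (n - r) \<le> N"
        using N(1) rn by (simp add: degree_power_eq)
      show "ord_le N (?L ^ r * ?Q')"
        using ord_le_poly_op[OF oQ deg] unfolding poly_op_gpoly'[OF oQ] lr .
      show "tpoly N (?L ^ r * ?Q') = gpoly (?l ^ r) * G"
        using tpoly_poly_op[OF oQ deg order_refl] unfolding poly_op_gpoly'[OF oQ] lr Q0(2) .
    qed
    ultimately show ?thesis using oQ rn by (intro exI[of _ ?Q']) simp
  qed
qed

end

subsection \<open>Meromorphic germs\<close>

lemma to_mero_0 [simp]: "to_mero 0 = 0" and to_mero_1 [simp]: "to_mero 1 = 1"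
  by (simp_all add: to_mero_def Zero_fract_def One_fract_def)

lemma to_mero_add: "to_mero (a + b) = to_mero a + to_mero b" by (simp add: to_mero_def)

lemma to_mero_mult: "to_mero (a * b) = to_mero a * to_mero b" by (simp add: to_mero_def)

lemma to_mero_uminus: "to_mero (- a) = - to_mero a" by (simp add: to_mero_def)

lemma to_mero_sum: "to_mero (sum f S) = (\<Sum>i\<in>S. to_mero (f i))"
  by (induction S rule: infinite_finite_induct) (simp_all add: to_mero_add)

lemma to_mero_eq_iff [simp]: "to_mero a = to_mero b \<longleftrightarrow> a = b" by (simp add: to_mero_def eq_fract)

lemma to_mero_eq_0_iff [simp]: "to_mero a = 0 \<longleftrightarrow> a = 0"
  using to_mero_eq_iff[of a 0] by (simp del: to_mero_eq_iff)

lemma Fract_to_mero: "b ~= 0 ==> Fract a b = to_mero a / to_mero b" by (simp add: to_mero_def)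

lemma germ_pd_0 [simp]: "germ_pd i 0 = 0" and germ_pd_1 [simp]: "germ_pd i 1 = 0"
  using germ_pd_const[of i 0] germ_pd_const[of i 1] by simp_all

lemma germ_pd_minus: "germ_pd i (- a) = - germ_pd i a"
  using germ_pd_add[of i a "- a"] by (simp add: eq_neg_iff_add_eq_0 add.commute)

text \<open>\<open>mero_pd\<close> takes the value common to all fractions representing the
  function; that the quotient rule gives the same result for a / b = c / d follows by
  differentiating a d = c b.\<close>

lemma mero_pd_Fract:
  assumes "b ~= 0"
  shows "mero_pd i (Fract a b) = Fract (germ_pd i a * b - a * germ_pd i b) (b * b)" unfolding mero_pd_def
proof (rule the_equality)
  have aux: "(a' * b - a * b') * (d * d) = (c' * d - c * d') * (b * b)"
    if "a' * d = c' * b + c * b' - a * d'" "a * d = c * b" for a' b' c' d' c d :: "'a germ"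
  proof -
    have "(a' * b - a * b') * (d * d) = (a' * d) * (b * d) - (a * d) * (b' * d)" by (simp add: algebra_simps)
    also have "\<dots> = c' * b * b * d - (a * d) * (d' * b)" unfolding that(1) by (simp add: that(2) algebra_simps)
    also have "\<dots> = (c' * d - c * d') * (b * b)" unfolding that(2) by (simp add: algebra_simps)
    finally show ?thesis .
  qed
  show "\<forall>a' b'. b' ~= 0 \<and> Fract a b = Fract a' b' \<longrightarrow>
     Fract (germ_pd i a * b - a * germ_pd i b) (b * b) = Fract (germ_pd i a' * b' - a' * germ_pd i b') (b' * b')"
  proof (intro allI impI, elim conjE)
    fix c d assume d: "d ~= 0" "Fract a b = Fract c d"
    hence eq: "a * d = c * b" using assms by (simp add: eq_fract)
    have "germ_pd i a * d + a * germ_pd i d = germ_pd i c * b + c * germ_pd i b"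
      using arg_cong[OF eq, of "germ_pd i"] by (simp add: germ_pd_mult add.commute)
    hence "germ_pd i a * d = germ_pd i c * b + c * germ_pd i b - a * germ_pd i d" by (simp add: eq_diff_eq)
    hence "(germ_pd i a * b - a * germ_pd i b) * (d * d) = (germ_pd i c * d - c * germ_pd i d) * (b * b)"
      by (rule aux[OF _ eq])
    thus "Fract (germ_pd i a * b - a * germ_pd i b) (b * b) = Fract (germ_pd i c * d - c * germ_pd i d) (d * d)"
      using assms d by (simp add: eq_fract)
  qed
qed (use assms in blast)

lemma mero_pd_to_mero: "mero_pd i (to_mero a) = to_mero (germ_pd i a)"
  by (simp add: to_mero_def mero_pd_Fract)

lemma mero_pd_0 [simp]: "mero_pd i 0 = 0" and mero_pd_1 [simp]: "mero_pd i 1 = 0"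
  using mero_pd_to_mero[of i 0] mero_pd_to_mero[of i 1] by simp_all

lemma mero_pd_add: "mero_pd i (p + q) = mero_pd i p + mero_pd i q"
proof (cases p rule: Fract_cases, cases q rule: Fract_cases)
  fix a b c d assume [simp]: "p = Fract a b" "b ~= 0" "q = Fract c d" "d ~= 0"
  show ?thesis by (simp add: mero_pd_Fract germ_pd_add germ_pd_mult eq_fract algebra_simps)
qed

lemma mero_pd_mult: "mero_pd i (p * q) = mero_pd i p * q + p * mero_pd i q"
proof (cases p rule: Fract_cases, cases q rule: Fract_cases)
  fix a b c d assume [simp]: "p = Fract a b" "b ~= 0" "q = Fract c d" "d ~= 0"
  show ?thesis by (simp add: mero_pd_Fract germ_pd_add germ_pd_mult eq_fract algebra_simps)
qed

lemma mero_pd_minus: "mero_pd i (- p) = - mero_pd i p"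
  using mero_pd_add[of i p "- p"] by (simp add: eq_neg_iff_add_eq_0 add.commute)

lemma mero_pd_sum: "mero_pd i (sum f S) = (\<Sum>j\<in>S. mero_pd i (f j))"
  by (induction S rule: infinite_finite_induct) (simp_all add: mero_pd_add)

subsection \<open>Exterior calculus\<close>

definition fscale :: "'m mero => ('m::finite) form => 'm form" (infixr "*f" 75) where
  "(q *f \<beta>) J = q * \<beta> J"

definition unit_form :: "('m::finite) form" where
  "unit_form J = (if J = [] then 1 else 0)"

lemma fscale_simps [simp]:
  "0 *f \<beta> = 0" "1 *f \<beta> = \<beta>" "q *f 0 = 0" "q *f r *f \<beta> = (q * r) *f \<beta>" "(- q) *f \<beta> = - (q *f \<beta>)" "q *f (- \<beta>) = - (q *f \<beta>)"
  by (simp_all add: fun_eq_iff fscale_def mult.assoc)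

lemma fscale_add: "q *f (\<beta> + \<gamma>) = q *f \<beta> + q *f \<gamma>" "(q + r) *f \<beta> = q *f \<beta> + r *f \<beta>"
  by (simp_all add: fun_eq_iff fscale_def algebra_simps)

lemma fscale_sum: "q *f sum f S = (\<Sum>i\<in>S. q *f f i)"
  using sum_comp_morphism[of "(*f) q" f S] by (simp add: fscale_add o_def)

lemma fscale_sum_left: "sum f S *f \<beta> = (\<Sum>i\<in>S. f i *f \<beta>)"
  by (induction S rule: infinite_finite_induct) (simp_all add: fscale_add)

lemma sum_form_apply: "sum f S J = (\<Sum>i\<in>S. f i J)" for f :: "'i => ('m::finite) form"
  by (induction S rule: infinite_finite_induct) simp_all

lemma wedge_Nil [simp]: "wedge \<xi> \<beta> [] = 0" and ext_d_Nil [simp]: "ext_d \<beta> [] = 0"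
  by (simp_all add: wedge_def ext_d_def)

text \<open>Peeling off the first argument amounts to contracting with a coordinate field. With this
  recursion the identities of exterior calculus follow by induction on the argument list, without
  sums over permutations.\<close>

lemma wedge_Cons: "wedge \<xi> \<beta> (j # J) = \<xi> [j] * \<beta> J - wedge \<xi> (%K. \<beta> (j # K)) J"
  unfolding wedge_def length_Cons sum.lessThan_Suc_shift by (simp add: sum_negf)

lemma ext_d_Cons: "ext_d \<beta> (j # J) = mero_pd j (\<beta> J) - ext_d (%K. \<beta> (j # K)) J"
  unfolding ext_d_def length_Cons sum.lessThan_Suc_shift by (simp add: sum_negf)

lemma wedge_add: "wedge \<xi> (\<beta> + \<gamma>) = wedge \<xi> \<beta> + wedge \<xi> \<gamma>" "wedge (\<xi> + \<xi>') \<beta> = wedge \<xi> \<beta> + wedge \<xi>' \<beta>"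
  by (simp_all add: fun_eq_iff wedge_def sum.distrib algebra_simps)

lemma wedge_scale: "wedge \<xi> (q *f \<beta>) = q *f wedge \<xi> \<beta>" "wedge (q *f \<xi>) \<beta> = q *f wedge \<xi> \<beta>"
  by (simp_all add: fun_eq_iff wedge_def fscale_def sum_distrib_left mult_ac)

lemma wedge_0 [simp]: "wedge \<xi> 0 = 0" "wedge 0 \<beta> = 0" by (simp_all add: fun_eq_iff wedge_def)

lemma wedge_minus [simp]: "wedge \<xi> (- \<beta>) = - wedge \<xi> \<beta>" "wedge (- \<xi>) \<beta> = - wedge \<xi> \<beta>"
  by (simp_all add: fun_eq_iff wedge_def sum_negf)

lemma wedge_diff: "wedge \<xi> (\<beta> - \<gamma>) = wedge \<xi> \<beta> - wedge \<xi> \<gamma>" using wedge_add(1)[of \<xi> \<beta> "- \<gamma>"] by simp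

lemma wedge_sum: "wedge \<xi> (sum f S) = (\<Sum>i\<in>S. wedge \<xi> (f i))" "wedge (sum f S) \<beta> = (\<Sum>i\<in>S. wedge (f i) \<beta>)"
  by (induction S rule: infinite_finite_induct) (simp_all add: wedge_add)

lemma ext_d_add: "ext_d (\<beta> + \<gamma>) = ext_d \<beta> + ext_d \<gamma>"
  by (simp add: fun_eq_iff ext_d_def mero_pd_add sum.distrib algebra_simps)

lemma ext_d_0 [simp]: "ext_d 0 = 0" by (simp add: fun_eq_iff ext_d_def)

lemma ext_d_minus: "ext_d (- \<beta>) = - ext_d \<beta>"
  using ext_d_add[of \<beta> "- \<beta>"] by (simp add: eq_neg_iff_add_eq_0 add.commute)

lemma ext_d_unit_form [simp]: "ext_d unit_form = 0"
  by (simp add: fun_eq_iff ext_d_def unit_form_def if_distrib cong: if_cong)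

lemma ext_d_scale: "ext_d (q *f \<beta>) = wedge (one_form (%i. mero_pd i q)) \<beta> + q *f ext_d \<beta>"
  by (simp add: fun_eq_iff ext_d_def wedge_def one_form_def fscale_def mero_pd_mult sum.distrib sum_distrib_left algebra_simps)

lemma wedge_wedge_self [simp]: "wedge a (wedge a \<gamma>) = 0"
proof
  show "wedge a (wedge a \<gamma>) J = 0 J" for J
  proof (induction J arbitrary: \<gamma>)
    case (Cons j J)
    have "(%K. wedge a \<gamma> (j # K)) = a [j] *f \<gamma> - wedge a (%K. \<gamma> (j # K))"
      by (simp add: fun_eq_iff wedge_Cons fscale_def)
    thus ?case by (simp add: wedge_Cons wedge_diff wedge_scale Cons.IH) (simp add: fscale_def)
  qed simp
qed

text \<open>Polarization of \<open>wedge_wedge_self\<close>.\<close>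

lemma wedge_anticommute: "wedge a (wedge b \<gamma>) = - wedge b (wedge a \<gamma>)"
proof -
  have "wedge (a + b) (wedge (a + b) \<gamma>) = 0" by (rule wedge_wedge_self)
  hence "wedge a (wedge b \<gamma>) + wedge b (wedge a \<gamma>) = 0"
    by (simp add: wedge_add del: wedge_wedge_self) (simp add: add.commute)
  thus ?thesis by (simp add: eq_neg_iff_add_eq_0)
qed

definition closed_form :: "('m::finite) form => bool" where
  "closed_form \<xi> \<longleftrightarrow> (\<forall>i j. mero_pd i (\<xi> [j]) = mero_pd j (\<xi> [i]))"

lemma ext_d_wedge:
  assumes "closed_form \<xi>"
  shows "ext_d (wedge \<xi> \<beta>) = - wedge \<xi> (ext_d \<beta>)"
proof
  have *: "mero_pd j (wedge \<xi> \<beta> J) = wedge (one_form (%i. mero_pd j (\<xi> [i]))) \<beta> J + wedge \<xi> (%K. mero_pd j (\<beta> K)) J" for j J \<beta>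
  proof -
    have "mero_pd j ((- 1) ^ k) = 0" for k :: nat by (cases "even k") (simp_all add: mero_pd_minus)
    thus ?thesis
      by (simp add: wedge_def mero_pd_sum mult.assoc mero_pd_mult one_form_def sum.distrib[symmetric] algebra_simps)
  qed
  show "ext_d (wedge \<xi> \<beta>) J = (- wedge \<xi> (ext_d \<beta>)) J" for J
  proof (induction J arbitrary: \<beta>)
    case (Cons j J)
    have 1: "(%K. wedge \<xi> \<beta> (j # K)) = \<xi> [j] *f \<beta> + - wedge \<xi> (%K. \<beta> (j # K))"
      by (simp add: fun_eq_iff wedge_Cons fscale_def)
    have 2: "(%K. ext_d \<beta> (j # K)) = (%K. mero_pd j (\<beta> K)) - ext_d (%K. \<beta> (j # K))"
      by (simp add: fun_eq_iff ext_d_Cons)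
    have 3: "one_form (%i. mero_pd i (\<xi> [j])) = one_form (%i. mero_pd j (\<xi> [i]))"
      using assms by (simp add: closed_form_def)
    show ?case using Cons.IH[of "%K. \<beta> (j # K)"]
      unfolding ext_d_Cons[of "wedge \<xi> \<beta>"] uminus_apply wedge_Cons[of \<xi> "ext_d \<beta>"] 1 2 ext_d_add ext_d_minus ext_d_scale 3 wedge_diff *
      by (simp add: fscale_def)
  qed simp
qed

definition contract :: "('m => 'm germ) => ('m::finite) form => 'm form" where
  "contract v \<beta> J = (\<Sum>i\<in>UNIV. to_mero (v i) * \<beta> (i # J))"

lemma contract_add: "contract v (\<beta> + \<gamma>) = contract v \<beta> + contract v \<gamma>"
  by (simp add: fun_eq_iff contract_def sum.distrib algebra_simps)

lemma contract_scale: "contract v (q *f \<beta>) = q *f contract v \<beta>"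
  by (simp add: fun_eq_iff contract_def fscale_def sum_distrib_left mult_ac)

lemma contract_minus: "contract v (- \<beta>) = - contract v \<beta>" by (simp add: fun_eq_iff contract_def sum_negf)

lemma contract_unit_form [simp]: "contract v unit_form = 0"
  by (simp add: fun_eq_iff contract_def unit_form_def)

lemma contract_wedge: "contract v (wedge \<xi> \<beta>) = pairing \<xi> v *f \<beta> - wedge \<xi> (contract v \<beta>)"
proof
  fix J
  have "contract v \<beta> = (\<Sum>i\<in>UNIV. to_mero (v i) *f (%K. \<beta> (i # K)))"
    by (simp add: fun_eq_iff contract_def sum_form_apply fscale_def)
  hence "wedge \<xi> (contract v \<beta>) J = (\<Sum>i\<in>UNIV. to_mero (v i) * wedge \<xi> (%K. \<beta> (i # K)) J)"
    by (simp add: wedge_sum wedge_scale sum_form_apply) (simp add: fscale_def)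
  thus "contract v (wedge \<xi> \<beta>) J = (pairing \<xi> v *f \<beta> - wedge \<xi> (contract v \<beta>)) J"
    by (simp add: contract_def wedge_Cons pairing_def fscale_def sum_subtractf algebra_simps sum_distrib_left sum_distrib_right)
qed

lemma pairing_add: "pairing (\<xi> + \<xi>') v = pairing \<xi> v + pairing \<xi>' v"
  by (simp add: pairing_def sum.distrib algebra_simps)

lemma pairing_scale: "pairing (q *f \<xi>) v = q * pairing \<xi> v"
  by (simp add: pairing_def fscale_def sum_distrib_left mult_ac)

lemma pairing_0 [simp]: "pairing 0 v = 0" by (simp add: pairing_def)

lemma pairing_sum: "pairing (sum f S) v = (\<Sum>i\<in>S. pairing (f i) v)"
  using sum_comp_morphism[of "%\<xi>. pairing \<xi> v" f S] by (simp add: pairing_add o_def)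

lemma pairing_dcoord [simp]: "pairing (dcoord i) v = to_mero (v i)"
  by (simp add: pairing_def dcoord_def one_form_def if_distrib[of "%x. x * _"] if_distrib[of to_mero] cong: if_cong)

subsection \<open>Submodules\<close>

lemma germ_ring_simps [simp]: "carrier germ_ring = UNIV" "zero germ_ring = 0" "add germ_ring = (+)"
    "monoid.mult germ_ring = (*)" "one germ_ring = 1" by (simp_all add: ring_of_type_algebra_def)

lemma complex_ring_simps [simp]: "carrier complex_ring = UNIV" "zero complex_ring = 0" "add complex_ring = (+)"
    "monoid.mult complex_ring = (*)" "one complex_ring = 1" by (simp_all add: ring_of_type_algebra_def)

lemma submodule_gen_inc: "x \<in> S ==> x \<in> submodule_gen R M S" unfolding submodule_gen_def by (rule hull_inc)

lemma submodule_gen_minimal: "S \<subseteq> N ==> submodule N R M ==> submodule_gen R M S \<subseteq> N"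
  unfolding submodule_gen_def by (rule hull_minimal)

lemma (in module) submodule_submodule_gen:
  assumes S: "S \<subseteq> carrier M"
  shows "submodule (submodule_gen R M S) R M"
proof (rule submoduleI)
  have *: "x \<in> submodule_gen R M S \<longleftrightarrow> (\<forall>N. submodule N R M \<longrightarrow> S \<subseteq> N \<longrightarrow> x \<in> N)" for x
    by (auto simp: submodule_gen_def hull_def)
  show "submodule_gen R M S \<subseteq> carrier M" by (rule submodule_gen_minimal[OF S carrier_is_submodule])
  show "\<zero>\<^bsub>M\<^esub> \<in> submodule_gen R M S" unfolding * by (auto simp: submodule_def dest: subgroup.one_closed)
  show "\<ominus>\<^bsub>M\<^esub> a \<in> submodule_gen R M S" if "a \<in> submodule_gen R M S" for a
    using that unfolding * by (auto dest: submoduleE(3))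
  show "a \<oplus>\<^bsub>M\<^esub> b \<in> submodule_gen R M S" if "a \<in> submodule_gen R M S" "b \<in> submodule_gen R M S" for a b
    using that unfolding * by (auto dest: submoduleE(5))
  show "a \<odot>\<^bsub>M\<^esub> x \<in> submodule_gen R M S" if "a \<in> carrier R" "x \<in> submodule_gen R M S" for a x
    using that unfolding * by (auto dest: submoduleE(4))
qed

lemma form_module_simps [simp]: "carrier form_module = UNIV" "zero form_module = 0" "add form_module = (+)"
    "a \<odot>\<^bsub>form_module\<^esub> \<beta> = to_mero a *f \<beta>" by (auto simp: form_module_def fun_eq_iff fscale_def)

lemma module_form_module: "module germ_ring form_module"
proof (rule moduleI)
  show "cring germ_ring" by (rule cring_from_type_algebra)
  show "abelian_group form_module" by (rule abelian_groupI) (auto simp: add_ac intro: exI[of _ "- x" for x])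
qed (auto simp: to_mero_add to_mero_mult fscale_add)

lemma form_module_minus: "\<ominus>\<^bsub>form_module\<^esub> \<beta> = - \<beta>"
proof -
  interpret module germ_ring form_module by (rule module_form_module)
  show ?thesis using minus_equality[of "- \<beta>" \<beta>] by simp
qed

lemma submodule_form_iff:
  "submodule N germ_ring form_module \<longleftrightarrow>
    0 \<in> N \<and> (\<forall>\<beta>\<in>N. \<forall>\<gamma>\<in>N. \<beta> + \<gamma> \<in> N) \<and> (\<forall>a. \<forall>\<beta>\<in>N. to_mero a *f \<beta> \<in> N)" (is "?l \<longleftrightarrow> ?r")
proof
  interpret module germ_ring form_module by (rule module_form_module)
  show ?r if ?l using submoduleE[OF that] subgroup.one_closed[OF submodule.axioms(1)[OF that]] by simp
  assume r: ?r
  have "- \<beta> \<in> N" if "\<beta> \<in> N" for \<beta>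
  proof -
    have "to_mero (- 1) *f \<beta> \<in> N" using r that by blast
    thus ?thesis by (simp add: to_mero_uminus)
  qed
  thus ?l using r by (intro submoduleI) (auto simp: form_module_minus)
qed

lemma submodule_form_gen: "submodule (submodule_gen germ_ring form_module S) germ_ring form_module"
  by (rule module.submodule_submodule_gen[OF module_form_module]) simp

lemmas form_gen_closed =
  submodule_form_gen[unfolded submodule_form_iff, THEN conjunct1]
  submodule_form_gen[unfolded submodule_form_iff, THEN conjunct2, THEN conjunct1, rule_format]
  submodule_form_gen[unfolded submodule_form_iff, THEN conjunct2, THEN conjunct2, rule_format]

lemma sum_closed_form: "0 \<in> N ==> (!!a b. a \<in> N ==> b \<in> N ==> a + b \<in> N) ==> (!!i. i \<in> S ==> f i \<in> N) ==> sum f S \<in> N"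
  for f :: "'i => ('m::finite) form" by (induction S rule: infinite_finite_induct) auto

subsection \<open>Logarithmic frames\<close>

lemmas log_forms_closed = form_gen_closed[where S = "{wedge_list \<omega>s | \<omega>s. length \<omega>s = q \<and> set \<omega>s \<subseteq> log_one_forms t}" for q t,
    folded log_forms_def]

lemmas log_one_closed = form_gen_closed[where S = "range dcoord \<union> {dlog g | g. \<exists>k. g dvd t ^ k}" for t,
    folded log_one_forms_def]

lemma dcoord_log: "dcoord i \<in> log_one_forms t" unfolding log_one_forms_def by (rule submodule_gen_inc) blast

definition dgerm :: "('m::finite) germ => 'm form" where
  "dgerm a = one_form (%i. mero_pd i (to_mero a))"

lemma one_form_eq_sum: "one_form f = (\<Sum>i\<in>UNIV. f i *f dcoord i)"
proof
  fix J
  have *: "(\<Sum>i\<in>UNIV. f i * (if j = i then 1 else 0)) = f j" for j by (simp add: if_distrib cong: if_cong)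
  show "one_form f J = (\<Sum>i\<in>UNIV. f i *f dcoord i) J"
    by (auto simp: one_form_def sum_form_apply fscale_def dcoord_def * split: list.splits)
qed

lemma dgerm_eq: "dgerm a = (\<Sum>i\<in>UNIV. to_mero (germ_pd i a) *f dcoord i)"
  by (simp add: dgerm_def one_form_eq_sum mero_pd_to_mero)

lemma sum_log_one: "(!!i. i \<in> S ==> f i \<in> log_one_forms t) ==> sum f S \<in> log_one_forms t"
  by (rule sum_closed_form[OF log_one_closed(1,2)])

lemma sum_log_forms: "(!!i. i \<in> S ==> f i \<in> log_forms t q) ==> sum f S \<in> log_forms t q"
  by (rule sum_closed_form[OF log_forms_closed(1,2)])

lemma dgerm_log: "dgerm a \<in> log_one_forms t"
  unfolding dgerm_eq by (intro sum_log_one log_one_closed dcoord_log)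

lemma pairing_dgerm: "pairing (dgerm a) v = to_mero (vf_apply v a)"
  by (simp add: dgerm_eq pairing_sum pairing_scale vf_apply_def to_mero_sum to_mero_mult mult.commute)

lemma wedge_list_Cons: "wedge_list (\<xi> # \<omega>s) = wedge \<xi> (wedge_list \<omega>s)" by (simp add: wedge_list_def)

lemma wedge_list_Nil: "wedge_list [] = unit_form" by (simp add: wedge_list_def unit_form_def fun_eq_iff)

lemma wedge_log_forms:
  assumes "\<xi> \<in> log_one_forms t" "\<beta> \<in> log_forms t q"
  shows "wedge \<xi> \<beta> \<in> log_forms t (Suc q)"
proof -
  have "log_forms t q \<subseteq> {\<beta>. wedge \<xi> \<beta> \<in> log_forms t (Suc q)}" unfolding log_forms_def[of t q]
  proof (rule submodule_gen_minimal)
    show "{wedge_list \<omega>s |\<omega>s. length \<omega>s = q \<and> set \<omega>s \<subseteq> log_one_forms t} \<subseteq> {\<beta>. wedge \<xi> \<beta> \<in> log_forms t (Suc q)}"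
    proof clarify
      fix \<omega>s assume "q = length \<omega>s" "set \<omega>s \<subseteq> log_one_forms t"
      thus "wedge \<xi> (wedge_list \<omega>s) \<in> log_forms t (Suc (length \<omega>s))" unfolding log_forms_def using assms(1)
        by (intro submodule_gen_inc CollectI exI[of _ "\<xi> # \<omega>s"]) (simp add: wedge_list_Cons)
    qed
    show "submodule {\<beta>. wedge \<xi> \<beta> \<in> log_forms t (Suc q)} germ_ring form_module"
      unfolding submodule_form_iff using log_forms_closed by (auto simp: wedge_add wedge_scale)
  qed
  thus ?thesis using assms(2) by blast
qed

text \<open>A coframe of closed logarithmic forms with dual commuting fields, one member being dt/t.
  It exists both off Y and at a crossing, so the translation of \<open>M\<close> into operators is
  done once for both. Closedness makes frame monomials closed; commutation with \<open>E p\<close>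
  makes R well defined.\<close>

locale log_frame =
  fixes t :: "'m::finite germ" and p :: 'm and \<eta> :: "'m => 'm form" and E :: "'m => 'm => 'm germ" and n :: nat
  assumes dim: "CARD('m) = n + 1"
    and \<eta>_p: "\<eta> p = dlog t"
    and \<eta>_closed: "closed_form (\<eta> j)"
    and \<eta>_E: "pairing (\<eta> i) (E j) = (if i = j then 1 else 0)"
    and \<eta>_log: "\<eta> j \<in> log_one_forms t"
    and log_one_span: "\<xi> \<in> log_one_forms t ==> \<exists>a. \<xi> = (\<Sum>j\<in>UNIV. to_mero (a j) *f \<eta> j)"
    and E_t: "vf_apply (E j) t = (if j = p then t else 0)"
    and E_commute: "vf_apply (E i) (vf_apply (E j) g) = vf_apply (E j) (vf_apply (E i) g)"
begin

abbreviation "forms \<equiv> log_forms t"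
abbreviation "rclass \<equiv> rel_class_Y t n"
abbreviation "inv_dt \<equiv> dt_wedge_inv t n"
abbreviation "tens \<equiv> dr_tensor t n"

text \<open>Monomials in the frame. The one for \<open>idx\<close>, which omits dt/t, is the
  generator \<zeta> of the relative logarithmic top forms.\<close>

definition wl :: "'m list => 'm form" where
  "wl js = foldr (%j. wedge (\<eta> j)) js unit_form"

definition idx :: "'m list" where
  "idx = (SOME js. distinct js \<and> set js = UNIV - {p})"

abbreviation \<zeta> :: "'m form" where
  "\<zeta> \<equiv> wl idx"

lemma idx: "distinct idx" "set idx = UNIV - {p}"
  using someI_ex[OF finite_distinct_list[of "UNIV - {p}"]] unfolding idx_def by (auto simp: conj_commute)

lemma length_idx: "length idx = n" using distinct_card[OF idx(1)] dim by (simp add: idx(2))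

lemma wl_Nil: "wl [] = unit_form" and wl_Cons: "wl (j # js) = wedge (\<eta> j) (wl js)" by (simp_all add: wl_def)

lemma wl_eq: "wl js = wedge_list (map \<eta> js)"
  by (induction js) (simp_all add: wl_Nil wl_Cons wedge_list_Nil wedge_list_Cons)

lemma wl_log: "wl js \<in> forms (length js)"
  unfolding log_forms_def wl_eq by (rule submodule_gen_inc) (auto intro!: exI[of _ "map \<eta> js"] \<eta>_log)

lemma log_frame_expand:
  assumes "\<xi> \<in> log_one_forms t"
  obtains a where "\<xi> = (\<Sum>j\<in>UNIV. to_mero (a j) *f \<eta> j)" "!!j. pairing \<xi> (E j) = to_mero (a j)"
proof -
  obtain a where a: "\<xi> = (\<Sum>j\<in>UNIV. to_mero (a j) *f \<eta> j)" using log_one_span[OF assms] by blast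
  have "pairing \<xi> (E j) = to_mero (a j)" for j
    by (simp add: a pairing_sum pairing_scale \<eta>_E if_distrib cong: if_cong)
  with a show thesis by (rule that)
qed

lemma log_one_eq: "\<xi> \<in> log_one_forms t ==> \<xi> = (\<Sum>j\<in>UNIV. pairing \<xi> (E j) *f \<eta> j)"
  by (erule log_frame_expand) simp

lemma dgerm_eq_frame: "dgerm a = (\<Sum>j\<in>UNIV. to_mero (vf_apply (E j) a) *f \<eta> j)"
  using log_one_eq[OF dgerm_log] by (simp add: pairing_dgerm)

lemma dcoord_eq_frame: "dcoord i = (\<Sum>j\<in>UNIV. to_mero (E j i) *f \<eta> j)" using log_one_eq[OF dcoord_log] by simp

lemma ext_d_wl [simp]: "ext_d (wl js) = 0"
proof (induction js)
  case (Cons j js)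
  show "ext_d (wl (j # js)) = 0" unfolding wl_Cons ext_d_wedge[OF \<eta>_closed] Cons by simp
qed (simp add: wl_Nil)

lemma ext_d_scale_wl: "ext_d (to_mero b *f wl js) = (\<Sum>j\<in>UNIV. to_mero (vf_apply (E j) b) *f wl (j # js))"
  by (simp add: ext_d_scale dgerm_def[symmetric] dgerm_eq_frame wedge_sum wedge_scale wl_Cons)

lemma dcoord_wedge_wl: "wedge (dcoord i) (wl js) = (\<Sum>j\<in>UNIV. to_mero (E j i) *f wl (j # js))"
  by (simp add: dcoord_eq_frame wedge_sum wedge_scale wl_Cons)

text \<open>\<open>log_forms\<close> is generated by wedge products of arbitrary logarithmic
  1-forms; expanding these in the frame shows that the frame monomials already generate.\<close>

lemma log_forms_induct [consumes 1, case_names zero add scale]: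
  assumes "\<beta> \<in> forms q" "P 0" "!!\<beta> \<gamma>. \<beta> \<in> forms q ==> \<gamma> \<in> forms q ==> P \<beta> ==> P \<gamma> ==> P (\<beta> + \<gamma>)"
    "!!b js. length js = q ==> P (to_mero b *f wl js)"
  shows "P \<beta>"
proof -
  define N where "N q = submodule_gen germ_ring form_module (wl ` {js. length js = q})" for q
  note N = form_gen_closed[where S = "wl ` {js. length js = q}" for q, folded N_def]
  have wlN: "wl js \<in> N (length js)" for js unfolding N_def by (rule submodule_gen_inc) blast
  have N_sub: "N q \<subseteq> forms q" for q
    unfolding N_def by (rule submodule_gen_minimal) (auto simp: submodule_form_iff intro: log_forms_closed wl_log)
  have wN: "wedge \<xi> \<beta> \<in> N (Suc q)" if "\<xi> \<in> log_one_forms t" "\<beta> \<in> N q" for \<xi> \<beta> q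
  proof -
    have "N q \<subseteq> {\<beta>. wedge \<xi> \<beta> \<in> N (Suc q)}" unfolding N_def[of q]
    proof (rule submodule_gen_minimal)
      show "submodule {\<beta>. wedge \<xi> \<beta> \<in> N (Suc q)} germ_ring form_module"
        unfolding submodule_form_iff using N by (auto simp: wedge_add wedge_scale)
      obtain a where a: "\<xi> = (\<Sum>j\<in>UNIV. to_mero (a j) *f \<eta> j)" using log_one_span[OF \<open>\<xi> \<in> _\<close>] by blast
      show "wl ` {js. length js = q} \<subseteq> {\<beta>. wedge \<xi> \<beta> \<in> N (Suc q)}"
      proof clarify
        fix js :: "'m list" assume "q = length js"
        have "(\<Sum>j\<in>UNIV. to_mero (a j) *f wl (j # js)) \<in> N (Suc (length js))"
          using N wlN[of "_ # js"] by (intro sum_closed_form) auto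
        thus "wedge \<xi> (wl js) \<in> N (Suc (length js))" by (simp add: a wedge_sum wedge_scale wl_Cons)
      qed
    qed
    thus ?thesis using that(2) by blast
  qed
  have "wedge_list \<omega>s \<in> N (length \<omega>s)" if "set \<omega>s \<subseteq> log_one_forms t" for \<omega>s
    using that by (induction \<omega>s) (auto simp: wedge_list_Nil wedge_list_Cons wN simp flip: wl_Nil intro: wlN[of "[]", simplified])
  hence sub: "forms q \<subseteq> N q"
    unfolding log_forms_def by (intro submodule_gen_minimal) (auto simp: submodule_form_iff N)
  have scale: "P (to_mero a *f \<beta>)" if "\<beta> \<in> {\<beta> \<in> N q. \<forall>a. P (to_mero a *f \<beta>)}" for a \<beta> using that by blast
  \<comment> \<open>The property P need not be stable under multiplication by germs, so stability is
    built into the set to which minimality of the generated submodule is applied.\<close>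
  have "N q \<subseteq> {\<beta> \<in> N q. \<forall>a. P (to_mero a *f \<beta>)}" unfolding N_def[of q]
  proof (rule submodule_gen_minimal, fold N_def)
    show "wl ` {js. length js = q} \<subseteq> {\<beta> \<in> N q. \<forall>a. P (to_mero a *f \<beta>)}" using wlN assms(4) by auto
    show "submodule {\<beta> \<in> N q. \<forall>a. P (to_mero a *f \<beta>)} germ_ring form_module" unfolding submodule_form_iff
      using N assms(2) assms(3)[OF subsetD[OF N_sub] subsetD[OF N_sub]]
      by (auto simp: fscale_add to_mero_mult[symmetric])
  qed
  hence "P (to_mero 1 *f \<beta>)" using sub assms(1) by blast
  thus ?thesis by simp
qed

lemma wl_move_to_front: "j \<in> set js ==> wl js \<in> {wl (j # remove1 j js), - wl (j # remove1 j js)}"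
proof (induction js)
  case (Cons i js)
  show ?case
  proof (cases "i = j")
    case False
    hence "j \<in> set js" using Cons.prems by simp
    hence "wl js \<in> {wl (j # remove1 j js), - wl (j # remove1 j js)}" by (rule Cons.IH)
    thus ?thesis using False wedge_anticommute[of "\<eta> i" "\<eta> j" "wl (remove1 j js)"] by (auto simp: wl_Cons)
  qed simp
qed simp

lemma wl_not_distinct: "\<not> distinct js ==> wl js = 0"
proof (induction js)
  case (Cons i js)
  show "wl (i # js) = 0"
  proof (cases "distinct js")
    case False
    hence "wl js = 0" by (rule Cons.IH)
    thus ?thesis by (simp add: wl_Cons)
  next
    case True
    thus ?thesis using wl_move_to_front[of i js] Cons.prems by (auto simp: wl_Cons)
  qed
qed simp

lemma wl_permute: "distinct js ==> distinct ks ==> set js = set ks ==> wl js \<in> {wl ks, - wl ks}"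
proof (induction ks arbitrary: js)
  case (Cons k ks)
  have "wl (remove1 k js) \<in> {wl ks, - wl ks}"
    using Cons.prems by (intro Cons.IH) (auto simp: distinct_remove1)
  moreover have "wl js \<in> {wl (k # remove1 k js), - wl (k # remove1 k js)}"
    using Cons.prems by (intro wl_move_to_front) auto
  ultimately show ?case by (auto simp: wl_Cons)
qed simp

lemma distinct_idx_cases:
  assumes "distinct js" "length js = n" "p \<notin> set js"
  shows "set js = UNIV - {p}"
  using card_subset_eq[of "UNIV - {p}" "set js"] assms distinct_card[OF assms(1)] dim by fastforce

lemma wl_cases:
  assumes "length js = n"
  obtains "wl js = 0" | "wl js \<in> {\<zeta>, - \<zeta>}" | ks where "Suc (length ks) = n" "wl js \<in> {wl (p # ks), - wl (p # ks)}"
proof (cases "distinct js")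
  case True
  show thesis
  proof (cases "p \<in> set js")
    case True
    hence "Suc (length (remove1 p js)) = n"
      using assms length_pos_if_in_set[OF True] by (simp add: length_remove1)
    thus thesis using wl_move_to_front[OF True] by (rule that(3))
  next
    case False
    thus thesis using wl_permute[OF \<open>distinct js\<close> idx(1)] distinct_idx_cases[OF True assms] idx(2) that(2) by simp
  qed
qed (use wl_not_distinct that in blast)

lemma wl_top_cases:
  assumes "length js = Suc n"
  shows "wl js \<in> {0, wl (p # idx), - wl (p # idx)}"
proof (cases "distinct js")
  case True
  hence "set js = UNIV" using card_subset_eq[of UNIV "set js"] distinct_card[OF True] assms dim by simp
  moreover have "set (p # idx) = UNIV" "distinct (p # idx)" using idx by auto
  ultimately show ?thesis using wl_permute[OF True, of "p # idx"] by auto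
qed (simp add: wl_not_distinct)

end

section \<open>Vector fields acting on germs and the ring of differential operators\<close>

lemma vf_apply_add: "vf_apply v (a + b) = vf_apply v a + vf_apply v b"
  by (simp add: vf_apply_def germ_pd_add sum.distrib algebra_simps)

lemma vf_apply_0 [simp]: "vf_apply v 0 = 0" by (simp add: vf_apply_def)

lemma vf_apply_minus: "vf_apply v (- a) = - vf_apply v a" by (simp add: vf_apply_def germ_pd_minus sum_negf)

lemma vf_apply_sum: "vf_apply v (sum f S) = (\<Sum>i\<in>S. vf_apply v (f i))"
  by (induction S rule: infinite_finite_induct) (simp_all add: vf_apply_add)

lemma vf_apply_mult: "vf_apply v (a * b) = vf_apply v a * b + a * vf_apply v b"
  by (simp add: vf_apply_def germ_pd_mult sum.distrib algebra_simps sum_distrib_left sum_distrib_right)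

lemma vf_apply_const [simp]: "vf_apply v (germ_const k) = 0" by (simp add: vf_apply_def)

lemma diffop_mono: "diffop k P ==> k \<le> k' ==> diffop k' P"
proof (induction arbitrary: k' rule: diffop.induct)
  case (pd k P i)
  then obtain l where "k' = Suc l" "k \<le> l" by (cases k') auto
  thus ?case using pd.IH diffop.pd by blast
qed (auto intro: diffop.intros)

abbreviation diffops :: "('m::finite germ => 'm germ) set" where
  "diffops \<equiv> carrier D_module"

lemma D_carrier_iff: "P \<in> diffops \<longleftrightarrow> (\<exists>k. diffop k P)"
proof
  assume "P \<in> diffops"
  then obtain l where l: "P \<in> D_filt l" by (auto simp: D_module_def)
  show "\<exists>k. diffop k P"
  proof (cases "l < 0")
    case True
    hence "P = (%g. 0 * g)" using l by (simp add: D_filt_def)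
    thus ?thesis using diffop.scalar[of 0 0] by blast
  qed (use l in \<open>auto simp: D_filt_def\<close>)
next
  assume "\<exists>k. diffop k P"
  then obtain k where "diffop k P" ..
  hence "P \<in> D_filt (int k)" by (simp add: D_filt_def)
  thus "P \<in> diffops" by (auto simp: D_module_def)
qed

lemma D_zero: "(%_. 0) \<in> diffops" using diffop.scalar[of 0 0] by (auto simp: D_carrier_iff)

lemma D_add: "P \<in> diffops ==> Q \<in> diffops ==> (%g. P g + Q g) \<in> diffops"
  unfolding D_carrier_iff by (metis diffop.add diffop_mono max.cobounded1 max.cobounded2)

lemma D_lmult: "P \<in> diffops ==> (%g. a * P g) \<in> diffops" unfolding D_carrier_iff using diffop.lmult by blast

lemma D_pd: "P \<in> diffops ==> (%g. germ_pd i (P g)) \<in> diffops" unfolding D_carrier_iff using diffop.pd by blast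

lemma D_minus: "P \<in> diffops ==> (%g. - P g) \<in> diffops" using D_lmult[of P "- 1"] by simp

lemma D_sum: "(!!i. i \<in> S ==> F i \<in> diffops) ==> (%g. \<Sum>i\<in>S. F i g) \<in> diffops"
  by (induction S rule: infinite_finite_induct) (auto intro: D_zero D_add)

lemma D_vf_apply: "P \<in> diffops ==> (%g. vf_apply v (P g)) \<in> diffops"
  unfolding vf_apply_def by (intro D_sum D_lmult D_pd)

section \<open>Coefficients of top forms and the right ideal cut out by the differentials\<close>

context log_frame
begin

text \<open>Contracting with the dual fields one after another reads off a frame coefficient. Along
  \<open>idx\<close> it kills all multiples of dt/t, so it descends to relative forms, where it is
  dual to \<zeta>.\<close>

fun kap :: "'m list => 'm form => 'm mero" where
  "kap [] \<beta> = \<beta> []"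
| "kap (j # js) \<beta> = kap js (contract (E j) \<beta>)"

lemma kap_add: "kap js (\<beta> + \<gamma>) = kap js \<beta> + kap js \<gamma>"
  by (induction js arbitrary: \<beta> \<gamma>) (simp_all add: contract_add)

lemma kap_scale: "kap js (q *f \<beta>) = q * kap js \<beta>"
  by (induction js arbitrary: \<beta>) (simp_all add: contract_scale, simp add: fscale_def)

lemma kap_0 [simp]: "kap js 0 = 0" using kap_scale[of js 0] by simp

lemma kap_minus: "kap js (- \<beta>) = - kap js \<beta>" using kap_scale[of js "- 1" \<beta>] by simp

lemma contract_0 [simp]: "contract v 0 = 0" using contract_scale[of v 0] by simp

lemma kap_wedge: "p \<notin> set js ==> kap js (wedge (\<eta> p) \<gamma>) = 0"
proof (induction js arbitrary: \<gamma>)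
  case (Cons j js)
  hence "kap (j # js) (wedge (\<eta> p) \<gamma>) = kap js (- wedge (\<eta> p) (contract (E j) \<gamma>))"
    by (simp add: contract_wedge \<eta>_E)
  thus ?case using Cons unfolding kap_minus by simp
qed simp

lemma contract_wl: "j \<notin> set js ==> contract (E j) (wl js) = 0"
proof (induction js)
  case (Cons i js)
  have "j \<notin> set js" "i ~= j" using Cons.prems by auto
  hence "contract (E j) (wl js) = 0" by (intro Cons.IH)
  thus "contract (E j) (wl (i # js)) = 0" using \<open>i ~= j\<close> by (simp add: wl_Cons contract_wedge \<eta>_E)
qed (simp add: wl_Nil)

lemma kap_wl: "distinct js ==> kap js (wl js) = 1"
proof (induction js)
  case (Cons i js)
  thus ?case by (simp add: wl_Cons contract_wedge \<eta>_E contract_wl)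
qed (simp add: wl_Nil unit_form_def)

definition \<kappa> :: "'m form => 'm mero" where
  "\<kappa> = kap idx"

lemma \<kappa>_linear: "\<kappa> (\<beta> + \<gamma>) = \<kappa> \<beta> + \<kappa> \<gamma>" "\<kappa> (q *f \<beta>) = q * \<kappa> \<beta>" "\<kappa> 0 = 0" "\<kappa> (- \<beta>) = - \<kappa> \<beta>"
  by (simp_all add: \<kappa>_def kap_add kap_scale kap_minus)

lemma \<kappa>_sum: "\<kappa> (sum f S) = (\<Sum>i\<in>S. \<kappa> (f i))" using sum_comp_morphism[of \<kappa> f S] by (simp add: \<kappa>_linear o_def)

lemma \<kappa>_\<eta>p [simp]: "\<kappa> (wedge (\<eta> p) \<gamma>) = 0" by (simp add: \<kappa>_def kap_wedge idx)

lemma \<kappa>_\<zeta> [simp]: "\<kappa> \<zeta> = 1" by (simp add: \<kappa>_def kap_wl idx)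

lemma \<kappa>_wl: "length js = n ==> \<kappa> (wl js) \<in> {0, 1, - 1}" by (erule wl_cases) (auto simp: \<kappa>_linear wl_Cons)

lemma \<kappa>_log: "\<beta> \<in> forms n ==> \<kappa> \<beta> \<in> range to_mero"
proof (induction rule: log_forms_induct)
  case zero
  show "\<kappa> 0 \<in> range to_mero" unfolding \<kappa>_linear by (rule range_eqI[of _ _ 0]) simp
next
  case (add \<beta> \<gamma>)
  thus "\<kappa> (\<beta> + \<gamma>) \<in> range to_mero" by (auto simp: \<kappa>_linear to_mero_add[symmetric] simp del: plus_fun_apply)
next
  case (scale b js)
  have "\<kappa> (wl js) \<in> {to_mero 0, to_mero 1, to_mero (- 1)}" using \<kappa>_wl[OF scale] by (simp add: to_mero_uminus)
  thus ?case by (auto simp: \<kappa>_linear to_mero_mult[symmetric] simp del: to_mero_0 to_mero_1)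
qed

definition coef :: "'m form => 'm germ" where
  "coef \<beta> = (THE a. to_mero a = \<kappa> \<beta>)"

lemma coef_eqI: "\<kappa> \<beta> = to_mero a ==> coef \<beta> = a" unfolding coef_def by (rule the_equality) auto

lemma to_mero_coef: "\<beta> \<in> forms n ==> to_mero (coef \<beta>) = \<kappa> \<beta>" using \<kappa>_log[of \<beta>] coef_eqI[of \<beta>] by auto

lemma coef_simps [simp]: "coef (wedge (\<eta> p) \<gamma>) = 0" "coef \<zeta> = 1" "coef 0 = 0"
  by (auto intro!: coef_eqI simp: \<kappa>_linear)

lemma coef_add: "\<beta> \<in> forms n ==> \<gamma> \<in> forms n ==> coef (\<beta> + \<gamma>) = coef \<beta> + coef \<gamma>"
  by (rule coef_eqI) (simp add: \<kappa>_linear to_mero_add to_mero_coef)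

lemma coef_scale: "\<beta> \<in> forms n ==> coef (to_mero a *f \<beta>) = a * coef \<beta>"
  by (rule coef_eqI) (simp add: \<kappa>_linear to_mero_mult to_mero_coef)

lemma coef_minus: "\<beta> \<in> forms n ==> coef (- \<beta>) = - coef \<beta>"
  by (rule coef_eqI) (simp add: \<kappa>_linear to_mero_uminus to_mero_coef)

lemma coef_sum: "(!!i. i \<in> S ==> f i \<in> forms n) ==> coef (sum f S) = (\<Sum>i\<in>S. coef (f i))"
  by (rule coef_eqI) (simp add: \<kappa>_sum to_mero_sum to_mero_coef)

lemma dt_multiplesI: "Suc q = n ==> \<gamma> \<in> forms q ==> wedge (\<eta> p) \<gamma> \<in> dt_multiples t n"
  unfolding dt_multiples_def \<eta>_p by blast

lemma submodule_dt_multiples: "submodule (dt_multiples t r) germ_ring form_module"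
proof (cases r)
  case 0
  hence "dt_multiples t r = {0}" by (auto simp: dt_multiples_def fun_eq_iff)
  thus ?thesis by (simp add: submodule_form_iff)
next
  case (Suc q)
  have z: "wedge (\<eta> p) 0 = (%_. 0)" by (simp add: fun_eq_iff)
  have eq: "dt_multiples t r = wedge (\<eta> p) ` forms q"
    using imageI[OF log_forms_closed(1)[of t q], of "wedge (\<eta> p)"] unfolding dt_multiples_def \<eta>_p[symmetric] Suc z by auto
  show ?thesis unfolding eq submodule_form_iff
  proof (intro conjI ballI allI)
    show "0 \<in> wedge (\<eta> p) ` forms q" using log_forms_closed(1) by (rule rev_image_eqI) simp
    fix a \<beta> assume "\<beta> \<in> wedge (\<eta> p) ` forms q"
    then obtain \<beta>' where \<beta>: "\<beta> = wedge (\<eta> p) \<beta>'" "\<beta>' \<in> forms q" by blast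
    show "to_mero a *f \<beta> \<in> wedge (\<eta> p) ` forms q"
      using log_forms_closed(3)[OF \<beta>(2), of a] unfolding \<beta>(1) wedge_scale(1)[symmetric] by (rule imageI)
    fix \<gamma> assume "\<gamma> \<in> wedge (\<eta> p) ` forms q"
    then obtain \<gamma>' where \<gamma>: "\<gamma> = wedge (\<eta> p) \<gamma>'" "\<gamma>' \<in> forms q" by blast
    show "\<beta> + \<gamma> \<in> wedge (\<eta> p) ` forms q"
      using log_forms_closed(2)[OF \<beta>(2) \<gamma>(2)] unfolding \<beta>(1) \<gamma>(1) wedge_add(1)[symmetric] by (rule imageI)
  qed
qed

lemma coef_dt_multiples: "\<beta> \<in> dt_multiples t r ==> coef \<beta> = 0"
  using coef_simps(3) unfolding dt_multiples_def \<eta>_p[symmetric] zero_fun_def by auto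

lemma \<eta>p_log: "\<eta> p \<in> log_one_forms t" by (rule \<eta>_log)

lemma dt_multiples_log: "dt_multiples t r \<subseteq> forms r"
  using wedge_log_forms[OF \<eta>p_log] log_forms_closed(1)[of t r]
  unfolding dt_multiples_def \<eta>_p[symmetric] zero_fun_def by auto

text \<open>A frame monomial of degree n repeats a factor, contains dt/t, or equals \<zeta> up to
  sign.\<close>

lemma log_form_reduce: "\<beta> \<in> forms n ==> \<beta> - to_mero (coef \<beta>) *f \<zeta> \<in> dt_multiples t n"
proof (induction rule: log_forms_induct)
  note dt = submodule_dt_multiples[unfolded submodule_form_iff, THEN conjunct1]
    submodule_dt_multiples[unfolded submodule_form_iff, THEN conjunct2, THEN conjunct1, rule_format]
    submodule_dt_multiples[unfolded submodule_form_iff, THEN conjunct2, THEN conjunct2, rule_format]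
  {
    case zero
    show "0 - to_mero (coef 0) *f \<zeta> \<in> dt_multiples t n" using dt(1) by (simp del: zero_fun_apply)
  next
    case (add \<beta> \<gamma>)
    have "\<beta> + \<gamma> - to_mero (coef (\<beta> + \<gamma>)) *f \<zeta> = (\<beta> - to_mero (coef \<beta>) *f \<zeta>) + (\<gamma> - to_mero (coef \<gamma>) *f \<zeta>)"
      by (simp add: coef_add add to_mero_add fscale_add)
    thus ?case using dt(2)[OF add(3,4)] by metis
  next
    case (scale b js)
    have wl: "wl js \<in> forms n" using wl_log[of js] scale by simp
    have "wl js - to_mero (coef (wl js)) *f \<zeta> \<in> dt_multiples t n" using scale
    proof (cases rule: wl_cases)
      case 1
      thus ?thesis using dt(1) by simp
    next
      case 2
      moreover have "coef (- \<zeta>) = - 1" using coef_minus[of \<zeta>] wl_log[of idx] by (simp add: length_idx)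
      ultimately show ?thesis using dt(1) by (auto simp: to_mero_uminus)
    next
      case (3 ks)
      have w: "wl (p # ks) \<in> dt_multiples t n" unfolding wl_Cons by (rule dt_multiplesI[OF 3(1) wl_log])
      have "to_mero (- 1) *f wl (p # ks) \<in> dt_multiples t n" by (rule dt(3)[OF w])
      hence "- wl (p # ks) \<in> dt_multiples t n" by (simp add: to_mero_uminus)
      with w 3(2) have "wl js \<in> dt_multiples t n" by auto
      thus ?thesis using coef_dt_multiples by simp
    qed
    moreover have "to_mero b *f (wl js - to_mero (coef (wl js)) *f \<zeta>) =
        to_mero b *f wl js - to_mero (coef (to_mero b *f wl js)) *f \<zeta>"
      using wl by (simp add: coef_scale to_mero_mult) (simp add: fun_eq_iff fscale_def algebra_simps)
    ultimately show "to_mero b *f wl js - to_mero (coef (to_mero b *f wl js)) *f \<zeta> \<in> dt_multiples t n"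
      using dt(3) by metis
  }
qed

lemma ext_d_log_forms: "\<beta> \<in> forms q ==> ext_d \<beta> \<in> forms (Suc q)"
proof (induction rule: log_forms_induct)
  case (scale b js)
  have "wl (j # js) \<in> forms (Suc q)" for j using wl_log[of "j # js"] scale by simp
  thus "ext_d (to_mero b *f wl js) \<in> forms (Suc q)"
    unfolding ext_d_scale_wl by (intro sum_log_forms log_forms_closed)
next
  case zero
  show "ext_d 0 \<in> forms (Suc q)" unfolding ext_d_0 by (rule log_forms_closed)
next
  case (add \<beta> \<gamma>)
  show "ext_d (\<beta> + \<gamma>) \<in> forms (Suc q)" unfolding ext_d_add using add(3,4) by (rule log_forms_closed)
qed

text \<open>\<open>dr_boundaries\<close> ranges over all dual frames, so each of them has to be
  compared with the coordinates. The coefficient of \<xi>_l in dx_i is found by pairing with D_l;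
  the dt/t term disappears in relative forms.\<close>

lemma dual_frames_dcoord:
  assumes "rel_dual_frames t n \<xi> D"
  obtains c where "dcoord i = to_mero c *f \<eta> p + (\<Sum>l<n. to_mero (D l i) *f \<xi> l)"
proof -
  have pair: "pairing (\<xi> l) (D m) = (if l = m then 1 else 0)" "pairing (\<eta> p) (D m) = 0" if "l < n" "m < n" for l m
    using assms that unfolding rel_dual_frames_def rel_log_fields_def \<eta>_p by auto
  let ?S = "{\<omega>. \<exists>c G. \<omega> = to_mero c *f \<eta> p + (\<Sum>l<n. to_mero (G l) *f \<xi> l)}"
  have "submodule ?S germ_ring form_module" unfolding submodule_form_iff
  proof (intro conjI ballI allI)
    show "0 \<in> ?S" by (intro CollectI exI[of _ 0] exI[of _ "%_. 0"]) simp
    fix a \<beta> assume "\<beta> \<in> ?S"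
    then obtain c G where \<beta>: "\<beta> = to_mero c *f \<eta> p + (\<Sum>l<n. to_mero (G l) *f \<xi> l)" by blast
    show "to_mero a *f \<beta> \<in> ?S"
      by (intro CollectI exI[of _ "a * c"] exI[of _ "%l. a * G l"]) (simp add: \<beta> fscale_add fscale_sum to_mero_mult)
    fix \<gamma> assume "\<gamma> \<in> ?S"
    then obtain d H where \<gamma>: "\<gamma> = to_mero d *f \<eta> p + (\<Sum>l<n. to_mero (H l) *f \<xi> l)" by blast
    show "\<beta> + \<gamma> \<in> ?S"
      by (intro CollectI exI[of _ "c + d"] exI[of _ "%l. G l + H l"]) (simp add: \<beta> \<gamma> fscale_add to_mero_add sum.distrib)
  qed
  moreover have "insert (dlog t) (\<xi> ` {..<n}) \<subseteq> ?S"
  proof -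
    have "dlog t \<in> ?S" by (intro CollectI exI[of _ 1] exI[of _ "%_. 0"]) (simp add: \<eta>_p)
    moreover have "\<xi> m \<in> ?S" if "m < n" for m
    proof (rule CollectI, rule exI[of _ 0], rule exI[of _ "%l. if l = m then 1 else 0"])
      have "(\<Sum>l<n. to_mero (if l = m then 1 else 0) *f \<xi> l) = (\<Sum>l<n. if l = m then \<xi> l else 0)"
        by (rule sum.cong) auto
      thus "\<xi> m = to_mero 0 *f \<eta> p + (\<Sum>l<n. to_mero (if l = m then 1 else 0) *f \<xi> l)" using that by simp
    qed
    ultimately show ?thesis by blast
  qed
  ultimately have "submodule_gen germ_ring form_module (insert (dlog t) (\<xi> ` {..<n})) \<subseteq> ?S"
    by (intro submodule_gen_minimal)
  hence "log_one_forms t \<subseteq> ?S" using assms unfolding rel_dual_frames_def by simp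
  then obtain c G where cG: "dcoord i = to_mero c *f \<eta> p + (\<Sum>l<n. to_mero (G l) *f \<xi> l)"
    using dcoord_log by blast
  have "D m i = G m" if m: "m < n" for m
  proof -
    have "to_mero (D m i) = pairing (dcoord i) (D m)" by simp
    also have "\<dots> = (\<Sum>l<n. to_mero (G l) * (if l = m then 1 else 0))"
      unfolding cG pairing_add pairing_sum pairing_scale using pair m by simp
    also have "\<dots> = to_mero (G m)" using m by (simp add: if_distrib cong: if_cong)
    finally show ?thesis by simp
  qed
  hence "dcoord i = to_mero c *f \<eta> p + (\<Sum>l<n. to_mero (D l i) *f \<xi> l)" unfolding cG by simp
  thus thesis by (rule that)
qed

lemma dual_frames_coef:
  assumes "rel_dual_frames t n \<xi> D" "Suc q = n" "\<beta> \<in> forms q"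
  shows "(\<Sum>l<n. coef (wedge (\<xi> l) \<beta>) * D l i) = coef (wedge (dcoord i) \<beta>)"
proof -
  obtain c where c: "dcoord i = to_mero c *f \<eta> p + (\<Sum>l<n. to_mero (D l i) *f \<xi> l)"
    using dual_frames_dcoord[OF assms(1)] .
  have l: "wedge (\<xi> l) \<beta> \<in> forms n" if "l < n" for l
    using wedge_log_forms[of "\<xi> l" t \<beta> q] assms that unfolding rel_dual_frames_def by blast
  have "\<kappa> (wedge (dcoord i) \<beta>) = to_mero (\<Sum>l<n. coef (wedge (\<xi> l) \<beta>) * D l i)"
    unfolding c by (simp add: wedge_add wedge_scale wedge_sum \<kappa>_linear \<kappa>_sum to_mero_sum to_mero_mult to_mero_coef l mult.commute)
  thus ?thesis by (rule coef_eqI[symmetric])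
qed

text \<open>The submodule of \<open>D\<close> generated by the images of the differentials, when the top degree
  relative forms are trivialized by \<open>\<zeta>\<close>.\<close>
definition K_ideal :: "('m germ => 'm germ) set" where
  "K_ideal = {%g. t * Q g + (\<Sum>j\<in>UNIV - {p}. vf_apply (E j) (S j g)) | Q S.
     Q \<in> diffops \<and> (\<forall>j. S j \<in> diffops)}"

lemma K_idealI:
  assumes "Q \<in> diffops" "!!j. S j \<in> diffops"
    "!!g. P g = t * Q g + (\<Sum>j\<in>UNIV - {p}. vf_apply (E j) (S j g))"
  shows "P \<in> K_ideal" unfolding K_ideal_def using assms by (intro CollectI exI[of _ Q] exI[of _ S]) auto

lemma K_ideal_t: "Q \<in> diffops ==> (%g. t * Q g) \<in> K_ideal"
  by (rule K_idealI[of Q "%_ _. 0"]) (auto intro: D_zero)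

lemma K_ideal_vf:
  assumes "P \<in> diffops" "j ~= p" shows "(%g. vf_apply (E j) (P g)) \<in> K_ideal"
proof (rule K_idealI[of "%_. 0" "%i. if i = j then P else (%_. 0)"])
  fix g
  have "(\<Sum>i\<in>UNIV - {p}. vf_apply (E i) ((if i = j then P else (%_. 0)) g)) =
      (\<Sum>i\<in>UNIV - {p}. if i = j then vf_apply (E j) (P g) else 0)" by (rule sum.cong) auto
  thus "vf_apply (E j) (P g) = t * 0 + (\<Sum>i\<in>UNIV - {p}. vf_apply (E i) ((if i = j then P else (%_. 0)) g))"
    using assms by simp
qed (auto intro: D_zero assms)

lemma K_ideal_add:
  assumes "P \<in> K_ideal" "P' \<in> K_ideal" shows "(%g. P g + P' g) \<in> K_ideal"
proof -
  obtain Q S where P: "P = (%g. t * Q g + (\<Sum>j\<in>UNIV - {p}. vf_apply (E j) (S j g)))" "Q \<in> diffops" "!!j. S j \<in> diffops"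
    using assms(1) unfolding K_ideal_def by blast
  obtain Q' S' where P': "P' = (%g. t * Q' g + (\<Sum>j\<in>UNIV - {p}. vf_apply (E j) (S' j g)))" "Q' \<in> diffops" "!!j. S' j \<in> diffops"
    using assms(2) unfolding K_ideal_def by blast
  show ?thesis unfolding P(1) P'(1) by (rule K_idealI[of "%g. Q g + Q' g" "%j g. S j g + S' j g"])
      (auto intro!: D_add P P' simp: vf_apply_add sum.distrib algebra_simps)
qed

lemma K_ideal_0: "(%_. 0) \<in> K_ideal" using K_ideal_t[OF D_zero] by simp

lemma K_ideal_const:
  assumes "P \<in> K_ideal" shows "(%g. germ_const k * P g) \<in> K_ideal"
proof -
  obtain Q S where P: "P = (%g. t * Q g + (\<Sum>j\<in>UNIV - {p}. vf_apply (E j) (S j g)))" "Q \<in> diffops" "!!j. S j \<in> diffops"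
    using assms(1) unfolding K_ideal_def by blast
  show ?thesis unfolding P(1) by (rule K_idealI[of "%g. germ_const k * Q g" "%j g. germ_const k * S j g"])
      (auto intro!: D_lmult P simp: vf_apply_mult sum_distrib_left algebra_simps)
qed

lemma K_ideal_minus: "P \<in> K_ideal ==> (%g. - P g) \<in> K_ideal"
  using K_ideal_const[of P "- 1"] by (simp add: germ_const_minus)

lemma K_ideal_sum: "(!!i. i \<in> S ==> F i \<in> K_ideal) ==> (%g. \<Sum>i\<in>S. F i g) \<in> K_ideal"
  by (induction S rule: infinite_finite_induct) (auto intro: K_ideal_0 K_ideal_add)

lemma K_ideal_sub: "K_ideal \<subseteq> diffops" unfolding K_ideal_def by (auto intro!: D_add D_lmult D_sum D_vf_apply)

lemma K_ideal_vf_p: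
  assumes "P \<in> K_ideal" shows "(%g. vf_apply (E p) (P g)) \<in> K_ideal"
proof -
  obtain Q S where P: "P = (%g. t * Q g + (\<Sum>j\<in>UNIV - {p}. vf_apply (E j) (S j g)))" "Q \<in> diffops" "!!j. S j \<in> diffops"
    using assms(1) unfolding K_ideal_def by blast
  show ?thesis unfolding P(1)
    by (rule K_idealI[of "%g. Q g + vf_apply (E p) (Q g)" "%j g. vf_apply (E p) (S j g)"])
      (auto intro!: D_add D_vf_apply P simp: vf_apply_mult vf_apply_add vf_apply_sum E_t E_commute[of p] algebra_simps)
qed

text \<open>What the differential of \<beta> tensor P becomes once relative top forms are identified
  with multiples of \<zeta>. It is written in coordinates, so that no dual frame occurs in
  it.\<close>

definition bd_op :: "'m form => ('m germ => 'm germ) => 'm germ => 'm germ" where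
  "bd_op \<beta> P g = coef (ext_d \<beta>) * P g + (\<Sum>i\<in>UNIV. coef (wedge (dcoord i) \<beta>) * germ_pd i (P g))"

text \<open>On a frame monomial with coefficient b the differential is a sum of c_j E_j (b P) with
  constants c_j among 0, 1, -1, as the monomials are closed. The term j = p drops out since its
  monomial contains dt/t, which leaves exactly elements of the shape allowed in
  \<open>K_ideal\<close>.\<close>

lemma bd_op_in_K:
  assumes "\<beta> \<in> forms q" "Suc q = n" "P \<in> diffops"
  shows "bd_op \<beta> P \<in> K_ideal" using assms(1)
proof (induction rule: log_forms_induct)
  case zero
  have "bd_op 0 P = (%_. 0)" by (simp add: bd_op_def fun_eq_iff del: zero_fun_apply)
  thus "bd_op 0 P \<in> K_ideal" using K_ideal_0 by metis
next
  case (add \<beta> \<gamma>)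
  have l: "ext_d \<beta> \<in> forms n" "wedge (dcoord i) \<beta> \<in> forms n" if "\<beta> \<in> forms q" for \<beta> i
    using ext_d_log_forms[OF that] wedge_log_forms[OF dcoord_log that] assms(2) by auto
  have "bd_op (\<beta> + \<gamma>) P = (%g. bd_op \<beta> P g + bd_op \<gamma> P g)"
    by (simp add: bd_op_def fun_eq_iff ext_d_add wedge_add coef_add l add sum.distrib algebra_simps)
  thus "bd_op (\<beta> + \<gamma>) P \<in> K_ideal" using K_ideal_add[OF add(3,4)] by simp
next
  case (scale b js)
  have l: "wl (j # js) \<in> forms n" for j using wl_log[of "j # js"] scale assms(2) by simp
  have c: "\<exists>c. coef (wl (j # js)) = germ_const c" for j
  proof -
    have "\<kappa> (wl (j # js)) \<in> {to_mero (germ_const 0), to_mero (germ_const 1), to_mero (germ_const (- 1))}"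
      using \<kappa>_wl[of "j # js"] scale assms(2) by (simp add: germ_const_minus to_mero_uminus)
    thus ?thesis using coef_eqI by blast
  qed
  have 1: "coef (ext_d (to_mero b *f wl js)) = (\<Sum>j\<in>UNIV. vf_apply (E j) b * coef (wl (j # js)))"
    unfolding ext_d_scale_wl using l by (simp add: coef_sum coef_scale log_forms_closed)
  have 2: "coef (wedge (dcoord i) (to_mero b *f wl js)) = b * (\<Sum>j\<in>UNIV. E j i * coef (wl (j # js)))" for i
    unfolding wedge_scale dcoord_wedge_wl using l by (simp add: coef_sum coef_scale log_forms_closed sum_log_forms)
  have "bd_op (to_mero b *f wl js) P g = (\<Sum>j\<in>UNIV - {p}. coef (wl (j # js)) * vf_apply (E j) (b * P g))" for g
  proof -
    have "bd_op (to_mero b *f wl js) P g = (\<Sum>j\<in>UNIV. vf_apply (E j) b * coef (wl (j # js)) * P g) +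
        (\<Sum>i\<in>UNIV. \<Sum>j\<in>UNIV. b * E j i * coef (wl (j # js)) * germ_pd i (P g))"
      unfolding bd_op_def 1 2 by (simp add: sum_distrib_right sum_distrib_left mult_ac)
    also have "(\<Sum>i\<in>UNIV. \<Sum>j\<in>UNIV. b * E j i * coef (wl (j # js)) * germ_pd i (P g)) =
        (\<Sum>j\<in>UNIV. coef (wl (j # js)) * b * vf_apply (E j) (P g))"
      by (subst sum.swap) (simp add: vf_apply_def sum_distrib_left mult_ac)
    finally have "bd_op (to_mero b *f wl js) P g = (\<Sum>j\<in>UNIV. coef (wl (j # js)) * vf_apply (E j) (b * P g))"
      by (simp add: vf_apply_mult sum.distrib[symmetric] algebra_simps)
    also have "\<dots> = (\<Sum>j\<in>UNIV - {p}. coef (wl (j # js)) * vf_apply (E j) (b * P g))"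
      by (rule sum.mono_neutral_right) (auto simp: wl_Cons)
    finally show ?thesis .
  qed
  moreover have "(%g. \<Sum>j\<in>UNIV - {p}. coef (wl (j # js)) * vf_apply (E j) (b * P g)) \<in> K_ideal"
  proof (rule K_ideal_sum)
    fix j assume "j \<in> UNIV - {p}"
    moreover obtain c where "coef (wl (j # js)) = germ_const c" using c by blast
    ultimately show "(%g. coef (wl (j # js)) * vf_apply (E j) (b * P g)) \<in> K_ideal"
      by (auto intro!: K_ideal_const K_ideal_vf D_lmult assms)
  qed
  ultimately have "(%g. bd_op (to_mero b *f wl js) P g) \<in> K_ideal" by simp
  thus "bd_op (to_mero b *f wl js) P \<in> K_ideal" by simp
qed

lemma log_forms_top: "\<omega> \<in> forms (Suc n) ==> \<omega> \<in> wedge (dlog t) ` forms n"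
proof (induction rule: log_forms_induct)
  case zero
  show "0 \<in> wedge (dlog t) ` forms n" using log_forms_closed(1) by (rule rev_image_eqI) simp
next
  case (add \<beta> \<gamma>)
  then obtain \<beta>' \<gamma>' where \<beta>: "\<beta> = wedge (dlog t) \<beta>'" "\<beta>' \<in> forms n"
    and \<gamma>: "\<gamma> = wedge (dlog t) \<gamma>'" "\<gamma>' \<in> forms n" by blast
  show "\<beta> + \<gamma> \<in> wedge (dlog t) ` forms n"
    using log_forms_closed(2)[OF \<beta>(2) \<gamma>(2)] unfolding \<beta>(1) \<gamma>(1) wedge_add(1)[symmetric] by (rule imageI)
next
  case (scale b js)
  have "\<zeta> \<in> forms n" using wl_log[of idx] by (simp add: length_idx)
  hence *: "to_mero c *f \<zeta> \<in> forms n" for c by (rule log_forms_closed(3))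
  have "wl js \<in> {to_mero 0 *f wl (p # idx), to_mero 1 *f wl (p # idx), to_mero (- 1) *f wl (p # idx)}"
    using wl_top_cases[OF scale] by (simp add: to_mero_uminus)
  then obtain c where "wl js = to_mero c *f wl (p # idx)" by blast
  hence "to_mero b *f wl js = wedge (dlog t) (to_mero (b * c) *f \<zeta>)"
    by (simp add: wl_Cons wedge_scale to_mero_mult \<eta>_p)
  thus "to_mero b *f wl js \<in> wedge (dlog t) ` forms n" using * by (rule image_eqI)
qed

lemma dt_wedge_inv:
  assumes "\<omega> \<in> forms (Suc n)"
  shows "inv_dt \<omega> \<in> forms n" "wedge (dlog t) (inv_dt \<omega>) = \<omega>"
  using someI_ex[of "%\<gamma>. \<gamma> \<in> forms n \<and> wedge (dlog t) \<gamma> = \<omega>"] log_forms_top[OF assms]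
  unfolding dt_wedge_inv_def by auto

lemma \<kappa>_contract_wedge: "\<kappa> (contract (E p) (wedge (\<eta> p) \<gamma>)) = \<kappa> \<gamma>"
  by (simp add: contract_wedge \<eta>_E diff_conv_add_uminus \<kappa>_linear del: add_uminus_conv_diff)

lemma coef_dt_wedge_inv:
  assumes "\<omega> \<in> forms (Suc n)"
  shows "to_mero (coef (inv_dt \<omega>)) = \<kappa> (contract (E p) \<omega>)"
  using \<kappa>_contract_wedge[of "inv_dt \<omega>"] dt_wedge_inv[OF assms] by (simp add: to_mero_coef \<eta>_p)

definition R_rep :: "'m form => ('m germ => 'm germ) => 'm germ => 'm germ" where
  "R_rep \<beta> P g = coef (inv_dt (ext_d \<beta>)) * P g +
     (\<Sum>i\<in>UNIV. coef (inv_dt (wedge (dcoord i) \<beta>)) * germ_pd i (P g))"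

text \<open>For a multiple c \<zeta> the formula gives E_p (c P) directly. What remains is dt/t
  wedge \<gamma>; as d and the products with dx_i anticommute with the product by dt/t, it
  contributes minus the boundary of \<gamma>, an element of \<open>K_ideal\<close>. So R does not
  depend on the lift of a relative form.\<close>

lemma R_rep_mod_K:
  assumes "\<beta> \<in> forms n" "P \<in> diffops"
  shows "(%g. R_rep \<beta> P g - vf_apply (E p) (coef \<beta> * P g)) \<in> K_ideal"
proof -
  have l: "ext_d \<beta> \<in> forms (Suc n)" "wedge (dcoord i) \<beta> \<in> forms (Suc n)" if "\<beta> \<in> forms n" for \<beta> i
    using ext_d_log_forms[OF that] wedge_log_forms[OF dcoord_log that] by auto
  have inv_add: "coef (inv_dt (\<omega> + \<omega>')) = coef (inv_dt \<omega>) + coef (inv_dt \<omega>')"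
    if "\<omega> \<in> forms (Suc n)" "\<omega>' \<in> forms (Suc n)" for \<omega> \<omega>'
  proof -
    have "to_mero (coef (inv_dt (\<omega> + \<omega>'))) = to_mero (coef (inv_dt \<omega>) + coef (inv_dt \<omega>'))"
      using that by (simp add: coef_dt_wedge_inv to_mero_add contract_add \<kappa>_linear log_forms_closed del: to_mero_eq_iff)
    thus ?thesis by simp
  qed
  have add: "R_rep (\<beta> + \<gamma>) P g = R_rep \<beta> P g + R_rep \<gamma> P g" if "\<beta> \<in> forms n" "\<gamma> \<in> forms n" for \<beta> \<gamma> g
    by (simp add: R_rep_def ext_d_add wedge_add inv_add l that sum.distrib algebra_simps)
  define c where "c = coef \<beta>"
  define \<mu> where "\<mu> = \<beta> - to_mero c *f \<zeta>"
  let ?\<beta> = "to_mero c *f \<zeta>"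
  have z: "\<zeta> \<in> forms n" using wl_log[of idx] by (simp add: length_idx)
  hence \<beta>: "?\<beta> \<in> forms n" by (rule log_forms_closed)
  have k: "\<kappa> (contract (E p) (wl (j # idx))) = (if j = p then 1 else 0)" for j
    using contract_wl[of p idx] idx(2) by (simp add: wl_Cons contract_wedge \<eta>_E \<kappa>_linear)
  have cs: "contract v (sum f S) = (\<Sum>i\<in>S. contract v (f i))" for v :: "'m => 'm germ" and f :: "'m => 'm form" and S
    using sum_comp_morphism[of "contract v" f S] by (simp add: contract_add o_def)
  have "to_mero (coef (inv_dt (ext_d ?\<beta>))) = to_mero (vf_apply (E p) c)"
    unfolding coef_dt_wedge_inv[OF l(1)[OF \<beta>]] unfolding ext_d_scale_wl
    by (simp add: cs contract_scale \<kappa>_sum \<kappa>_linear k if_distrib cong: if_cong)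
  hence 1: "coef (inv_dt (ext_d ?\<beta>)) = vf_apply (E p) c" by simp
  have "to_mero (coef (inv_dt (wedge (dcoord i) ?\<beta>))) = to_mero (c * E p i)" for i
    unfolding coef_dt_wedge_inv[OF l(2)[OF \<beta>]] unfolding wedge_scale dcoord_wedge_wl
    by (simp add: cs contract_scale \<kappa>_sum \<kappa>_linear k to_mero_mult if_distrib cong: if_cong)
  hence 2: "coef (inv_dt (wedge (dcoord i) ?\<beta>)) = c * E p i" for i by simp
  have main: "R_rep ?\<beta> P g = vf_apply (E p) (c * P g)" for g
    by (simp add: R_rep_def 1 2 vf_apply_mult) (simp add: vf_apply_def sum_distrib_left mult_ac)
  have \<mu>: "\<mu> \<in> dt_multiples t n" unfolding \<mu>_def c_def by (rule log_form_reduce[OF assms(1)])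
  have "R_rep \<beta> P = (%g. R_rep \<mu> P g + R_rep ?\<beta> P g)"
    using add[OF subsetD[OF dt_multiples_log \<mu>] \<beta>, symmetric] by (simp add: \<mu>_def)
  hence eq: "(%g. R_rep \<beta> P g - vf_apply (E p) (coef \<beta> * P g)) = R_rep \<mu> P" by (simp add: main[unfolded c_def] c_def)
  consider "\<mu> = 0" | \<gamma> q where "\<mu> = wedge (\<eta> p) \<gamma>" "Suc q = n" "\<gamma> \<in> forms q"
    using \<mu> unfolding dt_multiples_def \<eta>_p zero_fun_def by blast
  hence "R_rep \<mu> P \<in> K_ideal"
  proof cases
    case 1
    have "R_rep 0 P g = 0" for g
      using add[OF log_forms_closed(1) log_forms_closed(1), of g] by (metis add_0 add_cancel_right_left)
    hence "R_rep \<mu> P = (%_. 0)" unfolding 1 by (simp add: fun_eq_iff del: zero_fun_apply)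
    thus ?thesis using K_ideal_0 by metis
  next
    case (2 \<gamma> q)
    have g: "ext_d \<gamma> \<in> forms n" "wedge (dcoord i) \<gamma> \<in> forms n" for i
      using ext_d_log_forms[OF 2(3)] wedge_log_forms[OF dcoord_log 2(3)] 2(2) by auto
    have \<beta>: "wedge (\<eta> p) \<gamma> \<in> forms n" using wedge_log_forms[OF \<eta>p_log 2(3)] 2(2) by simp
    have "to_mero (coef (inv_dt (ext_d \<mu>))) = to_mero (- coef (ext_d \<gamma>))"
      unfolding 2(1) coef_dt_wedge_inv[OF l(1)[OF \<beta>]] to_mero_uminus to_mero_coef[OF g(1)]
      by (simp only: ext_d_wedge[OF \<eta>_closed] contract_minus \<kappa>_linear \<kappa>_contract_wedge)
    hence d: "coef (inv_dt (ext_d \<mu>)) = - coef (ext_d \<gamma>)" by simp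
    have "to_mero (coef (inv_dt (wedge (dcoord i) \<mu>))) = to_mero (- coef (wedge (dcoord i) \<gamma>))" for i
      unfolding 2(1) coef_dt_wedge_inv[OF l(2)[OF \<beta>]] to_mero_uminus to_mero_coef[OF g(2)]
      by (simp only: wedge_anticommute[of "dcoord i"] contract_minus \<kappa>_linear \<kappa>_contract_wedge)
    hence w: "coef (inv_dt (wedge (dcoord i) \<mu>)) = - coef (wedge (dcoord i) \<gamma>)" for i by simp
    have "R_rep \<mu> P = (%g. - bd_op \<gamma> P g)" unfolding R_rep_def bd_op_def d w by (simp add: sum_negf)
    thus ?thesis using K_ideal_minus[OF bd_op_in_K[OF 2(3,2) assms(2)]] by simp
  qed
  thus ?thesis unfolding eq .
qed

text \<open>\<open>dr_boundaries\<close> is generated by expressions that mention a dual frame; this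
  one guarantees that each differential actually occurs among the generators.\<close>

lemma frame_dual: "rel_dual_frames t n (%k. \<eta> (idx ! k)) (%k. E (idx ! k))"
proof -
  have idx_ne: "idx ! k ~= p" if "k < n" for k using nth_mem[of k idx] that idx(2) length_idx by auto
  have field: "E j \<in> rel_log_fields t" if "j ~= p" for j
    unfolding rel_log_fields_def \<eta>_p[symmetric] using that \<eta>_E[of p j] by (auto elim: log_frame_expand)
  have "submodule_gen germ_ring form_module (insert (dlog t) ((%k. \<eta> (idx ! k)) ` {..<n})) = log_one_forms t" (is "?N = _")
  proof
    show "?N \<subseteq> log_one_forms t"
      using \<eta>_log \<eta>p_log log_one_closed by (intro submodule_gen_minimal) (auto simp: submodule_form_iff \<eta>_p)
    have "\<eta> j \<in> ?N" for j
    proof (cases "j = p")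
      case False
      then obtain k where "k < n" "idx ! k = j" using idx(2) length_idx by (metis DiffI UNIV_I in_set_conv_nth singletonD)
      thus ?thesis by (auto intro!: submodule_gen_inc)
    qed (auto simp: \<eta>_p intro!: submodule_gen_inc)
    hence "(\<Sum>j\<in>UNIV. to_mero (a j) *f \<eta> j) \<in> ?N" for a by (intro sum_closed_form form_gen_closed)
    thus "log_one_forms t \<subseteq> ?N" using log_one_span by force
  qed
  thus ?thesis unfolding rel_dual_frames_def
    using \<eta>_log field idx_ne \<eta>_E idx(1) length_idx by (auto simp: nth_eq_iff_index_eq)
qed

lemma wl_omit:
  assumes "k < n"
  shows "wl (idx ! l # remove1 (idx ! k) idx) \<in> (if idx ! l = idx ! k then {\<zeta>, - \<zeta>} else if l < n then {0} else UNIV)"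
    "Suc (length (remove1 (idx ! k) idx)) = n"
proof -
  have m: "idx ! k \<in> set idx" using assms length_idx by auto
  show "Suc (length (remove1 (idx ! k) idx)) = n" using m assms by (simp add: length_remove1 length_idx)
  show "wl (idx ! l # remove1 (idx ! k) idx) \<in> (if idx ! l = idx ! k then {\<zeta>, - \<zeta>} else if l < n then {0} else UNIV)"
  proof (cases "idx ! l = idx ! k")
    case True
    have "\<zeta> \<in> {wl (idx ! k # remove1 (idx ! k) idx), - wl (idx ! k # remove1 (idx ! k) idx)}"
      by (rule wl_move_to_front[OF m])
    thus ?thesis using True by auto
  next
    case False
    have "wl (idx ! l # remove1 (idx ! k) idx) = 0" if "l < n"
      using nth_mem[of l idx] that False length_idx idx(1) by (intro wl_not_distinct) (auto simp: in_set_remove1)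
    thus ?thesis using False by simp
  qed
qed

end

section \<open>Quotients and tensor products of modules\<close>

lemma comm_group_more:
  "comm_group \<lparr>carrier = C, monoid.mult = f, one = e, \<dots> = y\<rparr> ==> comm_group \<lparr>carrier = C, monoid.mult = f, one = e, \<dots> = z\<rparr>"
  unfolding comm_group_def Group.comm_monoid_def Group.group_def Group.monoid_def group_axioms_def
    comm_monoid_axioms_def Units_def partial_object.select_convs monoid.select_convs .

lemma quot_module_simps:
  "carrier (quot_module M N) = (%x. N +>\<^bsub>M\<^esub> x) ` carrier M" "zero (quot_module M N) = N"
  by (auto simp: quot_module_def A_RCOSETS_def RCOSETS_def a_r_coset_def)

locale quot_setting = abelian_subgroup H G for H and G :: "('r, 'a, 'l) module_scheme" (structure)
begin

lemma quot_carrierI: "x \<in> carrier G ==> H +> x \<in> carrier (quot_module G H)" by (simp add: quot_module_simps)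

lemma quot_add: "x \<in> carrier G ==> y \<in> carrier G ==> (H +> x) \<oplus>\<^bsub>quot_module G H\<^esub> (H +> y) = H +> (x \<oplus> y)"
  by (simp add: quot_module_def a_rcos_sum)

lemma quot_eq_iff:
  assumes "x \<in> carrier G" "y \<in> carrier G"
  shows "H +> x = H +> y \<longleftrightarrow> x \<ominus> y \<in> H"
proof
  assume "H +> x = H +> y"
  hence "x \<in> H +> y" using a_rcos_self[OF assms(1)] by (simp only:)
  thus "x \<ominus> y \<in> H" unfolding a_minus_def by (rule a_rcos_module_imp[OF assms(2)])
next
  assume "x \<ominus> y \<in> H"
  hence "x \<in> H +> y" unfolding a_minus_def by (rule a_rcos_module_rev[OF assms(2,1)])
  thus "H +> x = H +> y" by (rule a_repr_independence'[OF _ assms(2), symmetric])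
qed

lemma quot_eq_zero_iff:
  assumes "x \<in> carrier G" shows "H +> x = H \<longleftrightarrow> x \<in> H"
proof
  show "x \<in> H" if "H +> x = H" using a_rcos_self[OF assms] unfolding that .
qed (rule a_rcos_const)

lemma quot_zero: "H +> \<zero> = H" using subgroup.one_closed[OF a_subgroup] by (intro a_rcos_const) simp

lemma abelian_group_quot: "abelian_group (quot_module G H)"
proof (rule comm_group_abelian_groupI)
  show "comm_group (add_monoid (quot_module G H))"
    using a_factorgroup_is_comm_group unfolding A_FactGroup_def' by (simp add: quot_module_def comm_group_more)
qed

lemma quot_minus:
  assumes "x \<in> carrier G" shows "\<ominus>\<^bsub>quot_module G H\<^esub> (H +> x) = H +> (\<ominus> x)"
proof (rule abelian_group.minus_equality[OF abelian_group_quot])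
  show "(H +> (\<ominus> x)) \<oplus>\<^bsub>quot_module G H\<^esub> (H +> x) = \<zero>\<^bsub>quot_module G H\<^esub>"
    using assms by (simp add: quot_add l_neg quot_zero quot_module_simps)
qed (use assms in \<open>auto intro: quot_carrierI\<close>)

lemma quot_smult:
  assumes "!!x. x \<in> carrier G ==> a \<odot>\<^bsub>G\<^esub> x \<in> carrier G"
    and "!!x y. x \<in> carrier G ==> y \<in> carrier G ==> a \<odot>\<^bsub>G\<^esub> (x \<oplus> y) = a \<odot>\<^bsub>G\<^esub> x \<oplus> a \<odot>\<^bsub>G\<^esub> y"
    and "!!x. x \<in> H ==> a \<odot>\<^bsub>G\<^esub> x \<in> H" and x: "x \<in> carrier G"
  shows "a \<odot>\<^bsub>quot_module G H\<^esub> (H +> x) = H +> (a \<odot>\<^bsub>G\<^esub> x)"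
proof -
  have "H +> (a \<odot>\<^bsub>G\<^esub> y) = H +> (a \<odot>\<^bsub>G\<^esub> x)" if "y \<in> H +> x" for y
  proof -
    obtain h where h: "h \<in> H" "y = h \<oplus> x" using \<open>y \<in> H +> x\<close> by (auto simp: a_r_coset_def')
    have c: "h \<in> carrier G" using h(1) a_subset by blast
    have "H +> (a \<odot>\<^bsub>G\<^esub> y) = (H +> (a \<odot>\<^bsub>G\<^esub> h)) <+> (H +> (a \<odot>\<^bsub>G\<^esub> x))" using assms c h by (simp add: a_rcos_sum)
    also have "H +> (a \<odot>\<^bsub>G\<^esub> h) = H +> \<zero>" using assms(3)[OF h(1)] by (simp add: a_rcos_const)
    also have "(H +> \<zero>) <+> (H +> (a \<odot>\<^bsub>G\<^esub> x)) = H +> (a \<odot>\<^bsub>G\<^esub> x)" using assms by (simp add: a_rcos_sum)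
    finally show ?thesis .
  qed
  moreover have "H +> x ~= {}" using a_rcos_self[OF x] by blast
  ultimately have "(\<Union>y\<in>H +> x. H +> (a \<odot>\<^bsub>G\<^esub> y)) = H +> (a \<odot>\<^bsub>G\<^esub> x)" by (intro SUP_eq_const)
  thus ?thesis unfolding quot_module_def module.select_convs .
qed

end

lemma (in module) submodule_quot_setting: "submodule N R M ==> quot_setting N M"
  by (intro quot_setting.intro abelian_subgroupI3 additive_subgroup.intro)
    (auto intro: submodule.axioms(1) abelian_group_axioms)

lemma (in module) quot_smult_submodule:
  assumes "submodule N R M" "a \<in> carrier R" "x \<in> carrier M"
  shows "a \<odot>\<^bsub>quot_module M N\<^esub> (N +>\<^bsub>M\<^esub> x) = N +>\<^bsub>M\<^esub> (a \<odot>\<^bsub>M\<^esub> x)"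
  using submodule.smult_closed[OF assms(1)] assms smult_r_distr
  by (intro quot_setting.quot_smult[OF submodule_quot_setting]) auto

lemma (in module) module_quot:
  assumes "submodule N R M"
  shows "module R (quot_module M N)"
proof -
  interpret N: quot_setting N M by (rule submodule_quot_setting[OF assms])
  note smult = quot_smult_submodule[OF assms]
  note carr = quot_module_simps(1)[of M N]
  show ?thesis
  proof (rule moduleI)
    fix a b U V assume a: "a \<in> carrier R" and "U \<in> carrier (quot_module M N)"
    then obtain x where x: "x \<in> carrier M" "U = N +>\<^bsub>M\<^esub> x" unfolding carr by (elim imageE)
    show "a \<odot>\<^bsub>quot_module M N\<^esub> U \<in> carrier (quot_module M N)"
      unfolding x(2) smult[OF a x(1)] by (intro N.quot_carrierI smult_closed a x)
    {
      assume "V \<in> carrier (quot_module M N)"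
      then obtain y where y: "y \<in> carrier M" "V = N +>\<^bsub>M\<^esub> y" unfolding carr by (elim imageE)
      show "a \<odot>\<^bsub>quot_module M N\<^esub> (U \<oplus>\<^bsub>quot_module M N\<^esub> V) =
          a \<odot>\<^bsub>quot_module M N\<^esub> U \<oplus>\<^bsub>quot_module M N\<^esub> a \<odot>\<^bsub>quot_module M N\<^esub> V"
        unfolding x(2) y(2) using a x(1) y(1) by (simp add: smult N.quot_add smult_r_distr)
    }
    assume b: "b \<in> carrier R"
    show "(a \<oplus>\<^bsub>R\<^esub> b) \<odot>\<^bsub>quot_module M N\<^esub> U = a \<odot>\<^bsub>quot_module M N\<^esub> U \<oplus>\<^bsub>quot_module M N\<^esub> b \<odot>\<^bsub>quot_module M N\<^esub> U"
      unfolding x(2) using a b x(1) by (simp add: smult N.quot_add smult_l_distr)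
    show "(a \<otimes>\<^bsub>R\<^esub> b) \<odot>\<^bsub>quot_module M N\<^esub> U = a \<odot>\<^bsub>quot_module M N\<^esub> (b \<odot>\<^bsub>quot_module M N\<^esub> U)"
      unfolding x(2) using a b x(1) by (simp add: smult smult_assoc1)
  next
    fix U assume "U \<in> carrier (quot_module M N)"
    then obtain x where x: "x \<in> carrier M" "U = N +>\<^bsub>M\<^esub> x" unfolding carr by (elim imageE)
    show "\<one>\<^bsub>R\<^esub> \<odot>\<^bsub>quot_module M N\<^esub> U = U" unfolding x(2) smult[OF one_closed x(1)] smult_one[OF x(1)] ..
  qed (rule is_cring N.abelian_group_quot)+
qed

lemma module_restrict_scalars:
  assumes "module R M" "cring S" "h \<in> ring_hom S R"
  shows "module S (restrict_scalars h M)"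
proof -
  interpret module R M by (rule assms)
  have "comm_group (add_monoid M)" by (rule M.a_comm_group)
  hence "abelian_group (restrict_scalars h M)"
    by (intro comm_group_abelian_groupI) (simp add: restrict_scalars_def comm_group_more)
  thus ?thesis using assms(2) ring_hom_closed[OF assms(3)]
    by (intro moduleI) (auto simp: restrict_scalars_def smult_l_distr smult_r_distr smult_assoc1
        ring_hom_add[OF assms(3)] ring_hom_mult[OF assms(3)] ring_hom_one[OF assms(3)])
qed

text \<open>The free abelian group on pairs, viewed as a module record so that the tensor product
  becomes an instance of \<open>quot_module\<close> and the coset lemmas apply to it.\<close>

definition pair_module ::
  "('r, 'a, 'l) module_scheme => ('r, 'b, 'l2) module_scheme => ('r, 'a \<times> 'b \<Rightarrow>\<^sub>0 int) module" where
  "pair_module M N =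
     \<lparr>carrier = {u. Poly_Mapping.keys u \<subseteq> carrier M \<times> carrier N}, monoid.mult = undefined, one = undefined,
      zero = 0, add = (+), module.smult = (%a. frag_extend (%(x, y). frag_of (a \<odot>\<^bsub>M\<^esub> x, y)))\<rparr>"

lemma pair_module_simps [simp]:
  "carrier (pair_module M N) = {u. Poly_Mapping.keys u \<subseteq> carrier M \<times> carrier N}"
  "zero (pair_module M N) = 0" "add (pair_module M N) = (+)"
  "a \<odot>\<^bsub>pair_module M N\<^esub> u = frag_extend (%(x, y). frag_of (a \<odot>\<^bsub>M\<^esub> x, y)) u" by (auto simp: pair_module_def)

lemma abelian_group_pair_module: "abelian_group (pair_module M N)"
proof (rule comm_group_abelian_groupI)
  show "comm_group (add_monoid (pair_module M N))"
    using abelian_free_Abelian_group[of "carrier M \<times> carrier N"]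
    unfolding free_Abelian_group_def by (simp add: pair_module_def comm_group_more)
qed

lemma pair_module_minus:
  assumes "Poly_Mapping.keys u \<subseteq> carrier M \<times> carrier N" shows "\<ominus>\<^bsub>pair_module M N\<^esub> u = - u"
  by (rule abelian_group.minus_equality[OF abelian_group_pair_module]) (use assms in auto)

lemma tensor_module_eq: "tensor_module R M N = quot_module (pair_module M N) (tensor_relations R M N)"
proof -
  note c = free_Abelian_group_def
  have "r_coset (free_Abelian_group (carrier M \<times> carrier N)) = a_r_coset (pair_module M N)"
    by (simp add: fun_eq_iff a_r_coset_def r_coset_def)
  thus ?thesis unfolding tensor_module_def quot_module_def Let_def A_RCOSETS_def set_add_def
    by (simp add: fun_eq_iff RCOSETS_def set_mult_def r_coset_def c)
qed

lemma pure_tensor_eq: "pure_tensor R M N x y = tensor_relations R M N +>\<^bsub>pair_module M N\<^esub> frag_of (x, y)"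
  by (simp add: pure_tensor_def a_r_coset_def r_coset_def)

locale tensor = M: module R M + N: module R N for R (structure) and M and N
begin

abbreviation "K \<equiv> tensor_relations R M N"
abbreviation "T \<equiv> tensor_module R M N"
abbreviation "tp \<equiv> pure_tensor R M N"
abbreviation on_pairs :: "('c \<times> 'e \<Rightarrow>\<^sub>0 int) => bool" where
  "on_pairs u \<equiv> Poly_Mapping.keys u \<subseteq> carrier M \<times> carrier N"

lemma relations:
  shows "x \<in> carrier M ==> x' \<in> carrier M ==> y \<in> carrier N ==>
      frag_of (x \<oplus>\<^bsub>M\<^esub> x', y) - frag_of (x, y) - frag_of (x', y) \<in> K"
    and "x \<in> carrier M ==> y \<in> carrier N ==> y' \<in> carrier N ==>
      frag_of (x, y \<oplus>\<^bsub>N\<^esub> y') - frag_of (x, y) - frag_of (x, y') \<in> K"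
    and "a \<in> carrier R ==> x \<in> carrier M ==> y \<in> carrier N ==>
      frag_of (a \<odot>\<^bsub>M\<^esub> x, y) - frag_of (x, a \<odot>\<^bsub>N\<^esub> y) \<in> K" unfolding tensor_relations_def
  subgoal by (intro generate.incl UnI1 CollectI exI conjI) (rule refl)
  subgoal by (intro generate.incl) (rule UnI1, rule UnI2, intro CollectI exI conjI, rule refl)
  subgoal by (intro generate.incl) (rule UnI2, intro CollectI exI conjI, rule refl)
  done

text \<open>Serves for the support of relations, for their stability under scalars and for their
  vanishing under balanced biadditive maps.\<close>

lemma relations_least:
  assumes H: "0 \<in> H" "!!u v. u \<in> H ==> v \<in> H ==> u + v \<in> H" "!!u. u \<in> H ==> - u \<in> H"
    and rel: "!!x x' y. x \<in> carrier M ==> x' \<in> carrier M ==> y \<in> carrier N ==>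
      frag_of (x \<oplus>\<^bsub>M\<^esub> x', y) - frag_of (x, y) - frag_of (x', y) \<in> H"
    "!!x y y'. x \<in> carrier M ==> y \<in> carrier N ==> y' \<in> carrier N ==>
      frag_of (x, y \<oplus>\<^bsub>N\<^esub> y') - frag_of (x, y) - frag_of (x, y') \<in> H"
    "!!a x y. a \<in> carrier R ==> x \<in> carrier M ==> y \<in> carrier N ==>
      frag_of (a \<odot>\<^bsub>M\<^esub> x, y) - frag_of (x, a \<odot>\<^bsub>N\<^esub> y) \<in> H"
    and u: "u \<in> K"
  shows "on_pairs u \<and> u \<in> H"
proof -
  have k: "on_pairs (frag_of a - frag_of b)"
    "on_pairs (frag_of a - frag_of b - frag_of c)"
    if "a \<in> carrier M \<times> carrier N" "b \<in> carrier M \<times> carrier N" "c \<in> carrier M \<times> carrier N" for a b c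
    using that keys_diff[of "frag_of a" "frag_of b"] keys_diff[of "frag_of a - frag_of b" "frag_of c"] by auto
  have gen: "on_pairs u \<and> u \<in> H"
    if "u \<in> ({frag_of (x \<oplus>\<^bsub>M\<^esub> x', y) - frag_of (x, y) - frag_of (x', y) | x x' y.
          x \<in> carrier M \<and> x' \<in> carrier M \<and> y \<in> carrier N} \<union>
       {frag_of (x, y \<oplus>\<^bsub>N\<^esub> y') - frag_of (x, y) - frag_of (x, y') | x y y'.
          x \<in> carrier M \<and> y \<in> carrier N \<and> y' \<in> carrier N} \<union>
       {frag_of (a \<odot>\<^bsub>M\<^esub> x, y) - frag_of (x, a \<odot>\<^bsub>N\<^esub> y) | a x y.
          a \<in> carrier R \<and> x \<in> carrier M \<and> y \<in> carrier N})" for u using that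
  proof (elim UnE CollectE exE conjE)
    fix x x' y assume u: "u = frag_of (x \<oplus>\<^bsub>M\<^esub> x', y) - frag_of (x, y) - frag_of (x', y)"
      and c: "x \<in> carrier M" "x' \<in> carrier M" "y \<in> carrier N"
    show ?thesis unfolding u using c by (intro conjI k(2) rel(1)) auto
  next
    fix x y y' assume u: "u = frag_of (x, y \<oplus>\<^bsub>N\<^esub> y') - frag_of (x, y) - frag_of (x, y')"
      and c: "x \<in> carrier M" "y \<in> carrier N" "y' \<in> carrier N"
    show ?thesis unfolding u using c by (intro conjI k(2) rel(2)) auto
  next
    fix a x y assume u: "u = frag_of (a \<odot>\<^bsub>M\<^esub> x, y) - frag_of (x, a \<odot>\<^bsub>N\<^esub> y)"
      and c: "a \<in> carrier R" "x \<in> carrier M" "y \<in> carrier N"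
    have "(x, y) \<in> carrier M \<times> carrier N" using c by simp
    thus ?thesis unfolding u using c by (intro conjI k(1) rel(3)) auto
  qed
  show ?thesis using u unfolding tensor_relations_def
  proof (induction rule: generate.induct)
    case one
    show ?case using H(1) by simp
  next
    case (incl u)
    thus ?case by (rule gen)
  next
    case (inv u)
    have g: "on_pairs u \<and> u \<in> H" by (rule gen[OF inv])
    thus ?case using H(3)[of u] by (simp add: inv_free_Abelian_group)
  next
    case (eng u v)
    thus ?case using H(2)[of u v] keys_add[of u v] by auto
  qed
qed

lemma relations_subset:
  assumes "u \<in> K" shows "on_pairs u" using relations_least[of UNIV, OF _ _ _ _ _ _ assms] by simp

lemma subgroup_relations: "subgroup K (free_Abelian_group (carrier M \<times> carrier N))"
  unfolding tensor_relations_def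
proof (rule group.generate_is_subgroup)
  show "{frag_of (x \<oplus>\<^bsub>M\<^esub> x', y) - frag_of (x, y) - frag_of (x', y) |x x' y.
      x \<in> carrier M \<and> x' \<in> carrier M \<and> y \<in> carrier N} \<union>
    {frag_of (x, y \<oplus>\<^bsub>N\<^esub> y') - frag_of (x, y) - frag_of (x, y') |x y y'.
      x \<in> carrier M \<and> y \<in> carrier N \<and> y' \<in> carrier N} \<union>
    {frag_of (a \<odot>\<^bsub>M\<^esub> x, y) - frag_of (x, a \<odot>\<^bsub>N\<^esub> y) |a x y. a \<in> carrier R \<and> x \<in> carrier M \<and> y \<in> carrier N}
    \<subseteq> carrier (free_Abelian_group (carrier M \<times> carrier N))" (is "?S \<subseteq> _")
  proof
    fix u assume "u \<in> ?S"
    hence "u \<in> K" unfolding tensor_relations_def by (rule generate.incl)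
    from relations_subset[OF this] show "u \<in> carrier (free_Abelian_group (carrier M \<times> carrier N))" by simp
  qed
qed simp

lemma relations_closed:
  assumes "u \<in> K" shows "- u \<in> K" "v \<in> K ==> u + v \<in> K"
  using subgroup.m_inv_closed[OF subgroup_relations assms] subgroup.m_closed[OF subgroup_relations assms]
    relations_subset[OF assms] by (auto simp: inv_free_Abelian_group)

sublocale Q: quot_setting K "pair_module M N"
proof -
  have "subgroup K (add_monoid (pair_module M N))"
  proof
    show "K \<subseteq> carrier (add_monoid (pair_module M N))" using relations_subset by auto
    show "\<one>\<^bsub>add_monoid (pair_module M N)\<^esub> \<in> K" using subgroup.one_closed[OF subgroup_relations] by simp
    show "u \<otimes>\<^bsub>add_monoid (pair_module M N)\<^esub> v \<in> K" if "u \<in> K" "v \<in> K" for u v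
      using relations_closed(2)[OF that] by simp
    show "inv\<^bsub>add_monoid (pair_module M N)\<^esub> u \<in> K" if "u \<in> K" for u
      using pair_module_minus[OF relations_subset[OF that]] relations_closed(1)[OF that] unfolding a_inv_def by simp
  qed
  thus "quot_setting K (pair_module M N)"
    by (intro quot_setting.intro abelian_subgroupI3 additive_subgroup.intro abelian_group_pair_module)
qed

abbreviation coset :: "('c \<times> 'e \<Rightarrow>\<^sub>0 int) => ('c \<times> 'e \<Rightarrow>\<^sub>0 int) set" where
  "coset u \<equiv> K +>\<^bsub>pair_module M N\<^esub> u"

lemma T_eq: "T = quot_module (pair_module M N) K" and tp_eq: "tp x y = coset (frag_of (x, y))"
  by (rule tensor_module_eq pure_tensor_eq)+

sublocale T: abelian_group T unfolding T_eq by (rule Q.abelian_group_quot)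

lemma coset_simps:
  assumes "on_pairs u" "on_pairs v"
  shows "coset u \<oplus>\<^bsub>T\<^esub> coset v = coset (u + v)" "\<ominus>\<^bsub>T\<^esub> coset u = coset (- u)" "coset u \<ominus>\<^bsub>T\<^esub> coset v = coset (u - v)"
    "coset u = coset v \<longleftrightarrow> u - v \<in> K" "coset 0 = \<zero>\<^bsub>T\<^esub>" "coset u \<in> carrier T"
proof -
  have m: "\<ominus>\<^bsub>pair_module M N\<^esub> u = - u" if "on_pairs u" for u by (rule pair_module_minus[OF that])
  have v: "on_pairs (- v)" using assms(2) by (simp add: keys_minus)
  have 1: "coset u \<oplus>\<^bsub>T\<^esub> coset v = coset (u + v)" if "on_pairs v" for v
    unfolding T_eq using Q.quot_add[of u v] assms(1) that by simp
  have 2: "\<ominus>\<^bsub>T\<^esub> coset u = coset (- u)" if "on_pairs u" for u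
    unfolding T_eq using Q.quot_minus[of u] that m[OF that] by simp
  show "coset u \<oplus>\<^bsub>T\<^esub> coset v = coset (u + v)" by (rule 1[OF assms(2)])
  show "\<ominus>\<^bsub>T\<^esub> coset u = coset (- u)" by (rule 2[OF assms(1)])
  show "coset u \<ominus>\<^bsub>T\<^esub> coset v = coset (u - v)" unfolding a_minus_def 2[OF assms(2)] 1[OF v] by simp
  show "coset u = coset v \<longleftrightarrow> u - v \<in> K"
    using Q.quot_eq_iff[of u v] assms m[OF assms(2)] by (simp add: a_minus_def)
  show "coset 0 = \<zero>\<^bsub>T\<^esub>" using Q.quot_zero by (simp add: T_eq quot_module_simps)
  show "coset u \<in> carrier T" unfolding T_eq using Q.quot_carrierI[of u] assms(1) by simp
qed

lemma T_carrier: "carrier T = coset ` {u. on_pairs u}" by (simp add: T_eq quot_module_simps)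

lemma tp_closed: "x \<in> carrier M ==> y \<in> carrier N ==> tp x y \<in> carrier T"
  unfolding tp_eq by (rule coset_simps) auto

lemma T_induct [consumes 1, case_names zero pure minus]:
  assumes "C \<in> carrier T" "P \<zero>\<^bsub>T\<^esub>" "!!x y. x \<in> carrier M ==> y \<in> carrier N ==> P (tp x y)"
    "!!A B. A \<in> carrier T ==> B \<in> carrier T ==> P A ==> P B ==> P (A \<ominus>\<^bsub>T\<^esub> B)"
  shows "P C"
proof -
  obtain u where u: "on_pairs u" "C = coset u" using assms(1) unfolding T_carrier by blast
  have "P (coset u)" using u(1)
  proof (rule free_Abelian_group_induct)
    show "P (coset 0)" using coset_simps(5)[of 0 0] assms(2) by simp
    show "P (coset (frag_of a))" if "a \<in> carrier M \<times> carrier N" for a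
      using assms(3)[of "fst a" "snd a"] that by (auto simp: tp_eq)
    show "P (coset (x - y))" if "on_pairs x" "on_pairs y"
      "P (coset x)" "P (coset y)" for x y
      using assms(4)[OF coset_simps(6)[OF that(1,1)] coset_simps(6)[OF that(2,2)] that(3,4)] coset_simps(3)[OF that(1,2)] by simp
  qed
  thus ?thesis by (simp add: u)
qed

lemma tp_add_left:
  assumes "x \<in> carrier M" "x' \<in> carrier M" "y \<in> carrier N"
  shows "tp (x \<oplus>\<^bsub>M\<^esub> x') y = tp x y \<oplus>\<^bsub>T\<^esub> tp x' y"
proof -
  have k: "on_pairs (frag_of (x, y) + frag_of (x', y))"
    using keys_add[of "frag_of (x, y)" "frag_of (x', y)"] assms by auto
  have "coset (frag_of (x \<oplus>\<^bsub>M\<^esub> x', y)) = coset (frag_of (x, y) + frag_of (x', y))"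
    using relations(1)[OF assms] coset_simps(4)[OF _ k, of "frag_of (x \<oplus>\<^bsub>M\<^esub> x', y)"] assms by (simp add: diff_diff_eq)
  thus ?thesis using assms by (simp add: tp_eq coset_simps)
qed

lemma tp_add_right:
  assumes "x \<in> carrier M" "y \<in> carrier N" "y' \<in> carrier N"
  shows "tp x (y \<oplus>\<^bsub>N\<^esub> y') = tp x y \<oplus>\<^bsub>T\<^esub> tp x y'"
proof -
  have k: "on_pairs (frag_of (x, y) + frag_of (x, y'))"
    using keys_add[of "frag_of (x, y)" "frag_of (x, y')"] assms by auto
  have "coset (frag_of (x, y \<oplus>\<^bsub>N\<^esub> y')) = coset (frag_of (x, y) + frag_of (x, y'))"
    using relations(2)[OF assms] coset_simps(4)[OF _ k, of "frag_of (x, y \<oplus>\<^bsub>N\<^esub> y')"] assms by (simp add: diff_diff_eq)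
  thus ?thesis using assms by (simp add: tp_eq coset_simps)
qed

lemma tp_balanced:
  assumes "a \<in> carrier R" "x \<in> carrier M" "y \<in> carrier N"
  shows "tp (a \<odot>\<^bsub>M\<^esub> x) y = tp x (a \<odot>\<^bsub>N\<^esub> y)"
  using relations(3)[OF assms] assms by (simp add: tp_eq coset_simps)

lemma smult_coset:
  assumes a: "a \<in> carrier R" and u: "on_pairs u"
  shows "a \<odot>\<^bsub>T\<^esub> coset u = coset (frag_extend (%(x, y). frag_of (a \<odot>\<^bsub>M\<^esub> x, y)) u)"
    "on_pairs (frag_extend (%(x, y). frag_of (a \<odot>\<^bsub>M\<^esub> x, y)) u)"
proof -
  let ?f = "frag_extend (%(x, y). frag_of (a \<odot>\<^bsub>M\<^esub> x, y))"
  have keys: "on_pairs (?f u)" if "on_pairs u" for u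
    using order_trans[OF keys_frag_extend] that a by (intro order_trans[OF keys_frag_extend] UN_least) (auto split: prod.splits)
  have "on_pairs u \<and> u \<in> {u. ?f u \<in> K}" if "u \<in> K" for u
  proof (rule relations_least[OF _ _ _ _ _ _ that])
    have z: "0 \<in> K" using subgroup.one_closed[OF subgroup_relations] by simp
    show "0 \<in> {u. ?f u \<in> K}" using z by simp
    show "u + v \<in> {u. ?f u \<in> K}" if "u \<in> {u. ?f u \<in> K}" "v \<in> {u. ?f u \<in> K}" for u v
      using that relations_closed(2) by (simp add: frag_extend_add)
    show "- u \<in> {u. ?f u \<in> K}" if "u \<in> {u. ?f u \<in> K}" for u
      using that relations_closed(1) by (simp add: frag_extend_minus)
    fix x y assume c: "x \<in> carrier M" "y \<in> carrier N"
    show "frag_of (x \<oplus>\<^bsub>M\<^esub> x', y) - frag_of (x, y) - frag_of (x', y) \<in> {u. ?f u \<in> K}" if "x' \<in> carrier M" for x'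
      using relations(1)[of "a \<odot>\<^bsub>M\<^esub> x" "a \<odot>\<^bsub>M\<^esub> x'" y] c that a by (simp add: frag_extend_diff M.smult_r_distr)
    show "frag_of (x, y \<oplus>\<^bsub>N\<^esub> y') - frag_of (x, y) - frag_of (x, y') \<in> {u. ?f u \<in> K}" if "y' \<in> carrier N" for y'
      using relations(2)[of "a \<odot>\<^bsub>M\<^esub> x" y y'] c that a by (simp add: frag_extend_diff)
    fix b assume b: "b \<in> carrier R"
    have "a \<odot>\<^bsub>M\<^esub> (b \<odot>\<^bsub>M\<^esub> x) = b \<odot>\<^bsub>M\<^esub> (a \<odot>\<^bsub>M\<^esub> x)"
      using a b c by (simp add: M.smult_assoc1[symmetric] M.R.m_comm)
    thus "frag_of (b \<odot>\<^bsub>M\<^esub> x, y) - frag_of (x, b \<odot>\<^bsub>N\<^esub> y) \<in> {u. ?f u \<in> K}"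
      using relations(3)[of b "a \<odot>\<^bsub>M\<^esub> x" y] c a b by (simp add: frag_extend_diff)
  qed
  hence K: "?f u \<in> K" if "u \<in> K" for u using that by blast
  show "a \<odot>\<^bsub>T\<^esub> coset u = coset (?f u)"
    unfolding T_eq using Q.quot_smult[of a u] keys K u by (simp add: frag_extend_add)
  show "on_pairs (?f u)" by (rule keys[OF u])
qed

lemma smult_tp: "a \<in> carrier R ==> x \<in> carrier M ==> y \<in> carrier N ==> a \<odot>\<^bsub>T\<^esub> tp x y = tp (a \<odot>\<^bsub>M\<^esub> x) y"
  by (simp add: tp_eq smult_coset)

lemma T_smult_closed:
  assumes "a \<in> carrier R" "A \<in> carrier T" shows "a \<odot>\<^bsub>T\<^esub> A \<in> carrier T"
  using assms(2) unfolding T_carrier using smult_coset[OF assms(1)] by auto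

lemma T_smult_r_distr:
  assumes "a \<in> carrier R" "A \<in> carrier T" "B \<in> carrier T"
  shows "a \<odot>\<^bsub>T\<^esub> (A \<oplus>\<^bsub>T\<^esub> B) = a \<odot>\<^bsub>T\<^esub> A \<oplus>\<^bsub>T\<^esub> a \<odot>\<^bsub>T\<^esub> B"
proof -
  obtain u v where u: "A = coset u" "on_pairs u"
    and v: "B = coset v" "on_pairs v" using assms(2,3) unfolding T_carrier by blast
  have uv: "on_pairs (u + v)" using keys_add[of u v] u v by blast
  note s = smult_coset[OF assms(1)]
  show ?thesis
    unfolding u(1) v(1) coset_simps(1)[OF u(2) v(2)] s(1)[OF uv] s(1)[OF u(2)] s(1)[OF v(2)] coset_simps(1)[OF s(2)[OF u(2)] s(2)[OF v(2)]]
    by (simp only: frag_extend_add)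
qed

end

section \<open>Additive maps between abelian groups and out of tensor products\<close>

lemma (in abelian_group) eq_if_minus_eq_zero:
  assumes "x \<in> carrier G" "y \<in> carrier G" "x \<ominus> y = \<zero>" shows "x = y"
proof -
  have "x = (x \<ominus> y) \<oplus> y" using assms(1,2) by (simp add: a_minus_def a_assoc l_neg)
  thus ?thesis unfolding assms(3) l_zero[OF assms(2)] .
qed

lemma (in abelian_group) additive_zero_minus:
  assumes "!!x. x \<in> carrier H ==> f x \<in> carrier G" "abelian_group H"
    "!!x y. x \<in> carrier H ==> y \<in> carrier H ==> f (x \<oplus>\<^bsub>H\<^esub> y) = f x \<oplus> f y"
  shows "f \<zero>\<^bsub>H\<^esub> = \<zero>" "!!x y. x \<in> carrier H ==> y \<in> carrier H ==> f (x \<ominus>\<^bsub>H\<^esub> y) = f x \<ominus> f y"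
proof -
  interpret H: abelian_group H by (rule assms(2))
  have "f \<zero>\<^bsub>H\<^esub> \<oplus> f \<zero>\<^bsub>H\<^esub> = f \<zero>\<^bsub>H\<^esub>" using assms(3)[of "\<zero>\<^bsub>H\<^esub>" "\<zero>\<^bsub>H\<^esub>"] by simp
  thus z: "f \<zero>\<^bsub>H\<^esub> = \<zero>" using add.r_cancel_one'[of "f \<zero>\<^bsub>H\<^esub>" "f \<zero>\<^bsub>H\<^esub>"] assms(1)[of "\<zero>\<^bsub>H\<^esub>"] by simp
  show "f (x \<ominus>\<^bsub>H\<^esub> y) = f x \<ominus> f y" if "x \<in> carrier H" "y \<in> carrier H" for x y
  proof -
    have "f (\<ominus>\<^bsub>H\<^esub> y) \<oplus> f y = \<zero>" using assms(3)[of "\<ominus>\<^bsub>H\<^esub> y" y] that z by (simp add: H.l_neg)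
    hence "\<ominus> f y = f (\<ominus>\<^bsub>H\<^esub> y)" using assms(1) that by (intro minus_equality) auto
    thus ?thesis using assms(3)[of x "\<ominus>\<^bsub>H\<^esub> y"] that by (simp add: a_minus_def)
  qed
qed

lemma (in abelian_group) additive_finsum:
  assumes f: "!!x. x \<in> carrier H ==> f x \<in> carrier G" "abelian_group H"
    "!!x y. x \<in> carrier H ==> y \<in> carrier H ==> f (x \<oplus>\<^bsub>H\<^esub> y) = f x \<oplus> f y"
    and "finite S" "!!i. i \<in> S ==> g i \<in> carrier H"
  shows "f (finsum H g S) = finsum G (%i. f (g i)) S" using assms(4,5)
proof (induction S rule: finite_induct)
  interpret H: abelian_group H by (rule assms(2))
  {
    case empty
    show ?case using additive_zero_minus(1)[OF f] by simp
  next
    case (insert i S)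
    have g: "g \<in> S \<rightarrow> carrier H" "g i \<in> carrier H" using insert.prems by auto
    have fg: "(%i. f (g i)) \<in> S \<rightarrow> carrier G" "f (g i) \<in> carrier G" using g f(1) by auto
    show ?case using insert g fg by (simp add: f(3) H.finsum_insert finsum_insert)
  }
qed

context tensor
begin

lemma T_ext:
  assumes G: "abelian_group G" and f: "!!C. C \<in> carrier T ==> f C \<in> carrier G" "!!C. C \<in> carrier T ==> g C \<in> carrier G"
    and add: "!!A B. A \<in> carrier T ==> B \<in> carrier T ==> f (A \<oplus>\<^bsub>T\<^esub> B) = f A \<oplus>\<^bsub>G\<^esub> f B"
      "!!A B. A \<in> carrier T ==> B \<in> carrier T ==> g (A \<oplus>\<^bsub>T\<^esub> B) = g A \<oplus>\<^bsub>G\<^esub> g B"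
    and pure: "!!x y. x \<in> carrier M ==> y \<in> carrier N ==> f (tp x y) = g (tp x y)"
    and C: "C \<in> carrier T"
  shows "f C = g C" using C
proof (induction rule: T_induct)
  note f0 = abelian_group.additive_zero_minus[OF G, of T f] and g0 = abelian_group.additive_zero_minus[OF G, of T g]
  case zero
  show ?case using f0(1) g0(1) f add T.abelian_group_axioms by simp
next
  note f0 = abelian_group.additive_zero_minus[OF G, of T f] and g0 = abelian_group.additive_zero_minus[OF G, of T g]
  case (minus A B)
  thus ?case using f0(2)[of A B] g0(2)[of A B] f add T.abelian_group_axioms by simp
qed (rule pure)

lemma module_T: "module R T"
proof (rule moduleI)
  note cl = T_smult_closed T_smult_r_distr T.add.m_closed
  show "cring R" by (rule M.R.is_cring)
  show "abelian_group T" by (rule T.abelian_group_axioms)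
  show "a \<odot>\<^bsub>T\<^esub> A \<in> carrier T" if "a \<in> carrier R" "A \<in> carrier T" for a A by (rule T_smult_closed[OF that])
  show "a \<odot>\<^bsub>T\<^esub> (A \<oplus>\<^bsub>T\<^esub> B) = a \<odot>\<^bsub>T\<^esub> A \<oplus>\<^bsub>T\<^esub> a \<odot>\<^bsub>T\<^esub> B"
    if "a \<in> carrier R" "A \<in> carrier T" "B \<in> carrier T" for a A B by (rule T_smult_r_distr[OF that])
  show "(a \<oplus> b) \<odot>\<^bsub>T\<^esub> A = a \<odot>\<^bsub>T\<^esub> A \<oplus>\<^bsub>T\<^esub> b \<odot>\<^bsub>T\<^esub> A" if "a \<in> carrier R" "b \<in> carrier R" "A \<in> carrier T" for a b A
    by (rule T_ext[OF T.abelian_group_axioms _ _ _ _ _ that(3)])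
      (use that in \<open>simp_all add: cl smult_tp M.smult_l_distr tp_add_left T.a_ac\<close>)
  show "(a \<otimes> b) \<odot>\<^bsub>T\<^esub> A = a \<odot>\<^bsub>T\<^esub> (b \<odot>\<^bsub>T\<^esub> A)" if "a \<in> carrier R" "b \<in> carrier R" "A \<in> carrier T" for a b A
    by (rule T_ext[OF T.abelian_group_axioms _ _ _ _ _ that(3)])
      (use that in \<open>simp_all add: cl smult_tp M.smult_assoc1\<close>)
  show "\<one> \<odot>\<^bsub>T\<^esub> A = A" if "A \<in> carrier T" for A by (rule T_ext[OF T.abelian_group_axioms _ _ _ _ _ that])
      (use that in \<open>simp_all add: cl smult_tp\<close>)
qed

text \<open>The map is extended to the free group and the relations lie in its kernel. A
  representative is chosen in each coset, and vanishing on the relations makes the choice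
  irrelevant.\<close>

lemma tensor_universal:
  assumes G: "abelian_group G" and f: "!!x y. x \<in> carrier M ==> y \<in> carrier N ==> f x y \<in> carrier G"
    and add: "!!x x' y. x \<in> carrier M ==> x' \<in> carrier M ==> y \<in> carrier N ==> f (x \<oplus>\<^bsub>M\<^esub> x') y = f x y \<oplus>\<^bsub>G\<^esub> f x' y"
      "!!x y y'. x \<in> carrier M ==> y \<in> carrier N ==> y' \<in> carrier N ==> f x (y \<oplus>\<^bsub>N\<^esub> y') = f x y \<oplus>\<^bsub>G\<^esub> f x y'"
    and bal: "!!a x y. a \<in> carrier R ==> x \<in> carrier M ==> y \<in> carrier N ==> f (a \<odot>\<^bsub>M\<^esub> x) y = f x (a \<odot>\<^bsub>N\<^esub> y)"
  obtains h where "!!C. C \<in> carrier T ==> h C \<in> carrier G"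
    "!!A B. A \<in> carrier T ==> B \<in> carrier T ==> h (A \<oplus>\<^bsub>T\<^esub> B) = h A \<oplus>\<^bsub>G\<^esub> h B"
    "!!x y. x \<in> carrier M ==> y \<in> carrier N ==> h (tp x y) = f x y"
proof -
  interpret G: abelian_group G by (rule G)
  let ?S = "carrier M \<times> carrier N"
  let ?F = "free_Abelian_group ?S"
  have "case_prod f ` ?S \<subseteq> carrier (add_monoid G)" using f by auto
  then obtain h0 where h0: "h0 \<in> hom ?F (add_monoid G)" "!!x. x \<in> ?S ==> h0 (frag_of x) = case_prod f x"
    apply (rule comm_group.free_Abelian_group_universal[OF G.a_comm_group])
    subgoal premises prems for h by (rule prems(1)[OF prems(2,3)])
    done
  have cl: "h0 u \<in> carrier G" if "on_pairs u" for u using hom_in_carrier[OF h0(1), of u] that by simp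
  have ad: "h0 (u + v) = h0 u \<oplus>\<^bsub>G\<^esub> h0 v" if "on_pairs u" "on_pairs v" for u v
    using hom_mult[OF h0(1), of u v] that by simp
  have P: "abelian_group (pair_module M N)" by (rule abelian_group_pair_module)
  have h00: "h0 0 = \<zero>\<^bsub>G\<^esub>" using G.additive_zero_minus(1)[of "pair_module M N" h0] P cl ad by simp
  have mi: "h0 (u - v) = h0 u \<ominus>\<^bsub>G\<^esub> h0 v" if "on_pairs u" "on_pairs v" for u v
    using G.additive_zero_minus(2)[of "pair_module M N" h0 u v] P cl ad that by (simp add: a_minus_def[of "pair_module M N"] pair_module_minus)
  let ?Z = "{u. on_pairs u \<and> h0 u = \<zero>\<^bsub>G\<^esub>}"
  have ker: "h0 u = \<zero>\<^bsub>G\<^esub>" if "u \<in> K" for u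
  proof -
    have k: "on_pairs (frag_of a - frag_of b)" if "a \<in> ?S" "b \<in> ?S" for a b :: "'c \<times> 'e"
      using that keys_diff[of "frag_of a" "frag_of b"] by auto
    have k0: "on_pairs (frag_of (x, y))" if "x \<in> carrier M" "y \<in> carrier N" for x y using that by simp
    have k3: "on_pairs (frag_of a - frag_of b - frag_of c)" if "a \<in> ?S" "b \<in> ?S" "c \<in> ?S" for a b c :: "'c \<times> 'e"
      using k[OF that(1,2)] that(3) keys_diff[of "frag_of a - frag_of b" "frag_of c"] by auto
    have "on_pairs u \<and> u \<in> ?Z"
    proof (rule relations_least[OF _ _ _ _ _ _ that])
      show "0 \<in> ?Z" by (simp add: h00)
      show "u + v \<in> ?Z"
        if "u \<in> ?Z" "v \<in> ?Z" for u v using that ad[of u v] keys_add[of u v] by auto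
      show "- u \<in> ?Z"
        if "u \<in> ?Z" for u using that mi[of 0 u] h00 by (simp add: keys_minus a_minus_def)
      fix x y assume c: "x \<in> carrier M" "y \<in> carrier N"
      show "frag_of (x \<oplus>\<^bsub>M\<^esub> x', y) - frag_of (x, y) - frag_of (x', y) \<in> ?Z"
        if "x' \<in> carrier M" for x'
        using c that k3 k f by (simp add: mi h0(2) add a_minus_def[of G] G.minus_add G.a_ac G.r_neg G.r_neg1 G.r_neg2)
      show "frag_of (x, y \<oplus>\<^bsub>N\<^esub> y') - frag_of (x, y) - frag_of (x, y') \<in> ?Z"
        if "y' \<in> carrier N" for y'
        using c that k3 k f by (simp add: mi h0(2) add a_minus_def[of G] G.minus_add G.a_ac G.r_neg G.r_neg1 G.r_neg2)
      show "frag_of (a \<odot>\<^bsub>M\<^esub> x, y) - frag_of (x, a \<odot>\<^bsub>N\<^esub> y) \<in> ?Z"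
        if "a \<in> carrier R" for a using c that k f by (simp add: mi h0(2) bal a_minus_def[of G] G.r_neg)
    qed
    thus ?thesis by blast
  qed
  define h where "h C = h0 (SOME u. on_pairs u \<and> C = coset u)" for C
  have h: "h (coset u) = h0 u" if u: "on_pairs u" for u
  proof -
    define v where "v = (SOME v. on_pairs v \<and> coset u = coset v)"
    have v: "on_pairs v \<and> coset u = coset v" unfolding v_def by (rule someI[of _ u]) (simp add: u)
    hence "u - v \<in> K" using coset_simps(4)[OF u, of v] by simp
    hence "h0 u \<ominus>\<^bsub>G\<^esub> h0 v = \<zero>\<^bsub>G\<^esub>" using ker mi[OF u, of v] v by simp
    hence "h0 u = h0 v" by (rule G.eq_if_minus_eq_zero[rotated -1]) (use cl u v in auto)
    moreover have "h (coset u) = h0 v" by (simp only: h_def v_def)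
    ultimately show ?thesis by simp
  qed
  show thesis
  proof (rule that[of h])
    show "h C \<in> carrier G" if "C \<in> carrier T" for C using that h cl unfolding T_carrier by auto
    show "h (tp x y) = f x y" if "x \<in> carrier M" "y \<in> carrier N" for x y
      using that by (simp add: tp_eq h h0(2))
    show "h (A \<oplus>\<^bsub>T\<^esub> B) = h A \<oplus>\<^bsub>G\<^esub> h B" if AB: "A \<in> carrier T" "B \<in> carrier T" for A B
    proof -
      obtain u v where u: "A = coset u" "on_pairs u"
        and v: "B = coset v" "on_pairs v" using AB unfolding T_carrier by blast
      have uv: "on_pairs (u + v)" using keys_add[of u v] u v by blast
      show ?thesis
        unfolding u(1) v(1) coset_simps(1)[OF u(2) v(2)] h[OF uv] h[OF u(2)] h[OF v(2)] by (rule ad[OF u(2) v(2)])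
    qed
  qed
qed

end

subsection \<open>The module of differential operators\<close>

lemma D_module_simps: "zero D_module = (%_. 0)" "add D_module P Q = (%g. P g + Q g)" "a \<odot>\<^bsub>D_module\<^esub> P = (%g. a * P g)"
  by (simp_all add: D_module_def)

lemma module_D_module: "module germ_ring (D_module :: (('m::finite) germ, 'm germ => 'm germ) module)"
proof (rule moduleI)
  show "cring germ_ring" by (rule cring_from_type_algebra)
  show "abelian_group (D_module :: (('m::finite) germ, 'm germ => 'm germ) module)"
  proof (rule abelian_groupI)
    show "\<exists>Q\<in>diffops. Q \<oplus>\<^bsub>D_module\<^esub> P = \<zero>\<^bsub>D_module\<^esub>" if "P \<in> diffops" for P :: "'m germ => 'm germ"
      using D_minus[OF that] by (rule rev_bexI) (simp add: D_module_simps)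
  qed (simp_all add: D_module_simps D_zero D_add add_ac)
qed (simp_all add: D_module_simps D_lmult algebra_simps)

lemma germ_const_ring_hom: "germ_const \<in> ring_hom complex_ring germ_ring"
  by (rule ring_hom_memI) (simp_all add: germ_const_add germ_const_mult)

definition D_complex :: "(complex, ('m::finite) germ => 'm germ) module" where
  "D_complex = restrict_scalars germ_const D_module"

lemma D_complex_simps: "carrier D_complex = diffops" "zero D_complex = (%_. 0)" "add D_complex P Q = (%g. P g + Q g)"
    "k \<odot>\<^bsub>D_complex\<^esub> P = (%g. germ_const k * P g)"
  by (simp_all add: D_complex_def restrict_scalars_def D_module_simps)

lemma module_D_complex: "module complex_ring D_complex" unfolding D_complex_def
  by (rule module_restrict_scalars[OF module_D_module cring_from_type_algebra germ_const_ring_hom])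

lemma D_complex_minus:
  assumes "P \<in> diffops" "Q \<in> diffops"
  shows "\<ominus>\<^bsub>D_complex\<^esub> P = (%g. - P g)" "P \<ominus>\<^bsub>D_complex\<^esub> Q = (%g. P g - Q g)"
proof -
  interpret module complex_ring D_complex by (rule module_D_complex)
  have *: "\<ominus>\<^bsub>D_complex\<^esub> P = (%g. - P g)" if "P \<in> diffops" for P :: "'a germ => 'a germ"
    using D_minus[OF that] that by (intro minus_equality) (simp_all add: D_complex_simps)
  show "\<ominus>\<^bsub>D_complex\<^esub> P = (%g. - P g)" by (rule *[OF assms(1)])
  show "P \<ominus>\<^bsub>D_complex\<^esub> Q = (%g. P g - Q g)" unfolding a_minus_def *[OF assms(2)] by (simp add: D_complex_simps)
qed

lemma (in abelian_group) D_additive_finsum: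
  fixes f :: "(('m::finite) germ => 'm germ) => 'a"
  assumes f: "!!P. P \<in> diffops ==> f P \<in> carrier G"
    "!!P Q. P \<in> diffops ==> Q \<in> diffops ==> f (%g. P g + Q g) = f P \<oplus> f Q"
    and "finite S" "!!i. i \<in> S ==> F i \<in> diffops"
  shows "finsum G (%i. f (F i)) S = f (%g. \<Sum>i\<in>S. F i g)" using assms(3,4)
proof (induction S rule: finite_induct)
  case empty
  have "abelian_group (D_complex :: (complex, 'm germ => 'm germ) module)" by (rule module.axioms(2)[OF module_D_complex])
  thus ?case using additive_zero_minus(1)[of D_complex f] f by (simp add: D_complex_simps)
next
  case (insert i S)
  have F: "F i \<in> diffops" "(%g. \<Sum>i\<in>S. F i g) \<in> diffops" using insert.prems by (auto intro: D_sum)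
  have fF: "(%i. f (F i)) \<in> S \<rightarrow> carrier G" "f (F i) \<in> carrier G" using insert.prems f(1) by auto
  show ?case using insert F fF by (simp add: f(2) finsum_insert)
qed

lemma (in module) submodule_smult_image:
  assumes a: "a \<in> carrier R" shows "submodule ((%x. a \<odot>\<^bsub>M\<^esub> x) ` carrier M) R M"
proof (rule submoduleI)
  show "(%x. a \<odot>\<^bsub>M\<^esub> x) ` carrier M \<subseteq> carrier M" using a by auto
  have z: "a \<odot>\<^bsub>M\<^esub> \<zero>\<^bsub>M\<^esub> = \<zero>\<^bsub>M\<^esub>" and m: "!!x y. x \<in> carrier M ==> y \<in> carrier M ==> a \<odot>\<^bsub>M\<^esub> (x \<ominus>\<^bsub>M\<^esub> y) = a \<odot>\<^bsub>M\<^esub> x \<ominus>\<^bsub>M\<^esub> a \<odot>\<^bsub>M\<^esub> y"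
    using additive_zero_minus[of M "%x. a \<odot>\<^bsub>M\<^esub> x"] a abelian_group_axioms by (simp_all add: smult_r_distr)
  show "\<zero>\<^bsub>M\<^esub> \<in> (%x. a \<odot>\<^bsub>M\<^esub> x) ` carrier M" by (rule rev_image_eqI[OF zero_closed]) (simp add: z)
  fix x assume "x \<in> (%x. a \<odot>\<^bsub>M\<^esub> x) ` carrier M"
  then obtain x' where x: "x' \<in> carrier M" "x = a \<odot>\<^bsub>M\<^esub> x'" by (elim imageE)
  have "a \<odot>\<^bsub>M\<^esub> (\<ominus>\<^bsub>M\<^esub> x') = \<ominus>\<^bsub>M\<^esub> x" using m[OF zero_closed x(1)] x a z by (simp add: a_minus_def)
  thus "\<ominus>\<^bsub>M\<^esub> x \<in> (%x. a \<odot>\<^bsub>M\<^esub> x) ` carrier M" using x(1) by (intro rev_image_eqI[of "\<ominus>\<^bsub>M\<^esub> x'"]) auto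
  show "b \<odot>\<^bsub>M\<^esub> x \<in> (%x. a \<odot>\<^bsub>M\<^esub> x) ` carrier M" if "b \<in> carrier R" for b
  proof (rule rev_image_eqI[of "b \<odot>\<^bsub>M\<^esub> x'"])
    show "b \<odot>\<^bsub>M\<^esub> x = a \<odot>\<^bsub>M\<^esub> (b \<odot>\<^bsub>M\<^esub> x')" using a that x by (simp add: smult_assoc1[symmetric] R.m_comm)
  qed (use that x in auto)
  fix y assume "y \<in> (%x. a \<odot>\<^bsub>M\<^esub> x) ` carrier M"
  then obtain y' where y: "y' \<in> carrier M" "y = a \<odot>\<^bsub>M\<^esub> y'" by (elim imageE)
  show "x \<oplus>\<^bsub>M\<^esub> y \<in> (%x. a \<odot>\<^bsub>M\<^esub> x) ` carrier M"
    by (rule rev_image_eqI[of "x' \<oplus>\<^bsub>M\<^esub> y'"]) (use x y a in \<open>simp_all add: smult_r_distr\<close>)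
qed

section \<open>Relative forms restricted to Y and their tensor product with D\<close>

context log_frame
begin

lemma log_module_simps: "carrier (log_module t r) = forms r" "zero (log_module t r) = 0" "add (log_module t r) = (+)"
    "a \<odot>\<^bsub>log_module t r\<^esub> \<beta> = to_mero a *f \<beta>" using form_module_simps by (simp_all add: log_module_def)

lemma module_log_module: "module germ_ring (log_module t r)" unfolding log_module_def
  by (rule submodule.submodule_is_module[OF _ module_form_module]) (simp add: submodule_form_iff log_forms_closed)

lemma log_module_minus:
  assumes "\<beta> \<in> forms r" "\<gamma> \<in> forms r"
  shows "\<beta> \<ominus>\<^bsub>log_module t r\<^esub> \<gamma> = \<beta> - \<gamma>"
proof -
  interpret module germ_ring "log_module t r" by (rule module_log_module)
  have "to_mero (- 1) *f \<gamma> \<in> forms r" using assms(2) by (rule log_forms_closed)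
  hence "\<ominus>\<^bsub>log_module t r\<^esub> \<gamma> = - \<gamma>"
    using assms by (intro minus_equality) (simp_all add: log_module_simps to_mero_uminus)
  thus ?thesis by (simp add: a_minus_def log_module_simps)
qed

lemma submodule_dt_log: "submodule (dt_multiples t r) germ_ring (log_module t r)"
proof -
  have "module germ_ring (form_module\<lparr>carrier := dt_multiples t r\<rparr>)"
    by (rule submodule.submodule_is_module[OF submodule_dt_multiples module_form_module])
  hence "module germ_ring ((log_module t r)\<lparr>carrier := dt_multiples t r\<rparr>)" by (simp add: log_module_def)
  moreover have "dt_multiples t r \<subseteq> carrier (log_module t r)"
    using dt_multiples_log by (simp add: log_module_simps)
  ultimately show ?thesis by (intro module.module_incl_imp_submodule[OF module_log_module])
qed

lemma module_rel: "module germ_ring (rel_log_module t r)"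
  unfolding rel_log_module_def by (rule module.module_quot[OF module_log_module submodule_dt_log])

lemma submodule_t_rel: "submodule ((%x. t \<odot>\<^bsub>rel_log_module t r\<^esub> x) ` carrier (rel_log_module t r)) germ_ring (rel_log_module t r)"
  by (rule module.submodule_smult_image[OF module_rel]) simp

lemma module_rel_Y: "module germ_ring (rel_log_module_Y t r)"
  unfolding rel_log_module_Y_def by (rule module.module_quot[OF module_rel submodule_t_rel])

lemma rel_class_Y_simps:
  assumes \<beta>: "\<beta> \<in> forms n"
  shows "rclass \<beta> \<in> carrier (rel_log_module_Y t n)"
    "\<gamma> \<in> forms n ==> rclass (\<beta> + \<gamma>) = rclass \<beta> \<oplus>\<^bsub>rel_log_module_Y t n\<^esub> rclass \<gamma>"
    "rclass (to_mero a *f \<beta>) = a \<odot>\<^bsub>rel_log_module_Y t n\<^esub> rclass \<beta>"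
    "\<gamma> \<in> forms n ==> rclass \<beta> = rclass \<gamma> \<longleftrightarrow>
      (\<exists>\<omega>\<in>forms n. \<beta> - \<gamma> - to_mero t *f \<omega> \<in> dt_multiples t n)"
proof -
  let ?R = "rel_log_module t n" and ?L = "log_module t n" and ?d = "dt_multiples t n"
  interpret L: module germ_ring ?L by (rule module_log_module)
  interpret R: module germ_ring ?R by (rule module_rel)
  interpret Ld: quot_setting ?d ?L by (rule L.submodule_quot_setting[OF submodule_dt_log])
  let ?T = "(%x. t \<odot>\<^bsub>?R\<^esub> x) ` carrier ?R"
  interpret RT: quot_setting ?T ?R by (rule R.submodule_quot_setting[OF submodule_t_rel])
  have z: "zero (rel_log_module_Y t n) = ?T" by (simp add: rel_log_module_Y_def quot_module_simps)
  let ?c = "%\<beta>. ?d +>\<^bsub>?L\<^esub> \<beta>"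
  have cls: "rclass \<beta> = ?T +>\<^bsub>?R\<^esub> ?c \<beta>" for \<beta> by (simp add: rel_class_Y_def z)
  have c: "?c \<beta> \<in> carrier ?R" if "\<beta> \<in> forms n" for \<beta>
    using Ld.quot_carrierI[of \<beta>] that by (simp add: rel_log_module_def log_module_simps)
  have c_add: "?c (\<beta> + \<gamma>) = ?c \<beta> \<oplus>\<^bsub>?R\<^esub> ?c \<gamma>" if "\<beta> \<in> forms n" "\<gamma> \<in> forms n" for \<beta> \<gamma>
    using Ld.quot_add[of \<beta> \<gamma>] that by (simp add: rel_log_module_def log_module_simps)
  have c_smult: "?c (to_mero a *f \<beta>) = a \<odot>\<^bsub>?R\<^esub> ?c \<beta>" if "\<beta> \<in> forms n" for a \<beta>
    using L.quot_smult_submodule[OF submodule_dt_log, of a \<beta>] that by (simp add: rel_log_module_def log_module_simps)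
  show "rclass \<beta> \<in> carrier (rel_log_module_Y t n)"
    unfolding cls rel_log_module_Y_def by (rule RT.quot_carrierI[OF c[OF \<beta>]])
  show "rclass (to_mero a *f \<beta>) = a \<odot>\<^bsub>rel_log_module_Y t n\<^esub> rclass \<beta>"
    unfolding cls rel_log_module_Y_def c_smult[OF \<beta>]
    by (rule R.quot_smult_submodule[OF submodule_t_rel _ c[OF \<beta>], symmetric]) simp
  assume \<gamma>: "\<gamma> \<in> forms n"
  show "rclass (\<beta> + \<gamma>) = rclass \<beta> \<oplus>\<^bsub>rel_log_module_Y t n\<^esub> rclass \<gamma>"
    unfolding cls rel_log_module_Y_def c_add[OF \<beta> \<gamma>] by (rule RT.quot_add[OF c[OF \<beta>] c[OF \<gamma>], symmetric])
  have \<beta>\<gamma>: "\<beta> - \<gamma> \<in> forms n"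
    using log_forms_closed(2)[OF \<beta> log_forms_closed(3)[OF \<gamma>, of "- 1"]] by (simp add: to_mero_uminus)
  have "?c \<beta> = ?c (\<beta> - \<gamma>) \<oplus>\<^bsub>?R\<^esub> ?c \<gamma>" using c_add[OF \<beta>\<gamma> \<gamma>] by simp
  hence "?c \<beta> \<ominus>\<^bsub>?R\<^esub> ?c \<gamma> = ?c (\<beta> - \<gamma>)" using c[OF \<beta>\<gamma>] c[OF \<gamma>] by (simp add: a_minus_def R.a_assoc R.r_neg)
  hence "rclass \<beta> = rclass \<gamma> \<longleftrightarrow> ?c (\<beta> - \<gamma>) \<in> ?T"
    unfolding cls using RT.quot_eq_iff[OF c[OF \<beta>] c[OF \<gamma>]] by simp
  also have "carrier ?R = ?c ` forms n" by (simp add: rel_log_module_def quot_module_simps log_module_simps)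
  hence "?c (\<beta> - \<gamma>) \<in> ?T \<longleftrightarrow> (\<exists>\<omega>\<in>forms n. ?c (\<beta> - \<gamma>) = t \<odot>\<^bsub>?R\<^esub> ?c \<omega>)" by (simp add: image_iff)
  also have "\<dots> \<longleftrightarrow> (\<exists>\<omega>\<in>forms n. \<beta> - \<gamma> - to_mero t *f \<omega> \<in> ?d)"
  proof (rule bex_cong[OF refl])
    fix \<omega> assume \<omega>: "\<omega> \<in> forms n"
    have t\<omega>: "to_mero t *f \<omega> \<in> forms n" by (rule log_forms_closed(3)[OF \<omega>])
    show "?c (\<beta> - \<gamma>) = t \<odot>\<^bsub>?R\<^esub> ?c \<omega> \<longleftrightarrow> \<beta> - \<gamma> - to_mero t *f \<omega> \<in> ?d" unfolding c_smult[OF \<omega>, symmetric]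
      using Ld.quot_eq_iff[of "\<beta> - \<gamma>" "to_mero t *f \<omega>"] \<beta>\<gamma> t\<omega> log_module_minus[OF \<beta>\<gamma> t\<omega>] by (simp add: log_module_simps)
  qed
  finally show "rclass \<beta> = rclass \<gamma> \<longleftrightarrow> (\<exists>\<omega>\<in>forms n. \<beta> - \<gamma> - to_mero t *f \<omega> \<in> dt_multiples t n)" .
qed

lemma rel_Y_carrier: "carrier (rel_log_module_Y t n) = rclass ` forms n"
  unfolding rel_class_Y_def rel_log_module_Y_def rel_log_module_def
  by (simp add: quot_module_simps log_module_simps image_image)

lemma rel_class_Y_eqI:
  assumes "\<beta> \<in> forms n" "\<gamma> \<in> forms n" "\<beta> - \<gamma> \<in> dt_multiples t n"
  shows "rclass \<beta> = rclass \<gamma>"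
  unfolding rel_class_Y_simps(4)[OF assms(1,2)] using assms(3) log_forms_closed(1) by (intro bexI[of _ 0]) simp_all

lemma \<zeta>_log: "\<zeta> \<in> forms n" using wl_log[of idx] length_idx by simp

lemma rel_class_Y_coef:
  assumes "\<beta> \<in> forms n" shows "rclass \<beta> = coef \<beta> \<odot>\<^bsub>rel_log_module_Y t n\<^esub> rclass \<zeta>"
  unfolding rel_class_Y_simps(3)[OF \<zeta>_log, symmetric]
  by (rule rel_class_Y_eqI[OF assms log_forms_closed(3)[OF \<zeta>_log] log_form_reduce[OF assms]])

lemma rel_class_Y_t_zeta: "t \<odot>\<^bsub>rel_log_module_Y t n\<^esub> rclass \<zeta> = rclass 0"
  unfolding rel_class_Y_simps(3)[OF \<zeta>_log, symmetric]
    rel_class_Y_simps(4)[OF log_forms_closed(3)[OF \<zeta>_log] log_forms_closed(1)]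
  using \<zeta>_log submodule_dt_multiples[unfolded submodule_form_iff] by (intro bexI[of _ \<zeta>]) simp_all

text \<open>A class on Y forgets multiples of dt/t, on which the coefficient vanishes, and multiples
  of t; hence the coefficient is well defined modulo t.\<close>

lemma rel_class_Y_eq_coef:
  assumes "\<beta> \<in> forms n" "\<gamma> \<in> forms n" "rclass \<beta> = rclass \<gamma>"
  shows "t dvd coef \<beta> - coef \<gamma>"
proof -
  obtain \<omega> where \<omega>: "\<omega> \<in> forms n" "\<beta> - \<gamma> - to_mero t *f \<omega> \<in> dt_multiples t n"
    using rel_class_Y_simps(4)[OF assms(1,2)] assms(3) by blast
  have "\<beta> = (\<beta> - \<gamma> - to_mero t *f \<omega>) + (\<gamma> + to_mero t *f \<omega>)" by simp
  hence "coef \<beta> = coef (\<beta> - \<gamma> - to_mero t *f \<omega>) + coef (\<gamma> + to_mero t *f \<omega>)"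
    using coef_add[of "\<beta> - \<gamma> - to_mero t *f \<omega>" "\<gamma> + to_mero t *f \<omega>"] subsetD[OF dt_multiples_log \<omega>(2)]
      log_forms_closed(2)[OF assms(2) log_forms_closed(3)[OF \<omega>(1)]] by metis
  hence "coef \<beta> = coef \<gamma> + t * coef \<omega>"
    using coef_dt_multiples[OF \<omega>(2)] coef_add[OF assms(2) log_forms_closed(3)[OF \<omega>(1)]] coef_scale[OF \<omega>(1)] by simp
  thus ?thesis by simp
qed

end

context log_frame
begin

lemma tensor_rel_D: "tensor germ_ring (rel_log_module_Y t n) D_module"
  by (intro tensor.intro module_rel_Y module_D_module)

abbreviation "T \<equiv> tensor_module germ_ring (rel_log_module_Y t n) D_module"

lemma dr_term_simps: "carrier (dr_term t n) = carrier T" "zero (dr_term t n) = zero T" "add (dr_term t n) = add T"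
    "k \<odot>\<^bsub>dr_term t n\<^esub> C = germ_const k \<odot>\<^bsub>T\<^esub> C" by (simp_all add: dr_term_def restrict_scalars_def)

lemma module_dr_term: "module complex_ring (dr_term t n)" unfolding dr_term_def
  by (rule module_restrict_scalars[OF tensor.module_T[OF tensor_rel_D] cring_from_type_algebra germ_const_ring_hom])

lemma dr_tensor_closed: "\<beta> \<in> forms n ==> P \<in> diffops ==> tens \<beta> P \<in> carrier (dr_term t n)"
  unfolding dr_tensor_def dr_term_simps by (intro tensor.tp_closed[OF tensor_rel_D] rel_class_Y_simps)

lemma dr_tensor_add:
  "\<beta> \<in> forms n ==> P \<in> diffops ==> Q \<in> diffops ==>
    tens \<beta> (%g. P g + Q g) = tens \<beta> P \<oplus>\<^bsub>dr_term t n\<^esub> tens \<beta> Q"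
  using tensor.tp_add_right[OF tensor_rel_D, of "rclass \<beta>" P Q] rel_class_Y_simps(1)
  by (simp add: dr_tensor_def dr_term_simps D_module_simps)

lemma dr_tensor_coef:
  assumes "\<beta> \<in> forms n" "P \<in> diffops"
  shows "tens \<beta> P = tens \<zeta> (%g. coef \<beta> * P g)"
  unfolding dr_tensor_def rel_class_Y_coef[OF assms(1)]
  using tensor.tp_balanced[OF tensor_rel_D, of "coef \<beta>" "rclass \<zeta>" P] rel_class_Y_simps(1)[OF \<zeta>_log] assms
  by (simp add: D_module_simps)

lemma dr_tensor_smult:
  assumes "\<beta> \<in> forms n" "P \<in> diffops"
  shows "k \<odot>\<^bsub>dr_term t n\<^esub> tens \<beta> P = tens \<beta> (%g. germ_const k * P g)"
  using tensor.smult_tp[OF tensor_rel_D, of "germ_const k" "rclass \<beta>" P]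
    tensor.tp_balanced[OF tensor_rel_D, of "germ_const k" "rclass \<beta>" P] rel_class_Y_simps(1)[OF assms(1)] assms(2)
  by (simp add: dr_tensor_def dr_term_simps D_module_simps)

lemma dr_tensor_\<zeta>_zero: "tens \<zeta> (%_. 0) = \<zero>\<^bsub>dr_term t n\<^esub>"
  and dr_tensor_\<zeta>_minus: "P \<in> diffops ==> Q \<in> diffops ==>
    tens \<zeta> (%g. P g - Q g) = tens \<zeta> P \<ominus>\<^bsub>dr_term t n\<^esub> tens \<zeta> Q"
proof -
  interpret dr: module complex_ring "dr_term t n" by (rule module_dr_term)
  interpret D: module complex_ring D_complex by (rule module_D_complex)
  note * = dr.additive_zero_minus[of D_complex "tens \<zeta>", unfolded D_complex_simps]
  show "tens \<zeta> (%_. 0) = \<zero>\<^bsub>dr_term t n\<^esub>"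
    by (rule *(1)) (simp_all add: dr_tensor_closed \<zeta>_log dr_tensor_add D.abelian_group_axioms)
  show "tens \<zeta> (%g. P g - Q g) = tens \<zeta> P \<ominus>\<^bsub>dr_term t n\<^esub> tens \<zeta> Q"
    if "P \<in> diffops" "Q \<in> diffops" unfolding D_complex_minus(2)[OF that, symmetric]
    by (rule *(2)) (simp_all add: dr_tensor_closed \<zeta>_log dr_tensor_add D.abelian_group_axioms that)
qed

lemma dr_tensor_t:
  assumes "P \<in> diffops" shows "tens \<zeta> (%g. t * P g) = \<zero>\<^bsub>dr_term t n\<^esub>"
proof -
  have "tens \<zeta> (%g. t * P g) = pure_tensor germ_ring (rel_log_module_Y t n) D_module (t \<odot>\<^bsub>rel_log_module_Y t n\<^esub> rclass \<zeta>) P"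
    using tensor.tp_balanced[OF tensor_rel_D, of t "rclass \<zeta>" P] rel_class_Y_simps(1)[OF \<zeta>_log] assms
    by (simp add: dr_tensor_def D_module_simps)
  also have "\<dots> = tens 0 P" by (simp only: rel_class_Y_t_zeta dr_tensor_def)
  also have "\<dots> = tens \<zeta> (%_. 0)" by (simp add: dr_tensor_coef[OF log_forms_closed(1) assms] del: zero_fun_apply)
  finally show ?thesis unfolding dr_tensor_\<zeta>_zero .
qed

text \<open>The dual frame drops out by \<open>dual_frames_coef\<close>: the sum over the frame
  regroups into a sum over coordinates.\<close>

lemma boundary_eq:
  assumes "Suc q = n" "\<beta> \<in> forms q" "P \<in> diffops" "rel_dual_frames t n \<xi> D"
  shows "tens (ext_d \<beta>) P \<oplus>\<^bsub>dr_term t n\<^esub>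
      (\<Oplus>\<^bsub>dr_term t n\<^esub>j\<in>{..<n}. tens (wedge (\<xi> j) \<beta>) (vf_apply (D j) \<circ> P)) = tens \<zeta> (bd_op \<beta> P)"
proof -
  interpret dr: module complex_ring "dr_term t n" by (rule module_dr_term)
  have l: "ext_d \<beta> \<in> forms n" "!!j. j < n ==> wedge (\<xi> j) \<beta> \<in> forms n"
    using ext_d_log_forms[OF assms(2)] wedge_log_forms[OF _ assms(2)] assms(1,4) by (auto simp: rel_dual_frames_def)
  let ?F = "%j g. coef (wedge (\<xi> j) \<beta>) * vf_apply (D j) (P g)"
  have F: "?F j \<in> diffops" for j by (intro D_lmult D_vf_apply assms)
  have "(\<Oplus>\<^bsub>dr_term t n\<^esub>j\<in>{..<n}. tens (wedge (\<xi> j) \<beta>) (vf_apply (D j) \<circ> P)) =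
      (\<Oplus>\<^bsub>dr_term t n\<^esub>j\<in>{..<n}. tens \<zeta> (?F j))" using l F by (intro dr.finsum_cong')
      (auto intro!: dr_tensor_closed \<zeta>_log simp: dr_tensor_coef[OF _ D_vf_apply[OF assms(3)]] o_def)
  also have "\<dots> = tens \<zeta> (%g. \<Sum>j<n. ?F j g)"
    by (rule dr.D_additive_finsum) (simp_all add: dr_tensor_closed \<zeta>_log dr_tensor_add F)
  also have "(%g. \<Sum>j<n. ?F j g) = (%g. \<Sum>i\<in>UNIV. coef (wedge (dcoord i) \<beta>) * germ_pd i (P g))"
  proof
    fix g
    have "(\<Sum>j<n. ?F j g) = (\<Sum>i\<in>UNIV. (\<Sum>j<n. coef (wedge (\<xi> j) \<beta>) * D j i) * germ_pd i (P g))"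
      unfolding vf_apply_def sum_distrib_left sum_distrib_right by (subst sum.swap) (simp add: mult_ac)
    thus "(\<Sum>j<n. ?F j g) = (\<Sum>i\<in>UNIV. coef (wedge (dcoord i) \<beta>) * germ_pd i (P g))"
      by (simp only: dual_frames_coef[OF assms(4,1,2)])
  qed
  finally have s: "(\<Oplus>\<^bsub>dr_term t n\<^esub>j\<in>{..<n}. tens (wedge (\<xi> j) \<beta>) (vf_apply (D j) \<circ> P)) =
      tens \<zeta> (%g. \<Sum>i\<in>UNIV. coef (wedge (dcoord i) \<beta>) * germ_pd i (P g))" .
  show ?thesis unfolding dr_tensor_coef[OF l(1) assms(3)] bd_op_def s
    by (rule dr_tensor_add[symmetric]) (intro \<zeta>_log D_lmult D_sum D_pd assms(3))+
qed

lemma dr_boundaries_eq: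
  "dr_boundaries t n = submodule_gen complex_ring (dr_term t n)
     {tens \<zeta> (bd_op \<beta> P) | \<beta> P q. Suc q = n \<and> \<beta> \<in> forms q \<and> P \<in> diffops}"
  (is "_ = submodule_gen _ _ ?S")
proof -
  have "{tens (ext_d \<beta>) P \<oplus>\<^bsub>dr_term t n\<^esub>
        (\<Oplus>\<^bsub>dr_term t n\<^esub>j\<in>{..<n}. tens (wedge (\<xi> j) \<beta>) (vf_apply (D j) \<circ> P))
      | \<beta> P \<xi> D p. Suc p = n \<and> \<beta> \<in> forms p \<and> P \<in> diffops \<and> rel_dual_frames t n \<xi> D} = ?S" (is "?S' = _")
  proof (intro equalityI subsetI)
    fix C assume "C \<in> ?S'"
    then obtain \<beta> P \<xi> D q where "C = tens (ext_d \<beta>) P \<oplus>\<^bsub>dr_term t n\<^esub>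
        (\<Oplus>\<^bsub>dr_term t n\<^esub>j\<in>{..<n}. tens (wedge (\<xi> j) \<beta>) (vf_apply (D j) \<circ> P))"
      and *: "Suc q = n" "\<beta> \<in> forms q" "P \<in> diffops" "rel_dual_frames t n \<xi> D" by auto
    hence "C = tens \<zeta> (bd_op \<beta> P)" using boundary_eq[OF *] by simp
    thus "C \<in> ?S" using * by auto
  next
    fix C assume "C \<in> ?S"
    then obtain \<beta> P q where "C = tens \<zeta> (bd_op \<beta> P)"
      and *: "Suc q = n" "\<beta> \<in> forms q" "P \<in> diffops" by auto
    thus "C \<in> ?S'" using boundary_eq[OF * frame_dual] frame_dual
      by (intro CollectI exI[of _ \<beta>] exI[of _ P] exI[of _ "%k. \<eta> (idx ! k)"] exI[of _ "%k. E (idx ! k)"] exI[of _ q]) (simp only: *)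
  qed
  thus ?thesis unfolding dr_boundaries_def by simp
qed

lemma bd_op_closed: "\<beta> \<in> forms q ==> Suc q = n ==> P \<in> diffops ==> bd_op \<beta> P \<in> diffops"
  using bd_op_in_K K_ideal_sub by blast

lemma submodule_dr_boundaries: "submodule (dr_boundaries t n) complex_ring (dr_term t n)"
  unfolding dr_boundaries_eq
  by (rule module.submodule_submodule_gen[OF module_dr_term], rule subsetI, elim CollectE exE conjE)
    (simp only: dr_tensor_closed \<zeta>_log bd_op_closed)

lemma submodule_K_ideal: "submodule K_ideal complex_ring D_complex"
proof -
  interpret D: module complex_ring D_complex by (rule module_D_complex)
  show ?thesis
  proof (rule D.submoduleI)
    show "\<ominus>\<^bsub>D_complex\<^esub> P \<in> K_ideal" if "P \<in> K_ideal" for P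
      using D_complex_minus(1)[of P P] subsetD[OF K_ideal_sub that] K_ideal_minus[OF that] by simp
  qed (simp_all add: D_complex_simps K_ideal_sub K_ideal_0 K_ideal_add K_ideal_const)
qed

text \<open>Sends \<beta> tensor P to the class of \<open>coef \<beta>\<close> times P. The
  coefficient is defined modulo t only, which is harmless because \<open>K_ideal\<close> contains t
  D. The map is what keeps operators outside \<open>K_ideal\<close> from becoming
  boundaries.\<close>

lemma tensor_to_quotient:
  obtains h where "!!C. C \<in> carrier (dr_term t n) ==> h C \<in> carrier (quot_module D_complex K_ideal)"
    "!!A B. A \<in> carrier (dr_term t n) ==> B \<in> carrier (dr_term t n) ==>
      h (A \<oplus>\<^bsub>dr_term t n\<^esub> B) = h A \<oplus>\<^bsub>quot_module D_complex K_ideal\<^esub> h B"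
    "!!k C. C \<in> carrier (dr_term t n) ==> h (k \<odot>\<^bsub>dr_term t n\<^esub> C) = k \<odot>\<^bsub>quot_module D_complex K_ideal\<^esub> h C"
    "!!P. P \<in> diffops ==> h (tens \<zeta> P) = K_ideal +>\<^bsub>D_complex\<^esub> P"
proof -
  let ?Y = "rel_log_module_Y t n" and ?Q = "quot_module D_complex K_ideal"
  let ?c = "%P. K_ideal +>\<^bsub>D_complex\<^esub> P"
  interpret D: module complex_ring D_complex by (rule module_D_complex)
  interpret K: quot_setting K_ideal D_complex by (rule D.submodule_quot_setting[OF submodule_K_ideal])
  interpret Q: module complex_ring ?Q by (rule D.module_quot[OF submodule_K_ideal])
  interpret ten: tensor germ_ring ?Y D_module by (rule tensor_rel_D)
  define f where "f U P = ?c (%g. coef (SOME \<beta>. \<beta> \<in> forms n \<and> U = rclass \<beta>) * P g)" for U P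
  have f: "f (rclass \<beta>) P = ?c (%g. coef \<beta> * P g)" if \<beta>: "\<beta> \<in> forms n" and P: "P \<in> diffops" for \<beta> P
  proof -
    define \<gamma> where "\<gamma> = (SOME \<gamma>. \<gamma> \<in> forms n \<and> rclass \<beta> = rclass \<gamma>)"
    have "\<gamma> \<in> forms n \<and> rclass \<beta> = rclass \<gamma>"
      unfolding \<gamma>_def by (rule someI[of _ \<beta>]) (simp add: \<beta>)
    then obtain a where a: "coef \<gamma> - coef \<beta> = t * a" using rel_class_Y_eq_coef[of \<gamma> \<beta>] \<beta> by (auto elim: dvdE)
    have "(%g. t * (a * P g)) \<in> K_ideal" by (intro K_ideal_t D_lmult P)
    hence "(%g. coef \<gamma> * P g - coef \<beta> * P g) \<in> K_ideal"
      by (simp add: left_diff_distrib[symmetric] a mult.assoc)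
    hence "?c (%g. coef \<gamma> * P g) = ?c (%g. coef \<beta> * P g)"
      using K.quot_eq_iff[of "%g. coef \<gamma> * P g" "%g. coef \<beta> * P g"] D_lmult[OF P]
      by (simp add: D_complex_minus D_complex_simps)
    thus ?thesis by (simp only: f_def \<gamma>_def)
  qed
  have c: "?c P \<in> carrier ?Q" if "P \<in> diffops" for P using K.quot_carrierI[of P] that by (simp add: D_complex_simps)
  have c_add: "?c (%g. P g + P' g) = ?c P \<oplus>\<^bsub>?Q\<^esub> ?c P'" if "P \<in> diffops" "P' \<in> diffops" for P P'
    using K.quot_add[of P P'] that by (simp add: D_complex_simps)
  have c_smult: "?c (%g. germ_const k * P g) = k \<odot>\<^bsub>?Q\<^esub> ?c P" if "P \<in> diffops" for k P
    using D.quot_smult_submodule[OF submodule_K_ideal, of k P] that by (simp add: D_complex_simps)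
  obtain h where h: "!!C. C \<in> carrier T ==> h C \<in> carrier ?Q"
    "!!A B. A \<in> carrier T ==> B \<in> carrier T ==> h (A \<oplus>\<^bsub>T\<^esub> B) = h A \<oplus>\<^bsub>?Q\<^esub> h B"
    "!!U P. U \<in> carrier ?Y ==> P \<in> diffops ==> h (pure_tensor germ_ring ?Y D_module U P) = f U P"
  proof (rule ten.tensor_universal[OF Q.abelian_group_axioms, of f])
    fix U and P :: "'m germ => 'm germ" assume U: "U \<in> carrier ?Y" and P: "P \<in> diffops"
    obtain \<beta> where \<beta>: "\<beta> \<in> forms n" "U = rclass \<beta>" using U unfolding rel_Y_carrier by (elim imageE)
    show "f U P \<in> carrier ?Q" unfolding \<beta>(2) f[OF \<beta>(1) P] by (intro c D_lmult P)
    show "f U (P \<oplus>\<^bsub>D_module\<^esub> P') = f U P \<oplus>\<^bsub>?Q\<^esub> f U P'" if P': "P' \<in> diffops" for P'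
      unfolding D_module_simps \<beta>(2) f[OF \<beta>(1) P] f[OF \<beta>(1) P'] f[OF \<beta>(1) D_add[OF P P']]
      unfolding distrib_left by (rule c_add[OF D_lmult[OF P] D_lmult[OF P']])
    show "f (U \<oplus>\<^bsub>?Y\<^esub> U') P = f U P \<oplus>\<^bsub>?Q\<^esub> f U' P" if U': "U' \<in> carrier ?Y" for U'
    proof -
      obtain \<gamma> where \<gamma>: "\<gamma> \<in> forms n" "U' = rclass \<gamma>" using U' unfolding rel_Y_carrier by (elim imageE)
      show ?thesis unfolding \<beta>(2) \<gamma>(2) rel_class_Y_simps(2)[OF \<beta>(1) \<gamma>(1), symmetric] f[OF \<beta>(1) P] f[OF \<gamma>(1) P]
          f[OF log_forms_closed(2)[OF \<beta>(1) \<gamma>(1)] P] coef_add[OF \<beta>(1) \<gamma>(1)]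
        unfolding distrib_right by (rule c_add[OF D_lmult[OF P] D_lmult[OF P]])
    qed
    show "f (a \<odot>\<^bsub>?Y\<^esub> U) P = f U (a \<odot>\<^bsub>D_module\<^esub> P)" for a
      unfolding D_module_simps \<beta>(2) rel_class_Y_simps(3)[OF \<beta>(1), symmetric] f[OF \<beta>(1) D_lmult[OF P]]
        f[OF log_forms_closed(3)[OF \<beta>(1)] P] coef_scale[OF \<beta>(1)] by (simp add: mult_ac)
  qed (rule that, assumption+)
  have pure: "h (tens \<beta> P) = ?c (%g. coef \<beta> * P g)" if "\<beta> \<in> forms n" "P \<in> diffops" for \<beta> P
    unfolding dr_tensor_def using h(3)[OF rel_class_Y_simps(1)] f that by simp
  show thesis
  proof (rule that[of h])
    show "h (tens \<zeta> P) = ?c P" if "P \<in> diffops" for P using pure[OF \<zeta>_log that] by simp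
    show "h (k \<odot>\<^bsub>dr_term t n\<^esub> C) = k \<odot>\<^bsub>?Q\<^esub> h C" if C: "C \<in> carrier (dr_term t n)" for k C
      using C[unfolded dr_term_simps]
    proof (rule ten.T_ext[OF Q.abelian_group_axioms, rotated -1])
      fix U and P :: "'m germ => 'm germ" assume "U \<in> carrier ?Y" and P: "P \<in> diffops"
      then obtain \<beta> where \<beta>: "\<beta> \<in> forms n" "U = rclass \<beta>" unfolding rel_Y_carrier by (elim imageE)
      have "h (k \<odot>\<^bsub>dr_term t n\<^esub> tens \<beta> P) = ?c (%g. germ_const k * (coef \<beta> * P g))"
        unfolding dr_tensor_smult[OF \<beta>(1) P] pure[OF \<beta>(1) D_lmult[OF P]] by (simp add: mult_ac)
      also have "\<dots> = k \<odot>\<^bsub>?Q\<^esub> h (tens \<beta> P)"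
        unfolding pure[OF \<beta>(1) P] by (rule c_smult[OF D_lmult[OF P]])
      finally show "h (k \<odot>\<^bsub>dr_term t n\<^esub> pure_tensor germ_ring ?Y D_module U P) = k \<odot>\<^bsub>?Q\<^esub> h (pure_tensor germ_ring ?Y D_module U P)"
        unfolding dr_tensor_def \<beta>(2) .
    qed (use module.smult_closed[OF module_dr_term, of k] module.smult_r_distr[OF module_dr_term, of k] h in
        \<open>simp_all add: dr_term_simps Q.smult_r_distr\<close>)
  qed (use h in \<open>simp_all add: dr_term_simps\<close>)
qed

text \<open>The forward direction uses the map to D modulo \<open>K_ideal\<close>. Conversely, t D
  vanishes by restriction to Y, and E_j S comes from the boundary of the frame monomial that omits
  both dt/t and \<eta>_j.\<close>

lemma dr_tensor_\<zeta>_boundary_iff: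
  assumes P: "P \<in> diffops"
  shows "tens \<zeta> P \<in> dr_boundaries t n \<longleftrightarrow> P \<in> K_ideal"
proof
  interpret dr: module complex_ring "dr_term t n" by (rule module_dr_term)
  interpret D: module complex_ring D_complex by (rule module_D_complex)
  interpret K: quot_setting K_ideal D_complex by (rule D.submodule_quot_setting[OF submodule_K_ideal])
  let ?Q = "quot_module D_complex K_ideal"
  interpret Q: module complex_ring ?Q by (rule D.module_quot[OF submodule_K_ideal])
  obtain h where h: "!!C. C \<in> carrier (dr_term t n) ==> h C \<in> carrier ?Q"
    "!!A B. A \<in> carrier (dr_term t n) ==> B \<in> carrier (dr_term t n) ==> h (A \<oplus>\<^bsub>dr_term t n\<^esub> B) = h A \<oplus>\<^bsub>?Q\<^esub> h B"
    "!!k C. C \<in> carrier (dr_term t n) ==> h (k \<odot>\<^bsub>dr_term t n\<^esub> C) = k \<odot>\<^bsub>?Q\<^esub> h C"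
    "!!P. P \<in> diffops ==> h (tens \<zeta> P) = K_ideal +>\<^bsub>D_complex\<^esub> P"
    by (rule tensor_to_quotient) (rule that)
  have h0: "h \<zero>\<^bsub>dr_term t n\<^esub> = \<zero>\<^bsub>?Q\<^esub>"
    "!!A B. A \<in> carrier (dr_term t n) ==> B \<in> carrier (dr_term t n) ==> h (A \<ominus>\<^bsub>dr_term t n\<^esub> B) = h A \<ominus>\<^bsub>?Q\<^esub> h B"
    using Q.additive_zero_minus[of "dr_term t n" h] h dr.abelian_group_axioms by simp_all
  have k0: "k \<odot>\<^bsub>?Q\<^esub> \<zero>\<^bsub>?Q\<^esub> = \<zero>\<^bsub>?Q\<^esub>" for k
    using Q.additive_zero_minus(1)[of ?Q "%x. k \<odot>\<^bsub>?Q\<^esub> x"] Q.abelian_group_axioms by (simp add: Q.smult_r_distr)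
  let ?N = "{C \<in> carrier (dr_term t n). h C = \<zero>\<^bsub>?Q\<^esub>}"
  have "submodule ?N complex_ring (dr_term t n)"
  proof (rule dr.submoduleI)
    show "\<ominus>\<^bsub>dr_term t n\<^esub> C \<in> ?N" if "C \<in> ?N" for C
    proof -
      have "\<zero>\<^bsub>dr_term t n\<^esub> \<ominus>\<^bsub>dr_term t n\<^esub> C = \<ominus>\<^bsub>dr_term t n\<^esub> C" using that by (simp add: a_minus_def)
      moreover have "h (\<zero>\<^bsub>dr_term t n\<^esub> \<ominus>\<^bsub>dr_term t n\<^esub> C) = \<zero>\<^bsub>?Q\<^esub>"
        using h0(2)[of "\<zero>\<^bsub>dr_term t n\<^esub>" C] that by (simp add: h0(1) a_minus_def[of ?Q])
      ultimately show ?thesis using that by simp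
    qed
  qed (auto simp: h h0 k0)
  hence "dr_boundaries t n \<subseteq> ?N" unfolding dr_boundaries_eq
  proof (rule submodule_gen_minimal[rotated])
    show "{tens \<zeta> (bd_op \<beta> P) | \<beta> P q. Suc q = n \<and> \<beta> \<in> forms q \<and> P \<in> diffops} \<subseteq> ?N"
    proof (rule subsetI, elim CollectE exE conjE)
      fix C \<beta> P q assume C: "C = tens \<zeta> (bd_op \<beta> P)" and *: "Suc q = n" "\<beta> \<in> forms q" "P \<in> diffops"
      have "K_ideal +>\<^bsub>D_complex\<^esub> bd_op \<beta> P = K_ideal" by (rule K.a_rcos_const[OF bd_op_in_K[OF *(2,1,3)]])
      thus "C \<in> ?N" unfolding C
        using h(4)[OF bd_op_closed[OF *(2,1,3)]] dr_tensor_closed[OF \<zeta>_log bd_op_closed[OF *(2,1,3)]]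
        by (simp add: quot_module_simps)
    qed
  qed
  hence "h (tens \<zeta> P) = K_ideal" if "tens \<zeta> P \<in> dr_boundaries t n" using that by (auto simp: quot_module_simps)
  thus "P \<in> K_ideal" if "tens \<zeta> P \<in> dr_boundaries t n"
    using K.quot_eq_zero_iff[of P] that h(4)[OF P] P by (simp add: D_complex_simps)
  note bd = dr.submoduleE[OF submodule_dr_boundaries]
  have vf: "tens \<zeta> (%g. vf_apply (E j) (S g)) \<in> dr_boundaries t n" if j: "j ~= p" and S: "S \<in> diffops" for j S
  proof -
    have "j \<in> set idx" using j idx(2) by simp
    then obtain k where k: "k < n" "idx ! k = j" using length_idx by (metis in_set_conv_nth)
    let ?js = "remove1 j idx"
    have len: "Suc (length ?js) = n" using wl_omit(2)[OF k(1)] k(2) by simp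
    have l: "wl (i # ?js) \<in> forms n" for i using wl_log[of "i # ?js"] len by simp
    have "wl (j # ?js) \<in> {\<zeta>, - \<zeta>}" using wl_omit(1)[OF k(1), of k] k(2) by simp
    \<comment> \<open>Moving \<eta>_j to the front costs a sign c; it is put into the operator as
      well, where c^2 = 1 cancels it.\<close>
    hence "\<exists>c. coef (wl (j # ?js)) = germ_const c \<and> c * c = 1"
    proof (elim insertE emptyE)
      show ?thesis if "wl (j # ?js) = \<zeta>" unfolding that by (rule exI[of _ 1]) simp
      show ?thesis if "wl (j # ?js) = - \<zeta>"
        unfolding that coef_minus[OF \<zeta>_log] by (rule exI[of _ "- 1"]) (simp add: germ_const_minus)
    qed
    then obtain c where c: "coef (wl (j # ?js)) = germ_const c" "c * c = 1" by blast
    have z: "coef (wl (i # ?js)) = 0" if "i ~= j" for i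
    proof (cases "i = p")
      case False
      hence "i \<in> set idx" using idx(2) by simp
      then obtain l where "l < n" "idx ! l = i" using length_idx by (metis in_set_conv_nth)
      thus ?thesis using wl_omit(1)[OF k(1), of l] k(2) that by simp
    qed (simp add: wl_Cons)
    have "coef (wedge (dcoord i) (wl ?js)) = E j i * germ_const c" for i
    proof -
      have "coef (wedge (dcoord i) (wl ?js)) = (\<Sum>l\<in>UNIV. E l i * coef (wl (l # ?js)))"
        unfolding dcoord_wedge_wl using l by (simp add: coef_sum coef_scale log_forms_closed)
      also have "\<dots> = (\<Sum>l\<in>{j}. E l i * coef (wl (l # ?js)))" by (rule sum.mono_neutral_right) (auto simp: z)
      finally show ?thesis by (simp add: c)
    qed
    hence "bd_op (wl ?js) (%g. germ_const c * S g) = (%g. germ_const (c * c) * vf_apply (E j) (S g))"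
      by (simp add: bd_op_def fun_eq_iff germ_pd_mult germ_const_mult)
        (simp add: vf_apply_def sum_distrib_left mult_ac)
    hence "tens \<zeta> (%g. vf_apply (E j) (S g)) = tens \<zeta> (bd_op (wl ?js) (%g. germ_const c * S g))"
      by (simp add: c(2))
    thus ?thesis
      unfolding dr_boundaries_eq using len wl_log[of ?js] D_lmult[OF S] by (intro submodule_gen_inc) blast
  qed
  assume "P \<in> K_ideal"
  then obtain Q S where QS: "P = (%g. t * Q g + (\<Sum>j\<in>UNIV - {p}. vf_apply (E j) (S j g)))"
    "Q \<in> diffops" "!!j. S j \<in> diffops" unfolding K_ideal_def by blast
  have "tens \<zeta> (%g. \<Sum>j\<in>J. vf_apply (E j) (S j g)) \<in> dr_boundaries t n" if "finite J" "J \<subseteq> UNIV - {p}" for J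
    using that
  proof (induction J rule: finite_induct)
    case empty
    show ?case using subgroup.one_closed[OF submodule.axioms(1)[OF submodule_dr_boundaries]] by (simp add: dr_tensor_\<zeta>_zero)
  next
    case (insert j J)
    thus ?case using vf[OF _ QS(3)[of j]] QS(3)
      by (auto simp: dr_tensor_add \<zeta>_log D_vf_apply D_sum intro!: bd(5))
  qed
  thus "tens \<zeta> P \<in> dr_boundaries t n" unfolding QS(1) using QS(2,3) dr_tensor_closed[OF \<zeta>_log]
    by (simp add: dr_tensor_add \<zeta>_log D_lmult D_sum D_vf_apply dr_tensor_t)
qed

end

section \<open>\<open>M\<close> as a quotient of D, with its filtration, R and generalized
  eigenspaces\<close>

lemma D_filt_0: "(%_. 0 :: 'm::finite germ) \<in> D_filt l"
  using diffop.scalar[of "nat l" "0 :: 'm germ"] by (simp add: D_filt_def)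

lemma D_filt_lmult: "P \<in> D_filt l ==> (%g. a * P g) \<in> D_filt l"
  using diffop.lmult[of "nat l" P a] by (cases "l < 0") (simp_all add: D_filt_def)

lemma D_filt_add: "P \<in> D_filt l ==> Q \<in> D_filt l ==> (%g. P g + Q g) \<in> D_filt l"
  using diffop.add[of "nat l" P Q] by (cases "l < 0") (simp_all add: D_filt_def)

lemma D_filt_carrier: "P \<in> D_filt l ==> P \<in> diffops" by (auto simp: D_module_def)

lemma D_filt_mono: "P \<in> D_filt l ==> l \<le> l' ==> P \<in> D_filt l'"
  using D_filt_0[of l'] diffop_mono[of "nat l" P "nat l'"] by (cases "l < 0") (simp_all add: D_filt_def)

lemma D_filt_pd: "P \<in> D_filt l ==> (%g. germ_pd i (P g)) \<in> D_filt (1 + l)"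
proof (cases "l < 0")
  case True
  thus "P \<in> D_filt l ==> (%g. germ_pd i (P g)) \<in> D_filt (1 + l)" using D_filt_0 by (simp add: D_filt_def[of l])
next
  case False
  hence "nat (1 + l) = Suc (nat l)" by simp
  thus "P \<in> D_filt l ==> (%g. germ_pd i (P g)) \<in> D_filt (1 + l)" using False by (simp add: D_filt_def diffop.pd)
qed

lemma D_filt_sum: "(!!i. i \<in> S ==> F i \<in> D_filt l) ==> (%g. \<Sum>i\<in>S. F i g) \<in> D_filt l"
proof (induction S rule: infinite_finite_induct)
  case (insert i S)
  have "(%g. F i g + (\<Sum>i\<in>S. F i g)) \<in> D_filt l" by (rule D_filt_add) (use insert in simp_all)
  thus ?case using insert by simp
qed (simp_all add: D_filt_0)

lemma D_filt_vf_apply: "P \<in> D_filt l ==> (%g. vf_apply v (P g)) \<in> D_filt (1 + l)"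
  unfolding vf_apply_def by (intro D_filt_sum D_filt_lmult D_filt_pd)

text \<open>Complex subspaces of D rather than right ideals: the steps of the order filtration are
  not ideals in general, and the generated submodules of \<open>M\<close> are taken over the complex
  numbers.\<close>

definition csub :: "(('m::finite) germ => 'm germ) set => bool" where
  "csub V \<longleftrightarrow> V \<subseteq> diffops \<and> (%_. 0) \<in> V \<and> (\<forall>P\<in>V. \<forall>Q\<in>V. (%g. P g + Q g) \<in> V) \<and>
     (\<forall>k. \<forall>P\<in>V. (%g. germ_const k * P g) \<in> V)"

lemma csub_carrier: "csub V ==> P \<in> V ==> P \<in> diffops" unfolding csub_def by (elim conjE) (rule subsetD)

lemma csub_0: "csub V ==> (%_. 0) \<in> V" by (simp add: csub_def)

lemma csub_add: "csub V ==> P \<in> V ==> Q \<in> V ==> (%g. P g + Q g) \<in> V" by (simp add: csub_def)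

lemma csub_scale: "csub V ==> P \<in> V ==> (%g. germ_const k * P g) \<in> V" by (simp add: csub_def)

lemma csub_D_filt: "csub (D_filt l)"
  unfolding csub_def by (intro conjI ballI allI subsetI) (rule D_filt_0 D_filt_lmult D_filt_add D_filt_carrier; assumption)+

lemma csub_minus:
  assumes "csub V" "P \<in> V" "Q \<in> V" shows "(%g. P g - Q g) \<in> V"
  using csub_add[OF assms(1,2) csub_scale[OF assms(1,3), of "- 1"]] by (simp add: germ_const_minus)

context log_frame
begin

text \<open>The surjection from D onto \<open>M\<close> with kernel \<open>K_ideal\<close>;
  statements about \<open>M\<close> are pulled back along it.\<close>

definition Phi :: "('m germ => 'm germ) => 'm dr_elem set" where
  "Phi P = M_class t n \<zeta> P"

abbreviation "M \<equiv> M_mod t n"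

sublocale M: module complex_ring M
  unfolding M_mod_def by (rule module.module_quot[OF module_dr_term submodule_dr_boundaries])

lemma quot_dr: "quot_setting (dr_boundaries t n) (dr_term t n)"
  by (rule module.submodule_quot_setting[OF module_dr_term submodule_dr_boundaries])

lemma Phi_closed [simp]: "P \<in> diffops ==> Phi P \<in> carrier M"
  unfolding Phi_def M_class_def M_mod_def by (intro quot_setting.quot_carrierI[OF quot_dr] dr_tensor_closed \<zeta>_log)

lemma Phi_add: "P \<in> diffops ==> Q \<in> diffops ==> Phi (%g. P g + Q g) = Phi P \<oplus>\<^bsub>M\<^esub> Phi Q"
  unfolding Phi_def M_class_def M_mod_def
  by (simp add: quot_setting.quot_add[OF quot_dr] dr_tensor_closed \<zeta>_log dr_tensor_add)

lemma Phi_smult: "P \<in> diffops ==> Phi (%g. germ_const k * P g) = k \<odot>\<^bsub>M\<^esub> Phi P"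
  unfolding Phi_def M_class_def M_mod_def
  by (simp add: module.quot_smult_submodule[OF module_dr_term submodule_dr_boundaries] dr_tensor_closed \<zeta>_log dr_tensor_smult)

lemma Phi_minus: "P \<in> diffops ==> Q \<in> diffops ==> Phi (%g. P g - Q g) = Phi P \<ominus>\<^bsub>M\<^esub> Phi Q"
  and Phi_zero: "Phi (%_. 0) = \<zero>\<^bsub>M\<^esub>"
proof -
  interpret D: module complex_ring "D_complex :: (complex, 'm germ => 'm germ) module" by (rule module_D_complex)
  have c: "Phi P \<in> carrier M" if "P \<in> carrier D_complex" for P
    using that unfolding D_complex_simps by (rule Phi_closed)
  have a: "Phi (P \<oplus>\<^bsub>D_complex\<^esub> Q) = Phi P \<oplus>\<^bsub>M\<^esub> Phi Q" if "P \<in> carrier D_complex" "Q \<in> carrier D_complex" for P Q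
    using that unfolding D_complex_simps by (rule Phi_add)
  note * = M.additive_zero_minus[of D_complex Phi, OF c D.abelian_group_axioms a]
  have "Phi \<zero>\<^bsub>D_complex\<^esub> = \<zero>\<^bsub>M\<^esub>" by (rule *(1))
  thus "Phi (%_. 0) = \<zero>\<^bsub>M\<^esub>" unfolding D_complex_simps .
  show "Phi (%g. P g - Q g) = Phi P \<ominus>\<^bsub>M\<^esub> Phi Q" if "P \<in> diffops" "Q \<in> diffops"
  proof -
    have "Phi (P \<ominus>\<^bsub>D_complex\<^esub> Q) = Phi P \<ominus>\<^bsub>M\<^esub> Phi Q"
      by (rule *(2)) (use that in \<open>simp_all add: D_complex_simps\<close>)
    thus ?thesis unfolding D_complex_minus(2)[OF that] .
  qed
qed

lemma Phi_eq_iff: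
  assumes "P \<in> diffops" "Q \<in> diffops"
  shows "Phi P = Phi Q \<longleftrightarrow> (%g. P g - Q g) \<in> K_ideal"
proof -
  have "(%g. P g - Q g) \<in> diffops" using D_add[OF assms(1) D_minus[OF assms(2)]] by simp
  hence "tens \<zeta> P \<ominus>\<^bsub>dr_term t n\<^esub> tens \<zeta> Q \<in> dr_boundaries t n \<longleftrightarrow> (%g. P g - Q g) \<in> K_ideal"
    unfolding dr_tensor_\<zeta>_minus[OF assms, symmetric] by (rule dr_tensor_\<zeta>_boundary_iff)
  thus ?thesis unfolding Phi_def M_class_def
    by (simp add: quot_setting.quot_eq_iff[OF quot_dr] dr_tensor_closed \<zeta>_log assms)
qed

lemma M_class_Phi: "\<beta> \<in> forms n ==> P \<in> diffops ==> M_class t n \<beta> P = Phi (%g. coef \<beta> * P g)"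
  unfolding Phi_def M_class_def by (subst dr_tensor_coef) simp_all

lemma M_carrier: "carrier M = Phi ` diffops"
proof
  interpret ten: tensor germ_ring "rel_log_module_Y t n" D_module by (rule tensor_rel_D)
  have "C \<in> tens \<zeta> ` diffops" if "C \<in> carrier T" for C using that
  proof (induction rule: ten.T_induct)
    case zero
    have "zero T = tens \<zeta> (%_. 0)" unfolding dr_tensor_\<zeta>_zero dr_term_simps ..
    thus ?case by (rule image_eqI[OF _ D_zero])
  next
    case (pure U P)
    then obtain \<beta> where \<beta>: "U = rclass \<beta>" "\<beta> \<in> forms n" unfolding rel_Y_carrier by (elim imageE)
    have "pure_tensor germ_ring (rel_log_module_Y t n) D_module U P = tens \<zeta> (%g. coef \<beta> * P g)"
      using dr_tensor_coef[OF \<beta>(2) pure(2)] unfolding \<beta>(1) dr_tensor_def .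
    thus ?case by (rule image_eqI[OF _ D_lmult[OF pure(2)]])
  next
    case (minus A B)
    obtain P where P: "A = tens \<zeta> P" "P \<in> diffops" using minus(3) by (elim imageE)
    obtain Q where Q: "B = tens \<zeta> Q" "Q \<in> diffops" using minus(4) by (elim imageE)
    have PQ: "(%g. P g - Q g) \<in> diffops" using D_add[OF P(2) D_minus[OF Q(2)]] by simp
    have "A \<ominus>\<^bsub>T\<^esub> B = A \<ominus>\<^bsub>dr_term t n\<^esub> B"
      unfolding a_minus_def a_inv_def dr_term_simps m_inv_def monoid.select_convs partial_object.select_convs ..
    also have "\<dots> = tens \<zeta> (%g. P g - Q g)" unfolding P(1) Q(1) by (rule dr_tensor_\<zeta>_minus[OF P(2) Q(2), symmetric])
    finally show ?case by (rule image_eqI[OF _ PQ])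
  qed
  hence "carrier T \<subseteq> tens \<zeta> ` diffops" by (rule subsetI)
  from image_mono[OF this, of "a_r_coset (dr_term t n) (dr_boundaries t n)"]
  show "carrier M \<subseteq> Phi ` diffops"
    unfolding M_mod_def quot_module_simps(1) dr_term_simps Phi_def M_class_def image_image .
qed (rule image_subsetI, rule Phi_closed)

lemma submodule_Phi:
  assumes "csub V" shows "submodule (Phi ` V) complex_ring M"
proof (rule M.submoduleI)
  note V = csub_carrier[OF assms]
  show "Phi ` V \<subseteq> carrier M" using V by auto
  show "\<zero>\<^bsub>M\<^esub> \<in> Phi ` V" unfolding Phi_zero[symmetric] by (rule imageI[OF csub_0[OF assms]])
  show "a \<oplus>\<^bsub>M\<^esub> b \<in> Phi ` V" if "a \<in> Phi ` V" "b \<in> Phi ` V" for a b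
    using that by (elim imageE) (simp add: Phi_add[symmetric] V csub_add[OF assms])
  show sm: "k \<odot>\<^bsub>M\<^esub> a \<in> Phi ` V" if "k \<in> carrier complex_ring" "a \<in> Phi ` V" for k a
    using that by (elim imageE) (simp add: Phi_smult[symmetric] V csub_scale[OF assms])
  show "\<ominus>\<^bsub>M\<^esub> a \<in> Phi ` V" if "a \<in> Phi ` V" for a
  proof -
    obtain P where P: "a = Phi P" "P \<in> V" using \<open>a \<in> Phi ` V\<close> by blast
    note z = csub_0[OF assms]
    have "\<ominus>\<^bsub>M\<^esub> a = Phi (%_. 0) \<ominus>\<^bsub>M\<^esub> a" using P V by (simp add: Phi_zero a_minus_def)
    also have "\<dots> = Phi (%g. 0 - P g)" unfolding P(1) by (rule Phi_minus[OF V[OF z] V[OF P(2)], symmetric])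
    finally show ?thesis using csub_minus[OF assms z P(2)] by simp
  qed
qed

lemma M_filt_eq: "M_filt t n l = Phi ` D_filt (l + int n)"
proof -
  have "{M_class t n \<beta> P | \<beta> P. \<beta> \<in> forms n \<and> P \<in> D_filt (l + int n)} = Phi ` D_filt (l + int n)"
  proof (intro equalityI subsetI)
    fix m assume "m \<in> {M_class t n \<beta> P | \<beta> P. \<beta> \<in> forms n \<and> P \<in> D_filt (l + int n)}"
    then obtain \<beta> P where "m = M_class t n \<beta> P" and \<beta>: "\<beta> \<in> forms n" and P: "P \<in> D_filt (l + int n)" by (elim CollectE exE conjE)
    hence "m = Phi (%g. coef \<beta> * P g)" by (simp only: M_class_Phi[OF \<beta> D_filt_carrier[OF P]])
    thus "m \<in> Phi ` D_filt (l + int n)" using D_filt_lmult[OF P] by (rule image_eqI)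
  next
    fix m assume "m \<in> Phi ` D_filt (l + int n)"
    thus "m \<in> {M_class t n \<beta> P | \<beta> P. \<beta> \<in> forms n \<and> P \<in> D_filt (l + int n)}"
      unfolding Phi_def by (elim imageE) (rule CollectI, rule exI[of _ \<zeta>], rule exI, intro conjI \<zeta>_log)
  qed
  moreover have "submodule_gen complex_ring M (Phi ` D_filt (l + int n)) = Phi ` D_filt (l + int n)"
  proof
    show "Phi ` D_filt (l + int n) \<subseteq> submodule_gen complex_ring M (Phi ` D_filt (l + int n))"
      by (rule subsetI) (rule submodule_gen_inc)
  qed (rule submodule_gen_minimal[OF subset_refl submodule_Phi[OF csub_D_filt]])
  ultimately show ?thesis unfolding M_filt_def by simp
qed

text \<open>Left multiplication by E_p on a chosen preimage; \<open>K_ideal_vf_p\<close> makes the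
  choice immaterial. The value \<open>undefined\<close> off the carrier matches the extensionality
  that \<open>R_op\<close> demands.\<close>

definition R0 :: "'m dr_elem set => 'm dr_elem set" where
  "R0 m = (if m \<in> carrier M then Phi (%g. vf_apply (E p) ((SOME P. P \<in> diffops \<and> Phi P = m) g)) else undefined)"

lemma R0_Phi:
  assumes P: "P \<in> diffops" shows "R0 (Phi P) = Phi (%g. vf_apply (E p) (P g))"
proof -
  define Q where "Q = (SOME Q. Q \<in> diffops \<and> Phi Q = Phi P)"
  have Q: "Q \<in> diffops \<and> Phi Q = Phi P" unfolding Q_def by (rule someI[of _ P]) (simp add: P)
  hence "(%g. Q g - P g) \<in> K_ideal" using Phi_eq_iff[of Q P] P by simp
  hence "(%g. vf_apply (E p) (Q g - P g)) \<in> K_ideal" by (rule K_ideal_vf_p)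
  hence "(%g. vf_apply (E p) (Q g) - vf_apply (E p) (P g)) \<in> K_ideal"
    by (simp add: diff_conv_add_uminus vf_apply_add vf_apply_minus del: add_uminus_conv_diff)
  hence "Phi (%g. vf_apply (E p) (Q g)) = Phi (%g. vf_apply (E p) (P g))"
    using Phi_eq_iff[OF D_vf_apply[of Q "E p"] D_vf_apply[OF P, of "E p"]] Q by simp
  thus ?thesis using P by (simp add: R0_def Q_def)
qed

lemma R_formula:
  assumes \<beta>: "\<beta> \<in> forms n" and P: "P \<in> diffops"
  shows "M_class t n (inv_dt (ext_d \<beta>)) P \<oplus>\<^bsub>M\<^esub>
      (\<Oplus>\<^bsub>M\<^esub>i\<in>UNIV. M_class t n (inv_dt (wedge (dcoord i) \<beta>)) (germ_pd i \<circ> P)) =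
    Phi (%g. vf_apply (E p) (coef \<beta> * P g))"
proof -
  have l: "inv_dt (ext_d \<beta>) \<in> forms n" "!!i. inv_dt (wedge (dcoord i) \<beta>) \<in> forms n"
    by (intro dt_wedge_inv ext_d_log_forms wedge_log_forms dcoord_log \<beta>)+
  let ?F = "%i g. coef (inv_dt (wedge (dcoord i) \<beta>)) * germ_pd i (P g)"
  have F: "?F i \<in> diffops" for i by (intro D_lmult D_pd P)
  have "M_class t n (inv_dt (wedge (dcoord i) \<beta>)) (germ_pd i \<circ> P) = Phi (?F i)" for i
    using M_class_Phi[OF l(2) D_pd[OF P]] by (simp add: o_def)
  hence "(\<Oplus>\<^bsub>M\<^esub>i\<in>UNIV. M_class t n (inv_dt (wedge (dcoord i) \<beta>)) (germ_pd i \<circ> P)) =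
      (\<Oplus>\<^bsub>M\<^esub>i\<in>UNIV. Phi (?F i))" by simp
  also have "\<dots> = Phi (%g. \<Sum>i\<in>UNIV. ?F i g)" by (rule M.D_additive_finsum) (simp_all add: Phi_add F)
  finally have s: "(\<Oplus>\<^bsub>M\<^esub>i\<in>UNIV. M_class t n (inv_dt (wedge (dcoord i) \<beta>)) (germ_pd i \<circ> P)) =
      Phi (%g. \<Sum>i\<in>UNIV. ?F i g)" .
  have "R_rep \<beta> P \<in> diffops" unfolding R_rep_def by (intro D_add D_lmult D_sum D_pd P)
  hence "Phi (R_rep \<beta> P) = Phi (%g. vf_apply (E p) (coef \<beta> * P g))"
    using Phi_eq_iff[of "R_rep \<beta> P" "%g. vf_apply (E p) (coef \<beta> * P g)"] R_rep_mod_K[OF \<beta> P] D_vf_apply[OF D_lmult[OF P]]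
    by simp
  moreover have "Phi (R_rep \<beta> P) = Phi (%g. coef (inv_dt (ext_d \<beta>)) * P g) \<oplus>\<^bsub>M\<^esub> Phi (%g. \<Sum>i\<in>UNIV. ?F i g)"
    unfolding R_rep_def by (rule Phi_add) (intro D_lmult D_sum D_pd P)+
  ultimately show ?thesis by (simp add: s M_class_Phi[OF l(1) P])
qed

text \<open>Uniqueness in the definite description: the classes of \<zeta> tensor P exhaust the
  carrier, so the formula fixes R there, and extensionality fixes it elsewhere.\<close>

lemma R_op_eq: "R_op t n = R0" unfolding R_op_def
proof (rule the_equality)
  have R0_closed: "R0 m \<in> carrier M" if "m \<in> carrier M" for m
    using that unfolding M_carrier by (elim imageE) (simp add: R0_Phi D_vf_apply)
  have R0_add: "R0 (m \<oplus>\<^bsub>M\<^esub> m') = R0 m \<oplus>\<^bsub>M\<^esub> R0 m'" if "m \<in> carrier M" "m' \<in> carrier M" for m m'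
    using that unfolding M_carrier by (elim imageE) (simp add: Phi_add[symmetric] R0_Phi D_add D_vf_apply vf_apply_add)
  show "R0 \<in> extensional (carrier M) \<and> R0 \<in> hom (add_monoid M) (add_monoid M) \<and>
    (\<forall>\<beta>\<in>forms n. \<forall>P\<in>diffops. R0 (M_class t n \<beta> P) =
          M_class t n (inv_dt (ext_d \<beta>)) P \<oplus>\<^bsub>M\<^esub>
          (\<Oplus>\<^bsub>M\<^esub>i\<in>UNIV. M_class t n (inv_dt (wedge (dcoord i) \<beta>)) (germ_pd i \<circ> P)))"
  proof (intro conjI ballI)
    show "R0 \<in> extensional (carrier M)" by (simp add: R0_def extensional_def)
    show "R0 \<in> hom (add_monoid M) (add_monoid M)" using R0_closed R0_add by (intro homI) simp_all
  qed (simp add: R_formula M_class_Phi R0_Phi D_lmult)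
  fix R assume R: "R \<in> extensional (carrier M) \<and> R \<in> hom (add_monoid M) (add_monoid M) \<and>
    (\<forall>\<beta>\<in>forms n. \<forall>P\<in>diffops. R (M_class t n \<beta> P) =
          M_class t n (inv_dt (ext_d \<beta>)) P \<oplus>\<^bsub>M\<^esub>
          (\<Oplus>\<^bsub>M\<^esub>i\<in>UNIV. M_class t n (inv_dt (wedge (dcoord i) \<beta>)) (germ_pd i \<circ> P)))"
  show "R = R0"
  proof
    fix m
    show "R m = R0 m"
    proof (cases "m \<in> carrier M")
      case True
      then obtain P where P: "P \<in> diffops" "m = Phi P" unfolding M_carrier by (elim imageE)
      have "R (M_class t n \<zeta> P) = Phi (%g. vf_apply (E p) (coef \<zeta> * P g))"
        unfolding R_formula[OF \<zeta>_log P(1), symmetric] by (rule bspec[OF bspec[OF conjunct2[OF conjunct2[OF R]] \<zeta>_log] P(1)])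
      thus ?thesis using R0_Phi[OF P(1)] by (simp add: P(2) Phi_def)
    next
      case False
      thus ?thesis using R by (simp add: R0_def extensional_def)
    qed
  qed
qed

definition shift :: "real => ('m germ => 'm germ) => 'm germ => 'm germ" where
  "shift \<mu> P = (%g. vf_apply (E p) (P g) - germ_const (complex_of_real \<mu>) * P g)"

lemma D_shift: "P \<in> diffops ==> shift \<mu> P \<in> diffops"
  using D_add[OF D_vf_apply[of P "E p"] D_minus[OF D_lmult[of P "germ_const (complex_of_real \<mu>)"]]] by (simp add: shift_def)

lemma D_shift_pow: "P \<in> diffops ==> (shift \<mu> ^^ k) P \<in> diffops" by (induction k) (simp_all add: D_shift)

lemma D_filt_shift: "P \<in> D_filt l ==> shift \<mu> P \<in> D_filt (1 + l)" unfolding shift_def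
proof -
  assume P: "P \<in> D_filt l"
  have "l \<le> 1 + l" by linarith
  with P show "(%g. vf_apply (E p) (P g) - germ_const (complex_of_real \<mu>) * P g) \<in> D_filt (1 + l)"
    by (intro csub_minus[OF csub_D_filt] D_filt_vf_apply D_filt_mono[OF D_filt_lmult])
qed

lemma D_filt_shift_pow: "P \<in> D_filt l ==> (shift \<mu> ^^ k) P \<in> D_filt (int k + l)"
proof (induction k)
  case (Suc k)
  thus ?case using D_filt_shift[of "(shift \<mu> ^^ k) P" "int k + l" \<mu>] by (simp add: add_ac)
qed simp

lemma R_minus_Phi: "P \<in> diffops ==> R_minus t n \<mu> (Phi P) = Phi (shift \<mu> P)"
  unfolding R_minus_def R_op_eq shift_def by (simp add: R0_Phi Phi_minus D_vf_apply D_lmult Phi_smult)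

lemma R_minus_pow_Phi: "P \<in> diffops ==> (R_minus t n \<mu> ^^ k) (Phi P) = Phi ((shift \<mu> ^^ k) P)"
  by (induction k) (simp_all add: R_minus_Phi D_shift_pow)

lemma Phi_eq_zero_iff: "P \<in> diffops ==> Phi P = \<zero>\<^bsub>M\<^esub> \<longleftrightarrow> P \<in> K_ideal"
  using Phi_eq_iff[of P "%_. 0"] D_zero by (simp add: Phi_zero)

lemma R_gen_eigen_eq: "R_gen_eigen t n \<mu> = Phi ` {P \<in> diffops. \<exists>k. (shift \<mu> ^^ k) P \<in> K_ideal}"
proof -
  have "(R_minus t n \<mu> ^^ k) (Phi P) = \<zero>\<^bsub>M\<^esub> \<longleftrightarrow> (shift \<mu> ^^ k) P \<in> K_ideal" if "P \<in> diffops" for P k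
    by (simp only: R_minus_pow_Phi[OF that] Phi_eq_zero_iff[OF D_shift_pow[OF that]])
  thus ?thesis unfolding R_gen_eigen_def M_carrier by auto
qed

text \<open>The hypothesis \<open>span\<close> tests V against all subspaces W that contain
  \<open>K_ideal\<close> and the generalized eigenvectors. Taking for W the preimage of the
  generated submodule gives the harder inclusion, and no sum of eigenvectors has to be written
  down.\<close>

lemma eigen_span_eq:
  assumes V: "csub V"
    and sub: "!!\<mu> P k. \<mu> \<in> S ==> P \<in> diffops ==> (shift \<mu> ^^ k) P \<in> K_ideal ==> P \<in> V"
    and span: "!!W. csub W ==> K_ideal \<subseteq> W ==>
      (!!\<mu> P k. \<mu> \<in> S ==> P \<in> diffops ==> (shift \<mu> ^^ k) P \<in> K_ideal ==> P \<in> W) ==> V \<subseteq> W"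
  shows "submodule_gen complex_ring M (\<Union>\<mu>\<in>S. R_gen_eigen t n \<mu>) = Phi ` V"
proof
  show "submodule_gen complex_ring M (\<Union>\<mu>\<in>S. R_gen_eigen t n \<mu>) \<subseteq> Phi ` V" (is "?N \<subseteq> _")
    by (rule submodule_gen_minimal[OF _ submodule_Phi[OF V]]) (auto simp: R_gen_eigen_eq sub)
  have N: "submodule ?N complex_ring M" by (rule M.submodule_submodule_gen) (auto simp: R_gen_eigen_def)
  let ?W = "{P \<in> diffops. Phi P \<in> ?N}"
  have z: "\<zero>\<^bsub>M\<^esub> \<in> ?N" using subgroup.one_closed[OF submodule.axioms(1)[OF N]] by simp
  have "V \<subseteq> ?W"
  proof (rule span)
    show "csub ?W" unfolding csub_def using M.submoduleE(4,5)[OF N] z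
      by (intro conjI ballI allI subsetI) (simp_all add: D_zero Phi_zero D_add Phi_add D_lmult Phi_smult)
    show "K_ideal \<subseteq> ?W"
    proof
      fix P assume "P \<in> K_ideal"
      thus "P \<in> ?W" using Phi_eq_zero_iff[OF subsetD[OF K_ideal_sub]] subsetD[OF K_ideal_sub] z by simp
    qed
    show "P \<in> ?W" if "\<mu> \<in> S" "P \<in> diffops" "(shift \<mu> ^^ k) P \<in> K_ideal" for \<mu> P k
      using that by (auto simp: R_gen_eigen_eq intro!: submodule_gen_inc)
  qed
  thus "Phi ` V \<subseteq> ?N" by blast
qed

text \<open>Reduces strictness on the graded piece to operators. The inclusion from left to right
  uses that the shift raises the order by at most one; \<open>strict\<close> gives the other one,
  for P of bounded order and Q of arbitrary order.\<close>

theorem strict_of_span: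
  assumes ge: "csub Vge" "M_ge t n \<alpha> = Phi ` Vge" and gt: "csub Vgt" "M_gt t n \<alpha> = Phi ` Vgt"
    and sub: "K_ideal \<subseteq> Vgt" "Vgt \<subseteq> Vge"
    and shift: "!!P. P \<in> Vge ==> shift \<alpha> P \<in> Vge" "!!P. P \<in> Vgt ==> shift \<alpha> P \<in> Vgt"
    and strict: "!!P Q k. P \<in> D_filt (int a + k) ==> P \<in> Vge ==> Q \<in> Vge ==> (%g. P g - (shift \<alpha> ^^ a) Q g) \<in> Vgt ==>
      \<exists>Q'\<in>Vge \<inter> D_filt k. (%g. P g - (shift \<alpha> ^^ a) Q' g) \<in> Vgt"
  shows "(R_gr t n \<alpha> ^^ a) ` M_gr_filt t n \<alpha> l = M_gr_filt t n \<alpha> (int a + l) \<inter> (R_gr t n \<alpha> ^^ a) ` carrier (M_gr t n \<alpha>)"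
proof -
  let ?c = "%P. M_gt t n \<alpha> +>\<^bsub>M\<^esub> Phi P"
  note D = csub_carrier[OF ge(1)] and Dgt = csub_carrier[OF gt(1)]
  interpret gt: quot_setting "M_gt t n \<alpha>" M
    unfolding gt(2) by (rule M.submodule_quot_setting[OF submodule_Phi[OF gt(1)]])
  \<comment> \<open>As V contains the kernel of \<open>Phi\<close>, membership can be lifted from
    images back to operators; this lets filtration and subspace be intersected inside D.\<close>
  have in_ge: "P \<in> V" if V: "csub V" "K_ideal \<subseteq> V" and P: "P \<in> diffops" "Phi P \<in> Phi ` V" for P V
  proof -
    obtain Q where Q: "Phi P = Phi Q" "Q \<in> V" using P(2) by (elim imageE)
    have "(%g. P g - Q g) \<in> K_ideal" using Phi_eq_iff[OF P(1) csub_carrier[OF V(1) Q(2)]] Q(1) by simp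
    hence "(%g. Q g + (P g - Q g)) \<in> V" by (intro csub_add[OF V(1) Q(2)] subsetD[OF V(2)])
    thus ?thesis by simp
  qed
  have c_eq: "?c P = ?c Q \<longleftrightarrow> (%g. P g - Q g) \<in> Vgt" if "P \<in> diffops" "Q \<in> diffops" for P Q
  proof -
    have PQ: "(%g. P g - Q g) \<in> diffops" using D_add[OF that(1) D_minus[OF that(2)]] by simp
    have "?c P = ?c Q \<longleftrightarrow> Phi (%g. P g - Q g) \<in> Phi ` Vgt"
      using gt.quot_eq_iff[of "Phi P" "Phi Q"] that by (simp add: Phi_minus gt(2))
    thus ?thesis using in_ge[OF gt(1) sub(1) PQ] by blast
  qed
  have gr: "carrier (M_gr t n \<alpha>) = ?c ` Vge"
  proof -
    have "a_r_coset (M\<lparr>carrier := M_ge t n \<alpha>\<rparr>) (M_gt t n \<alpha>) = a_r_coset M (M_gt t n \<alpha>)"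
      by (simp add: fun_eq_iff a_r_coset_def r_coset_def)
    thus ?thesis by (simp add: M_gr_def quot_module_simps ge(2) image_image)
  qed
  have filt: "M_gr_filt t n \<alpha> k = ?c ` (Vge \<inter> D_filt (k + int n))" for k
  proof -
    have "Phi ` D_filt (k + int n) \<inter> Phi ` Vge = Phi ` (Vge \<inter> D_filt (k + int n))"
      using in_ge[OF ge(1) order_trans[OF sub]] D_filt_carrier by blast
    thus ?thesis unfolding M_gr_filt_def M_filt_eq ge(2) by (simp add: image_image)
  qed
  have R: "R_gr t n \<alpha> (?c P) = ?c (shift \<alpha> P)" if P: "P \<in> Vge" for P
  proof -
    have "M_gt t n \<alpha> +>\<^bsub>M\<^esub> R_minus t n \<alpha> m = ?c (shift \<alpha> P)" if m: "m \<in> ?c P" for m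
    proof -
      obtain Q where Q: "Q \<in> Vgt" "m = Phi Q \<oplus>\<^bsub>M\<^esub> Phi P" using m unfolding a_r_coset_def' gt(2) by auto
      have QP: "(%g. Q g + P g) \<in> diffops" using D_add[OF Dgt[OF Q(1)] D[OF P]] .
      have m': "m = Phi (%g. Q g + P g)" unfolding Q(2) by (rule Phi_add[OF Dgt[OF Q(1)] D[OF P], symmetric])
      have "(%g. shift \<alpha> (%g. Q g + P g) g - shift \<alpha> P g) = shift \<alpha> Q"
        by (simp add: shift_def fun_eq_iff vf_apply_add algebra_simps)
      hence "?c (shift \<alpha> (%g. Q g + P g)) = ?c (shift \<alpha> P)"
        using c_eq[OF D_shift[OF QP] D_shift[OF D[OF P]]] shift(2)[OF Q(1)] by simp
      thus ?thesis unfolding m' R_minus_Phi[OF QP] .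
    qed
    moreover have "?c P ~= {}" using gt.a_rcos_self[of "Phi P"] D[OF P] by auto
    ultimately show ?thesis unfolding R_gr_def by (intro SUP_eq_const)
  qed
  have shift_pow: "(shift \<alpha> ^^ k) P \<in> Vge" if "P \<in> Vge" for P k
    using that by (induction k) (simp_all add: shift)
  have Rpow: "(R_gr t n \<alpha> ^^ k) (?c P) = ?c ((shift \<alpha> ^^ k) P)" if "P \<in> Vge" for P k
    using that by (induction k) (simp_all add: R shift_pow)
  show ?thesis
  proof (intro equalityI subsetI IntI)
    fix C assume "C \<in> (R_gr t n \<alpha> ^^ a) ` M_gr_filt t n \<alpha> l"
    then obtain P where P: "P \<in> Vge" "P \<in> D_filt (l + int n)" "C = ?c ((shift \<alpha> ^^ a) P)"
      unfolding filt by (auto simp: Rpow)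
    show "C \<in> M_gr_filt t n \<alpha> (int a + l)"
      unfolding filt P(3) using shift_pow[OF P(1)] D_filt_shift_pow[OF P(2), of a \<alpha>] by (simp add: add_ac)
    show "C \<in> (R_gr t n \<alpha> ^^ a) ` carrier (M_gr t n \<alpha>)"
      unfolding gr P(3) Rpow[OF P(1), symmetric] using P(1) by blast
  next
    fix C assume "C \<in> M_gr_filt t n \<alpha> (int a + l) \<inter> (R_gr t n \<alpha> ^^ a) ` carrier (M_gr t n \<alpha>)"
    then obtain P Q where P: "P \<in> Vge" "P \<in> D_filt (int a + l + int n)" "C = ?c P" and Q: "Q \<in> Vge" "C = ?c ((shift \<alpha> ^^ a) Q)"
      unfolding filt gr by (auto simp: Rpow)
    have "(%g. P g - (shift \<alpha> ^^ a) Q g) \<in> Vgt"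
      using c_eq[OF D[OF P(1)] D_shift_pow[OF D[OF Q(1)], of a \<alpha>]] P(3) Q(2) by simp
    then obtain Q' where Q': "Q' \<in> Vge" "Q' \<in> D_filt (l + int n)" "(%g. P g - (shift \<alpha> ^^ a) Q' g) \<in> Vgt"
      using strict[of P "l + int n" Q] P Q by (auto simp: add_ac)
    have "C = ?c ((shift \<alpha> ^^ a) Q')"
      using c_eq[OF D[OF P(1)] D_shift_pow[OF D[OF Q'(1)], of a \<alpha>]] Q'(3) P(3) by simp
    thus "C \<in> (R_gr t n \<alpha> ^^ a) ` M_gr_filt t n \<alpha> l"
      unfolding filt using Q' by (auto simp: Rpow[symmetric] intro!: imageI)
  qed
qed

end

subsection \<open>Closed forms and logarithmic differentials\<close>

lemma one_form_single [simp]: "one_form f [i] = f i" by (simp add: one_form_def)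

lemma closed_dgerm: "closed_form (dgerm a)"
  unfolding closed_form_def dgerm_def by (simp add: mero_pd_to_mero germ_pd_commute)

lemma closed_dlog: "g ~= 0 ==> closed_form (dlog g)"
  unfolding closed_form_def dlog_def by (simp add: mero_pd_Fract germ_pd_commute mult.commute)

lemma dlog_eq: "g ~= 0 ==> dlog g = (1 / to_mero g) *f dgerm g" unfolding dlog_def dgerm_def one_form_eq_sum
  by (simp add: fscale_sum Fract_to_mero mero_pd_to_mero mult.commute)

lemma pairing_dlog: "g ~= 0 ==> pairing (dlog g) v = to_mero (vf_apply v g) / to_mero g"
  by (simp add: dlog_eq pairing_scale pairing_dgerm)

lemma dgerm_mult: "dgerm (a * b) = to_mero b *f dgerm a + to_mero a *f dgerm b"
  unfolding dgerm_def one_form_eq_sum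
  by (simp add: to_mero_mult mero_pd_mult fscale_sum fscale_add sum.distrib[symmetric] mult.commute)

lemma dlog_mult: "a ~= 0 ==> b ~= 0 ==> dlog (a * b) = dlog a + dlog b"
  by (simp add: dlog_eq dgerm_mult fscale_add to_mero_mult)

lemma dgerm_const [simp]: "dgerm (germ_const k) = 0" by (simp add: dgerm_eq)

lemma dlog_1 [simp]: "dlog 1 = 0" using dgerm_const[of 1] by (simp add: dlog_eq del: dgerm_const)

lemma dlog_power: "a ~= 0 ==> dlog (a ^ k) = to_mero (of_nat k) *f dlog a"
  by (induction k) (simp_all add: dlog_mult to_mero_add fscale_add)

lemma dlog_prod:
  assumes "finite J" "!!i. i \<in> J ==> a i ~= 0"
  shows "dlog (\<Prod>i\<in>J. a i ^ w i) = (\<Sum>i\<in>J. to_mero (of_nat (w i)) *f dlog (a i))" using assms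
proof (induction J rule: finite_induct)
  case (insert i J)
  have ne: "a i ^ w i ~= 0" "(\<Prod>i\<in>J. a i ^ w i) ~= 0" using insert by simp_all
  show "dlog (\<Prod>i\<in>insert i J. a i ^ w i) = (\<Sum>i\<in>insert i J. to_mero (of_nat (w i)) *f dlog (a i))"
    unfolding prod.insert[OF insert.hyps] sum.insert[OF insert.hyps] dlog_mult[OF ne]
    using insert by (simp only: dlog_power insert_iff simp_thms)
qed simp

abbreviation fspan :: "('m::finite => 'm form) => 'm form set" where
  "fspan \<eta> \<equiv> range (%a. \<Sum>j\<in>UNIV. to_mero (a j) *f \<eta> j)"

lemma fspan_closed:
  "0 \<in> fspan \<eta>" "\<beta> \<in> fspan \<eta> ==> \<gamma> \<in> fspan \<eta> ==> \<beta> + \<gamma> \<in> fspan \<eta>" "\<beta> \<in> fspan \<eta> ==> to_mero a *f \<beta> \<in> fspan \<eta>" "\<eta> j \<in> fspan \<eta>"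
proof -
  show "0 \<in> fspan \<eta>" by (rule range_eqI[of _ _ "%_. 0"]) simp
  show "\<beta> + \<gamma> \<in> fspan \<eta>" if bc: "\<beta> \<in> fspan \<eta>" "\<gamma> \<in> fspan \<eta>"
  proof -
    obtain b c where "\<beta> = (\<Sum>j\<in>UNIV. to_mero (b j) *f \<eta> j)" "\<gamma> = (\<Sum>j\<in>UNIV. to_mero (c j) *f \<eta> j)"
      using bc by (elim rangeE)
    thus ?thesis by (intro range_eqI[of _ _ "%j. b j + c j"]) (simp only: to_mero_add fscale_add sum.distrib)
  qed
  show "to_mero a *f \<beta> \<in> fspan \<eta>" if b: "\<beta> \<in> fspan \<eta>"
  proof -
    obtain b where "\<beta> = (\<Sum>j\<in>UNIV. to_mero (b j) *f \<eta> j)" using b by (elim rangeE)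
    thus ?thesis by (intro range_eqI[of _ _ "%j. a * b j"]) (simp only: to_mero_mult fscale_sum fscale_simps)
  qed
  have "\<eta> j = (\<Sum>i\<in>UNIV. to_mero (if i = j then 1 else 0) *f \<eta> i)"
    by (simp add: if_distrib[of to_mero] if_distrib[of "%q. q *f _"] cong: if_cong)
  thus "\<eta> j \<in> fspan \<eta>" by (rule range_eqI[of _ _ "%i. if i = j then 1 else 0"])
qed

lemma fspan_sum: "(!!i. i \<in> S ==> f i \<in> fspan \<eta>) ==> sum f S \<in> fspan \<eta>"
  by (rule sum_closed_form) (rule fspan_closed; assumption)+

lemma log_one_subset_fspan:
  assumes "!!i. dcoord i \<in> fspan \<eta>" "!!g k. g dvd t ^ k ==> dlog g \<in> fspan \<eta>"
  shows "log_one_forms t \<subseteq> fspan \<eta>" unfolding log_one_forms_def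
proof (rule submodule_gen_minimal)
  show "submodule (fspan \<eta>) germ_ring form_module"
    unfolding submodule_form_iff using fspan_closed(1-3) by (intro conjI ballI allI)
qed (use assms in blast)

section \<open>From coordinate derivations to logarithmic frames and order filtrations\<close>

context germ_coords
begin

definition fld :: "'m => 'm => 'm germ" where
  "fld j i = \<delta> j (germ_coord i)"

lemma vf_fld: "vf_apply (fld j) a = \<delta> j a" unfolding vf_apply_def fld_def by (rule \<delta>_pd[symmetric])

lemma dgerm_expand: "dgerm a = (\<Sum>j\<in>UNIV. to_mero (\<delta> j a) *f dgerm (x j))"
proof -
  have "dgerm a = (\<Sum>i\<in>UNIV. \<Sum>j\<in>UNIV. (to_mero (\<delta> j a) * to_mero (germ_pd i (x j))) *f dcoord i)"
    unfolding dgerm_eq by (subst pd_\<delta>) (simp add: to_mero_sum to_mero_mult fscale_sum_left mult.commute)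
  also have "\<dots> = (\<Sum>j\<in>UNIV. to_mero (\<delta> j a) *f dgerm (x j))"
    unfolding dgerm_eq by (subst sum.swap) (simp add: fscale_sum)
  finally show ?thesis .
qed

lemma dcoord_dgerm: "dcoord i = dgerm (germ_coord i)"
proof -
  have "dgerm (germ_coord i) = (\<Sum>j\<in>UNIV. if j = i then dcoord i else 0)"
    unfolding dgerm_eq by (rule sum.cong) (auto simp: germ_pd_coord)
  thus ?thesis by simp
qed

lemma fspan_coords:
  assumes "!!j. dgerm (x j) \<in> fspan \<eta>"
  shows "dgerm a \<in> fspan \<eta>" "dcoord i \<in> fspan \<eta>" "g dvd 1 ==> dlog g \<in> fspan \<eta>"
proof -
  show d: "dgerm a \<in> fspan \<eta>" for a unfolding dgerm_expand[of a] by (intro fspan_sum fspan_closed(3) assms)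
  show "dcoord i \<in> fspan \<eta>" unfolding dcoord_dgerm by (rule d)
  assume "g dvd 1"
  then obtain h where h: "1 = g * h" by (elim dvdE)
  hence "to_mero g * to_mero h = 1" and g: "g ~= 0" by (auto simp: to_mero_mult[symmetric])
  hence "1 / to_mero g = to_mero h" by (simp add: field_simps)
  thus "dlog g \<in> fspan \<eta>" unfolding dlog_eq[OF g] by (simp only: fspan_closed(3)[OF d])
qed

text \<open>Off Y every divisor of a power of t is a unit, so the logarithmic forms are the
  holomorphic ones and the coordinate differentials form the frame. The differential of x_p is dt/t
  because \<delta>_p t = t and the other derivations kill t.\<close>

lemma unit_log_frame:
  assumes "t dvd 1" "!!j. \<delta> j t = (if j = p then t else 0)" "CARD('m) = n + 1"
  shows "log_frame t p (%j. dgerm (x j)) fld n"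
proof
  have t0: "t ~= 0" using assms(1) by auto
  have "dgerm t = to_mero t *f dgerm (x p)" unfolding dgerm_expand[of t] assms(2)
    by (simp add: if_distrib[of to_mero] if_distrib[of "%q. q *f _"] cong: if_cong)
  thus "dgerm (x p) = dlog t" using t0 by (simp add: dlog_eq)
  show "pairing (dgerm (x i)) (fld j) = (if i = j then 1 else 0)" for i j
    by (simp add: pairing_dgerm vf_fld \<delta>_x)
  show "vf_apply (fld j) t = (if j = p then t else 0)" for j by (simp add: vf_fld assms(2))
  show "vf_apply (fld i) (vf_apply (fld j) g) = vf_apply (fld j) (vf_apply (fld i) g)" for i j g
    unfolding vf_fld by (rule \<delta>_commute)
  have "log_one_forms t \<subseteq> fspan (%j. dgerm (x j))"
  proof (rule log_one_subset_fspan)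
    have d: "dgerm (x j) \<in> fspan (%j. dgerm (x j))" for j by (rule fspan_closed(4))
    show "dcoord i \<in> fspan (%j. dgerm (x j))" for i by (rule fspan_coords(2)[OF d])
    fix g k assume "g dvd t ^ k"
    hence "g dvd 1" using dvd_power_same[OF assms(1), of k] by (metis dvd_trans power_one)
    thus "dlog g \<in> fspan (%j. dgerm (x j))" by (rule fspan_coords(3)[OF d])
  qed
  thus "\<exists>a. \<xi> = (\<Sum>j\<in>UNIV. to_mero (a j) *f dgerm (x j))" if "\<xi> \<in> log_one_forms t" for \<xi> using that by blast
qed (rule assms closed_dgerm dgerm_log)+

lemma x_dvd_iff: "x i dvd a \<longleftrightarrow> \<rho> i a = 0"
proof
  assume "\<rho> i a = 0"
  thus "x i dvd a" using x_dvd[of i a] by simp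
qed (auto simp: \<rho>_mult \<rho>_x elim!: dvdE)

lemma x_dvd_mult: "x i dvd a * b \<longleftrightarrow> x i dvd a \<or> x i dvd b" by (simp add: x_dvd_iff \<rho>_mult)

text \<open>Each x_j is prime, since restriction to x_j = 0 is a ring homomorphism into a domain.
  Cancelling the primes of the monomial one at a time shows that a divisor is a unit times a product
  of some x_j.\<close>

lemma dlog_fspan_divisor:
  assumes d: "!!j. dgerm (x j) \<in> fspan \<eta>" and l: "!!j. j \<in> set js ==> dlog (x j) \<in> fspan \<eta>"
    and "g * h = prod_list (map x js)"
  shows "dlog g \<in> fspan \<eta>" using l assms(3)
proof (induction js arbitrary: g h)
  case Nil
  hence "g dvd 1" by (metis dvd_triv_left list.map(1) prod_list.Nil)
  thus "dlog g \<in> fspan \<eta>" by (rule fspan_coords(3)[OF d])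
next
  case (Cons j js)
  have l: "dlog (x i) \<in> fspan \<eta>" if "i \<in> set (j # js)" for i by (rule Cons.prems(1)[OF that])
  have eq: "g * h = x j * prod_list (map x js)" using Cons.prems(2) by simp
  hence "x j dvd g * h" by simp
  then consider g' where "g = x j * g'" | h' where "h = x j * h'" unfolding x_dvd_mult by (auto elim!: dvdE)
  thus "dlog g \<in> fspan \<eta>"
  proof cases
    case 1
    hence e: "g' * h = prod_list (map x js)" using eq x_nonzero[of j] by (simp add: mult.assoc)
    have "dlog g' \<in> fspan \<eta>" by (rule Cons.IH[OF l e]) simp
    moreover have "prod_list (map x js) ~= 0" for js by (induction js) (simp_all add: x_nonzero)
    hence "g' ~= 0" using e mult_zero_left by metis
    ultimately show ?thesis unfolding 1 dlog_mult[OF x_nonzero \<open>g' ~= 0\<close>] by (intro fspan_closed(2) l) simp_all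
  next
    case 2
    hence e: "g * h' = prod_list (map x js)" using eq x_nonzero[of j] by (simp add: mult.left_commute)
    show ?thesis by (rule Cons.IH[OF l e]) simp
  qed
qed

text \<open>Half of the comparison between the filtration by coordinate derivatives with left
  coefficients and the one by \<delta>_j with right coefficients: the two systems of derivations are
  combinations of each other with germs as coefficients.\<close>

lemma diffop_endo: "diffop k P ==> \<exists>Q. P = app Q \<and> ord_le k Q"
proof (induction rule: diffop.induct)
  case (scalar k a)
  show ?case by (rule exI[of _ "mop a"]) (simp add: app_simps fun_eq_iff)
next
  case (add k P Q)
  then obtain P' Q' where "P = app P'" "ord_le k P'" "Q = app Q'" "ord_le k Q'" by auto
  thus ?case by (intro exI[of _ "P' + Q'"]) (simp add: app_simps fun_eq_iff ord_le.add)
next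
  case (lmult k P a)
  then obtain P' where "P = app P'" "ord_le k P'" by auto
  thus ?case by (intro exI[of _ "mop a * P'"]) (simp add: app_simps fun_eq_iff ord_le_mop_left)
next
  case (pd k P i)
  then obtain P' where P': "P = app P'" "ord_le k P'" by auto
  have s: "app (\<Sum>j\<in>J. F j) a = (\<Sum>j\<in>J. app (F j) a)" for F :: "'m => 'm germ endo" and J a
    by (induction J rule: infinite_finite_induct) (simp_all add: app_simps)
  show ?case
  proof (intro exI[of _ "\<Sum>j\<in>UNIV. mop (germ_pd i (x j)) * (deriv_op j * P')"] conjI)
    show "(%g. germ_pd i (P g)) = app (\<Sum>j\<in>UNIV. mop (germ_pd i (x j)) * (deriv_op j * P'))"
      unfolding P'(1) fun_eq_iff by (subst pd_\<delta>) (simp add: s app_simps app_deriv_op)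
  qed (intro ord_le_sum ord_le_mop_left ord_le_deriv_op_left P'(2))
qed

lemma diffop_\<delta>: "diffop k P ==> diffop (Suc k) (%g. \<delta> j (P g))"
proof -
  assume P: "diffop k P"
  have "diffop (Suc k) (%g. \<Sum>i\<in>J. \<delta> j (germ_coord i) * germ_pd i (P g))" for J
  proof (induction J rule: infinite_finite_induct)
    case (insert i J)
    show ?case unfolding sum.insert[OF insert.hyps]
      by (rule diffop.add[OF diffop.lmult[OF diffop.pd[OF P]] insert.IH])
  qed (use diffop.scalar[of "Suc k" 0] in simp_all)
  thus ?thesis by (subst \<delta>_pd)
qed

lemma ord_le_diffop: "ord_le k Q ==> diffop k (app Q)"
proof (induction rule: ord_le.induct)
  case (monom \<gamma> k b)
  have "diffop (sum \<gamma> UNIV) (app (dmon \<gamma> * mop b))" for \<gamma>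
  proof (induction \<gamma> rule: multi_index_induct)
    case zero
    have "app (dmon (%_. 0) * mop b) = (%g. b * g)" by (simp add: app_simps fun_eq_iff)
    thus ?case using diffop.scalar by simp
  next
    case (incr \<gamma> j)
    have eq: "app (dmon (\<gamma>(j := Suc (\<gamma> j))) * mop b) = (%g. \<delta> j (app (dmon \<gamma> * mop b) g))"
      by (simp add: dmon_incr app_simps app_deriv_op fun_eq_iff)
    show ?case unfolding sum_incr eq by (rule diffop_\<delta>[OF incr])
  qed
  moreover have "sum \<gamma> UNIV \<le> k" using monom by (simp add: mi_le_def)
  ultimately show ?case using diffop_mono by blast
next
  case (add k P Q)
  have "app (P + Q) = (%g. app P g + app Q g)" by (simp add: app_simps fun_eq_iff)
  thus ?case using diffop.add[OF add.IH] by simp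
qed

lemma app_inject: "app P = app Q ==> P = Q" by (rule endo_eqI) simp

lemma D_filt_iff: "0 \<le> l ==> app Q \<in> D_filt l \<longleftrightarrow> ord_le (nat l) Q"
  using diffop_endo[of "nat l" "app Q"] ord_le_diffop[of "nat l" Q] app_inject by (auto simp: D_filt_def)

lemma D_carrierE: assumes "P \<in> diffops" obtains Q k where "P = app Q" "ord_le k Q"
  using assms diffop_endo unfolding D_carrier_iff by blast

lemma ord_le_D_carrier: "ord_le k Q ==> app Q \<in> diffops"
  using ord_le_diffop unfolding D_carrier_iff by blast

end

section \<open>The logarithmic frame at a normal crossing\<close>

context snc_coords
begin

abbreviation t where "t \<equiv> xmon e"

definition L_op :: "'m => 'm germ endo" where
  "L_op j = (if j = p then s_op else E_op j)"

definition log_fld :: "'m => 'm => 'm germ" where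
  "log_fld j i = app (L_op j) (germ_coord i)"

definition log_coframe :: "'m => 'm form" where
  "log_coframe j = (if j = p then dlog t else if j \<in> I then dlog (x j) else dgerm (x j))"

definition \<theta>_op :: "'m => 'm germ => 'm germ" where
  "\<theta>_op j g = (if j \<in> I then x j * \<delta> j g else \<delta> j g)"

lemma app_L_op:
  "app (L_op j) g = germ_const (if j = p then 1 / of_nat (e p) else 1) * \<theta>_op j g -
    germ_const (if j \<in> I - {p} then of_nat (e j) / of_nat (e p) else 0) * \<theta>_op p g"
  using p_in_I by (auto simp: L_op_def E_op_def s_op_def \<theta>_op_def app_simps app_deriv_op euler_op_def const_op_def)

lemma \<theta>_op_linear: "\<theta>_op j (a - b) = \<theta>_op j a - \<theta>_op j b" "\<theta>_op j (germ_const k * a) = germ_const k * \<theta>_op j a"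
proof -
  have "\<delta> j (a - b) = \<delta> j a - \<delta> j b" using \<delta>_add[of j a "- b"] by (simp only: \<delta>_minus add_uminus_conv_diff)
  thus "\<theta>_op j (a - b) = \<theta>_op j a - \<theta>_op j b" by (simp add: \<theta>_op_def right_diff_distrib)
qed (simp add: \<theta>_op_def \<delta>_const_mult mult.left_commute)

lemma \<theta>_op_commute: "\<theta>_op i (\<theta>_op j g) = \<theta>_op j (\<theta>_op i g)"
  by (auto simp: \<theta>_op_def \<delta>_mult \<delta>_x \<delta>_commute[of i j] algebra_simps)

lemma L_op_commute: "app (L_op i) (app (L_op j) g) = app (L_op j) (app (L_op i) g)"
  unfolding app_L_op \<theta>_op_linear
  by (simp only: \<theta>_op_commute[of j i] \<theta>_op_commute[of j p] \<theta>_op_commute[of i p] right_diff_distrib mult_ac)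
    (simp add: algebra_simps)

lemma vf_log_fld: "vf_apply (log_fld j) a = app (L_op j) a"
proof -
  have \<theta>: "\<theta>_op j a = (\<Sum>i\<in>UNIV. \<theta>_op j (germ_coord i) * germ_pd i a)" for j a
    by (simp add: \<theta>_op_def \<delta>_pd[of j a] sum_distrib_left mult.assoc)
  show ?thesis unfolding vf_apply_def log_fld_def app_L_op
    by (subst (3 4) \<theta>) (simp add: sum_distrib_left left_diff_distrib sum_subtractf mult.assoc)
qed

lemma t_neq_0: "t ~= 0" by (rule xmon_neq_0)

lemma \<theta>_op_x: "\<theta>_op j (x i) = (if i = j then (if i \<in> I then x i else 1) else 0)" by (simp add: \<theta>_op_def \<delta>_x)

text \<open>The eigenvalue of x_i, for i in I, under the j-th field. Weighted by e_i the eigenvalues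
  add up to that of t, which is 1 for s and 0 for the E_j.\<close>

definition weight :: "'m => 'm => complex" where
  "weight j i = (if j = p then (if i = p then 1 / of_nat (e p) else 0)
     else (if i = j then 1 else 0) - (if i = p \<and> j \<in> I then of_nat (e j) / of_nat (e p) else 0))"

lemma L_op_x: "i \<in> I ==> app (L_op j) (x i) = germ_const (weight j i) * x i"
  unfolding app_L_op \<theta>_op_x weight_def by (auto simp: germ_const_minus)

lemma pairing_dlog_x: "i \<in> I ==> pairing (dlog (x i)) (log_fld j) = to_mero (germ_const (weight j i))"
  by (simp add: pairing_dlog x_neq_0 vf_log_fld L_op_x to_mero_mult)

lemma weight_sum: "(\<Sum>i\<in>I. of_nat (e i) * weight j i) = (if j = p then 1 else 0)"
proof -
  have *: "(\<Sum>i\<in>I. of_nat (e i) * (if i = k then c else 0)) = (if k \<in> I then of_nat (e k) * c else 0)" for k and c :: complex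
    by (simp add: if_distrib cong: if_cong)
  show ?thesis
  proof (cases "j = p")
    case True
    thus ?thesis using * p_in_I ep_neq_0 by (simp add: weight_def)
  next
    case False
    have "(\<Sum>i\<in>I. of_nat (e i) * weight j i) = (\<Sum>i\<in>I. of_nat (e i) * (if i = j then 1 else 0)) -
        (\<Sum>i\<in>I. of_nat (e i) * (if i = p then (if j \<in> I then of_nat (e j) / of_nat (e p) else 0) else 0))"
      unfolding sum_subtractf[symmetric] using False by (intro sum.cong) (auto simp: weight_def right_diff_distrib)
    also have "\<dots> = 0" unfolding * using p_in_I ep_neq_0 by simp
    finally show ?thesis using False by simp
  qed
qed

lemma dlog_t: "dlog t = (\<Sum>i\<in>I. to_mero (of_nat (e i)) *f dlog (x i))"
  unfolding xmon_def by (rule dlog_prod) (simp_all add: x_neq_0)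

lemma pairing_dlog_t: "pairing (dlog t) (log_fld j) = (if j = p then 1 else 0)"
proof -
  have "pairing (dlog t) (log_fld j) = to_mero (germ_const (\<Sum>i\<in>I. of_nat (e i) * weight j i))"
  proof -
    have s: "germ_const (sum f S) = (\<Sum>i\<in>S. germ_const (f i))" for f :: "'m => complex" and S
      by (induction S rule: infinite_finite_induct) (simp_all add: germ_const_add)
    show ?thesis unfolding dlog_t pairing_sum pairing_scale s to_mero_sum
      by (rule sum.cong) (simp_all add: pairing_dlog_x germ_const_mult to_mero_mult germ_of_nat)
  qed
  thus ?thesis by (simp add: weight_sum)
qed

lemma coframe_dual: "pairing (log_coframe i) (log_fld j) = (if i = j then 1 else 0)"
proof -
  consider "i = p" | "i \<in> I" "i ~= p" | "i \<notin> I" "i ~= p" using p_in_I by blast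
  thus ?thesis
  proof cases
    case 1
    thus ?thesis by (simp add: log_coframe_def pairing_dlog_t eq_commute)
  next
    case 2
    thus ?thesis by (auto simp: log_coframe_def pairing_dlog_x weight_def)
  next
    case 3
    thus ?thesis using p_in_I by (auto simp: log_coframe_def pairing_dgerm vf_log_fld app_L_op \<theta>_op_x)
  qed
qed

lemma t_power_prod_list: "\<exists>js. set js \<subseteq> I \<and> t ^ k = prod_list (map x js)"
proof -
  have pl: "prod_list (map x (concat (replicate k js))) = prod_list (map x js) ^ k" for js k
    by (induction k) simp_all
  have "\<exists>js. set js \<subseteq> J \<and> (\<Prod>i\<in>J. x i ^ e i) = prod_list (map x js)" if "finite J" for J using that
  proof (induction J rule: finite_induct)
    case (insert i J)
    then obtain js where "set js \<subseteq> J" "(\<Prod>i\<in>J. x i ^ e i) = prod_list (map x js)" by blast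
    thus ?case using insert.hyps by (intro exI[of _ "replicate (e i) i @ js"]) (auto simp: prod_list_replicate)
  qed simp
  then obtain js where "set js \<subseteq> I" "t = prod_list (map x js)" unfolding xmon_def by (meson finite)
  thus ?thesis using pl[of k js] by (intro exI[of _ "concat (replicate k js)"]) auto
qed

lemma log_frame_snc:
  assumes "CARD('m) = n + 1" shows "log_frame t p log_coframe log_fld n"
proof
  show "log_coframe p = dlog t" by (simp add: log_coframe_def)
  show "closed_form (log_coframe j)" for j
    by (simp add: log_coframe_def closed_dlog closed_dgerm t_neq_0 x_neq_0)
  show "pairing (log_coframe i) (log_fld j) = (if i = j then 1 else 0)" for i j by (rule coframe_dual)
  show "vf_apply (log_fld j) t = (if j = p then t else 0)" for j
    using pairing_dlog_t[of j] t_neq_0 by (auto simp: pairing_dlog split: if_splits)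
  show "vf_apply (log_fld i) (vf_apply (log_fld j) g) = vf_apply (log_fld j) (vf_apply (log_fld i) g)" for i j g
    unfolding vf_log_fld by (rule L_op_commute)
  have x_t: "x j dvd t ^ 1" if "j \<in> I" for j
  proof -
    have "x j dvd x j ^ e j" using e_pos[OF that] by (intro dvd_power) auto
    also have "\<dots> dvd t" unfolding xmon_def using that by (intro dvd_prodI) simp_all
    finally show ?thesis by simp
  qed
  show "log_coframe j \<in> log_one_forms t" for j
  proof -
    have g: "dlog g \<in> log_one_forms t" if "g dvd t ^ k" for g k
      unfolding log_one_forms_def using that by (intro submodule_gen_inc) blast
    show ?thesis using g[of t 1] g[OF x_t] dgerm_log by (auto simp: log_coframe_def)
  qed
  let ?S = "fspan log_coframe"
  have gen: "log_coframe j \<in> ?S" for j by (rule fspan_closed(4))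
  have lx: "dlog (x j) \<in> ?S" if j: "j \<in> I" for j
  proof (cases "j = p")
    case False
    thus ?thesis using gen[of j] j by (simp add: log_coframe_def)
  next
    case True
    let ?c = "germ_const (1 / of_nat (e p)) :: 'm germ"
    have "?c * of_nat (e p) = 1" using ep_neq_0 by (simp add: germ_of_nat flip: germ_const_mult)
    hence c: "to_mero ?c * to_mero (of_nat (e p)) = 1" by (simp only: to_mero_mult[symmetric] to_mero_1)
    \<comment> \<open>dlog x_p is replaced by dt/t in the coframe; it is recovered by solving dt/t =
      \<Sum> e_i dlog x_i for it, dividing by the nonzero constant e_p.\<close>
    have "dlog t = to_mero (of_nat (e p)) *f dlog (x p) + (\<Sum>i\<in>I - {p}. to_mero (of_nat (e i)) *f dlog (x i))"
      unfolding dlog_t by (rule sum.remove) (simp_all add: p_in_I)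
    hence "to_mero (of_nat (e p)) *f dlog (x p) = log_coframe p + to_mero (- 1) *f (\<Sum>i\<in>I - {p}. to_mero (of_nat (e i)) *f log_coframe i)"
      by (simp add: log_coframe_def to_mero_uminus)
    also have "\<dots> \<in> ?S" by (intro fspan_closed(2,3) fspan_sum gen)
    finally have "to_mero ?c *f to_mero (of_nat (e p)) *f dlog (x p) \<in> ?S" by (rule fspan_closed(3))
    thus ?thesis by (simp add: c True)
  qed
  have dx: "dgerm (x j) \<in> ?S" for j
  proof (cases "j \<in> I")
    case True
    have "dgerm (x j) = to_mero (x j) *f dlog (x j)" using x_neq_0[of j] by (simp add: dlog_eq)
    thus ?thesis using fspan_closed(3)[OF lx[OF True]] by simp
  next
    case False
    hence "log_coframe j = dgerm (x j)" using p_in_I by (auto simp: log_coframe_def)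
    thus ?thesis using gen[of j] by simp
  qed
  have "log_one_forms t \<subseteq> ?S"
  proof (rule log_one_subset_fspan)
    show "dcoord i \<in> ?S" for i by (rule fspan_coords(2)[OF dx])
    fix g k assume "g dvd t ^ k"
    then obtain h where "t ^ k = g * h" by (elim dvdE)
    moreover obtain js where "set js \<subseteq> I" "t ^ k = prod_list (map x js)" using t_power_prod_list by blast
    ultimately show "dlog g \<in> ?S" using lx by (intro dlog_fspan_divisor[OF dx, of js g h]) auto
  qed
  thus "\<exists>a. \<xi> = (\<Sum>j\<in>UNIV. to_mero (a j) *f log_coframe j)" if "\<xi> \<in> log_one_forms t" for \<xi> using that by blast
qed (rule assms)

end

section \<open>Strictness off Y and at a crossing\<close>

lemma app_0: "app 0 = (%_. 0)" by (simp add: fun_eq_iff app_simps)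

context log_frame
begin

text \<open>If t is a unit, \<open>K_ideal\<close> is all of D, so \<open>M\<close> vanishes and the
  zero operator solves the lifting problem.\<close>

lemma span_unit:
  assumes "t dvd 1"
  shows "(R_gr t n \<alpha> ^^ a) ` M_gr_filt t n \<alpha> l = M_gr_filt t n \<alpha> (int a + l) \<inter> (R_gr t n \<alpha> ^^ a) ` carrier (M_gr t n \<alpha>)"
proof -
  obtain u where u: "1 = t * u" using assms by (elim dvdE)
  have K: "K_ideal = diffops"
  proof (rule equalityI[OF K_ideal_sub subsetI])
    fix P :: "'m germ => 'm germ" assume P: "P \<in> diffops"
    have "(%g. t * (u * P g)) \<in> K_ideal" by (rule K_ideal_t[OF D_lmult[OF P]])
    thus "P \<in> K_ideal" by (simp add: u[symmetric] mult.assoc[symmetric])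
  qed
  have c: "csub (diffops :: ('m germ => 'm germ) set)"
    unfolding csub_def by (intro conjI ballI allI subset_refl) (rule D_zero D_add D_lmult; assumption)+
  have span: "submodule_gen complex_ring M (\<Union>\<mu>\<in>S. R_gen_eigen t n \<mu>) = Phi ` diffops" for S
    by (rule eigen_span_eq[OF c]) (simp_all add: K)
  show ?thesis
  proof (rule strict_of_span[OF c _ c])
    show "M_ge t n \<alpha> = Phi ` diffops" "M_gt t n \<alpha> = Phi ` diffops" unfolding M_ge_def M_gt_def by (rule span)+
    fix P Q :: "'m germ => 'm germ" and k assume P: "P \<in> diffops"
    show "\<exists>Q'\<in>diffops \<inter> D_filt k. (%g. P g - (shift \<alpha> ^^ a) Q' g) \<in> diffops"
      by (rule bexI[of _ "%_. 0"], rule csub_minus[OF c P D_shift_pow[OF D_zero]]) (simp add: D_filt_0 D_zero)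
  qed (simp_all add: K D_shift)
qed

end

context snc_coords
begin

lemma app_const_op: "app (const_op k * P) g = germ_const k * app P g" by (simp add: const_op_def app_simps)

lemma csub_V_ideal: "csub (app ` V_ideal a)" unfolding csub_def
proof (intro conjI ballI allI subsetI)
  show "P \<in> diffops" if "P \<in> app ` V_ideal a" for P
    using that by (auto elim!: V_ideal_order intro: ord_le_D_carrier)
  show "(%_. 0) \<in> app ` V_ideal a" unfolding app_0[symmetric] by (rule imageI[OF V_ideal_0])
  fix P assume "P \<in> app ` V_ideal a"
  then obtain P' where P: "P = app P'" "P' \<in> V_ideal a" by (elim imageE)
  show "(%g. germ_const k * P g) \<in> app ` V_ideal a" for k
    using V_ideal_const_op[OF P(2), of k] by (rule rev_image_eqI) (simp add: P(1) fun_eq_iff app_const_op)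
  fix Q assume "Q \<in> app ` V_ideal a"
  then obtain Q' where Q: "Q = app Q'" "Q' \<in> V_ideal a" by (elim imageE)
  show "(%g. P g + Q g) \<in> app ` V_ideal a"
    using V_ideal_add[OF P(2) Q(2)] by (rule rev_image_eqI) (simp add: P(1) Q(1) fun_eq_iff app_simps)
qed

lemma app_in_V_iff: "app Q \<in> app ` V_ideal a \<longleftrightarrow> Q \<in> V_ideal a" using app_inject by blast

lemma V_ideal_mono:
  assumes "!!i. i \<in> I ==> a i \<le> b i" shows "V_ideal b \<subseteq> V_ideal a"
proof
  fix P assume "P \<in> V_ideal b"
  then obtain Q n where Q: "ord_le n Q" "P - mop (xmon b) * Q \<in> E_ideal" by (auto simp: V_ideal_def)
  have "xmon b = xmon (%i. a i + (b i - a i))" by (rule xmon_cong) (simp add: assms)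
  hence "mop (xmon b) * Q = mop (xmon a) * (mop (xmon (%i. b i - a i)) * Q)"
    by (simp add: xmon_add mop_mult mult.assoc)
  thus "P \<in> V_ideal a" using Q ord_le_mop_left[OF Q(1)] unfolding V_ideal_def by auto
qed

context
  fixes n assumes dim: "CARD('m) = n + 1"
begin

interpretation F: log_frame t p log_coframe log_fld n by (rule log_frame_snc[OF dim])

lemma shift_app: "F.shift \<mu> (app P) = app ((s_op - const_op (of_real \<mu>)) * P)"
  by (simp add: F.shift_def vf_log_fld L_op_def fun_eq_iff left_diff_distrib app_simps const_op_def)

lemma shift_pow_app: "(F.shift \<mu> ^^ k) (app P) = app ((s_op - const_op (of_real \<mu>)) ^ k * P)"
  by (induction k) (simp_all add: shift_app mult.assoc)

lemma V_ideal_shift: "P \<in> V_ideal a ==> (s_op - const_op (of_real \<mu>)) * P \<in> V_ideal a"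
  using V_ideal_cpoly_op[of P a "lin_root (of_real \<mu>)"] by (simp only: cpoly_op_lin_root)

text \<open>The two descriptions differ in the index p, where \<open>E_op\<close> is 0 and
  \<open>K_ideal\<close> omits the summand, and in the common bound on orders, which exists because
  there are finitely many j.\<close>

lemma K_ideal_V_ideal: "F.K_ideal = app ` V_ideal e"
proof (intro equalityI subsetI)
  have s: "app (\<Sum>j\<in>J. G j) g = (\<Sum>j\<in>J. app (G j) g)" for G :: "'m => 'm germ endo" and J g
    by (induction J rule: infinite_finite_induct) (simp_all add: app_simps)
  have E: "app (\<Sum>j\<in>UNIV. E_op j * G j) g = (\<Sum>j\<in>UNIV - {p}. vf_apply (log_fld j) (app (G j) g))" for G g
  proof -
    have "app (\<Sum>j\<in>UNIV. E_op j * G j) g = (\<Sum>j\<in>UNIV. app (E_op j) (app (G j) g))" by (simp add: s app_simps)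
    also have "\<dots> = (\<Sum>j\<in>UNIV - {p}. app (E_op j) (app (G j) g))"
      by (rule sum.mono_neutral_right) (auto simp: E_op_p app_simps)
    also have "\<dots> = (\<Sum>j\<in>UNIV - {p}. vf_apply (log_fld j) (app (G j) g))"
      by (rule sum.cong) (auto simp: vf_log_fld L_op_def)
    finally show ?thesis .
  qed
  fix P
  {
    assume "P \<in> F.K_ideal"
    then obtain Q S where P: "P = (%g. t * Q g + (\<Sum>j\<in>UNIV - {p}. vf_apply (log_fld j) (S j g)))"
      and Q: "Q \<in> diffops" and S: "!!j. S j \<in> diffops" unfolding F.K_ideal_def by blast
    obtain Q' k where Q': "Q = app Q'" "ord_le k Q'" by (rule D_carrierE[OF Q])
    have "\<forall>j. \<exists>S' m. S j = app S' \<and> ord_le m S'" using D_carrierE[OF S] by metis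
    then obtain S' m where S': "!!j. S j = app (S' j)" "!!j. ord_le (m j) (S' j)" by metis
    have o: "ord_le (Max (range m)) (S' j)" for j by (rule ord_le_mono[OF S'(2)]) simp
    have "P = app (mop t * Q' + (\<Sum>j\<in>UNIV. E_op j * S' j))"
      unfolding fun_eq_iff app_simps E by (simp add: P Q'(1) S'(1))
    moreover have "mop t * Q' + (\<Sum>j\<in>UNIV. E_op j * S' j) \<in> V_ideal e"
      unfolding V_ideal_def using Q'(2) E_idealI[OF o] by (intro CollectI exI[of _ Q'] exI[of _ k]) simp
    ultimately show "P \<in> app ` V_ideal e" by (rule image_eqI)
  }
  assume "P \<in> app ` V_ideal e"
  then obtain P' where P: "P = app P'" "P' \<in> V_ideal e" by (elim imageE)
  then obtain Q k where Q: "ord_le k Q" "P' - mop t * Q \<in> E_ideal" by (auto simp: V_ideal_def)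
  obtain S m where S: "!!j. ord_le m (S j)" "P' - mop t * Q = (\<Sum>j\<in>UNIV. E_op j * S j)"
    by (rule E_idealE[OF Q(2)]) (rule that)
  have "P' = mop t * Q + (\<Sum>j\<in>UNIV. E_op j * S j)" using S(2) by (simp add: algebra_simps)
  hence "P g = t * app Q g + (\<Sum>j\<in>UNIV - {p}. vf_apply (log_fld j) (app (S j) g))" for g
    unfolding P(1) by (simp only: app_simps E)
  thus "P \<in> F.K_ideal"
    by (intro F.K_idealI[of "app Q" "%j. app (S j)"] ord_le_D_carrier[OF Q(1)] ord_le_D_carrier[OF S(1)])
qed

text \<open>\<open>lower\<close> puts every generalized eigenvector with eigenvalue in S into the
  ideal, by cancelling its power of s - \<mu>. \<open>upper\<close> makes the roots k / e_i of the
  annihilating polynomial lie in S, so that such eigenvectors span the ideal modulo the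
  kernel.\<close>

lemma eigen_span_V_ideal:
  assumes a: "!!i. i \<in> I ==> a i \<le> e i"
    and lower: "!!\<mu> i. \<mu> \<in> S ==> i \<in> I ==> real (a i) < real (e i) * \<mu> + 1"
    and upper: "!!i k. i \<in> I ==> a i \<le> k ==> real k / real (e i) \<in> S"
  shows "submodule_gen complex_ring F.M (\<Union>\<mu>\<in>S. R_gen_eigen t n \<mu>) = F.Phi ` (app ` V_ideal a)"
proof (rule F.eigen_span_eq[OF csub_V_ideal])
  fix \<mu> P k assume \<mu>: "\<mu> \<in> S" and P: "P \<in> diffops" "(F.shift \<mu> ^^ k) P \<in> F.K_ideal"
  obtain Q m where Q: "P = app Q" "ord_le m Q" by (rule D_carrierE[OF P(1)])
  have "(s_op - const_op (of_real \<mu>)) ^ k * Q \<in> V_ideal e"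
    using P(2) unfolding Q(1) shift_pow_app K_ideal_V_ideal app_in_V_iff .
  hence "Q \<in> V_ideal a" by (rule gen_eigen_in_V_ideal[OF Q(2) _ a lower[OF \<mu>]])
  thus "P \<in> app ` V_ideal a" unfolding Q(1) by (rule imageI)
next
  fix W assume W: "csub W" "F.K_ideal \<subseteq> W"
    and eig: "!!\<mu> P k. \<mu> \<in> S ==> P \<in> diffops ==> (F.shift \<mu> ^^ k) P \<in> F.K_ideal ==> P \<in> W"
  show "app ` V_ideal a \<subseteq> W"
  proof
    fix P assume "P \<in> app ` V_ideal a"
    then obtain P' where P: "P = app P'" "P' \<in> V_ideal a" by (elim imageE)
    have "P' \<in> {P. app P \<in> W}"
    proof (rule V_ideal_subset_eigen_span[OF P(2) a])
      show "0 \<in> {P. app P \<in> W}" using csub_0[OF W(1)] by (simp add: app_0)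
      show "P + Q \<in> {P. app P \<in> W}" if "P \<in> {P. app P \<in> W}" "Q \<in> {P. app P \<in> W}" for P Q
      proof -
        have "app (P + Q) = (%g. app P g + app Q g)" by (simp add: fun_eq_iff app_simps)
        thus ?thesis using csub_add[OF W(1), of "app P" "app Q"] that by simp
      qed
      show "V_ideal e \<subseteq> {P. app P \<in> W}" using W(2) unfolding K_ideal_V_ideal by blast
      fix i k m l P assume i: "i \<in> I" "a i \<le> k" and o: "ord_le m P"
        and v: "(s_op - const_op (of_real (real k / real (e i)))) ^ l * P \<in> V_ideal e"
      have "app P \<in> W" by (rule eig[OF upper[OF i] ord_le_D_carrier[OF o], of l])
          (unfold shift_pow_app K_ideal_V_ideal, rule imageI[OF v])
      thus "P \<in> {P. app P \<in> W}" by simp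
    qed
    thus "P \<in> W" by (simp add: P(1))
  qed
qed

lemma strictness_snc:
  assumes \<alpha>: "0 \<le> \<alpha>" "\<alpha> < 1"
  shows "(R_gr t n \<alpha> ^^ r) ` M_gr_filt t n \<alpha> l = M_gr_filt t n \<alpha> (int r + l) \<inter> (R_gr t n \<alpha> ^^ r) ` carrier (M_gr t n \<alpha>)"
proof -
  \<comment> \<open>a_i is the least integer k with k / e_i \<ge> \<alpha> and b_i the least one
    with k / e_i > \<alpha>, so the roots from there on are those belonging to \<open>M_ge\<close>
    and \<open>M_gt\<close>. They differ, by one, exactly when e_i \<alpha> is an integer.\<close>
  define a where "a i = nat \<lceil>real (e i) * \<alpha>\<rceil>" for i
  define b where "b i = nat (\<lfloor>real (e i) * \<alpha>\<rfloor> + 1)" for i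
  have e\<alpha>: "0 \<le> real (e i) * \<alpha>" for i using \<alpha>(1) by simp
  have ra: "real (a i) = of_int \<lceil>real (e i) * \<alpha>\<rceil>" "real (b i) = of_int \<lfloor>real (e i) * \<alpha>\<rfloor> + 1" for i
    using e\<alpha>[of i] by (simp_all add: a_def b_def)
  have a_le: "real (e i) * \<alpha> \<le> real (a i)" "real (a i) < real (e i) * \<alpha> + 1" and b_le: "real (e i) * \<alpha> < real (b i)" "real (b i) \<le> real (e i) * \<alpha> + 1" for i
    unfolding ra by linarith+
  have ab: "a i \<le> b i" for i
  proof -
    have "real (a i) < real (b i) + 1" using a_le(2)[of i] b_le(1)[of i] by linarith
    thus ?thesis by linarith
  qed
  \<comment> \<open>Here \<alpha> < 1 enters: e_i \<alpha> < e_i leaves room for rounding up, so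
    both ideals contain t D.\<close>
  have be: "b i \<le> e i" if "i \<in> I" for i
  proof -
    have "real (e i) * \<alpha> < real (e i)" using \<alpha>(2) e_pos[OF that] by simp
    hence "real (b i) < real (e i) + 1" using b_le(2)[of i] by linarith
    thus ?thesis by linarith
  qed
  have ae: "a i \<le> e i" if "i \<in> I" for i using ab be[OF that] order_trans by blast
  define J where "J = {i \<in> I. b i ~= a i}"
  have J: "b i = Suc (a i) \<and> real (a i) = real (e i) * \<alpha>" if "i \<in> J" for i
  proof -
    have lt: "a i < b i" using ab[of i] that by (simp add: J_def)
    hence "real (a i) + 1 \<le> real (b i)" by linarith
    hence "real (a i) = real (e i) * \<alpha>" "real (b i) = real (a i) + 1" using a_le(1)[of i] b_le(2)[of i] by linarith+
    thus ?thesis by linarith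
  qed
  have frac: "real (e i) * (real k / real (e i)) = real k" if "i \<in> I" for i k using e_pos[OF that] by simp
  have ge: "M_ge t n \<alpha> = F.Phi ` (app ` V_ideal a)" unfolding M_ge_def
  proof (rule eigen_span_V_ideal[OF ae])
    fix \<mu> i assume "\<mu> \<in> {\<alpha>..}" "i \<in> I"
    hence "real (e i) * \<alpha> \<le> real (e i) * \<mu>" by (simp add: mult_left_mono)
    thus "real (a i) < real (e i) * \<mu> + 1" using a_le(2)[of i] by linarith
  next
    fix i k assume i: "i \<in> I" "a i \<le> k"
    hence "real (e i) * \<alpha> \<le> real k" using a_le(1)[of i] by linarith
    thus "real k / real (e i) \<in> {\<alpha>..}" using e_pos[OF i(1)] by (simp add: pos_le_divide_eq mult.commute)
  qed
  have gt: "M_gt t n \<alpha> = F.Phi ` (app ` V_ideal b)" unfolding M_gt_def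
  proof (rule eigen_span_V_ideal[OF be])
    fix \<mu> i assume "\<mu> \<in> {\<alpha><..}" "i \<in> I"
    hence "real (e i) * \<alpha> < real (e i) * \<mu>" using e_pos[of i] by simp
    thus "real (b i) < real (e i) * \<mu> + 1" using b_le(2)[of i] by linarith
  next
    fix i k assume i: "i \<in> I" "b i \<le> k"
    hence "real (e i) * \<alpha> < real k" using b_le(1)[of i] by linarith
    thus "real k / real (e i) \<in> {\<alpha><..}" using e_pos[OF i(1)] by (simp add: pos_less_divide_eq mult.commute)
  qed
  show ?thesis
  proof (rule F.strict_of_span[OF csub_V_ideal ge csub_V_ideal gt])
    show "F.K_ideal \<subseteq> app ` V_ideal b" unfolding K_ideal_V_ideal by (intro image_mono V_ideal_mono be)
    show "app ` V_ideal b \<subseteq> app ` V_ideal a" by (intro image_mono V_ideal_mono ab)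
    have sh: "F.shift \<alpha> P \<in> app ` V_ideal w" if "P \<in> app ` V_ideal w" for P w
      using that by (elim imageE) (simp add: shift_app V_ideal_shift)
    show "F.shift \<alpha> P \<in> app ` V_ideal a" if "P \<in> app ` V_ideal a" for P using that by (rule sh)
    show "F.shift \<alpha> P \<in> app ` V_ideal b" if "P \<in> app ` V_ideal b" for P using that by (rule sh)
    fix P Q k assume P: "P \<in> D_filt (int r + k)" "P \<in> app ` V_ideal a" and Q: "Q \<in> app ` V_ideal a"
      and PQ: "(%g. P g - (F.shift \<alpha> ^^ r) Q g) \<in> app ` V_ideal b"
    note z = app_0
    show "\<exists>Q'\<in>app ` V_ideal a \<inter> D_filt k. (%g. P g - (F.shift \<alpha> ^^ r) Q' g) \<in> app ` V_ideal b"
    \<comment> \<open>Orders are natural numbers in the operator calculus but integers in the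
      filtration. Below 0 only the zero operator remains, and Q' = 0 solves the problem.\<close>
    proof (cases "int r + k < 0")
      case True
      hence "P = app 0" using P(1) by (simp add: D_filt_def z)
      hence "(%g. P g - (F.shift \<alpha> ^^ r) (app 0) g) = app 0" unfolding shift_pow_app by (simp add: z)
      thus ?thesis by (intro bexI[of _ "app 0"]) (simp_all add: z D_filt_0 csub_0[OF csub_V_ideal])
    next
      case False
      obtain P' where P': "P = app P'" "P' \<in> V_ideal a" using P(2) by (elim imageE)
      obtain Q' where Q': "Q = app Q'" "Q' \<in> V_ideal a" using Q by (elim imageE)
      have d: "(%g. app P' g - (F.shift \<alpha> ^^ r) (app S) g) = app (P' - (s_op - const_op (of_real \<alpha>)) ^ r * S)" for S
        unfolding shift_pow_app by (simp add: fun_eq_iff app_simps)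
      have o: "ord_le (nat (int r + k)) P'" using P(1) False D_filt_iff[of "int r + k" P'] by (simp add: P'(1))
      have "P' - (s_op - const_op (of_real \<alpha>)) ^ r * Q' \<in> V_ideal b"
        using PQ unfolding P'(1) Q'(1) d app_in_V_iff .
      hence "\<exists>S. S \<in> V_ideal a \<and> (if r \<le> nat (int r + k) then ord_le (nat (int r + k) - r) S else S = 0) \<and>
          P' - (s_op - const_op (of_real \<alpha>)) ^ r * S \<in> V_ideal b"
        using J_def by (intro strictness[where J = J, OF ab be _ J _ a_le(2) o P'(2) Q'(2)]) auto
      then obtain S where S: "S \<in> V_ideal a" "if r \<le> nat (int r + k) then ord_le (nat (int r + k) - r) S else S = 0"
        "P' - (s_op - const_op (of_real \<alpha>)) ^ r * S \<in> V_ideal b" by blast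
      have "app S \<in> D_filt k"
      proof (cases "0 \<le> k")
        case True
        hence "nat (int r + k) - r = nat k" "r \<le> nat (int r + k)" by linarith+
        thus ?thesis using S(2) D_filt_iff[OF True] by simp
      next
        case k: False
        \<comment> \<open>For k < 0 the order r + k of P is smaller than r, and the alternative S =
          0 in \<open>strictness\<close> is the one element of filtration degree k.\<close>
        hence "\<not> r \<le> nat (int r + k)" using False by linarith
        hence "S = 0" using S(2) by simp
        thus ?thesis by (simp add: z D_filt_0)
      qed
      thus ?thesis using S(1,3) unfolding P'(1) by (intro bexI[of _ "app S"]) (simp_all add: d app_in_V_iff)
    qed
  qed
qed

end

end

theorem theorem7p5:
  fixes A :: "('x::{t2_space, second_countable_topology}, 'm::finite) chart set"
    and h :: "('x, 'm) chart \<Rightarrow> complex ^ 'm \<Rightarrow> complex ^ 'm \<Rightarrow> complex ^ 'm \<Rightarrow> complex"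
    and f :: "'x \<Rightarrow> complex" and n :: nat and \<alpha> :: real
    and c :: "('x, 'm) chart" and x :: 'x and a :: nat and l :: int
  assumes manifold: "complex_atlas A" and dim: "CARD('m) = n + 1"
    and kaehler: "kaehler_metric A h"
    and holomorphic: "holo_function A UNIV f"
    and surjective: "range f = ball 0 1"
    and proper: "\<And>K. compact K \<Longrightarrow> K \<subseteq> ball 0 1 \<Longrightarrow> compact (f -` K)"
    and smooth: "\<And>y. f y \<noteq> 0 \<Longrightarrow> submersive_at A f y"
    and snc: "snc_zero_divisor A f"
    and alpha: "\<alpha> \<in> \<rat>" "0 \<le> \<alpha>" "\<alpha> < 1"
    and chart: "holo_chart A c" "x \<in> fst c"
  shows "let t = germ_at c x f in
    (R_gr t n \<alpha> ^^ a) ` M_gr_filt t n \<alpha> l =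
      M_gr_filt t n \<alpha> (int a + l) \<inter> (R_gr t n \<alpha> ^^ a) ` carrier (M_gr t n \<alpha>)" unfolding Let_def
proof (cases "f x = 0")
  case False
  then obtain y \<delta> \<rho> i where "germ_coords y \<delta> \<rho>" and t: "germ_at c x f dvd 1"
    and \<delta>: "!!j. \<delta> j (germ_at c x f) = (if j = i then germ_at c x f else 0)"
    using unit_normal_form[OF manifold holomorphic chart False smooth[OF False]] by metis
  then interpret germ_coords y \<delta> \<rho> by simp
  interpret F: log_frame "germ_at c x f" i "%j. dgerm (y j)" fld n by (rule unit_log_frame[OF t \<delta> dim])
  show "(R_gr (germ_at c x f) n \<alpha> ^^ a) ` M_gr_filt (germ_at c x f) n \<alpha> l =
      M_gr_filt (germ_at c x f) n \<alpha> (int a + l) \<inter> (R_gr (germ_at c x f) n \<alpha> ^^ a) ` carrier (M_gr (germ_at c x f) n \<alpha>)"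
    by (rule F.span_unit[OF t])
next
  case True
  then obtain y \<delta> \<rho> I e where y: "germ_coords y \<delta> \<rho>" "I ~= {}" "!!i. i \<in> I ==> e i \<ge> 1"
    "germ_at c x f = (\<Prod>i\<in>I. y i ^ e i)" using snc_normal_form[OF manifold holomorphic chart snc True] by metis
  \<comment> \<open>Any branch through x can serve to normalize s.\<close>
  then obtain p where "p \<in> I" by blast
  interpret germ_coords y \<delta> \<rho> by (rule y(1))
  interpret snc_coords y \<delta> \<rho> I e p using \<open>p \<in> I\<close> y(3) by unfold_locales
  have "germ_at c x f = xmon e" by (simp only: xmon_def y(4))
  thus "(R_gr (germ_at c x f) n \<alpha> ^^ a) ` M_gr_filt (germ_at c x f) n \<alpha> l =
      M_gr_filt (germ_at c x f) n \<alpha> (int a + l) \<inter> (R_gr (germ_at c x f) n \<alpha> ^^ a) ` carrier (M_gr (germ_at c x f) n \<alpha>)"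
    using strictness_snc[OF dim alpha(2,3)] by simp
qed

end
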